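(* Let $X$, $f$, $c$, $q_u$, $q_d$ be as in the context. There is an ergodic equilibrium $(a^*,b^* )$, with $a^*\le 0\le b^*$, that satisfies: (i) there is a sequence $\{(a^*_{\epsilon_n},b^*_{\epsilon_n},\epsilon_n)\}_{n\ge0}$ with $\epsilon_n>0$ converging to $(a^*,b^*,0)$ as $n\to\infty$, such that $(a^*_{\epsilon_n},b^*_{\epsilon_n})$ is an $\epsilon_n$-discounted equilibrium for every $n$; and (ii) (for this sequence) for every $x\in\mathbb R$, $$\lim_{n\to\infty}\epsilon_n G_{\epsilon_n}(x,X^{a^*_{\epsilon_n},b^*_{\epsilon_n}}_\infty)=G(x,X^{a^*,b^*}_\infty).$$
   Context: Process. $X=\{X_t\}_{t\ge0}$ is a real Lévy process with finite mean, neither a subordinator nor the opposite of a subordinator, on a stochastic basis $(\Omega,\mathcal F,\mathbf F=(\mathcal F_t)_{t\ge0},\mathbf P_x)$ with right-continuous complete filtration, $X_0=x$ under $\mathbf P_x$; $\mathbf E_x$ is the expectation under $\mathbf P_x$, $\mathbf P=\mathbf P_0$, $\mathbf E=\mathbf E_0$. If $X$ has bounded variation, write $X_t=x+S^+_t-S^-_t$ with $S^\pm$ independent subordinators starting at $0$. Controls. An admissible control is a pair $(U,D)$ of non-negative $\mathbf F$-adapted processes, almost surely right-continuous and nondecreasing, with $U_t,D_t$ of finite expectation for each $t\ge0$; $\mathcal A$ is the set of them. The controlled process is $X^{U,D}_t=X_t+U_t-D_t$, with $U_0=u_0$, $D_0=d_0$. For $a<b$, the reflecting controls $(U^{a,b},D^{a,b})$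 are the unique solution of the Skorokhod problem: $X^{a,b}_t=X_t+U^{a,b}_t-D^{a,b}_t\in[a,b]$, $\int_0^\infty(X^{a,b}_t-a)dU^{a,b}_t=0$, $\int_0^\infty(b-X^{a,b}_t)dD^{a,b}_t=0$, with initial values $U^{a,b}_0=(a-x)^+$, $D^{a,b}_0=(x-b)^+$. If $X$ has bounded variation, the degenerate reflecting control at $a=b$ consists of the initial jumps $U^{a,a}_0=(a-x)^+$, $D^{a,a}_0=(x-a)^+$ with increments $U^{a,a}_t-U^{a,a}_0=S^-_t$, $D^{a,a}_t-D^{a,a}_0=S^+_t$, so that $X^{a,a}_t=a$ for all $t$. Mean-field parameter. $f:\mathbb R\to\mathbb R$ is continuous. $\mathcal P^\infty$ is the set of compactly supported random variables $X^\eta_\infty$ for which there is $\eta=(U,D)\in\mathcal A$ with $X^{U,D}_t\to X^\eta_\infty$ in distribution as $t\to\infty$; $p^\eta:=\mathbf E(f(X^\eta_\infty))$. For $a<b$, $X^{a,b}_\infty\in\mathcal P^\infty$ is the stationary limit of $X^{a,b}_t$ and $p^{a,b}:=\mathbf E f(X^{a,b}_\infty)$; for $a=b$, $X^{a,a}_\infty:=a$ and $p^{a,a}:=f(a)$. Costs. $q_u,q_d>0$ are constants. $c:\mathbb R^2\to[0,\infty)$ is continuous, $x\mapsto c(x,y)$ is twice continuously differentiable for every $y$ (with $x$-derivatives $c_x,c_{xx}$), and: (1) for every $y$, $c(\cdot,y)$ is strictly convex with global minimum at $0$, and for every $r>0$, $\inf_{|x|\ge r,\,y\in\mathbb R}c_{xx}(x,y)>0$;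 (2) there is a constant $N>0$, independent of $y$, and for each $y$ a constant $M_y>0$, with $c(x,y)+M_y\ge N|x|$ for all $x$; (3) $\mathbf E_x(\int_0^\infty c_x(X_s,y)e^{-\epsilon s}ds)<\infty$ for all $(x,y)\in\mathbb R^2$ and $\epsilon>0$. For $(\hat U,\hat D)\in\mathcal A$ with initial values $\hat u_0,\hat d_0$ and $X^\eta_\infty\in\mathcal P^\infty$, $$J_\epsilon(x,(\hat U,\hat D),X^\eta_\infty)=\mathbf E_x\left(\int_0^\infty e^{-\epsilon s}\big(c(X^{\hat U,\hat D}_s,p^\eta)ds+q_u d\hat U_s+q_d d\hat D_s\big)\right)+\hat u_0q_u+\hat d_0q_d$$ (the integrals do not count the jumps at time $0$), $$J(x,(\hat U,\hat D),X^\eta_\infty)=\limsup_{T\to\infty}\frac1T\mathbf E_x\left(\int_0^Tc(X^{\hat U,\hat D}_s,p^\eta)ds+q_u\hat U_T+q_d\hat D_T\right),$$ and $G_\epsilon(x,X^\eta_\infty)$, $G(x,X^\eta_\infty)$ are the infima over $(\hat U,\hat D)\in\mathcal A$ of $J_\epsilon$ and $J$, respectively. A pair $(a,b)$ with $a\le b$ ($a<b$ if $X$ has unbounded variation) is an $\epsilon$-discounted equilibrium if $G_\epsilon(x,X^{a,b}_\infty)=J_\epsilon(x,(U^{a,b},D^{a,b}),X^{a,b}_\infty)$ for all $x\in\mathbb R$, and an ergodic equilibrium if $G(x,X^{a,b}_\infty)=J(x,(U^{a,b},D^{a,b}),X^{a,b}_\infty)$ for all $x\in\mathbb R$. *)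

theory Defs
  imports "HOL-Probability.Probability"
begin

text \<open>
  Time is the half line of non-negative reals. Processes and filtrations are indexed by
  \<^typ>\<open>real\<close> and only their members at non-negative times matter.

  The measures \<open>P_x\<close> are realised on one probability space \<open>M\<close> (which is \<open>P_0\<close>): \<open>L\<close> is the Levy
  process started at \<open>0\<close>, and \<open>X\<close> under \<open>P_x\<close> is \<open>x + L\<close> under \<open>M\<close>.

  Costs are non-negative, so their expectations are taken in \<^typ>\<open>ennreal\<close> and may be infinite.
\<close>

type_synonym 'w process = "real \<Rightarrow> 'w \<Rightarrow> real"
type_synonym 'w control = "'w process \<times> 'w process"


section \<open>Levy processes\<close>

definition stochastic_basis :: "'w measure \<Rightarrow> (real \<Rightarrow> 'w measure) \<Rightarrow> bool" where
  "stochastic_basis M F \<longleftrightarrow>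
     prob_space M \<and> filtration (space M) F \<and> (\<forall>t\<ge>0. subalgebra M (F t)) \<and>
     (\<forall>t\<ge>0. sets (F t) = (\<Inter>s\<in>{t<..}. sets (F s))) \<and>
     (\<forall>N\<in>null_sets M. \<forall>A\<subseteq>N. A \<in> sets (F 0))"

definition adapted :: "(real \<Rightarrow> 'w measure) \<Rightarrow> 'w process \<Rightarrow> bool" where
  "adapted F Y \<longleftrightarrow> (\<forall>t\<ge>0. Y t \<in> borel_measurable (F t))"

definition cadlag :: "(real \<Rightarrow> real) \<Rightarrow> bool" where
  "cadlag g \<longleftrightarrow>
     (\<forall>t\<ge>0. continuous (at_right t) g) \<and> (\<forall>t>0. \<exists>l. (g \<longlongrightarrow> l) (at_left t))"

definition levy_process :: "'w measure \<Rightarrow> (real \<Rightarrow> 'w measure) \<Rightarrow> 'w process \<Rightarrow> bool" where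
  "levy_process M F L \<longleftrightarrow>
     adapted F L \<and>
     (AE \<omega> in M. L 0 \<omega> = 0) \<and>
     (AE \<omega> in M. cadlag (\<lambda>t. L t \<omega>)) \<and>
     (\<forall>s\<ge>0. \<forall>t\<ge>s. prob_space.indep_set M (sets (F s))
        (sets (vimage_algebra (space M) (\<lambda>\<omega>. L t \<omega> - L s \<omega>) borel))) \<and>
     (\<forall>s\<ge>0. \<forall>h\<ge>0. distr M borel (\<lambda>\<omega>. L (s + h) \<omega> - L s \<omega>) = distr M borel (L h))"

definition subordinator :: "'w measure \<Rightarrow> (real \<Rightarrow> 'w measure) \<Rightarrow> 'w process \<Rightarrow> bool" where
  "subordinator M F S \<longleftrightarrow>
     levy_process M F S \<and> (AE \<omega> in M. mono_on {0..} (\<lambda>t. S t \<omega>))"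

definition path_variation :: "(real \<Rightarrow> real) \<Rightarrow> real \<Rightarrow> ennreal" where
  "path_variation g t =
     (SUP ts\<in>{ts. sorted ts \<and> set ts \<subseteq> {0..t}}.
        \<Sum>i<length ts - 1. ennreal \<bar>g (ts ! Suc i) - g (ts ! i)\<bar>)"

definition bounded_variation :: "'w measure \<Rightarrow> 'w process \<Rightarrow> bool" where
  "bounded_variation M L \<longleftrightarrow> (AE \<omega> in M. \<forall>t\<ge>0. path_variation (\<lambda>s. L s \<omega>) t < \<infinity>)"

text \<open>
  \<open>L = Sp - Sm\<close> with independent subordinators determines \<open>Sp\<close> and \<open>Sm\<close> only up to adding the same
  drift to both. The last conjunct selects the minimal (Jordan) decomposition.
\<close>

definition subordinator_decomposition ::
  "'w measure \<Rightarrow> (real \<Rightarrow> 'w measure) \<Rightarrow> 'w process \<Rightarrow> 'w process \<Rightarrow> 'w process \<Rightarrow> bool" where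
  "subordinator_decomposition M F L Sp Sm \<longleftrightarrow>
     subordinator M F Sp \<and> subordinator M F Sm \<and>
     prob_space.indep_var M
       (\<Pi>\<^sub>M t\<in>{0..}. borel) (\<lambda>\<omega>. \<lambda>t\<in>{0..}. Sp t \<omega>)
       (\<Pi>\<^sub>M t\<in>{0..}. borel) (\<lambda>\<omega>. \<lambda>t\<in>{0..}. Sm t \<omega>) \<and>
     (AE \<omega> in M. \<forall>t\<ge>0. L t \<omega> = Sp t \<omega> - Sm t \<omega>) \<and>
     (AE \<omega> in M. \<forall>t\<ge>0. ennreal (Sp t \<omega> + Sm t \<omega>) = path_variation (\<lambda>s. L s \<omega>) t)"


section \<open>Controls\<close>

definition admissible :: "'w measure \<Rightarrow> (real \<Rightarrow> 'w measure) \<Rightarrow> 'w control set" where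
  "admissible M F = {(U, D). \<forall>Y\<in>{U, D}.
     adapted F Y \<and>
     (\<forall>t\<ge>0. \<forall>\<omega>\<in>space M. 0 \<le> Y t \<omega>) \<and>
     (AE \<omega> in M. (\<forall>t\<ge>0. continuous (at_right t) (\<lambda>s. Y s \<omega>)) \<and> mono_on {0..} (\<lambda>s. Y s \<omega>)) \<and>
     (\<forall>t\<ge>0. integrable M (Y t))}"

definition controlled :: "'w process \<Rightarrow> real \<Rightarrow> 'w control \<Rightarrow> 'w process" where
  "controlled L x = (\<lambda>(U, D) t \<omega>. x + L t \<omega> + U t \<omega> - D t \<omega>)"

text \<open>
  The measure \<open>dg\<close> on the open half line: \<open>g\<close> is extended by the constant \<open>g 0\<close> to negative times,
  so a jump of a control at time \<open>0\<close> is not counted.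
\<close>

definition stieltjes :: "(real \<Rightarrow> real) \<Rightarrow> real measure" where
  "stieltjes g = interval_measure (\<lambda>t. g (max 0 t))"

definition skorokhod_control ::
  "'w measure \<Rightarrow> (real \<Rightarrow> 'w measure) \<Rightarrow> 'w process \<Rightarrow> real \<Rightarrow> real \<Rightarrow> real \<Rightarrow> 'w control \<Rightarrow> bool" where
  "skorokhod_control M F L x a b = (\<lambda>(U, D).
     (U, D) \<in> admissible M F \<and>
     (AE \<omega> in M. U 0 \<omega> = max (a - x) 0 \<and> D 0 \<omega> = max (x - b) 0) \<and>
     (AE \<omega> in M. \<forall>t\<ge>0. controlled L x (U, D) t \<omega> \<in> {a..b}) \<and>
     (AE \<omega> in M. (\<integral>\<^sup>+t\<in>{0<..}. ennreal (controlled L x (U, D) t \<omega> - a)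
                     \<partial>stieltjes (\<lambda>t. U t \<omega>)) = 0) \<and>
     (AE \<omega> in M. (\<integral>\<^sup>+t\<in>{0<..}. ennreal (b - controlled L x (U, D) t \<omega>)
                     \<partial>stieltjes (\<lambda>t. D t \<omega>)) = 0))"

definition degenerate_control ::
  "'w measure \<Rightarrow> (real \<Rightarrow> 'w measure) \<Rightarrow> 'w process \<Rightarrow> real \<Rightarrow> real \<Rightarrow> 'w control \<Rightarrow> bool" where
  "degenerate_control M F L x a = (\<lambda>(U, D).
     (U, D) \<in> admissible M F \<and>
     (AE \<omega> in M. U 0 \<omega> = max (a - x) 0 \<and> D 0 \<omega> = max (x - a) 0) \<and>
     (\<exists>Sp Sm. subordinator_decomposition M F L Sp Sm \<and>
        (AE \<omega> in M. \<forall>t\<ge>0. U t \<omega> - U 0 \<omega> = Sm t \<omega> \<and> D t \<omega> - D 0 \<omega> = Sp t \<omega>)))"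

definition reflecting_control ::
  "'w measure \<Rightarrow> (real \<Rightarrow> 'w measure) \<Rightarrow> 'w process \<Rightarrow> real \<Rightarrow> real \<Rightarrow> real \<Rightarrow> 'w control \<Rightarrow> bool" where
  "reflecting_control M F L x a b UD \<longleftrightarrow>
     (if a = b then degenerate_control M F L x a UD
      else a < b \<and> skorokhod_control M F L x a b UD)"


section \<open>Mean-field parameter\<close>

text \<open>A limiting random variable enters only through its law, a probability measure on the line.\<close>

definition converges_in_distribution ::
  "'w measure \<Rightarrow> 'w process \<Rightarrow> real measure \<Rightarrow> bool" where
  "converges_in_distribution M Y \<mu> \<longleftrightarrow>
     (\<forall>\<tau>. filterlim \<tau> at_top sequentially \<longrightarrow> weak_conv_m (\<lambda>n. distr M borel (Y (\<tau> n))) \<mu>)"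

definition limit_laws ::
  "'w measure \<Rightarrow> (real \<Rightarrow> 'w measure) \<Rightarrow> 'w process \<Rightarrow> real measure set" where
  "limit_laws M F L =
     {\<mu>. real_distribution \<mu> \<and> (\<exists>K. compact K \<and> (AE y in \<mu>. y \<in> K)) \<and>
         (\<exists>\<eta>\<in>admissible M F. converges_in_distribution M (controlled L 0 \<eta>) \<mu>)}"

definition stationary_law ::
  "'w measure \<Rightarrow> (real \<Rightarrow> 'w measure) \<Rightarrow> 'w process \<Rightarrow> real \<Rightarrow> real \<Rightarrow> real measure" where
  "stationary_law M F L a b =
     (if a = b then return borel a
      else THE \<mu>. \<mu> \<in> limit_laws M F L \<and>
             (\<forall>x UD. reflecting_control M F L x a b UD \<longrightarrow>
                converges_in_distribution M (controlled L x UD) \<mu>))"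

definition mean_field_parameter :: "(real \<Rightarrow> real) \<Rightarrow> real measure \<Rightarrow> real" where
  "mean_field_parameter f \<mu> = (\<integral>y. f y \<partial>\<mu>)"


section \<open>Costs and equilibria\<close>

definition discounted_cost ::
  "'w measure \<Rightarrow> 'w process \<Rightarrow> (real \<Rightarrow> real) \<Rightarrow> (real \<Rightarrow> real \<Rightarrow> real) \<Rightarrow> real \<Rightarrow> real \<Rightarrow>
   real \<Rightarrow> real \<Rightarrow> 'w control \<Rightarrow> real measure \<Rightarrow> ennreal" where
  "discounted_cost M L f c qu qd \<epsilon> x = (\<lambda>(U, D) \<mu>.
     (\<integral>\<^sup>+\<omega>.
        (\<integral>\<^sup>+s\<in>{0..}. ennreal (exp (- \<epsilon> * s) *
            c (controlled L x (U, D) s \<omega>) (mean_field_parameter f \<mu>)) \<partial>lborel)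
        + ennreal qu * (\<integral>\<^sup>+s\<in>{0<..}. ennreal (exp (- \<epsilon> * s)) \<partial>stieltjes (\<lambda>t. U t \<omega>))
        + ennreal qd * (\<integral>\<^sup>+s\<in>{0<..}. ennreal (exp (- \<epsilon> * s)) \<partial>stieltjes (\<lambda>t. D t \<omega>)) \<partial>M)
     + ennreal qu * (\<integral>\<^sup>+\<omega>. ennreal (U 0 \<omega>) \<partial>M)
     + ennreal qd * (\<integral>\<^sup>+\<omega>. ennreal (D 0 \<omega>) \<partial>M))"

definition ergodic_cost ::
  "'w measure \<Rightarrow> 'w process \<Rightarrow> (real \<Rightarrow> real) \<Rightarrow> (real \<Rightarrow> real \<Rightarrow> real) \<Rightarrow> real \<Rightarrow> real \<Rightarrow>
   real \<Rightarrow> 'w control \<Rightarrow> real measure \<Rightarrow> ennreal" where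
  "ergodic_cost M L f c qu qd x = (\<lambda>(U, D) \<mu>.
     Limsup at_top (\<lambda>T. ennreal (1 / T) *
       (\<integral>\<^sup>+\<omega>.
          (\<integral>\<^sup>+s\<in>{0..T}. ennreal
              (c (controlled L x (U, D) s \<omega>) (mean_field_parameter f \<mu>)) \<partial>lborel)
          + ennreal (qu * U T \<omega>) + ennreal (qd * D T \<omega>) \<partial>M)))"

definition discounted_value ::
  "'w measure \<Rightarrow> (real \<Rightarrow> 'w measure) \<Rightarrow> 'w process \<Rightarrow> (real \<Rightarrow> real) \<Rightarrow> (real \<Rightarrow> real \<Rightarrow> real) \<Rightarrow>
   real \<Rightarrow> real \<Rightarrow> real \<Rightarrow> real \<Rightarrow> real measure \<Rightarrow> ennreal" where
  "discounted_value M F L f c qu qd \<epsilon> x \<mu> =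
     (INF UD\<in>admissible M F. discounted_cost M L f c qu qd \<epsilon> x UD \<mu>)"

definition ergodic_value ::
  "'w measure \<Rightarrow> (real \<Rightarrow> 'w measure) \<Rightarrow> 'w process \<Rightarrow> (real \<Rightarrow> real) \<Rightarrow> (real \<Rightarrow> real \<Rightarrow> real) \<Rightarrow>
   real \<Rightarrow> real \<Rightarrow> real \<Rightarrow> real measure \<Rightarrow> ennreal" where
  "ergodic_value M F L f c qu qd x \<mu> =
     (INF UD\<in>admissible M F. ergodic_cost M L f c qu qd x UD \<mu>)"

definition discounted_equilibrium ::
  "'w measure \<Rightarrow> (real \<Rightarrow> 'w measure) \<Rightarrow> 'w process \<Rightarrow> (real \<Rightarrow> real) \<Rightarrow> (real \<Rightarrow> real \<Rightarrow> real) \<Rightarrow>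
   real \<Rightarrow> real \<Rightarrow> real \<Rightarrow> real \<Rightarrow> real \<Rightarrow> bool" where
  "discounted_equilibrium M F L f c qu qd \<epsilon> a b \<longleftrightarrow>
     a \<le> b \<and> (\<not> bounded_variation M L \<longrightarrow> a < b) \<and>
     (\<forall>x. \<exists>UD. reflecting_control M F L x a b UD \<and>
        discounted_value M F L f c qu qd \<epsilon> x (stationary_law M F L a b) =
        discounted_cost M L f c qu qd \<epsilon> x UD (stationary_law M F L a b))"

definition ergodic_equilibrium ::
  "'w measure \<Rightarrow> (real \<Rightarrow> 'w measure) \<Rightarrow> 'w process \<Rightarrow> (real \<Rightarrow> real) \<Rightarrow> (real \<Rightarrow> real \<Rightarrow> real) \<Rightarrow>
   real \<Rightarrow> real \<Rightarrow> real \<Rightarrow> real \<Rightarrow> bool" where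
  "ergodic_equilibrium M F L f c qu qd a b \<longleftrightarrow>
     a \<le> b \<and> (\<not> bounded_variation M L \<longrightarrow> a < b) \<and>
     (\<forall>x. \<exists>UD. reflecting_control M F L x a b UD \<and>
        ergodic_value M F L f c qu qd x (stationary_law M F L a b) =
        ergodic_cost M L f c qu qd x UD (stationary_law M F L a b))"

definition strictly_convex :: "(real \<Rightarrow> real) \<Rightarrow> bool" where
  "strictly_convex g \<longleftrightarrow>
     (\<forall>x y u. x \<noteq> y \<longrightarrow> 0 < u \<longrightarrow> u < 1 \<longrightarrow>
        g (u * x + (1 - u) * y) < u * g x + (1 - u) * g y)"

end

theory Submission
 imports Defs
begin

text \<open>
 For a fixed parameter \<open>p\<close> the discounted cost is convex in the path, so reflection in \<open>[a, b]\<close> is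
 optimal from every starting point as soon as the adjoint function
 \<open>v y = E (\<integral>exp (- e s) * c\<^sub>x (X\<^sub>s, p) ds)\<close>, where \<open>X\<close> is the process reflected in \<open>[a, b]\<close> from \<open>y\<close>, satisfies
 \<open>v a = - q\<^sub>u\<close> and \<open>v b = q\<^sub>d\<close>. A pair \<open>(a, b)\<close> solving these equations with \<open>p = p\<^sup>a\<^sup>b\<close> is found
 by applying Brouwer's theorem to a variational inequality on \<open>{a \<le> 0 \<le> b, w \<le> b - a \<le> W}\<close>. Neither
 width constraint is active: on a wide band \<open>v b - v a\<close> is large by strict convexity, and on a narrow one it is
 small because a drop of size \<open>b - a\<close>, which has positive probability as \<open>X\<close> is not a
 subordinator, makes all reflected paths coincide. As \<open>w\<close>, \<open>W\<close> do not depend on the discount rate \<open>e\<close>,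
 the equilibria accumulate as \<open>e\<close> tends to 0 and no degenerate band arises. The same coupling gives uniform
 ergodicity, so that \<open>e\<close> times the discounted cost of a band is within \<open>O(e)\<close> of its ergodic cost; an
 Abelian argument bounds the discounted cost of any other control by its ergodic cost. The running process is
 first modified on a null set to have regular paths.
\<close>

section \<open>Two-sided reflection on a grid\<close>

text \<open>Reflection is built by hand, as the least pair of controls that keeps the path in the
  band, in a limit over dyadic grids. Leastness then replaces stochastic calculus: comparison, the
  flow property and convexity in the band all follow from it. Finiteness of the limit comes from an
  expectation bound with a Huber function, quadratic inside the band and linear outside, hence
  integrable. In the vanishing-discount step a competitor may leave every compact set, and there the
  costs for nearby parameters need not be uniformly close. The comparison therefore passes through a
  further band, optimal for the limiting parameter: along a reflected path a change of parameter
  costs little. Stationary cost rates are continuous in the band for two reasons: the law of the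
  position by uniform ergodicity, the rates of pushing because they are convex functions of the
  band. Control costs are integrated by parts, so that they become Lebesgue integrals in
  time.\<close>

primrec grid_controls :: "real => real => real => (nat => real) => nat => real \<times> real" where
 "grid_controls a b x w 0 = (max 0 (a - x - w 0), max 0 (x + w 0 - b))"
| "grid_controls a b x w (Suc k) =
   (case grid_controls a b x w k of (u, d) =>
    (max u (a - x - w (Suc k) + d), max d (x + w (Suc k) + u - b)))"

definition "grid_up a b x w k = fst (grid_controls a b x w k)"
definition "grid_down a b x w k = snd (grid_controls a b x w k)"
definition "grid_pos a b x w k = x + w k + grid_up a b x w k - grid_down a b x w k"

lemma grid_up_0 [simp]: "grid_up a b x w 0 = max 0 (a - x - w 0)"
 and grid_down_0 [simp]: "grid_down a b x w 0 = max 0 (x + w 0 - b)" by (auto simp: grid_up_def grid_down_def)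

lemma grid_up_Suc:
  "grid_up a b x w (Suc k) = max (grid_up a b x w k) (a - x - w (Suc k) + grid_down a b x w k)" and grid_down_Suc:
  "grid_down a b x w (Suc k) = max (grid_down a b x w k) (x + w (Suc k) + grid_up a b x w k - b)"
 by (auto simp: grid_up_def grid_down_def split: prod.splits)

lemma grid_down_eq_grid_up:
 "grid_down a b x w k = grid_up (- b) (- a) (- x) (%i. - w i) k"
 "grid_up a b x w k = grid_down (- b) (- a) (- x) (%i. - w i) k"
 by (induction k) (auto simp: grid_up_Suc grid_down_Suc algebra_simps max.commute)

text \<open>Each recursion reads the old value of the opposite control. As \<open>a <= b\<close>, at
  most one barrier is overstepped in a step, so together they amount to clipping the moved
  position.\<close>

lemma grid_pos_Suc':
 assumes "a <= b"
 shows "grid_pos a b x w (Suc k) = max a (min b (grid_pos a b x w k + (w (Suc k) - w k)))"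
 using assms by (auto simp: grid_pos_def grid_up_Suc grid_down_Suc)

lemma grid_pos_0: "a <= b ==> grid_pos a b x w 0 = max a (min b (x + w 0))"
 by (auto simp: grid_pos_def)

lemma grid_pos_bounds:
 assumes "a <= b"
 shows "a <= grid_pos a b x w k" "grid_pos a b x w k <= b"
 using assms by (cases k; simp add: grid_pos_Suc' grid_pos_0)+

lemma grid_up_Suc_eq:
 "grid_up a b x w (Suc k) =
  grid_up a b x w k + max 0 (a - (grid_pos a b x w k + (w (Suc k) - w k)))"
 by (simp add: grid_up_Suc grid_pos_def max_def)

lemma grid_down_Suc_eq:
 "grid_down a b x w (Suc k) =
  grid_down a b x w k + max 0 (grid_pos a b x w k + (w (Suc k) - w k) - b)"
 by (simp add: grid_down_Suc grid_pos_def max_def)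

lemma grid_up_mono: "i <= j ==> grid_up a b x w i <= grid_up a b x w j"
 by (rule lift_Suc_mono_le) (auto simp: grid_up_Suc)

lemma grid_down_mono: "i <= j ==> grid_down a b x w i <= grid_down a b x w j"
 by (rule lift_Suc_mono_le) (auto simp: grid_down_Suc)

lemma grid_up_nonneg: "0 <= grid_up a b x w k"
 using grid_up_mono[of 0 k a b x w] by (auto simp: max_def split: if_splits)

lemma grid_down_nonneg: "0 <= grid_down a b x w k"
 using grid_down_mono[of 0 k a b x w] by (auto simp: max_def split: if_splits)

text \<open>Discrete form of the fixed point equation between the two controls. When the upward
  control grows in a step, the downward one does not, so the maximum is attained at that very
  index.\<close>

lemma grid_up_attained:
 assumes "a <= b"
 shows "grid_up a b x w k = 0 \<or>
     (EX j<=k. grid_up a b x w k = a - x - w j + grid_down a b x w j)"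
proof (induction k)
 case 0
 then show ?case using assms by (auto simp: max_def)
next
 case (Suc k)
 show ?case
 proof (cases "grid_up a b x w (Suc k) = grid_up a b x w k")
  case True
  then show ?thesis using Suc by (metis le_Suc_eq)
 next
  case False
  then have *: "grid_up a b x w (Suc k) = a - x - w (Suc k) + grid_down a b x w k"
   "grid_up a b x w k < a - x - w (Suc k) + grid_down a b x w k" by (auto simp: grid_up_Suc max_def split: if_splits)
  then have "grid_down a b x w (Suc k) = grid_down a b x w k" using assms by (auto simp: grid_down_Suc)
  then show ?thesis using * by auto
 qed
qed

text \<open>The source of every later comparison of controls. At each step \<open>u\<close> is at
  least its old value and, since the position stays above \<open>a\<close> and \<open>d\<close>
  grows, at least the push that the grid recursion computes from the smaller
  \<open>grid_down\<close>.\<close>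

lemma grid_minimal:
 assumes u: "!!i j. i <= j ==> u i <= u j" "0 <= u 0"
  and d: "!!i j. i <= j ==> d i <= d j" "0 <= d 0"
  and in_band: "!!k. a <= x + w k + u k - d k" "!!k. x + w k + u k - d k <= b"
 shows "grid_up a b x w k <= u k & grid_down a b x w k <= d k"
proof (induction k)
 case 0
 show ?case using u(2) d(2) in_band(1)[of 0] in_band(2)[of 0] by auto
next
 case (Suc k)
 have "u k <= u (Suc k)" "d k <= d (Suc k)" using u d by auto
 then show ?case using Suc in_band(1)[of "Suc k"] in_band(2)[of "Suc k"] by (auto simp: grid_up_Suc grid_down_Suc)
qed

lemma grid_pos_mono:
 assumes "a <= a'" "b <= b'" "x <= x'" "a <= b" "a' <= b'"
 shows "grid_pos a b x w k <= grid_pos a' b' x' w k"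
proof (induction k)
 case 0
 then show ?case using assms by (auto simp: grid_pos_0 max_def min_def)
next
 case (Suc k)
 then show ?case using assms by (auto simp: grid_pos_Suc' max_def min_def)
qed

lemma grid_pos_shift:
 assumes "a <= b"
 shows "grid_pos (a + c) (b + c) (x + c) w k = grid_pos a b x w k + c" using assms
 by (induction k) (auto simp: grid_pos_Suc' grid_pos_0 max_def min_def)

text \<open>A monotone map that commutes with translations is nonexpansive for the maximum
  norm.\<close>

lemma grid_pos_lipschitz:
 assumes "abs (a - a') <= e" "abs (b - b') <= e" "abs (x - x') <= e" "a <= b" "a' <= b'"
 shows "abs (grid_pos a b x w k - grid_pos a' b' x' w k) <= e"
proof -
 have "grid_pos a b x w k <= grid_pos (a' + e) (b' + e) (x' + e) w k" using assms by (intro grid_pos_mono) auto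
 moreover have "grid_pos a' b' x' w k <= grid_pos (a + e) (b + e) (x + e) w k"
  using assms by (intro grid_pos_mono) auto
 ultimately show ?thesis using assms by (simp add: grid_pos_shift abs_le_iff)
qed

section \<open>Two-sided reflection of a path\<close>

definition grid_index :: "nat => real => nat" where
 "grid_index N t = nat \<lfloor>2 ^ N * t\<rfloor>"

text \<open>The first point of the level-\<open>n\<close> grid strictly after \<open>t\<close>:
  right-continuous functions have to be approached from the right.\<close>

definition next_grid :: "nat => real => real" where
 "next_grid N t = (real (grid_index N t) + 1) / 2 ^ N"

definition sample :: "(real => real) => nat => nat => real" where
 "sample l N k = l (real k / 2 ^ N)"

text \<open>Valued in \<open>ennreal\<close> because the supremum may be infinite for a path that
  oscillates across the band infinitely often in finite time.\<close>

definition dyadic_up :: "real => real => real => (real => real) => real => ennreal" where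
 "dyadic_up a b x l t = (SUP N. ennreal (grid_up a b x (sample l N) (grid_index N t)))"

text \<open>\<open>dyadic_up\<close> only sees the path at dyadic times up to \<open>t\<close>; the
  infimum over later grid times is its right-continuous version.\<close>

definition refl_up :: "real => real => real => (real => real) => real => real" where
 "refl_up a b x l t = (INF n. enn2real (dyadic_up a b x l (next_grid n t)))"

definition refl_down :: "real => real => real => (real => real) => real => real" where
 "refl_down a b x l t = refl_up (- b) (- a) (- x) (%s. - l s) t"

definition refl_pos :: "real => real => real => (real => real) => real => real" where
 "refl_pos a b x l t = x + l t + refl_up a b x l t - refl_down a b x l t"

definition right_cont :: "(real => real) => bool" where
 "right_cont l \<longleftrightarrow> (ALL t>=0. continuous (at_right t) l)"

text \<open>Negating path and band exchanges the two controls, so the second half is finiteness of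
  the downward control.\<close>

definition tame :: "real => real => real => (real => real) => bool" where
 "tame a b x l \<longleftrightarrow> right_cont l &
   (ALL t>=0. dyadic_up a b x l t < \<infinity> & dyadic_up (- b) (- a) (- x) (%s. - l s) t < \<infinity>)"

definition feasible ::
 "real => real => real => (real => real) => (real => real) => (real => real) => bool" where
 "feasible a b x l u d \<longleftrightarrow> mono_on {0..} u & mono_on {0..} d & 0 <= u 0 & 0 <= d 0 &
   (ALL t>=0. a <= x + l t + u t - d t & x + l t + u t - d t <= b)"

lemma feasible_uminus:
 "feasible a b x l u d ==> feasible (- b) (- a) (- x) (%s. - l s) d u"
 unfolding feasible_def by auto

lemma right_cont_uminus: "right_cont l ==> right_cont (%s. - l s)"
 unfolding right_cont_def by (auto intro: continuous_minus)

lemma tame_uminus: "tame a b x l ==> tame (- b) (- a) (- x) (%s. - l s)"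
 unfolding tame_def by (auto simp: right_cont_uminus)

lemma refl_up_uminus: "refl_up (- b) (- a) (- x) (%s. - l s) t = refl_down a b x l t"
 and refl_down_uminus: "refl_down (- b) (- a) (- x) (%s. - l s) t = refl_up a b x l t"
 by (simp_all add: refl_down_def)

lemma refl_pos_uminus: "refl_pos (- b) (- a) (- x) (%s. - l s) t = - refl_pos a b x l t"
 by (simp add: refl_pos_def refl_down_def)

section \<open>Dyadic times and right-continuous functions\<close>

lemma grid_index_mono: "s <= t ==> grid_index N s <= grid_index N t"
 unfolding grid_index_def by (intro nat_mono floor_mono mult_left_mono) auto

lemma grid_index_le: "0 <= t ==> real (grid_index N t) / 2 ^ N <= t" unfolding grid_index_def
 by (simp add: divide_le_eq mult.commute)

lemma grid_index_double: "0 <= t ==> 2 * grid_index N t <= grid_index (Suc N) t"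
proof -
 assume "0 <= t"
 then have "2 * \<lfloor>2 ^ N * t\<rfloor> <= \<lfloor>2 ^ Suc N * t\<rfloor>"
  by (simp add: le_floor_iff mult.assoc)
 then show ?thesis using \<open>0 <= t\<close> unfolding grid_index_def by simp
qed

lemma grid_index_Suc_le: "0 <= t ==> grid_index (Suc N) t <= 2 * grid_index N t + 1"
proof -
 assume "0 <= t"
 have "2 ^ N * t < \<lfloor>2 ^ N * t\<rfloor> + 1" by linarith
 then have "\<lfloor>2 ^ Suc N * t\<rfloor> < 2 * \<lfloor>2 ^ N * t\<rfloor> + 2"
  by (simp add: floor_less_iff mult.assoc) linarith
 then show ?thesis using \<open>0 <= t\<close> unfolding grid_index_def by (simp add: nat_le_iff)
qed

lemma grid_index_dyadic: "n <= N ==> grid_index N (real k / 2 ^ n) = k * 2 ^ (N - n)"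
proof -
 assume "n <= N"
 then have "2 ^ N * (real k / 2 ^ n) = real (k * 2 ^ (N - n))"
  by (simp add: power_diff_conv_inverse[of "2::real"] field_simps)
 then show ?thesis unfolding grid_index_def by (simp del: of_nat_mult)
qed

lemma next_grid_gt: "0 <= t ==> t < next_grid n t"
proof -
 assume "0 <= t"
 have "2 ^ n * t < real (grid_index n t) + 1"
  using \<open>0 <= t\<close> unfolding grid_index_def by (simp; linarith)
 then show ?thesis unfolding next_grid_def by (simp add: less_divide_eq mult.commute)
qed

lemma next_grid_le: "0 <= t ==> next_grid n t <= t + 1 / 2 ^ n"
 using grid_index_le[of t n] unfolding next_grid_def by (simp add: add_divide_distrib)

lemma next_grid_decseq: "0 <= t ==> decseq (%n. next_grid n t)"
proof (rule decseq_SucI)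
 fix n assume "0 <= t"
 then have "real (grid_index (Suc n) t) <= 2 * real (grid_index n t) + 1"
  using grid_index_Suc_le[of t n] by linarith
 then show "next_grid (Suc n) t <= next_grid n t" unfolding next_grid_def by (simp add: divide_le_eq)
qed

lemma tendsto_half_power: "(%n. 1 / 2 ^ n :: real) \<longlonglongrightarrow> 0"
 using LIMSEQ_realpow_zero[of "1/2 :: real"] by (simp add: power_one_over)

lemma next_grid_tendsto:
 assumes "0 <= t"
 shows "(%n. next_grid n t) \<longlonglongrightarrow> t"
proof (rule tendsto_sandwich[of "%_. t" _ _ "%n. t + 1 / 2 ^ n"])
 show "(%n. t + 1 / 2 ^ n) \<longlonglongrightarrow> t"
  using tendsto_add[OF tendsto_const[of t] tendsto_half_power] by simp
qed (use assms next_grid_gt next_grid_le in \<open>auto intro!: always_eventually less_imp_le\<close>)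

lemma right_cont_tendsto:
 assumes "right_cont g" "0 <= t" "r \<longlonglongrightarrow> t" "!!n. t < r n"
 shows "(%n. g (r n)) \<longlonglongrightarrow> g t"
proof -
 have "(g \<longlongrightarrow> g t) (at_right t)" using assms(1,2) by (auto simp: right_cont_def continuous_within)
 moreover have "filterlim r (at_right t) sequentially"
  using assms(3,4) by (auto simp: filterlim_at intro!: always_eventually less_imp_neq[symmetric])
 ultimately show ?thesis by (rule filterlim_compose)
qed

lemma right_cont_ex:
 assumes "right_cont g" "0 <= t" "0 < (e::real)"
 obtains r where "t < r" "!!s. t <= s ==> s < r ==> abs (g s - g t) < e"
proof -
 have "(g \<longlongrightarrow> g t) (at_right t)" using assms(1,2) by (auto simp: right_cont_def continuous_within)
 then have "eventually (%s. dist (g s) (g t) < e) (at_right t)" using assms(3) tendstoD by blast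
 then obtain r where "t < r" "ALL s>t. s < r --> dist (g s) (g t) < e"
  unfolding eventually_at_right_field by auto
 then show thesis using that assms(3) by (smt (verit, best) dist_real_def)
qed

lemma right_contI:
 assumes "!!t e. 0 <= t ==> 0 < e ==> EX r>t. ALL s. t < s & s < r --> abs (g s - g t) < (e::real)"
 shows "right_cont g" unfolding right_cont_def continuous_within
proof (intro allI impI tendstoI)
 fix t e :: real assume "0 <= t" "0 < e"
 from assms[OF this] show "eventually (%s. dist (g s) (g t) < e) (at_right t)"
  unfolding eventually_at_right_field dist_real_def by auto
qed

lemma right_cont_add: "right_cont f ==> right_cont g ==> right_cont (%s. f s + g s)"
 and right_cont_diff: "right_cont f ==> right_cont g ==> right_cont (%s. f s - g s)"
 and right_cont_const: "right_cont (%s. c)"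
 and right_cont_cmult: "right_cont f ==> right_cont (%s. c * f s)"
 unfolding right_cont_def by (auto intro!: continuous_intros)

lemma right_cont_shift:
 assumes "right_cont g" "0 <= t"
 shows "right_cont (%s. g (t + s))"
proof (rule right_contI)
 fix r e :: real assume "0 <= r" "0 < e"
 then obtain q where "t + r < q" "!!s. t + r <= s ==> s < q ==> abs (g s - g (t + r)) < e"
  using right_cont_ex[OF assms(1), of "t + r" e] assms(2) by auto
 then show "EX q>r. ALL s. r < s & s < q --> abs (g (t + s) - g (t + r)) < e"
  by (intro exI[of _ "q - t"]) auto
qed

section \<open>Limits of the grid controls\<close>

lemma grid_up_refine:
 assumes "a <= b"
 shows "grid_up a b x (sample l N) k <= grid_up a b x (sample l (Suc N)) (2 * k)"
proof -
 have s: "sample l N i = sample l (Suc N) (2 * i)" for i unfolding sample_def by simp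
 \<comment> \<open>The controls of the finer grid, read at even indices, are feasible for the
   coarser grid.\<close>
 show ?thesis using grid_minimal[of "%k. grid_up a b x (sample l (Suc N)) (2 * k)"
    "%k. grid_down a b x (sample l (Suc N)) (2 * k)" a x "sample l N" b k]
   grid_pos_bounds[OF assms, of x "sample l (Suc N)" "2 * _"]
  by (auto simp: grid_up_mono grid_down_mono grid_up_nonneg grid_down_nonneg grid_pos_def s
   simp del: grid_up_0 grid_down_0)
qed

lemma grid_up_incseq:
 assumes "a <= b" "0 <= t"
 shows "incseq (%N. grid_up a b x (sample l N) (grid_index N t))"
proof (rule incseq_SucI)
 fix N
 show "grid_up a b x (sample l N) (grid_index N t) <= grid_up a b x (sample l (Suc N)) (grid_index (Suc N) t)"
  using grid_up_refine[OF assms(1)] grid_up_mono[OF grid_index_double[OF assms(2)]] by (rule order_trans)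
qed

lemma dyadic_up_mono: "s <= t ==> dyadic_up a b x l s <= dyadic_up a b x l t"
 unfolding dyadic_up_def by (intro SUP_mono' ennreal_leI grid_up_mono grid_index_mono)

text \<open>A pair that is feasible in continuous time is feasible on every grid when read at the
  grid times. Exhibiting any feasible pair is therefore a proof of tameness.\<close>

lemma dyadic_up_le_feasible:
 assumes "feasible a b x l u d" "0 <= t"
 shows "dyadic_up a b x l t <= ennreal (u t)" unfolding dyadic_up_def
proof (intro SUP_least ennreal_leI)
 fix N
 have "grid_up a b x (sample l N) (grid_index N t) <= u (real (grid_index N t) / 2 ^ N)"
  using grid_minimal[of "%k. u (real k / 2 ^ N)" "%k. d (real k / 2 ^ N)" a x "sample l N" b]
   assms(1) unfolding feasible_def sample_def by (auto simp: mono_on_def divide_right_mono)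
 also have "\<dots> <= u t" using assms grid_index_le[of t N] unfolding feasible_def
  by (intro mono_onD[of "{0..}" u]) auto
 finally show "grid_up a b x (sample l N) (grid_index N t) <= u t" .
qed

lemma feasible_tame:
 assumes "feasible a b x l u d" "right_cont l"
 shows "tame a b x l" using dyadic_up_le_feasible[OF assms(1)] dyadic_up_le_feasible[OF feasible_uminus[OF assms(1)]]
  assms(2) unfolding tame_def by (auto intro: order_le_less_trans[OF _ ennreal_less_top])

lemma refl_up_nonneg: "0 <= refl_up a b x l t" unfolding refl_up_def by (auto intro: cINF_greatest)

lemma refl_down_nonneg: "0 <= refl_down a b x l t" unfolding refl_down_def by (rule refl_up_nonneg)

lemma dyadic_up_tendsto:
 assumes "a <= b" "tame a b x l" "0 <= t"
 shows "(%N. grid_up a b x (sample l N) (grid_index N t)) \<longlonglongrightarrow> enn2real (dyadic_up a b x l t)"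
proof -
 have "incseq (%N. ennreal (grid_up a b x (sample l N) (grid_index N t)))"
  using grid_up_incseq[OF assms(1,3), of x l] by (auto simp: incseq_def intro: ennreal_leI)
 then have "(%N. ennreal (grid_up a b x (sample l N) (grid_index N t))) \<longlonglongrightarrow> dyadic_up a b x l t"
  unfolding dyadic_up_def by (rule LIMSEQ_SUP)
 also have "dyadic_up a b x l t = ennreal (enn2real (dyadic_up a b x l t))" using assms by (simp add: tame_def)
 finally show ?thesis by (subst (asm) tendsto_ennreal_iff) (auto simp: grid_up_nonneg)
qed

lemma refl_up_tendsto:
 assumes "tame a b x l" "0 <= t"
 shows "(%n. enn2real (dyadic_up a b x l (next_grid n t))) \<longlonglongrightarrow> refl_up a b x l t"
 unfolding refl_up_def
proof (rule LIMSEQ_decseq_INF)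
 show "bdd_below (range (%n. enn2real (dyadic_up a b x l (next_grid n t))))"
  by (intro bdd_belowI2[of _ 0]) auto
 show "decseq (%n. enn2real (dyadic_up a b x l (next_grid n t)))"
 proof (rule decseq_SucI)
  fix n
  have "0 <= next_grid n t" using next_grid_gt[OF assms(2), of n] assms(2) by linarith
  moreover have "next_grid (Suc n) t <= next_grid n t"
   using next_grid_decseq[OF assms(2)] by (auto simp: decseq_Suc_iff)
  ultimately show "enn2real (dyadic_up a b x l (next_grid (Suc n) t))
   <= enn2real (dyadic_up a b x l (next_grid n t))"
   using assms(1) by (intro enn2real_mono dyadic_up_mono) (auto simp: tame_def)
 qed
qed

lemma dyadic_up_real_mono:
 assumes "tame a b x l" "s <= t" "0 <= t"
 shows "enn2real (dyadic_up a b x l s) <= enn2real (dyadic_up a b x l t)"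
 using assms by (intro enn2real_mono dyadic_up_mono) (auto simp: tame_def)

lemma refl_up_le_dyadic:
 assumes "tame a b x l" "0 <= t" "t < r"
 shows "refl_up a b x l t <= enn2real (dyadic_up a b x l r)"
proof -
 have "eventually (%n. next_grid n t < r) sequentially"
  using next_grid_tendsto[OF assms(2)] assms(3) by (rule order_tendstoD)
 then obtain n where n: "next_grid n t < r" by (auto simp: eventually_sequentially)
 have "refl_up a b x l t <= enn2real (dyadic_up a b x l (next_grid n t))"
  unfolding refl_up_def by (intro cINF_lower bdd_belowI2[of _ 0]) auto
 also have "\<dots> <= enn2real (dyadic_up a b x l r)" using n assms by (intro dyadic_up_real_mono) auto
 finally show ?thesis .
qed

lemma dyadic_le_refl_up:
 assumes "tame a b x l" "0 <= t"
 shows "enn2real (dyadic_up a b x l t) <= refl_up a b x l t" unfolding refl_up_def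
proof (rule cINF_greatest)
 fix n
 show "enn2real (dyadic_up a b x l t) <= enn2real (dyadic_up a b x l (next_grid n t))"
  using next_grid_gt[OF assms(2), of n] assms by (intro dyadic_up_real_mono) auto
qed simp

lemma refl_up_mono:
 assumes "tame a b x l" "0 <= s" "s <= t"
 shows "refl_up a b x l s <= refl_up a b x l t"
proof (cases "s = t")
 case False
 then show ?thesis using refl_up_le_dyadic[OF assms(1,2), of t] dyadic_le_refl_up[OF assms(1), of t] assms by auto
qed simp

lemma refl_up_right_cont:
 assumes "tame a b x l"
 shows "right_cont (refl_up a b x l)"
proof (rule right_contI)
 fix t e :: real assume te: "0 <= t" "0 < e"
 have "eventually (%n. enn2real (dyadic_up a b x l (next_grid n t)) < refl_up a b x l t + e) sequentially"
  using refl_up_tendsto[OF assms te(1)] by (rule order_tendstoD) (use te in simp)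
 then obtain n where n: "enn2real (dyadic_up a b x l (next_grid n t)) < refl_up a b x l t + e"
  by (auto simp: eventually_sequentially)
 show "EX r>t. ALL s. t < s & s < r --> abs (refl_up a b x l s - refl_up a b x l t) < e"
 proof (intro exI[of _ "next_grid n t"] conjI allI impI)
  fix s assume s: "t < s & s < next_grid n t"
  then have "refl_up a b x l s <= enn2real (dyadic_up a b x l (next_grid n t))"
   using assms te by (intro refl_up_le_dyadic) auto
  moreover have "refl_up a b x l t <= refl_up a b x l s" using assms te s by (intro refl_up_mono) auto
  ultimately show "abs (refl_up a b x l s - refl_up a b x l t) < e" using n by auto
 qed (use te next_grid_gt in auto)
qed

text \<open>Leastness survives both limits: the bound by \<open>u\<close> holds at the grid times
  after \<open>t\<close>, and right-continuity of \<open>u\<close> brings it back to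
  \<open>t\<close>.\<close>

lemma refl_up_le_feasible:
 assumes "feasible a b x l u d" "right_cont l" "right_cont u" "0 <= t"
 shows "refl_up a b x l t <= u t"
proof -
 have T: "tame a b x l" using assms(1,2) by (rule feasible_tame)
 have "(%n. u (next_grid n t)) \<longlonglongrightarrow> u t"
  by (rule right_cont_tendsto[OF assms(3,4) next_grid_tendsto[OF assms(4)] next_grid_gt[OF assms(4)]])
 moreover have "enn2real (dyadic_up a b x l (next_grid n t)) <= u (next_grid n t)" for n
 proof -
  have n: "0 <= next_grid n t" using next_grid_gt[OF assms(4), of n] assms(4) by simp
  then have "0 <= u (next_grid n t)"
   using assms(1) mono_onD[of "{0..}" u 0 "next_grid n t"] unfolding feasible_def by auto
  moreover have "enn2real (dyadic_up a b x l (next_grid n t)) <= enn2real (ennreal (u (next_grid n t)))"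
   by (intro enn2real_mono dyadic_up_le_feasible[OF assms(1) n]) simp
  ultimately show ?thesis by simp
 qed
 ultimately show ?thesis by (intro LIMSEQ_le[OF refl_up_tendsto[OF T assms(4)]]) auto
qed

lemma refl_down_le_feasible:
 assumes "feasible a b x l u d" "right_cont l" "right_cont d" "0 <= t"
 shows "refl_down a b x l t <= d t" unfolding refl_down_def
 by (rule refl_up_le_feasible[OF feasible_uminus[OF assms(1)]])
  (use assms right_cont_uminus in auto)

lemma refl_down_mono:
 "tame a b x l ==> 0 <= s ==> s <= t ==> refl_down a b x l s <= refl_down a b x l t"
 unfolding refl_down_def by (intro refl_up_mono tame_uminus)

lemma refl_down_right_cont: "tame a b x l ==> right_cont (refl_down a b x l)"
 using refl_up_right_cont[OF tame_uminus] unfolding refl_down_def by auto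

lemma refl_pos_right_cont: "tame a b x l ==> right_cont (refl_pos a b x l)" unfolding refl_pos_def
 by (intro right_cont_diff right_cont_add right_cont_const refl_up_right_cont refl_down_right_cont)
  (auto simp: tame_def)

lemma sample_uminus: "sample (%s. - l s) N = (%k. - sample l N k)"
 by (simp add: sample_def fun_eq_iff)

text \<open>At a dyadic time, the grid processes with finer and finer grids see the path at that very time.\<close>

lemma grid_pos_tendsto:
 assumes "a <= b" "tame a b x l" "t = real k / 2 ^ n"
 shows "(%N. grid_pos a b x (sample l N) (grid_index N t)) \<longlonglongrightarrow>
   x + l t + enn2real (dyadic_up a b x l t) - enn2real (dyadic_up (- b) (- a) (- x) (%s. - l s) t)"
proof -
 have t: "0 <= t" using assms by simp
 have *: "(%N. x + l t + grid_up a b x (sample l N) (grid_index N t)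
   - grid_up (- b) (- a) (- x) (sample (%s. - l s) N) (grid_index N t)) \<longlonglongrightarrow>
   x + l t + enn2real (dyadic_up a b x l t) - enn2real (dyadic_up (- b) (- a) (- x) (%s. - l s) t)"
  using assms(1) by (intro tendsto_diff tendsto_add tendsto_const dyadic_up_tendsto
    assms(2) tame_uminus t) auto
 have "eventually (%N. x + l t + grid_up a b x (sample l N) (grid_index N t)
   - grid_up (- b) (- a) (- x) (sample (%s. - l s) N) (grid_index N t)
   = grid_pos a b x (sample l N) (grid_index N t)) sequentially" using eventually_ge_at_top[of n]
 proof eventually_elim
  case (elim N)
  have "sample l N (grid_index N t) = l t" using elim unfolding assms(3) sample_def
   by (simp add: grid_index_dyadic[OF elim] power_diff_conv_inverse[of "2::real"] field_simps)
  then show ?case by (simp add: grid_pos_def grid_down_eq_grid_up(1)[of a b x] sample_uminus)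
 qed
 from Lim_transform_eventually[OF * this] show ?thesis .
qed

section \<open>The reflected position as an iterated limit\<close>

definition dyadic_pos :: "real => real => real => (real => real) => real => real" where
 "dyadic_pos a b x l t = x + l t + enn2real (dyadic_up a b x l t)
   - enn2real (dyadic_up (- b) (- a) (- x) (%s. - l s) t)"

lemma grid_pos_tendsto_next:
 assumes "a <= b" "tame a b x l"
 shows "(%N. grid_pos a b x (sample l N) (grid_index N (next_grid n t)))
  \<longlonglongrightarrow> dyadic_pos a b x l (next_grid n t)" unfolding dyadic_pos_def
 by (rule grid_pos_tendsto[OF assms, of _ "grid_index n t + 1" n]) (simp add: next_grid_def)

lemma refl_pos_tendsto:
 assumes "tame a b x l" "0 <= t"
 shows "(%n. dyadic_pos a b x l (next_grid n t)) \<longlonglongrightarrow> refl_pos a b x l t"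
 unfolding dyadic_pos_def refl_pos_def refl_down_def
 by (intro tendsto_diff tendsto_add tendsto_const refl_up_tendsto tame_uminus
   right_cont_tendsto[of l] next_grid_tendsto next_grid_gt assms)
  (use assms(1) in \<open>simp add: tame_def\<close>)

lemma refl_pos_bounds:
 assumes "a <= b" "tame a b x l" "0 <= t"
 shows "a <= refl_pos a b x l t" "refl_pos a b x l t <= b"
proof -
 have "a <= dyadic_pos a b x l (next_grid n t)" for n
  by (intro LIMSEQ_le_const[OF grid_pos_tendsto_next[OF assms(1,2)]] exI allI impI
    grid_pos_bounds[OF assms(1)])
 then show "a <= refl_pos a b x l t" using refl_pos_tendsto[OF assms(2,3)] by (intro LIMSEQ_le_const) auto
 have "dyadic_pos a b x l (next_grid n t) <= b" for n
  by (intro LIMSEQ_le_const2[OF grid_pos_tendsto_next[OF assms(1,2)]] exI allI impI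
    grid_pos_bounds[OF assms(1)])
 then show "refl_pos a b x l t <= b" using refl_pos_tendsto[OF assms(2,3)] by (intro LIMSEQ_le_const2) auto
qed

text \<open>Inequalities between grid positions pass to the limit along the two-step approximation.\<close>

lemma refl_pos_le_transfer:
 assumes "a <= b" "tame a b x l" "a' <= b'" "tame a' b' x' l" "0 <= t"
  and le: "!!N k. grid_pos a b x (sample l N) k <= grid_pos a' b' x' (sample l N) k + c"
 shows "refl_pos a b x l t <= refl_pos a' b' x' l t + c"
proof -
 have "dyadic_pos a b x l (next_grid n t) <= dyadic_pos a' b' x' l (next_grid n t) + c" for n
  using grid_pos_tendsto_next[OF assms(1,2)]
   tendsto_add[OF grid_pos_tendsto_next[OF assms(3,4)] tendsto_const[of c]] by (rule LIMSEQ_le) (use le in auto)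
 then show ?thesis using LIMSEQ_le[OF refl_pos_tendsto[OF assms(2,5)]
   tendsto_add[OF refl_pos_tendsto[OF assms(4,5)] tendsto_const[of c]]] by auto
qed

lemma refl_pos_mono:
 assumes "a <= b" "tame a b x l" "a' <= b'" "tame a' b' x' l" "0 <= t"
  and "a <= a'" "b <= b'" "x <= x'"
 shows "refl_pos a b x l t <= refl_pos a' b' x' l t"
proof -
 have "refl_pos a b x l t <= refl_pos a' b' x' l t + 0" by (intro refl_pos_le_transfer[OF assms(1-5)])
   (simp add: grid_pos_mono[OF assms(6,7,8,1,3)])
 then show ?thesis by simp
qed

lemma refl_pos_lipschitz:
 assumes "a <= b" "tame a b x l" "a' <= b'" "tame a' b' x' l" "0 <= t"
  and "abs (a - a') <= e" "abs (b - b') <= e" "abs (x - x') <= e"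
 shows "abs (refl_pos a b x l t - refl_pos a' b' x' l t) <= e"
proof -
 have *: "abs (grid_pos a b x w k - grid_pos a' b' x' w k) <= e" for w k
  using assms by (intro grid_pos_lipschitz)
 have "grid_pos a b x w k <= grid_pos a' b' x' w k + e"
  "grid_pos a' b' x' w k <= grid_pos a b x w k + e" for w k using *[of w k] by linarith+
 then have "refl_pos a b x l t <= refl_pos a' b' x' l t + e"
  "refl_pos a' b' x' l t <= refl_pos a b x l t + e" using assms by (auto intro!: refl_pos_le_transfer)
 then show ?thesis by linarith
qed

text \<open>
 The fixed point equation \<open>u t = sup {(a - x - l s + d s)\<^sup>+ | s <= t}\<close> of the two-sided
 Skorokhod problem, of which the following is the nontrivial half. \<close>

lemma refl_up_attained:
 assumes "a <= b" "tame a b x l" "0 <= t" "0 < e" "0 < refl_up a b x l t"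
 shows "EX s:{0..t}. a - x - l s + refl_down a b x l s > refl_up a b x l t - e"
proof -
 let ?U = "refl_up a b x l" and ?D = "refl_down a b x l"
 \<comment> \<open>With \<open>e'\<close> below the control at \<open>t\<close>, the grid control
   exceeds a positive number, which rules out the alternative \<open>grid_up = 0\<close> in
   \<open>grid_up_attained\<close>.\<close>
 define e' where "e' = min (e / 2) (?U t / 2)"
 have e': "0 < e'" "e' < e" "e' < ?U t" using assms unfolding e'_def by auto
 have "EX r:{0..next_grid n t}. a - x - l r + ?D r > ?U t - e'" for n
 proof -
  let ?q = "next_grid n t"
  have q: "t < ?q" using next_grid_gt assms by auto
  have "?U t - e' < enn2real (dyadic_up a b x l ?q)" using refl_up_le_dyadic[OF assms(2,3) q] e' by linarith
  then have "eventually (%N. ?U t - e' < grid_up a b x (sample l N) (grid_index N ?q)) sequentially"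
   using dyadic_up_tendsto[OF assms(1,2), of ?q] q assms(3) by (intro order_tendstoD(1)) auto
  then obtain N where N: "?U t - e' < grid_up a b x (sample l N) (grid_index N ?q)"
   by (auto simp: eventually_sequentially)
  then obtain j where j: "j <= grid_index N ?q"
   "grid_up a b x (sample l N) (grid_index N ?q) =
     a - x - sample l N j + grid_down a b x (sample l N) j"
   using grid_up_attained[OF assms(1), of x "sample l N" "grid_index N ?q"] e' by auto
  define r where "r = real j / 2 ^ N"
  have r: "0 <= r" "r <= ?q"
  proof -
   show "0 <= r" unfolding r_def by simp
   have "r <= real (grid_index N ?q) / 2 ^ N" unfolding r_def using j(1) by (simp add: divide_right_mono)
   then show "r <= ?q" using grid_index_le[of ?q N] q assms(3) by linarith
  qed
  have "grid_down a b x (sample l N) j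
    = grid_up (- b) (- a) (- x) (sample (%s. - l s) N) (grid_index N r)"
   unfolding r_def by (simp add: grid_index_dyadic grid_down_eq_grid_up(1)[of a b x] sample_uminus)
  also have "\<dots> <= enn2real (dyadic_up (- b) (- a) (- x) (%s. - l s) r)"
   using grid_up_incseq[of "- b" "- a" r "- x" "%s. - l s"]
    dyadic_up_tendsto[of "- b" "- a" "- x" "%s. - l s" r] tame_uminus[OF assms(2)] assms(1) r(1)
   by (intro incseq_le) auto
  also have "\<dots> <= ?D r"
   unfolding refl_down_def using tame_uminus[OF assms(2)] r by (intro dyadic_le_refl_up) auto
  finally have "a - x - l r + ?D r > ?U t - e'" using N j(2) by (simp add: sample_def r_def)
  then show ?thesis using r by auto
 qed
 then obtain r where r: "!!n. 0 <= r n & r n <= next_grid n t & a - x - l (r n) + ?D (r n) > ?U t - e'"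
  by (auto simp: Bex_def) metis
 show ?thesis
 proof (cases "EX n. r n <= t")
  case True
  then obtain n where "r n <= t" by auto
  then show ?thesis using r[of n] e' by (intro bexI[of _ "r n"]) auto
 next
  case False
  \<comment> \<open>The witnesses come from grids that reach slightly beyond \<open>t\<close>. If
    all of them lie after \<open>t\<close>, they converge to \<open>t\<close>, and right-continuity
    moves the estimate to \<open>t\<close> itself.\<close>
  have lim: "r \<longlonglongrightarrow> t"
  proof (rule tendsto_sandwich[of "%_. t" _ _ "%n. next_grid n t"])
   show "\<forall>\<^sub>F n in sequentially. t <= r n"
    using False by (auto simp: not_le intro: always_eventually less_imp_le)
   show "\<forall>\<^sub>F n in sequentially. r n <= next_grid n t" using r by auto
  qed (use next_grid_tendsto assms in auto)
  have "t < r n" for n using False by (simp add: not_le)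
  then have lim': "(%n. g (r n)) \<longlonglongrightarrow> g t" if "right_cont g" for g
   using right_cont_tendsto[OF that assms(3) lim] by blast
  have "(%n. a - x - l (r n) + ?D (r n)) \<longlonglongrightarrow> a - x - l t + ?D t"
   by (intro tendsto_add tendsto_diff tendsto_const lim' refl_down_right_cont assms(2))
    (use assms(2) in \<open>simp add: tame_def\<close>)
  moreover have "?U t - e' <= a - x - l (r n) + ?D (r n)" for n using r[of n] by linarith
  ultimately have "?U t - e' <= a - x - l t + ?D t" by (intro LIMSEQ_le_const) blast+
  then show ?thesis using e' assms by (intro bexI[of _ t]) auto
 qed
qed

text \<open>Upward push happens only near the lower barrier. An almost maximizing time in the fixed
  point equation comes after \<open>s\<close>, because up to \<open>s\<close> the control is at most
  its value at \<open>s\<close>; at that time the position is near \<open>a\<close> and almost all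
  of the push has been given.\<close>

lemma refl_up_increase:
 assumes "a <= b" "tame a b x l" "0 <= s" "s < t" "0 < e" "refl_up a b x l s < refl_up a b x l t"
 shows "EX r:{s<..t}. refl_pos a b x l r < a + e & refl_up a b x l t - refl_up a b x l r < e"
proof -
 let ?U = "refl_up a b x l" and ?D = "refl_down a b x l"
 define e' where "e' = min e (?U t - ?U s)"
 have e': "0 < e'" "e' <= e" "e' <= ?U t - ?U s" using assms unfolding e'_def by auto
 have "0 < ?U t" using refl_up_nonneg[of a b x l s] assms by linarith
 then obtain r where r: "0 <= r" "r <= t" "a - x - l r + ?D r > ?U t - e'"
  using refl_up_attained[OF assms(1,2), of t e'] assms e' by auto
 have "a - x - l r + ?D r <= ?U r" using refl_pos_bounds(1)[OF assms(1,2) r(1)] unfolding refl_pos_def by linarith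
 then have 1: "?U t - ?U r < e'" using r(3) by linarith
 have "s < r"
 proof (rule ccontr)
  assume "~ s < r"
  then have "?U r <= ?U s" using r assms by (intro refl_up_mono) auto
  then show False using 1 e' by linarith
 qed
 moreover have "?U r <= ?U t" using r assms by (intro refl_up_mono) auto
 then have "refl_pos a b x l r < a + e" using r(3) e' unfolding refl_pos_def by linarith
 ultimately show ?thesis using r 1 e' by (intro bexI[of _ r]) auto
qed

text \<open>With zero error in the fixed point equation, a positive control at time 0 puts the
  position exactly on its barrier. As \<open>a < b\<close>, the controls cannot both be positive,
  and the values follow.\<close>

lemma refl_initial:
 assumes "a < b" "tame a b x l"
 shows "refl_up a b x l 0 = max 0 (a - x - l 0)" "refl_down a b x l 0 = max 0 (x + l 0 - b)"
proof -
 let ?U = "refl_up a b x l 0" and ?D = "refl_down a b x l 0"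
 have bd: "a <= x + l 0 + ?U - ?D" "x + l 0 + ?U - ?D <= b"
  using refl_pos_bounds[OF less_imp_le[OF assms(1)] assms(2), of 0] by (auto simp: refl_pos_def)
 have up: "x + l 0 + ?U - ?D <= a" if "0 < ?U"
 proof (rule field_le_epsilon)
  fix e :: real assume "0 < e"
  then show "x + l 0 + ?U - ?D <= a + e"
   using refl_up_attained[OF less_imp_le[OF assms(1)] assms(2), of 0 e] that by auto
 qed
 have down: "b <= x + l 0 + ?U - ?D" if D: "0 < ?D"
 proof (rule field_le_epsilon)
  fix e :: real assume "0 < e"
  have "0 < refl_up (- b) (- a) (- x) (%s. - l s) 0" using D by (simp add: refl_up_uminus)
  then obtain s where "s \<in> {0..0}"
   "- b - - x - - l s + refl_down (- b) (- a) (- x) (%s. - l s) s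
     > refl_up (- b) (- a) (- x) (%s. - l s) 0 - e"
   using refl_up_attained[OF _ tame_uminus[OF assms(2)] order_refl \<open>0 < e\<close>] assms(1) by auto
  then show "b <= x + l 0 + ?U - ?D + e" by (simp add: refl_up_uminus refl_down_uminus)
 qed
 have nonneg: "0 <= ?U" "0 <= ?D" by (rule refl_up_nonneg, rule refl_down_nonneg)
 have up': "?U = 0 \<or> x + l 0 + ?U - ?D <= a" and down': "?D = 0 \<or> b <= x + l 0 + ?U - ?D"
  using up down nonneg by (metis order_le_less)+
 show "?U = max 0 (a - x - l 0)" "?D = max 0 (x + l 0 - b)" using up' down' bd nonneg assms(1) by linarith+
qed

section \<open>Change of start, time shift and the flow property\<close>

lemma refl_feasible:
 assumes "a <= b" "tame a b x l"
 shows "feasible a b x l (refl_up a b x l) (refl_down a b x l)"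
 using refl_pos_bounds[OF assms] refl_up_mono[OF assms(2)] refl_down_mono[OF assms(2)]
 unfolding feasible_def refl_pos_def by (auto simp: refl_up_nonneg refl_down_nonneg intro!: mono_onI)

text \<open>A different start is absorbed by an initial jump of one control. By leastness this makes
  the controls Lipschitz in the start.\<close>

lemma feasible_change_start:
 assumes "feasible a b x' l u d"
 shows "feasible a b x l (%t. u t + max 0 (x' - x)) (%t. d t + max 0 (x - x'))"
proof -
 have "x + (max 0 (x' - x) - max 0 (x - x')) = x'" by (simp add: max_def)
 then have "x + l t + (u t + max 0 (x' - x)) - (d t + max 0 (x - x')) = x' + l t + u t - d t" for t by linarith
 then show ?thesis using assms unfolding feasible_def by (auto simp: mono_on_def)
qed

lemma refl_change_start:
 assumes "a <= b" "tame a b x' l" "0 <= t"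
 shows "refl_up a b x l t <= refl_up a b x' l t + max 0 (x' - x)"
  "refl_down a b x l t <= refl_down a b x' l t + max 0 (x - x')"
proof -
 note f = feasible_change_start[OF refl_feasible[OF assms(1,2)], of x]
 have l: "right_cont l" using assms(2) by (simp add: tame_def)
 show "refl_up a b x l t <= refl_up a b x' l t + max 0 (x' - x)" by (rule refl_up_le_feasible[OF f l _ assms(3)])
   (intro right_cont_add right_cont_const refl_up_right_cont assms(2))
 show "refl_down a b x l t <= refl_down a b x' l t + max 0 (x - x')"
  by (rule refl_down_le_feasible[OF f l _ assms(3)])
   (intro right_cont_add right_cont_const refl_down_right_cont assms(2))
qed

text \<open>Countably many bands are tested, which is what an almost sure statement can deliver.
  They suffice: after a translation and a change of start, every nondegenerate band contains one of
  width \<open>1 / real (Suc m)\<close>.\<close>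

definition regular_path :: "(real => real) => bool" where
 "regular_path l \<longleftrightarrow> right_cont l & l 0 = 0 & (ALL m. tame 0 (1 / real (Suc m)) 0 l)"

definition shift_path :: "real => (real => real) => real => real" where
 "shift_path s l t = l (s + t) - l s"

lemma regular_path_right_cont: "regular_path l ==> right_cont l" by (simp add: regular_path_def)

lemma regular_path_tame:
 assumes "regular_path l" "a < b"
 shows "tame a b x l"
proof -
 obtain m where m: "1 / real (Suc m) < b - a" using assms(2) nat_approx_posE[of "b - a"] by auto
 let ?h = "1 / real (Suc m)"
 have "feasible 0 ?h 0 l (refl_up 0 ?h 0 l) (refl_down 0 ?h 0 l)"
  using assms(1) by (intro refl_feasible) (simp_all add: regular_path_def)
 then have "feasible a b a l (refl_up 0 ?h 0 l) (refl_down 0 ?h 0 l)" using m unfolding feasible_def by (smt (verit))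
 then have "feasible a b x l (%t. refl_up 0 ?h 0 l t + max 0 (a - x))
   (%t. refl_down 0 ?h 0 l t + max 0 (x - a))" by (rule feasible_change_start)
 then show ?thesis using assms(1) by (intro feasible_tame) (auto simp: regular_path_def)
qed

lemma feasible_shift:
 assumes "feasible a b x l u d" "0 <= s"
 shows "feasible a b (x + l s + u s - d s) (shift_path s l) (%t. u (s + t) - u s) (%t. d (s + t) - d s)"
proof -
 have "a <= x + l (s + t) + u (s + t) - d (s + t)" "x + l (s + t) + u (s + t) - d (s + t) <= b"
  if "0 <= t" for t using assms that by (auto simp: feasible_def)
 then show ?thesis using assms unfolding feasible_def shift_path_def by (auto simp: mono_on_def algebra_simps)
qed

lemma right_cont_shift_path: "right_cont l ==> 0 <= s ==> right_cont (shift_path s l)"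
 unfolding shift_path_def by (rule right_cont_diff[OF right_cont_shift right_cont_const])

lemma regular_path_shift:
 assumes "regular_path l" "0 <= s"
 shows "regular_path (shift_path s l)"
proof -
 have rc: "right_cont (shift_path s l)" using assms by (intro right_cont_shift_path) (auto simp: regular_path_def)
 have "tame 0 h 0 (shift_path s l)" if "tame 0 h 0 l" "0 <= h" for h
  using feasible_change_start[OF feasible_shift[OF refl_feasible[OF that(2,1)] assms(2)], of 0] rc
  by (rule feasible_tame)
 then show ?thesis using assms rc unfolding regular_path_def by (auto simp: shift_path_def)
qed

lemma right_cont_concat:
 assumes "right_cont f" "right_cont g"
 shows "right_cont (%r. if r < s then f r else g (r - s))"
proof (rule right_contI)
 fix t e :: real assume te: "0 <= t" "0 < e"
 show "EX r>t. ALL q. t < q & q < r -->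
  \<bar>(if q < s then f q else g (q - s)) - (if t < s then f t else g (t - s))\<bar> < e"
 proof (cases "t < s")
  case True
  obtain r where r: "t < r" "!!q. t <= q ==> q < r ==> abs (f q - f t) < e"
   using right_cont_ex[OF assms(1) te] by blast
  show ?thesis by (rule exI[of _ "min r s"]) (use r True in auto)
 next
  case False
  obtain r where r: "t - s < r" "!!q. t - s <= q ==> q < r ==> abs (g q - g (t - s)) < e"
   using right_cont_ex[OF assms(2) _ te(2), of "t - s"] False by auto
  show ?thesis
  proof (intro exI[of _ "r + s"] conjI allI impI)
   fix q assume "t < q & q < r + s"
   then show "abs ((if q < s then f q else g (q - s)) - (if t < s then f t else g (t - s))) < e"
    using r(2)[of "q - s"] False by auto
  qed (use r False in auto)
 qed
qed

lemma mono_on_concat: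
 assumes "mono_on {0..} f" "mono_on {0..} g" "f s <= g 0" "0 <= s"
 shows "mono_on {0..} (%r. if r < s then f r else g (r - s :: real) :: real)"
proof (rule mono_onI)
 fix r q :: real assume rq: "r \<in> {0..}" "q \<in> {0..}" "r <= q"
 have 1: "f r <= f s" if "r < s" using assms(1,4) that rq by (auto simp: mono_on_def)
 have 2: "g 0 <= g (q - s)" if "s <= q" using assms(2) that by (auto simp: mono_on_def)
 show "(if r < s then f r else g (r - s)) <= (if q < s then f q else g (q - s))"
  using mono_onD[OF assms(1), of r q] mono_onD[OF assms(2), of "r - s" "q - s"] 1 2 assms(3) rq by auto
qed

text \<open>Leastness is applied twice. The controls restarted at \<open>s\<close> are feasible for
  the shifted path; conversely, the controls up to \<open>s\<close> followed by those of the shifted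
  path are feasible for the whole path.\<close>

lemma refl_flow:
 fixes a b x s t :: real
 assumes "regular_path l" "a < b" "0 <= s" "0 <= t"
 defines "y \<equiv> refl_pos a b x l s"
 shows "refl_up a b x l (s + t) = refl_up a b x l s + refl_up a b y (shift_path s l) t"
  and "refl_down a b x l (s + t) = refl_down a b x l s + refl_down a b y (shift_path s l) t"
  and "refl_pos a b x l (s + t) = refl_pos a b y (shift_path s l) t"
proof -
 let ?U = "refl_up a b x l" and ?D = "refl_down a b x l"
 let ?U' = "refl_up a b y (shift_path s l)" and ?D' = "refl_down a b y (shift_path s l)"
 have ab: "a <= b" using assms by simp
 have T: "tame a b x l" using assms by (intro regular_path_tame)
 have sp: "regular_path (shift_path s l)" using assms by (intro regular_path_shift)
 have T': "tame a b y (shift_path s l)" using assms sp by (intro regular_path_tame)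
 have rc: "right_cont ?U" "right_cont ?D" "right_cont ?U'" "right_cont ?D'"
  using T T' by (auto intro: refl_up_right_cont refl_down_right_cont)
 have F: "feasible a b x l ?U ?D" using refl_feasible[OF ab T] .
 have F': "feasible a b y (shift_path s l) ?U' ?D'" using refl_feasible[OF ab T'] .
 have y: "y = x + l s + ?U s - ?D s" unfolding y_def refl_pos_def ..
 have Fs: "feasible a b y (shift_path s l) (%t. ?U (s + t) - ?U s) (%t. ?D (s + t) - ?D s)"
  using feasible_shift[OF F assms(3)] unfolding y .
 have "?U' t <= ?U (s + t) - ?U s" by (rule refl_up_le_feasible[OF Fs regular_path_right_cont[OF sp] _ assms(4)])
   (rule right_cont_diff[OF right_cont_shift[OF rc(1) assms(3)] right_cont_const])
 moreover have "?D' t <= ?D (s + t) - ?D s"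
  by (rule refl_down_le_feasible[OF Fs regular_path_right_cont[OF sp] _ assms(4)])
   (rule right_cont_diff[OF right_cont_shift[OF rc(2) assms(3)] right_cont_const])
 moreover
 define u where "u = (%r. if r < s then ?U r else ?U s + ?U' (r - s))"
 define d where "d = (%r. if r < s then ?D r else ?D s + ?D' (r - s))"
 have Fc: "feasible a b x l u d" unfolding feasible_def
 proof (intro conjI allI impI)
  show "mono_on {0..} u" unfolding u_def using F F' assms(3) unfolding feasible_def
   by (intro mono_on_concat[of ?U "%r. ?U s + ?U' r"]) (auto simp: mono_on_def)
  show "mono_on {0..} d" unfolding d_def using F F' assms(3) unfolding feasible_def
   by (intro mono_on_concat[of ?D "%r. ?D s + ?D' r"]) (auto simp: mono_on_def)
  show "0 <= u 0" "0 <= d 0" unfolding u_def d_def by (auto simp: refl_up_nonneg refl_down_nonneg)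
  fix r :: real assume "0 <= r"
  have *: "a <= x + l r + ?U r - ?D r & x + l r + ?U r - ?D r <= b"
   using F \<open>0 <= r\<close> unfolding feasible_def by auto
  have **: "a <= y + (l r - l s) + ?U' (r - s) - ?D' (r - s) &
    y + (l r - l s) + ?U' (r - s) - ?D' (r - s) <= b" if "s <= r"
  proof -
   have "0 <= r - s" using that by simp
   then have "a <= y + shift_path s l (r - s) + ?U' (r - s) - ?D' (r - s) &
     y + shift_path s l (r - s) + ?U' (r - s) - ?D' (r - s) <= b" using F' unfolding feasible_def by blast
   then show ?thesis by (simp add: shift_path_def)
  qed
  show "a <= x + l r + u r - d r" "x + l r + u r - d r <= b"
   using * ** unfolding u_def d_def y by (cases "r < s"; simp)+
 qed
 have rcc: "right_cont u" "right_cont d" unfolding u_def d_def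
  by (rule right_cont_concat[OF rc(1) right_cont_add[OF right_cont_const rc(3)]],
    rule right_cont_concat[OF rc(2) right_cont_add[OF right_cont_const rc(4)]])
 have l: "right_cont l" using assms(1) by (simp add: regular_path_def)
 have "?U (s + t) <= ?U s + ?U' t"
  using refl_up_le_feasible[OF Fc l rcc(1), of "s + t"] assms(3,4) by (simp add: u_def)
 moreover have "?D (s + t) <= ?D s + ?D' t"
  using refl_down_le_feasible[OF Fc l rcc(2), of "s + t"] assms(3,4) by (simp add: d_def)
 ultimately show 1: "?U (s + t) = ?U s + ?U' t" and 2: "?D (s + t) = ?D s + ?D' t" by linarith+
 show "refl_pos a b x l (s + t) = refl_pos a b y (shift_path s l) t"
 proof -
  have "refl_pos a b x l (s + t) = x + l (s + t) + ?U (s + t) - ?D (s + t)" by (rule refl_pos_def)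
  moreover have "refl_pos a b y (shift_path s l) t = y + (l (s + t) - l s) + ?U' t - ?D' t"
   by (simp add: refl_pos_def shift_path_def)
  ultimately show ?thesis using 1 2 y by linarith
 qed
qed

section \<open>Convexity of the controls and coalescence of paths\<close>

lemma feasible_convex:
 assumes "feasible a b x l u d" "feasible a' b' x' l u' d'" "0 <= (v::real)" "0 <= w" "v + w = 1"
 shows "feasible (v * a + w * a') (v * b + w * b') (v * x + w * x') l
  (%t. v * u t + w * u' t) (%t. v * d t + w * d' t)"
proof -
 have eq: "v * x + w * x' + l t + (v * u t + w * u' t) - (v * d t + w * d' t)
   = v * (x + l t + u t - d t) + w * (x' + l t + u' t - d' t)" for t
 proof -
  have "l t = (v + w) * l t" using assms(5) by simp
  then show ?thesis by (simp add: algebra_simps)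
 qed
 have "a <= x + l t + u t - d t" "x + l t + u t - d t <= b"
  "a' <= x' + l t + u' t - d' t" "x' + l t + u' t - d' t <= b'" if "0 <= t" for t
  using assms(1,2) that by (auto simp: feasible_def)
 then have "v * a + w * a' <= v * (x + l t + u t - d t) + w * (x' + l t + u' t - d' t)"
  "v * (x + l t + u t - d t) + w * (x' + l t + u' t - d' t) <= v * b + w * b'" if "0 <= t" for t
  using assms(3,4) that by (intro add_mono mult_left_mono; blast)+
 moreover have "mono_on {0..} (%t. v * f t + w * g t)" if "mono_on {0..} f" "mono_on {0..} g"
  for f g :: "real => real"
  using that assms(3,4) by (auto intro!: mono_onI add_mono mult_left_mono dest: mono_onD)
 ultimately show ?thesis using assms(1-4) unfolding feasible_def eq by simp
qed

text \<open>A convex combination of feasible pairs is feasible for the combined band and start, and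
  the least controls lie below it. This is the source of convex, hence continuous, push
  rates.\<close>

lemma refl_convex:
 assumes "regular_path l" "a < b" "a' < b'" "0 <= t" "0 <= (v::real)" "0 <= w" "v + w = 1"
 shows "refl_up (v * a + w * a') (v * b + w * b') (v * x + w * x') l t
   <= v * refl_up a b x l t + w * refl_up a' b' x' l t"
  "refl_down (v * a + w * a') (v * b + w * b') (v * x + w * x') l t
   <= v * refl_down a b x l t + w * refl_down a' b' x' l t"
proof -
 have T: "tame a b x l" "tame a' b' x' l" using assms by (auto intro: regular_path_tame)
 have F: "feasible (v * a + w * a') (v * b + w * b') (v * x + w * x') l
  (%t. v * refl_up a b x l t + w * refl_up a' b' x' l t)
  (%t. v * refl_down a b x l t + w * refl_down a' b' x' l t)"
  using assms T by (intro feasible_convex refl_feasible) auto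
 show "refl_up (v * a + w * a') (v * b + w * b') (v * x + w * x') l t
   <= v * refl_up a b x l t + w * refl_up a' b' x' l t"
  by (intro refl_up_le_feasible[OF F regular_path_right_cont[OF assms(1)] _ assms(4)]
    right_cont_add right_cont_cmult refl_up_right_cont T)
 show "refl_down (v * a + w * a') (v * b + w * b') (v * x + w * x') l t
   <= v * refl_down a b x l t + w * refl_down a' b' x' l t"
  by (intro refl_down_le_feasible[OF F regular_path_right_cont[OF assms(1)] _ assms(4)]
    right_cont_add right_cont_cmult refl_down_right_cont T)
qed

text \<open>A drop of the path by the band width forces the process started at the top onto the bottom.\<close>

lemma refl_coalesce:
 assumes "regular_path l" "a < b" "0 <= s" "0 < h" "l (s + h) - l s <= - (b - a)"
 shows "refl_pos a b a l (s + h) = refl_pos a b b l (s + h)"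
proof -
 have ab: "a <= b" using assms by simp
 note T = regular_path_tame[OF assms(1,2)]
 let ?X = "refl_pos a b b l" and ?Y = "refl_pos a b a l"
 have le: "?Y t <= ?X t" if "0 <= t" for t using ab that T by (intro refl_pos_mono) auto
 show ?thesis
 proof (rule ccontr)
  assume "?Y (s + h) \<noteq> ?X (s + h)"
  then have neq: "?Y (s + h) < ?X (s + h)" using le[of "s + h"] assms by auto
  define e where "e = ?X (s + h) - ?Y (s + h)"
  have e: "0 < e" using neq by (simp add: e_def)
  \<comment> \<open>The gap between the two reflected paths never grows, so a gap \<open>e\<close>
    at the end means a gap of at least \<open>e\<close> before. The lower path stays above
    \<open>a\<close>, so the upper one stays above \<open>a + e\<close>, where it is not pushed
    up.\<close>
  have above: "a + e <= ?X r" if r: "r \<in> {s<..s + h}" for r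
  proof -
   have r0: "0 <= r" "0 <= s + h - r" using r assms(3) by auto
   have reg: "regular_path (shift_path r l)" using assms(1) r0 by (intro regular_path_shift) auto
   have "?X (s + h) = refl_pos a b (?X r) (shift_path r l) (s + h - r)"
    "?Y (s + h) = refl_pos a b (?Y r) (shift_path r l) (s + h - r)" using refl_flow(3)[OF assms(1,2) r0] by simp_all
   moreover have "\<bar>refl_pos a b (?X r) (shift_path r l) (s + h - r) -
     refl_pos a b (?Y r) (shift_path r l) (s + h - r)\<bar> <= \<bar>?X r - ?Y r\<bar>"
    by (rule refl_pos_lipschitz[OF ab regular_path_tame[OF reg assms(2)] ab
      regular_path_tame[OF reg assms(2)] r0(2)]) auto
   moreover have "a <= ?Y r" using refl_pos_bounds[OF ab T r0(1)] by auto
   ultimately show ?thesis using le[OF r0(1)] neq unfolding e_def by linarith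
  qed
  have "~ refl_up a b b l s < refl_up a b b l (s + h)"
  proof
   assume "refl_up a b b l s < refl_up a b b l (s + h)"
   then obtain r where "r \<in> {s<..s + h}" "?X r < a + e"
    using refl_up_increase[OF ab T assms(3) _ e, of "s + h" b] assms(4) by auto
   then show False using above[of r] by simp
  qed
  moreover have "refl_down a b b l s <= refl_down a b b l (s + h)" using assms by (intro refl_down_mono T) auto
  moreover have "?X s <= b" using refl_pos_bounds[OF ab T assms(3)] by auto
  \<comment> \<open>Without upward push, a drop by the band width from a position at most
    \<open>b\<close> ends at or below \<open>a\<close>.\<close>
  ultimately have "?X (s + h) <= a" using assms(5) unfolding refl_pos_def by linarith
  then show False using above[of "s + h"] e assms(4) by auto
 qed
qed

section \<open>Stieltjes integrals and uniqueness in the Skorokhod problem\<close>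

lemma grid_index_measurable [measurable]: "grid_index n \<in> borel \<rightarrow>\<^sub>M count_space UNIV"
 unfolding grid_index_def[abs_def] by measurable

text \<open>Joint measurability by approximation from the right with processes that are constant in
  time on dyadic intervals.\<close>

lemma right_cont_process_measurable:
 assumes "!!t. 0 <= t ==> Y t \<in> borel_measurable M"
  and "!!w. w \<in> space M ==> right_cont (%t. Y t w)"
 shows "(%(t, w). Y (max 0 t) w :: real) \<in> borel_measurable (borel \<Otimes>\<^sub>M M)"
proof -
 define f where "f n p = Y (next_grid n (max 0 (fst p))) (snd p)" for n and p :: "real \<times> 'a"
 have f: "f n \<in> borel_measurable (borel \<Otimes>\<^sub>M M)" for n
 proof -
  have "(%p. (%i p. Y ((real i + 1) / 2 ^ n) (snd p)) (grid_index n (max 0 (fst p))) p)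
    \<in> borel_measurable (borel \<Otimes>\<^sub>M M)"
  proof (rule measurable_compose_countable[where f = "%i p. Y ((real i + 1) / 2 ^ n) (snd p)"
     and g = "%p. grid_index n (max 0 (fst p))"])
   show "(%p. Y ((real i + 1) / 2 ^ n) (snd p)) \<in> borel_measurable (borel \<Otimes>\<^sub>M M)" for i
    by (rule measurable_compose[OF measurable_snd assms(1)]) simp
  qed measurable
  then show ?thesis unfolding f_def next_grid_def .
 qed
 show ?thesis
 proof (rule borel_measurable_LIMSEQ_real)
  fix p :: "real \<times> 'a" assume p: "p \<in> space (borel \<Otimes>\<^sub>M M)"
  show "(%n. f n p) \<longlonglongrightarrow> (case p of (t, w) => Y (max 0 t) w)"
  proof -
   obtain t w where [simp]: "p = (t, w)" and w: "w \<in> space M" using p by (auto simp: space_pair_measure)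
   have t: "0 <= max 0 t" by simp
   show ?thesis unfolding f_def
    using right_cont_tendsto[OF assms(2)[OF w] t next_grid_tendsto[OF t] next_grid_gt[OF t]] by simp
  qed
 qed (rule f)
qed

lemma right_cont_measurable:
 assumes "right_cont g"
 shows "(%t. g (max 0 t)) \<in> borel_measurable borel"
proof -
 have "(%(t, w :: unit). g (max 0 t)) \<in> borel_measurable (borel \<Otimes>\<^sub>M count_space UNIV)"
  using assms by (intro right_cont_process_measurable) auto
 from measurable_compose[OF measurable_Pair[OF measurable_ident measurable_const[of "()"]] this]
 show ?thesis by simp
qed

lemma sets_stieltjes [simp, measurable_cong]: "sets (stieltjes g) = sets borel"
 and space_stieltjes [simp]: "space (stieltjes g) = UNIV" by (simp_all add: stieltjes_def)

context
 fixes g :: "real => real"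
 assumes mono: "mono_on {0..} g" and rc: "right_cont g"
begin

lemma stieltjes_integrand:
 shows "x <= y ==> g (max 0 x) <= g (max 0 y)"
  and "continuous (at_right s) (%t. g (max 0 t))"
proof -
 show "x <= y ==> g (max 0 x) <= g (max 0 y)"
  using mono_onD[OF mono, of "max 0 x" "max 0 y"] by auto
 show "continuous (at_right s) (%t. g (max 0 t))"
 proof (cases "0 <= s")
  case True
  have "(g \<longlongrightarrow> g s) (at_right s)" using rc True by (auto simp: right_cont_def continuous_within)
  moreover have "eventually (%t. g t = g (max 0 t)) (at_right s)"
   using True by (auto simp: eventually_at_filter)
  ultimately show ?thesis using True by (auto simp: continuous_within intro: Lim_transform_eventually)
 next
  case False
  have "eventually (%t. g 0 = g (max 0 t)) (at_right s)"
   using False eventually_at_right_field[of _ s] by (auto intro!: exI[of _ 0])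
  then show ?thesis using False by (auto simp: continuous_within intro: Lim_transform_eventually)
 qed
qed

lemma emeasure_stieltjes_Ioc:
 assumes "0 <= s" "s <= t"
 shows "emeasure (stieltjes g) {s<..t} = ennreal (g t - g s)" using assms stieltjes_integrand unfolding stieltjes_def
 by (subst emeasure_interval_measure_Ioc) auto

lemma sigma_finite_stieltjes: "sigma_finite_measure (stieltjes g)"
 unfolding stieltjes_def using stieltjes_integrand by (intro sigma_finite_interval_measure)

lemma emeasure_stieltjes_singleton:
 assumes "0 < t" "!!e. 0 < e ==> EX s:{0..<t}. g t - g s < e"
 shows "emeasure (stieltjes g) {t} = 0"
proof -
 have *: "emeasure (stieltjes g) {t} <= 0 + ennreal e" if e: "0 < e" for e
 proof -
  obtain s where s: "s \<in> {0..<t}" "g t - g s < e" using assms(2)[OF e] by auto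
  have "emeasure (stieltjes g) {t} <= emeasure (stieltjes g) {s<..t}" using s by (intro emeasure_mono) auto
  also have "\<dots> <= ennreal e" using s by (subst emeasure_stieltjes_Ioc) (auto intro: ennreal_leI)
  finally show ?thesis by simp
 qed
 have "emeasure (stieltjes g) {t} <= 0" by (rule ennreal_le_epsilon) (rule *)
 then show ?thesis by simp
qed

text \<open>The hypothesis leaves open an increase immediately after \<open>s\<close>;
  right-continuity at \<open>s\<close> excludes it.\<close>

lemma emeasure_stieltjes_Ioc_null:
 assumes "0 <= s" "s < t" "!!r. s < r ==> r <= t ==> g r = g t"
 shows "{s<..t} \<in> null_sets (stieltjes g)"
proof -
 have "abs (g t - g s) <= 0 + e" if e: "0 < e" for e
 proof -
  obtain r where r: "s < r" "!!q. s <= q ==> q < r ==> abs (g q - g s) < e"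
   using right_cont_ex[OF rc assms(1) e] by blast
  let ?q = "min t ((s + r) / 2)"
  have q: "s < ?q" "?q <= t" "?q < r" using r(1) assms(2) by (auto simp: min_less_iff_disj)
  have "abs (g ?q - g s) < e" using q by (intro r(2)) auto
  then show ?thesis using assms(3)[OF q(1,2)] by simp
 qed
 then have "abs (g t - g s) <= 0" by (rule field_le_epsilon)
 then have "g t = g s" by simp
 then show ?thesis using assms(1,2) by (intro null_setsI) (auto simp: emeasure_stieltjes_Ioc)
qed

text \<open>
 A set of times is null when \<open>g\<close> does not jump there and each of its points starts an interval
 on which \<open>g\<close> is constant: such intervals contain rationals, so countably many suffice. \<close>

lemma AE_stieltjes_notin:
 assumes B: "B \<subseteq> {0<..}"
  and left: "!!t e. t \<in> B ==> 0 < e ==> EX s:{0..<t}. g t - g s < e"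
  and right: "!!t. t \<in> B ==> EX r>t. g r = g t"
 shows "AE t in stieltjes g. t \<notin> B"
proof -
 define A where "A q = {t \<in> B. t < q & g q = g t}" for q
 have gm: "g s <= g t" if "0 <= s" "s <= t" for s t using mono_onD[OF mono, of s t] that by auto
 have "AE t in stieltjes g. t \<notin> A q" for q
 proof (cases "A q = {}")
  case False
  \<comment> \<open>\<open>A q\<close> lies between \<open>\<sigma>\<close> and \<open>q\<close>,
    and \<open>g\<close> is constant on the part after \<open>\<sigma>\<close>. Only the point
    \<open>\<sigma>\<close> itself could carry mass, and it carries none when it belongs to
    \<open>B\<close>.\<close>
  define \<sigma> where "\<sigma> = Inf (A q)"
  have bdd: "bdd_below (A q)" by (rule bdd_belowI[of _ 0]) (use B in \<open>force simp: A_def\<close>)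
  have \<sigma>0: "0 <= \<sigma>" unfolding \<sigma>_def using False B by (intro cInf_greatest) (auto simp: A_def)
  have \<sigma>le: "\<sigma> <= t" if "t \<in> A q" for t unfolding \<sigma>_def using that bdd by (rule cInf_lower)
  obtain t0 where "t0 \<in> A q" using False by blast
  then have \<sigma>q: "\<sigma> < q" using \<sigma>le[of t0] by (simp add: A_def)
  have const: "g r = g q" if r: "\<sigma> < r" "r <= q" for r
  proof -
   obtain t where t: "t \<in> A q" "t < r" using cInf_lessD[OF False] r(1) unfolding \<sigma>_def by blast
   have "0 < t" "g q = g t" using t(1) B by (auto simp: A_def)
   then show ?thesis using gm[of t r] gm[of r q] t(2) r(2) by linarith
  qed
  have 1: "AE t in stieltjes g. t \<notin> {\<sigma><..q}"
   by (rule AE_not_in[OF emeasure_stieltjes_Ioc_null[OF \<sigma>0 \<sigma>q const]])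
  have 2: "AE t in stieltjes g. t \<noteq> \<sigma>" if "\<sigma> \<in> B"
  proof -
   have "{\<sigma>} \<in> null_sets (stieltjes g)"
    using that B left[OF that] by (intro null_setsI emeasure_stieltjes_singleton) auto
   from AE_not_in[OF this] show ?thesis by auto
  qed
  show ?thesis
  proof (cases "\<sigma> \<in> B")
   case True
   show ?thesis using 1 2[OF True] by eventually_elim (use \<sigma>le in \<open>force simp: A_def\<close>)
  next
   case False
   show ?thesis using 1
   proof eventually_elim
    case (elim t)
    then show ?case using \<sigma>le[of t] False by (cases "t = \<sigma>") (auto simp: A_def)
   qed
  qed
 qed simp
 then have "AE t in stieltjes g. ALL q:\<rat>. t \<notin> A q"
  by (subst AE_ball_countable) (auto simp: countable_rat)
 then show ?thesis
 proof eventually_elim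
  case (elim t)
  show ?case
  proof
   assume t: "t \<in> B"
   then obtain r where r: "t < r" "g r = g t" using right by auto
   then obtain q where q: "q \<in> \<rat>" "t < q" "q < r" using Rats_dense_in_real by blast
   then have "g t <= g q" "g q <= g r" using gm[of t q] gm[of q r] t B by auto
   then have "t \<in> A q" using q r t by (auto simp: A_def)
   then show False using elim q by auto
  qed
 qed
qed

text \<open>The measure has no mass where the integrand is positive: none on intervals, so
  \<open>g\<close> is constant there, and none at single points, so \<open>g\<close> does not jump
  there.\<close>

lemma stieltjes_zero_imp:
 assumes zero: "(\<integral>\<^sup>+t\<in>{0<..}. ennreal (Y t) \<partial>stieltjes g) = 0" and Y: "right_cont Y"
 shows "0 <= s ==> s < t ==> (!!r. s < r ==> r <= t ==> 0 < Y r) ==> g t = g s"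
  and "0 < t ==> 0 < Y t ==> 0 < e ==> EX s:{0..<t}. g t - g s < e"
proof -
 have [measurable]: "(%t. Y (max 0 t)) \<in> borel_measurable borel" using Y by (rule right_cont_measurable)
 have "(\<integral>\<^sup>+t\<in>{0<..}. ennreal (Y (max 0 t)) \<partial>stieltjes g)
   = (\<integral>\<^sup>+t\<in>{0<..}. ennreal (Y t) \<partial>stieltjes g)"
  by (intro nn_integral_cong) (simp split: split_indicator)
 then have "(\<integral>\<^sup>+t. ennreal (Y (max 0 t)) * indicator {0<..} t \<partial>stieltjes g) = 0"
  by (simp only: zero)
 then have "AE t in stieltjes g. ennreal (Y (max 0 t)) * indicator {0<..} t = 0"
  by (subst (asm) nn_integral_0_iff_AE) measurable
 then have "AE t in stieltjes g. ~ (0 < t & 0 < Y t)"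
  by eventually_elim (auto split: split_indicator simp: max_def)
 then obtain N where N: "{t. 0 < t & 0 < Y t} \<subseteq> N" "N \<in> null_sets (stieltjes g)"
  unfolding eventually_ae_filter by auto
 have null: "emeasure (stieltjes g) A = 0" if "A \<subseteq> {t. 0 < t & 0 < Y t}" for A
 proof -
  have "emeasure (stieltjes g) A <= emeasure (stieltjes g) N" using N that by (intro emeasure_mono) auto
  then show ?thesis using N(2) by (simp add: null_sets_def)
 qed
 show "g t = g s" if "0 <= s" "s < t" "!!r. s < r ==> r <= t ==> 0 < Y r"
 proof -
  have "emeasure (stieltjes g) {s<..t} = 0" by (rule null) (use that in auto)
  then show ?thesis
   using emeasure_stieltjes_Ioc[of s t] that mono_onD[OF mono, of s t] by (auto simp: ennreal_eq_0_iff)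
 qed
 show "EX s:{0..<t}. g t - g s < e" if t: "0 < t" "0 < Y t" "0 < e"
 proof (rule ccontr)
  assume neg: "~ ?thesis"
  define A where "A n = {t - t / (real n + 1)<..t}" for n
  have "(%n. emeasure (stieltjes g) (A n)) \<longlonglongrightarrow> emeasure (stieltjes g) (\<Inter>n. A n)"
  proof (rule Lim_emeasure_decseq)
   have "t / (real n + 1) <= t / (real m + 1)" if "m <= n" for m n :: nat
    using t that by (intro divide_left_mono) auto
   then show "decseq A" unfolding A_def decseq_def by (fastforce intro: order_le_less_trans[rotated])
   have A0: "0 <= t - t / (real n + 1)" for n using t by (simp add: field_simps)
   show "emeasure (stieltjes g) (A n) \<noteq> \<infinity>" for n
    unfolding A_def using t A0[of n] by (subst emeasure_stieltjes_Ioc) auto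
  qed (auto simp: A_def)
  moreover have "(\<Inter>n. A n) = {t}"
  proof (intro set_eqI iffI)
   fix r assume r: "r \<in> (\<Inter>n. A n)"
   have "t <= r"
   proof (rule field_le_epsilon)
    fix d :: real assume "0 < d"
    obtain n where "t / d < real n" using reals_Archimedean2 by blast
    then have "t / (real n + 1) <= d" using \<open>0 < d\<close> t by (simp add: field_simps)
    moreover have "t - t / (real n + 1) < r" using r by (auto simp: A_def)
    ultimately show "t <= r + d" by linarith
   qed
   then show "r \<in> {t}" using r by (auto simp: A_def)
  qed (use t in \<open>auto simp: A_def\<close>)
  moreover have "emeasure (stieltjes g) {t} = 0" by (rule null) (use t in auto)
  moreover have "ennreal e <= emeasure (stieltjes g) (A n)" for n
  proof -
   have "t - t / (real n + 1) \<in> {0..<t}" using t by (auto simp: field_simps)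
   with neg have "~ g t - g (t - t / (real n + 1)) < e" by blast
   then have "e <= g t - g (t - t / (real n + 1))" by simp
   then show ?thesis unfolding A_def using t
    by (subst emeasure_stieltjes_Ioc) (auto simp: field_simps intro: ennreal_leI)
  qed
  ultimately have "ennreal e <= 0" by (intro LIMSEQ_le_const[of "%n. emeasure (stieltjes g) (A n)"]) auto
  then show False using t by simp
 qed
qed

text \<open>Integration by parts: \<open>exp (- e * s)\<close> is the integral of
  \<open>e * exp (- e * r)\<close> over \<open>r >= s\<close>, and the two integrals are
  exchanged.\<close>

lemma stieltjes_exp:
 assumes "0 < e"
 shows "(\<integral>\<^sup>+s\<in>{0<..}. ennreal (exp (- e * s)) \<partial>stieltjes g) =
  (\<integral>\<^sup>+s\<in>{0..}. ennreal (e * exp (- e * s) * (g s - g 0)) \<partial>lborel)"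
proof -
 interpret S: sigma_finite_measure "stieltjes g" by (rule sigma_finite_stieltjes)
 interpret pair_sigma_finite "stieltjes g" lborel ..
 have tail: "(\<integral>\<^sup>+r. ennreal (e * exp (- e * r)) * indicator {s..} r \<partial>lborel) = ennreal (exp (- e * s))" for s
 proof -
  have "((%r. - exp (- e * r)) \<longlongrightarrow> 0) at_top" using assms by real_asymp
  then have "(\<integral>\<^sup>+r. ennreal (e * exp (- e * r)) * indicator {s..} r \<partial>lborel)
    = ennreal (0 - (- exp (- e * s)))" using assms
   by (intro nn_integral_FTC_atLeast) (auto intro!: derivative_eq_intros)
  then show ?thesis by simp
 qed
 have "(\<integral>\<^sup>+s\<in>{0<..}. ennreal (exp (- e * s)) \<partial>stieltjes g) =
  (\<integral>\<^sup>+s. (\<integral>\<^sup>+r. ennreal (e * exp (- e * r)) * indicator {s..} r * indicator {0<..} s \<partial>lborel) \<partial>stieltjes g)"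
 proof (intro nn_integral_cong)
  fix s
  have "(%r. ennreal (e * exp (- e * r)) * indicator {s..} r) \<in> borel_measurable lborel" by measurable
  from nn_integral_multc[OF this, of "indicator {0<..} s"]
  show "ennreal (exp (- e * s)) * indicator {0<..} s =
   (\<integral>\<^sup>+r. ennreal (e * exp (- e * r)) * indicator {s..} r * indicator {0<..} s \<partial>lborel)"
   unfolding tail by (rule sym)
 qed
 also have "\<dots> = (\<integral>\<^sup>+r. (\<integral>\<^sup>+s. ennreal (e * exp (- e * r)) * indicator {s..} r * indicator {0<..} s \<partial>stieltjes g) \<partial>lborel)"
 proof (rule Fubini'[symmetric])
  have "(%(x, y). ennreal (e * exp (- e * y)) * (if x <= y then 1 else 0) * indicator {0<..} x)
   \<in> borel_measurable (stieltjes g \<Otimes>\<^sub>M lborel)" by measurable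
  then show "(%(x, y). ennreal (e * exp (- e * y)) * indicator {x..} y * indicator {0<..} x)
   \<in> borel_measurable (stieltjes g \<Otimes>\<^sub>M lborel)" by (simp add: indicator_def of_bool_def)
 qed
 also have "\<dots> = (\<integral>\<^sup>+s\<in>{0..}. ennreal (e * exp (- e * s) * (g s - g 0)) \<partial>lborel)"
 proof (intro nn_integral_cong)
  fix r :: real
  have "(\<integral>\<^sup>+s. ennreal (e * exp (- e * r)) * indicator {s..} r * indicator {0<..} s \<partial>stieltjes g)
    = (\<integral>\<^sup>+s. ennreal (e * exp (- e * r)) * indicator {0<..r} s \<partial>stieltjes g)"
   by (intro nn_integral_cong) (auto split: split_indicator)
  also have "\<dots> = ennreal (e * exp (- e * r)) * emeasure (stieltjes g) {0<..r}"
   by (subst nn_integral_cmult_indicator) auto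
  also have "\<dots> = ennreal (e * exp (- e * r) * (g r - g 0)) * indicator {0..} r"
   using mono_onD[OF mono, of 0 r] assms by (cases "0 <= r") (auto simp: emeasure_stieltjes_Ioc ennreal_mult)
  finally show "(\<integral>\<^sup>+s. ennreal (e * exp (- e * r)) * indicator {s..} r * indicator {0<..} s \<partial>stieltjes g)
    = ennreal (e * exp (- e * r) * (g r - g 0)) * indicator {0..} r" .
 qed
 finally show ?thesis .
qed

end

text \<open>The pathwise content of \<open>skorokhod_control\<close>, so that uniqueness can be
  argued for one path at a time.\<close>

definition skorokhod_path ::
 "real => real => real => (real => real) => (real => real) => (real => real) => bool" where
 "skorokhod_path a b x l u d \<longleftrightarrow>
   mono_on {0..} u & mono_on {0..} d & right_cont u & right_cont d &
   u 0 = max (a - x) 0 & d 0 = max (x - b) 0 &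
   (ALL t>=0. a <= x + l t + u t - d t & x + l t + u t - d t <= b) &
   (\<integral>\<^sup>+t\<in>{0<..}. ennreal (x + l t + u t - d t - a) \<partial>stieltjes u) = 0 &
   (\<integral>\<^sup>+t\<in>{0<..}. ennreal (b - (x + l t + u t - d t)) \<partial>stieltjes d) = 0"

text \<open>At a time when the position is above \<open>a\<close>, \<open>refl_up_increase\<close>
  forbids a jump of the control as well as growth shortly afterwards. By
  \<open>AE_stieltjes_notin\<close> such times form a null set.\<close>

lemma refl_up_complementary:
 assumes "a <= b" "tame a b x l"
 shows "(\<integral>\<^sup>+t\<in>{0<..}. ennreal (refl_pos a b x l t - a) \<partial>stieltjes (refl_up a b x l)) = 0"
proof -
 let ?U = "refl_up a b x l" and ?X = "refl_pos a b x l"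
 have mono: "mono_on {0..} ?U" using refl_feasible[OF assms] by (simp add: feasible_def)
 have "AE t in stieltjes ?U. t \<notin> {t. 0 < t & a < ?X t}"
 proof (rule AE_stieltjes_notin[OF mono refl_up_right_cont[OF assms(2)]])
  fix t assume t: "t \<in> {t. 0 < t & a < ?X t}"
  show "EX s:{0..<t}. ?U t - ?U s < e" if e: "0 < e" for e
  proof (rule ccontr)
   assume neg: "~ ?thesis"
   define s where "s = t / 2"
   have s: "0 <= s" "s < t" using t by (auto simp: s_def)
   have "?U s < ?U t" using neg s e by (force simp: not_less)
   then obtain r where r: "r \<in> {s<..t}" "?X r < a + min e (?X t - a)" "?U t - ?U r < min e (?X t - a)"
    using refl_up_increase[OF assms s, of "min e (?X t - a)"] e t by auto
   then have "r \<noteq> t" by auto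
   then show False using r neg s by force
  qed
  obtain q where q: "t < q" "!!s. t <= s ==> s < q ==> abs (?X s - ?X t) < (?X t - a) / 2"
   using right_cont_ex[OF refl_pos_right_cont[OF assms(2)], of t "(?X t - a) / 2"] t by auto
  show "EX r>t. ?U r = ?U t"
  proof (intro exI conjI)
   let ?r = "(t + q) / 2"
   show r: "t < ?r" using q by simp
   have "~ ?U t < ?U ?r"
   proof
    assume "?U t < ?U ?r"
    then obtain s where s: "s \<in> {t<..?r}" "?X s < a + (?X t - a) / 2"
     using refl_up_increase[OF assms, of t ?r "(?X t - a) / 2"] t r by auto
    then have "abs (?X s - ?X t) < (?X t - a) / 2" using q(2)[of s] q(1) by auto
    then have "?X t - ?X s < (?X t - a) / 2" by linarith
    then show False using s(2) by (simp add: field_simps)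
   qed
   moreover have "?U t <= ?U ?r" using t r assms by (intro refl_up_mono) auto
   ultimately show "?U ?r = ?U t" by simp
  qed
 qed auto
 then have "AE t in stieltjes ?U. ennreal (?X t - a) * indicator {0<..} t = 0"
  by eventually_elim (auto split: split_indicator simp: ennreal_neg)
 then have "(\<integral>\<^sup>+t\<in>{0<..}. ennreal (?X t - a) \<partial>stieltjes ?U) = (\<integral>\<^sup>+t. 0 \<partial>stieltjes ?U)"
  by (rule nn_integral_cong_AE)
 then show ?thesis by simp
qed

lemma refl_skorokhod_path:
 assumes "regular_path l" "a < b"
 shows "skorokhod_path a b x l (refl_up a b x l) (refl_down a b x l)"
proof -
 have ab: "a <= b" and T: "tame a b x l" using assms by (auto intro: regular_path_tame)
 have "(\<integral>\<^sup>+t\<in>{0<..}. ennreal (refl_pos a b x l t - a) \<partial>stieltjes (refl_up a b x l)) = 0"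
  by (rule refl_up_complementary[OF ab T])
 moreover have "(\<integral>\<^sup>+t\<in>{0<..}. ennreal (b - refl_pos a b x l t) \<partial>stieltjes (refl_down a b x l)) = 0"
 proof -
  have "refl_up (- b) (- a) (- x) (%s. - l s) = refl_down a b x l" by (rule ext) (rule refl_up_uminus)
  then show ?thesis using refl_up_complementary[OF _ tame_uminus[OF T]] ab by (simp add: refl_pos_uminus add.commute)
 qed
 ultimately show ?thesis using refl_feasible[OF ab T] refl_up_right_cont[OF T] refl_down_right_cont[OF T]
   refl_initial[OF assms(2) T] assms(1) unfolding skorokhod_path_def feasible_def refl_pos_def
  by (auto simp: max.commute regular_path_def)
qed

text \<open>Suppose the first solution is above the second at \<open>t\<close>, and let
  \<open>\<sigma>\<close> be the supremum of the earlier times at which it is not. After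
  \<open>\<sigma>\<close> the first is above \<open>a\<close> and the second below \<open>b\<close>,
  so \<open>u\<close> and \<open>d'\<close> are flat and the other controls only shrink the
  difference; hence it is positive at \<open>\<sigma>\<close> too. But \<open>u\<close> and
  \<open>d'\<close> do not jump there, so it cannot have become positive.\<close>

lemma skorokhod_path_le:
 assumes S: "skorokhod_path a b x l u d" and S': "skorokhod_path a b x l u' d'"
  and l: "right_cont l" and t: "0 <= t"
 shows "x + l t + u t - d t <= x + l t + u' t - d' t"
proof (rule ccontr)
 assume contr: "~ ?thesis"
 define Z where "Z r = (u r - u' r) - (d r - d' r)" for r
 define X where "X r = x + l r + u r - d r" for r
 define X' where "X' r = x + l r + u' r - d' r" for r
 have XZ: "X r - X' r = Z r" for r by (simp add: X_def X'_def Z_def)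
 have Zt: "0 < Z t" using contr by (simp add: Z_def)
 note s = S[unfolded skorokhod_path_def] S'[unfolded skorokhod_path_def]
 have mono: "u r <= u q" "d r <= d q" "u' r <= u' q" "d' r <= d' q" if "0 <= r" "r <= q" for r q
  using s that by (auto dest!: mono_onD[of "{0..}" _ r q])
 have rc: "right_cont (%r. X r - a)" "right_cont (%r. b - X' r)" unfolding X_def X'_def using s l
  by (auto intro!: right_cont_add right_cont_diff right_cont_const)
 have zu: "(\<integral>\<^sup>+t\<in>{0<..}. ennreal (X t - a) \<partial>stieltjes u) = 0"
  and zd: "(\<integral>\<^sup>+t\<in>{0<..}. ennreal (b - X' t) \<partial>stieltjes d') = 0"
  using s unfolding X_def X'_def by auto
 have pos: "0 < X r - a" "0 < b - X' r" if "0 <= r" "0 < Z r" for r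
  using s that XZ[of r] unfolding X_def X'_def by (smt (verit))+
 have u: "mono_on {0..} u" "right_cont u" and d': "mono_on {0..} d'" "right_cont d'" using s by auto
 have step: "Z t <= Z r" if "0 <= r" "r <= t" "!!q. r < q ==> q <= t ==> 0 < Z q" for r
 proof (cases "r = t")
  case False
  then have "u t = u r" "d' t = d' r"
   using that pos by (auto intro!: stieltjes_zero_imp(1)[OF u zu rc(1)] stieltjes_zero_imp(1)[OF d' zd rc(2)])
  then show ?thesis using mono[OF that(1,2)] by (simp add: Z_def)
 qed simp
 define A where "A = {r \<in> {0..t}. Z r <= 0}"
 define \<sigma> where "\<sigma> = Sup A"
 have Z0: "Z 0 = 0" using s by (simp add: Z_def)
 then have A0: "0 \<in> A" using t by (simp add: A_def)
 have bdd: "bdd_above A" by (rule bdd_aboveI[of _ t]) (simp add: A_def)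
 have \<sigma>: "0 <= \<sigma>" "\<sigma> <= t"
 proof -
  show "0 <= \<sigma>" unfolding \<sigma>_def by (rule cSup_upper[OF A0 bdd])
  show "\<sigma> <= t" unfolding \<sigma>_def by (rule cSup_least) (use A0 in \<open>auto simp: A_def\<close>)
 qed
 have above: "0 < Z q" if "\<sigma> < q" "q <= t" for q
 proof (rule ccontr)
  assume "~ 0 < Z q"
  then have "q \<in> A" using that \<sigma> unfolding A_def by auto
  from cSup_upper[OF this bdd] show False using that(1) unfolding \<sigma>_def by linarith
 qed
 have \<sigma>Z: "0 < Z \<sigma>" using step[OF \<sigma> above] Zt by (rule order_less_le_trans[rotated]) 
 \<comment> \<open>The initial values agree, so \<open>\<sigma>\<close> is not 0 and can be
   approached from the left.\<close>
 then have \<sigma>pos: "0 < \<sigma>" using Z0 \<sigma>(1) \<sigma>Z by (metis less_irrefl order_le_less)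
 have "Z \<sigma> <= 0 + e" if e: "0 < e" for e
 proof -
  obtain r1 where r1: "r1 \<in> {0..<\<sigma>}" "u \<sigma> - u r1 < e / 2"
   using stieltjes_zero_imp(2)[OF u zu rc(1) \<sigma>pos pos(1)[OF \<sigma>(1) \<sigma>Z], of "e / 2"] e by auto
  obtain r2 where r2: "r2 \<in> {0..<\<sigma>}" "d' \<sigma> - d' r2 < e / 2"
   using stieltjes_zero_imp(2)[OF d' zd rc(2) \<sigma>pos pos(2)[OF \<sigma>(1) \<sigma>Z], of "e / 2"] e by auto
  obtain r where r: "r \<in> A" "max r1 r2 < r"
   using less_cSup_iff[of A "max r1 r2"] A0 bdd r1 r2 unfolding \<sigma>_def[symmetric] by auto
  have "r <= \<sigma>" using cSup_upper[OF r(1) bdd] by (simp add: \<sigma>_def)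
  then have "u \<sigma> - u r < e / 2" "d' \<sigma> - d' r < e / 2" "u' r <= u' \<sigma>" "d r <= d \<sigma>"
   using mono[of r1 r] mono[of r2 r] mono[of r \<sigma>] r1 r2 r by (auto simp: A_def)
  then show ?thesis using r(1) by (simp add: A_def Z_def)
 qed
 then have "Z \<sigma> <= 0" by (rule field_le_epsilon)
 then show False using \<sigma>Z by simp
qed

lemma skorokhod_path_unique:
 assumes "regular_path l" "a < b" "skorokhod_path a b x l u d" "0 <= t"
 shows "x + l t + u t - d t = refl_pos a b x l t"
 using skorokhod_path_le[OF assms(3) refl_skorokhod_path[OF assms(1,2)]]
  skorokhod_path_le[OF refl_skorokhod_path[OF assms(1,2)] assms(3)] assms
 unfolding refl_pos_def by (intro antisym) (auto simp: regular_path_def)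

section \<open>Huber functions\<close>

definition huber_slope :: "real => real => real" where
 "huber_slope w y = max (- 1) (min 1 (y / w))"

text \<open>Equal to \<open>y^2 / (2 * w)\<close> for \<open>abs y <= w\<close> and to
  \<open>abs y - w / 2\<close> elsewhere. Written as the maximum over slopes \<open>v\<close> in
  [-1, 1] of \<open>v * y - w * v^2 / 2\<close>, taken at its maximizer, so that testing other
  slopes gives all bounds.\<close>

definition huber :: "real => real => real" where
 "huber w y = huber_slope w y * y - w * (huber_slope w y)\<^sup>2 / 2"

lemma huber_slope_bound: "abs (huber_slope w y) <= 1" by (auto simp: huber_slope_def)

lemma huber_slope_measurable [measurable]: "huber_slope w \<in> borel_measurable borel"
 unfolding huber_slope_def[abs_def] by measurable

lemma huber_measurable [measurable]: "huber w \<in> borel_measurable borel" unfolding huber_def[abs_def] by measurable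

lemma huber_slope_inside:
 assumes "0 < w" "abs y <= w"
 shows "huber_slope w y = y / w"
proof -
 have "- 1 <= y / w" "y / w <= 1" using assms by (auto simp: field_simps abs_le_iff)
 then show ?thesis by (simp add: huber_slope_def)
qed

text \<open>The Legendre representation of the Huber function.\<close>

lemma huber_ge:
 assumes "0 < w" "abs v <= 1"
 shows "v * y - w * v\<^sup>2 / 2 <= huber w y"
proof -
 consider "abs y <= w" | "w < y" | "y < - w" by linarith
 then show ?thesis
 proof cases
  case 1
  then have s: "huber_slope w y = y / w" using assms(1) by (intro huber_slope_inside)
  have "0 <= (y - w * v)\<^sup>2 / (2 * w)" using assms(1) by simp
  also have "\<dots> = huber w y - (v * y - w * v\<^sup>2 / 2)"
   unfolding huber_def s using assms(1) by (simp add: field_simps power2_eq_square)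
  finally show ?thesis by simp
 next
  case 2
  then have s: "huber_slope w y = 1" using assms(1) by (simp add: huber_slope_def)
  have "w * (1 + v) / 2 <= w" using assms by (simp add: field_simps)
  then have "0 <= (1 - v) * (y - w * (1 + v) / 2)" using 2 assms(2) by (intro mult_nonneg_nonneg) auto
  also have "\<dots> = huber w y - (v * y - w * v\<^sup>2 / 2)"
   unfolding huber_def s by (simp add: field_simps power2_eq_square)
  finally show ?thesis by simp
 next
  case 3
  then have "y / w <= - 1" using assms(1) by (simp add: field_simps)
  then have s: "huber_slope w y = - 1" by (simp add: huber_slope_def)
  have "w * (1 - v) <= w * 2" using assms by (intro mult_left_mono) auto
  then have "w * (1 - v) / 2 <= w" by simp
  then have "0 <= (1 + v) * (- y - w * (1 - v) / 2)" using 3 assms(2) by (intro mult_nonneg_nonneg) auto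
  also have "\<dots> = huber w y - (v * y - w * v\<^sup>2 / 2)"
   unfolding huber_def s by (simp add: field_simps power2_eq_square)
  finally show ?thesis by simp
 qed
qed

lemma huber_nonneg: "0 < w ==> 0 <= huber w y" using huber_ge[of w 0 y] by simp

lemma huber_le_abs:
 assumes "0 < w"
 shows "huber w y <= abs y"
proof -
 have "huber_slope w y * y <= abs (huber_slope w y) * abs y" by (simp flip: abs_mult)
 also have "\<dots> <= 1 * abs y" using huber_slope_bound by (intro mult_right_mono) auto
 finally show ?thesis using assms unfolding huber_def by (smt (verit) mult_nonneg_nonneg zero_le_power2 divide_nonneg_nonneg)
qed

lemma huber_slope_lipschitz:
 assumes "0 < w"
 shows "abs (huber_slope w (y + d) - huber_slope w y) <= abs d / w"
proof -
 have "abs (max (- 1) (min 1 p) - max (- 1) (min 1 q)) <= abs (p - q)" for p q :: real by (simp add: max_def min_def)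
 from this[of "(y + d) / w" "y / w"] show ?thesis
  using assms unfolding huber_slope_def by (simp add: add_divide_distrib)
qed

text \<open>The correction is quadratic for small and linear for large increments, so it has finite
  expectation for any increment of finite mean.\<close>

lemma huber_increment_le:
 assumes "0 < w"
 shows "huber w (y + d) <= huber w y + huber_slope w y * d + min (d\<^sup>2 / w) (2 * abs d)"
proof -
 let ?v = "huber_slope w (y + d)" and ?u = "huber_slope w y"
 have "huber w (y + d) - huber w y <= ?v * d"
  using huber_ge[OF assms huber_slope_bound, of w "y + d" y] unfolding huber_def[of w "y + d"]
  by (simp add: algebra_simps)
 also have "?v * d = ?u * d + (?v - ?u) * d" by (simp add: algebra_simps)
 also have "(?v - ?u) * d <= abs (?v - ?u) * abs d" by (simp flip: abs_mult)
 also have "abs (?v - ?u) * abs d <= min (abs d / w) 2 * abs d"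
 proof (rule mult_right_mono)
  show "abs (?v - ?u) <= min (abs d / w) 2"
   using huber_slope_lipschitz[OF assms, of y d] huber_slope_bound[of w y] huber_slope_bound[of w "y + d"] by linarith
 qed simp
 also have "min (abs d / w) 2 * abs d = min (d\<^sup>2 / w) (2 * abs d)"
  by (simp add: min_mult_distrib_right power2_eq_square)
 finally show ?thesis by simp
qed

text \<open>Quantified strict convexity near the centre, from testing the slope
  \<open>y / 2 + s\<close> in the Legendre formula at \<open>y + d\<close>.\<close>

lemma huber_increment_ge:
 assumes "abs y <= 1"
 shows "huber 2 y + huber_slope 2 y * d + min (d\<^sup>2) \<bar>d\<bar> / 4 <= huber 2 (y + d)"
proof -
 \<comment> \<open>Half of \<open>d\<close>, truncated to size 1/2. The slope at \<open>y\<close> is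
   \<open>y / 2\<close>, also of size at most 1/2, so the sum is an admissible slope.\<close>
 define s where "s = (if \<bar>d\<bar> <= 1 then d / 2 else sgn d / 2)"
 have sl: "huber_slope 2 y = y / 2" using assms by (simp add: huber_slope_def)
 have s: "abs s <= 1 / 2" unfolding s_def by (auto simp: sgn_if)
 have v: "abs (y / 2 + s) <= 1" using s assms by linarith
 have "huber 2 y + huber_slope 2 y * d + (s * d - s\<^sup>2) = (y / 2 + s) * (y + d) - 2 * (y / 2 + s)\<^sup>2 / 2"
  unfolding huber_def sl by (simp add: field_simps power2_eq_square)
 also have "\<dots> <= huber 2 (y + d)" by (rule huber_ge) (use v in auto)
 finally have "huber 2 y + huber_slope 2 y * d + (s * d - s\<^sup>2) <= huber 2 (y + d)" .
 moreover have "min (d\<^sup>2) \<bar>d\<bar> / 4 <= s * d - s\<^sup>2"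
 proof (cases "abs d <= 1")
  case True
  then show ?thesis unfolding s_def by (simp add: power2_eq_square field_simps)
 next
  case False
  have "s * d - s\<^sup>2 = abs d / 2 - 1 / 4" using False unfolding s_def
   by (auto simp: sgn_if power2_eq_square)
  then show ?thesis using False by linarith
 qed
 ultimately show ?thesis by linarith
qed

text \<open>With \<open>w\<close> half the band width the slope is 1 above the band and -1 below it,
  so clipping lowers the function by exactly the distance pushed.\<close>

lemma huber_outside:
 assumes "a < b"
 defines "w \<equiv> (b - a) / 2" and "m \<equiv> (a + b) / 2"
 shows "huber w (y - m) - huber w (max a (min b y) - m) = max 0 (a - y) + max 0 (y - b)"
proof -
 have w: "0 < w" using assms by simp
 have ends: "b - m = w" "a - m = - w" by (simp_all add: w_def m_def field_simps)
 have end_val: "huber w w = w / 2" "huber w (- w) = w / 2" using w by (simp_all add: huber_def huber_slope_def)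
 consider "a <= y" "y <= b" | "b < y" | "y < a" by linarith
 then show ?thesis
 proof cases
  case 2
  then have "w < y - m" using ends by linarith
  then have "1 < (y - m) / w" using w by (simp add: field_simps)
  then have "huber w (y - m) = (y - m) - w / 2" by (simp add: huber_def huber_slope_def)
  then show ?thesis using 2 assms(1) ends end_val by simp
 next
  case 3
  then have "y - m < - w" using ends by linarith
  then have "(y - m) / w < - 1" using w by (simp add: field_simps)
  then have "huber w (y - m) = - (y - m) - w / 2" by (simp add: huber_def huber_slope_def)
  then show ?thesis using 3 assms(1) ends end_val by simp
 qed simp
qed

lemma huber_inside:
 assumes "0 < w" "abs y <= w"
 shows "huber w y <= w / 2"
proof -
 have "huber w y = y * y / w / 2"
  unfolding huber_def huber_slope_inside[OF assms] using assms(1) by (simp add: power2_eq_square)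
 also have "\<dots> <= w * w / w / 2"
  using assms abs_mult_self_eq[of y] mult_mono[of "abs y" w "abs y" w]
  by (intro divide_right_mono) auto
 finally show ?thesis using assms(1) by simp
qed

text \<open>A telescoping sum for the Huber function of the centred position: each push is paid for
  by a decrease of the function, and each increment of the path raises it by at most a linear term
  and a correction. The initial value is at most \<open>(b - a) / 4\<close>.\<close>

lemma grid_controls_le_huber:
 assumes "a < b"
 defines "w' \<equiv> (b - a) / 2" and "m \<equiv> (a + b) / 2"
 shows "grid_up a b x w n + grid_down a b x w n <=
   max 0 (a - x - w 0) + max 0 (x + w 0 - b) + (b - a) / 4 +
   (\<Sum>k<n. huber_slope w' (grid_pos a b x w k - m) * (w (Suc k) - w k)
    + min ((w (Suc k) - w k)\<^sup>2 / w') (2 * abs (w (Suc k) - w k)))"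
proof -
 have ab: "a <= b" using assms by simp
 have w': "0 < w'" using assms by simp
 let ?h = "%k. huber w' (grid_pos a b x w k - m)"
 have "grid_up a b x w n + grid_down a b x w n + ?h n <=
   max 0 (a - x - w 0) + max 0 (x + w 0 - b) + ?h 0 +
   (\<Sum>k<n. huber_slope w' (grid_pos a b x w k - m) * (w (Suc k) - w k)
    + min ((w (Suc k) - w k)\<^sup>2 / w') (2 * abs (w (Suc k) - w k)))"
 proof (induction n)
  case (Suc k)
  let ?D = "w (Suc k) - w k" and ?p = "grid_pos a b x w k"
  have "huber w' (?p + ?D - m) - ?h (Suc k) = max 0 (a - (?p + ?D)) + max 0 (?p + ?D - b)"
   unfolding grid_pos_Suc'[OF ab] w'_def m_def by (rule huber_outside[OF assms(1)])
  moreover have "huber w' (?p - m + ?D) <= ?h k + huber_slope w' (?p - m) * ?D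
    + min (?D\<^sup>2 / w') (2 * abs ?D)" by (rule huber_increment_le[OF w'])
  moreover have "?p + ?D - m = ?p - m + ?D" by simp
  ultimately show ?case using Suc unfolding grid_up_Suc_eq grid_down_Suc_eq sum.lessThan_Suc by simp
 qed simp
 moreover have "?h 0 <= w' / 2" using grid_pos_bounds[OF ab, of x w 0]
  by (intro huber_inside[OF w']) (simp add: w'_def m_def abs_le_iff field_simps)
 moreover have "0 <= ?h n" by (rule huber_nonneg[OF w'])
 moreover have "w' / 2 = (b - a) / 4" by (simp add: w'_def)
 ultimately show ?thesis by linarith
qed

section \<open>Levy processes and bounds on their controls\<close>

locale levy_model =
 fixes M :: "'w measure" and F :: "real => 'w measure" and L :: "real => 'w => real"
 assumes basis: "stochastic_basis M F" and levy: "levy_process M F L"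
  and finite_mean: "!!t. 0 <= t ==> integrable M (L t)"
begin

lemma basis_facts:
 shows prob_space_M: "prob_space M" and filtration_F: "filtration (space M) F"
  and subalgebra_F: "0 <= t ==> subalgebra M (F t)"
  and F_right_continuous: "0 <= t ==> sets (F t) = (\<Inter>s\<in>{t<..}. sets (F s))"
  and F_complete: "N \<in> null_sets M ==> A \<subseteq> N ==> A \<in> sets (F 0)"
proof -
 note b = basis[unfolded stochastic_basis_def]
 show "prob_space M" using b by (rule conjunct1)
 note b = b[THEN conjunct2]
 show "filtration (space M) F" using b by (rule conjunct1)
 note b = b[THEN conjunct2]
 show "subalgebra M (F t)" if "0 <= t" for t using that by (rule b[THEN conjunct1, rule_format])
 note b = b[THEN conjunct2]
 show "sets (F t) = (\<Inter>s\<in>{t<..}. sets (F s))" if "0 <= t" for t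
  using that by (rule b[THEN conjunct1, rule_format])
 note b = b[THEN conjunct2]
 show "A \<in> sets (F 0)" if "N \<in> null_sets M" "A \<subseteq> N" for N A using that by (rule b[rule_format])
qed

sublocale prob_space M by (rule prob_space_M)

lemma space_F [simp]: "space (F t) = space M" using filtration_F by (rule filtration.space_F)

lemma sets_F_mono: "s <= t ==> sets (F s) \<subseteq> sets (F t)"
 using filtration_F by (rule filtration.sets_F_mono)

lemma sets_F_M: "0 <= t ==> sets (F t) \<subseteq> sets M"
 using subalgebra_F by (simp add: subalgebra_def)

lemma sets_F_right: "0 <= t ==> (!!u. t < u ==> A \<in> sets (F u)) ==> A \<in> sets (F t)"
 by (subst F_right_continuous) (assumption, rule INT_I, simp)

lemma null_subset_F: "N \<in> null_sets M ==> A \<subseteq> N ==> 0 <= t ==> A \<in> sets (F t)"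
 by (rule subsetD[OF sets_F_mono[of 0 t] F_complete])

lemma measurable_F_mono:
 assumes "f \<in> F s \<rightarrow>\<^sub>M N" "s <= t"
 shows "f \<in> F t \<rightarrow>\<^sub>M N"
proof (rule measurableI)
 show "f x \<in> space N" if "x \<in> space (F t)" for x using measurable_space[OF assms(1)] that by simp
 show "f -` A \<inter> space (F t) \<in> sets (F t)" if "A \<in> sets N" for A
  using subsetD[OF sets_F_mono[OF assms(2)] measurable_sets[OF assms(1) that]] by simp
qed

lemma measurable_F_M:
 assumes "f \<in> F s \<rightarrow>\<^sub>M N" "0 <= s"
 shows "f \<in> M \<rightarrow>\<^sub>M N"
proof (rule measurableI)
 show "f x \<in> space N" if "x \<in> space M" for x using measurable_space[OF assms(1)] that by simp
 show "f -` A \<inter> space M \<in> sets M" if "A \<in> sets N" for A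
  using subsetD[OF sets_F_M[OF assms(2)] measurable_sets[OF assms(1) that]] by simp
qed

lemma measurable_F_right:
 assumes "!!u. t < u ==> f \<in> F u \<rightarrow>\<^sub>M N" "0 <= t"
 shows "f \<in> F t \<rightarrow>\<^sub>M N"
proof (rule measurableI)
 have f: "f \<in> F (t + 1) \<rightarrow>\<^sub>M N" by (rule assms) simp
 show "f x \<in> space N" if "x \<in> space (F t)" for x using measurable_space[OF f] that by simp
 show "f -` A \<inter> space (F t) \<in> sets (F t)" if "A \<in> sets N" for A
 proof (rule sets_F_right[OF assms(2)])
  fix u assume "t < u"
  from measurable_sets[OF assms(1)[OF this] that] show "f -` A \<inter> space (F t) \<in> sets (F u)" by simp
 qed
qed

lemma levy_facts:
 shows L_adapted: "adapted F L" and L_0: "AE w in M. L 0 w = 0" and L_cadlag: "AE w in M. cadlag (%t. L t w)"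
  and L_indep: "0 <= s ==> s <= t ==> indep_set (sets (F s))
    (sets (vimage_algebra (space M) (%w. L t w - L s w) borel))"
  and L_stationary: "0 <= s ==> 0 <= h ==>
    distr M borel (%w. L (s + h) w - L s w) = distr M borel (L h)"
proof -
 note l = levy[unfolded levy_process_def]
 show "adapted F L" using l by (rule conjunct1)
 note l = l[THEN conjunct2]
 show "AE w in M. L 0 w = 0" using l by (rule conjunct1)
 note l = l[THEN conjunct2]
 show "AE w in M. cadlag (%t. L t w)" using l by (rule conjunct1)
 note l = l[THEN conjunct2]
 show "indep_set (sets (F s)) (sets (vimage_algebra (space M) (%w. L t w - L s w) borel))"
  if "0 <= s" "s <= t" for s t using that by (rule l[THEN conjunct1, rule_format])
 note l = l[THEN conjunct2]
 show "distr M borel (%w. L (s + h) w - L s w) = distr M borel (L h)" if "0 <= s" "0 <= h" for s h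
  using that by (rule l[rule_format])
qed

lemma L_measurable_F: "0 <= s ==> s <= t ==> L s \<in> borel_measurable (F t)"
 using L_adapted measurable_F_mono[of "L s" s borel t] by (auto simp: adapted_def)

lemma L_measurable: "0 <= s ==> L s \<in> borel_measurable M"
 using measurable_F_M[OF L_measurable_F[of s s]] by auto

lemma L_right_cont: "AE w in M. right_cont (%t. L t w)"
 using L_cadlag by eventually_elim (simp add: cadlag_def right_cont_def)

definition law :: "real => real measure" where
 "law h = distr M borel (L h)"

lemma law_increment: "0 <= s ==> 0 <= h ==> distr M borel (%w. L (s + h) w - L s w) = law h"
 unfolding law_def by (rule L_stationary)

lemma increment_measurable: "0 <= s ==> 0 <= h ==> (%w. L (s + h) w - L s w) \<in> borel_measurable M"
 using L_measurable[of s] L_measurable[of "s + h"] by auto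

lemma prob_increment:
 assumes "0 <= s" "0 <= h" "A \<in> sets (F s)" "B \<in> sets borel"
 shows "prob (A \<inter> ((%w. L (s + h) w - L s w) -` B \<inter> space M)) = prob A * measure (law h) B"
proof -
 let ?D = "%w. L (s + h) w - L s w"
 have D: "?D \<in> borel_measurable M" using assms by (intro increment_measurable)
 have "s <= s + h" using assms by simp
 from L_indep[OF assms(1) this]
 have "indep_set (sets (F s)) (sets (vimage_algebra (space M) ?D borel))" .
 moreover have "?D -` B \<inter> space M \<in> sets (vimage_algebra (space M) ?D borel)"
  using assms(4) by (rule in_vimage_algebra)
 ultimately have "prob (A \<inter> (?D -` B \<inter> space M)) = prob A * prob (?D -` B \<inter> space M)"
  using assms(3) by (auto simp: indep_sets2_eq)
 also have "prob (?D -` B \<inter> space M) = measure (law h) B"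
  using assms D by (subst law_increment[OF assms(1,2), symmetric]) (simp add: measure_distr)
 finally show ?thesis .
qed

text \<open>The freezing lemma: \<open>Y\<close> and the later increment are independent, so their
  joint law is a product and Tonelli applies.\<close>

lemma nn_integral_increment:
 assumes "0 <= s" "0 <= h" "Y \<in> F s \<rightarrow>\<^sub>M N" "g \<in> borel_measurable (N \<Otimes>\<^sub>M borel)"
 shows "(\<integral>\<^sup>+w. g (Y w, L (s + h) w - L s w) \<partial>M) = (\<integral>\<^sup>+w. (\<integral>\<^sup>+z. g (Y w, z) \<partial>law h) \<partial>M)"
proof -
 let ?D = "%w. L (s + h) w - L s w"
 have D [measurable]: "?D \<in> borel_measurable M" using assms by (intro increment_measurable)
 have Y [measurable]: "Y \<in> M \<rightarrow>\<^sub>M N" using measurable_F_M[OF assms(3,1)] .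
 have [measurable_cong]: "sets (law h) = sets borel" by (simp add: law_def)
 interpret D: prob_space "law h"
  using assms by (subst law_increment[OF assms(1,2), symmetric]) (rule prob_space_distr[OF D])
 interpret Y: prob_space "distr M N Y" by (rule prob_space_distr[OF Y])
 have eq: "distr M N Y \<Otimes>\<^sub>M law h = distr M (N \<Otimes>\<^sub>M borel) (%w. (Y w, ?D w))"
 proof (rule pair_measure_eqI[OF Y.sigma_finite_measure_axioms D.sigma_finite_measure_axioms])
  show "sets (distr M N Y \<Otimes>\<^sub>M law h) = sets (distr M (N \<Otimes>\<^sub>M borel) (%w. (Y w, ?D w)))"
   by (simp add: law_def cong: sets_pair_measure_cong)
  fix A B assume "A \<in> sets (distr M N Y)" "B \<in> sets (law h)"
  then have A [measurable]: "A \<in> sets N" and B [measurable]: "B \<in> sets borel" by (auto simp: law_def)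
  have "Y -` A \<inter> space M \<in> sets (F s)" using measurable_sets[OF assms(3) A] by simp
  from prob_increment[OF assms(1,2) this B]
  have *: "emeasure M ((Y -` A \<inter> space M) \<inter> (?D -` B \<inter> space M))
    = emeasure M (Y -` A \<inter> space M) * emeasure (law h) B"
   by (simp add: emeasure_eq_measure D.emeasure_eq_measure ennreal_mult)
  show "emeasure (distr M N Y) A * emeasure (law h) B
    = emeasure (distr M (N \<Otimes>\<^sub>M borel) (%w. (Y w, ?D w))) (A \<times> B)"
  proof -
   have "(%w. (Y w, ?D w)) -` (A \<times> B) \<inter> space M = (Y -` A \<inter> space M) \<inter> (?D -` B \<inter> space M)"
    by auto
   then show ?thesis using * by (simp add: emeasure_distr)
  qed
 qed
 have "(\<integral>\<^sup>+w. g (Y w, ?D w) \<partial>M) = (\<integral>\<^sup>+p. g p \<partial>(distr M (N \<Otimes>\<^sub>M borel) (%w. (Y w, ?D w))))"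
  using assms(4) by (subst nn_integral_distr) auto
 also have "\<dots> = (\<integral>\<^sup>+p. g p \<partial>(distr M N Y \<Otimes>\<^sub>M law h))" by (simp only: eq)
 also have "\<dots> = (\<integral>\<^sup>+y. \<integral>\<^sup>+z. g (y, z) \<partial>law h \<partial>distr M N Y)"
  using assms(4) by (subst D.nn_integral_fst) (auto cong: measurable_cong_sets)
 also have "\<dots> = (\<integral>\<^sup>+w. \<integral>\<^sup>+z. g (Y w, z) \<partial>law h \<partial>M)"
  using assms(4) by (subst nn_integral_distr) auto
 finally show ?thesis .
qed

lemma indep_increment:
 assumes "0 <= s" "0 <= h" "Y \<in> borel_measurable (F s)"
 shows "indep_var borel Y borel (%w. L (s + h) w - L s w)"
proof -
 let ?D = "%w. L (s + h) w - L s w"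
 have D: "?D \<in> borel_measurable M" using assms by (intro increment_measurable)
 have Y: "Y \<in> borel_measurable M" by (rule measurable_F_M[OF assms(3,1)])
 have 1: "Int_stable {f -` A \<inter> space M |A. A \<in> sets borel}" for f :: "'w => real"
 proof (rule Int_stableI)
  fix a b assume "a \<in> {f -` A \<inter> space M |A. A \<in> sets borel}" "b \<in> {f -` A \<inter> space M |A. A \<in> sets borel}"
  then obtain A B where "a = f -` A \<inter> space M" "b = f -` B \<inter> space M" "A \<in> sets borel" "B \<in> sets borel"
   by auto
  then have "a \<inter> b = f -` (A \<inter> B) \<inter> space M" "A \<inter> B \<in> sets borel" by auto
  then show "a \<inter> b \<in> {f -` A \<inter> space M |A. A \<in> sets borel}" by blast
 qed
 have "indep_set {Y -` A \<inter> space M |A. A \<in> sets borel} {?D -` A \<inter> space M |A. A \<in> sets borel}"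
  unfolding indep_sets2_eq
 proof (intro conjI ballI)
  fix a b assume "a \<in> {Y -` A \<inter> space M |A. A \<in> sets borel}" "b \<in> {?D -` A \<inter> space M |A. A \<in> sets borel}"
  then obtain A B where ab: "a = Y -` A \<inter> space M" "b = ?D -` B \<inter> space M" "A \<in> sets borel" "B \<in> sets borel"
   by auto
  have "a \<in> sets (F s)" using measurable_sets[OF assms(3) ab(3)] ab(1) by simp
  moreover have "measure (law h) B = prob b"
   using D ab by (subst law_increment[OF assms(1,2), symmetric]) (simp add: measure_distr)
  ultimately show "prob (a \<inter> b) = prob a * prob b" using prob_increment[OF assms(1,2) _ ab(4)] ab(2) by simp
 qed (use D Y in \<open>auto intro: measurable_sets\<close>)
 from indep_set_sigma_sets[OF this 1 1] show ?thesis unfolding indep_var_eq using D Y by simp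
qed

lemma expectation_increment:
 fixes g :: "real => real"
 assumes "0 <= s" "0 <= h" "g \<in> borel_measurable borel"
 shows "expectation (%w. g (L (s + h) w - L s w)) = (\<integral>z. g z \<partial>law h)"
 by (subst law_increment[OF assms(1,2), symmetric])
  (rule integral_distr[symmetric, OF increment_measurable[OF assms(1,2)] assms(3)])

lemma integral_law:
 assumes "0 <= h" "g \<in> borel_measurable borel"
 shows "(\<integral>z. g z \<partial>law h) = expectation (%w. g (L h w) :: real)"
 unfolding law_def using assms L_measurable by (intro integral_distr) auto

lemma integrable_increment:
 assumes "0 <= s" "0 <= h"
 shows "integrable M (%w. L (s + h) w - L s w)"
 using assms by (intro Bochner_Integration.integrable_diff finite_mean) auto

lemma expectation_L_add:
 assumes "0 <= s" "0 <= h"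
 shows "expectation (L (s + h)) = expectation (L s) + expectation (L h)"
proof -
 have "expectation (L h) = expectation (%w. L (s + h) w - L s w)"
  using expectation_increment[OF assms, of "%x. x"] integral_law[OF assms(2), of "%x. x"] by simp
 also have "\<dots> = expectation (L (s + h)) - expectation (L s)"
  using assms by (intro Bochner_Integration.integral_diff finite_mean) auto
 finally show ?thesis by simp
qed

lemma expectation_L_mult:
 assumes "0 <= h"
 shows "expectation (L (real n * h)) = real n * expectation (L h)"
proof (induction n)
 case 0
 have "expectation (L 0) = expectation (%w. 0)" using L_0 L_measurable[of 0] by (intro integral_cong_AE) auto
 then show ?case by simp
next
 case (Suc n)
 then show ?case using expectation_L_add[of "real n * h" h] assms by (simp add: algebra_simps)
qed

text \<open>Second moment of small values and first moment of large ones: the quantity that bounds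
  the Huber corrections and is finite under a finite mean.\<close>

definition "clip_moment h = expectation (%w. min ((L h w)\<^sup>2) \<bar>L h w\<bar>)"

lemma clip_moment_nonneg: "0 <= clip_moment h" unfolding clip_moment_def by (intro integral_nonneg_AE) auto

lemma integrable_clip:
 assumes "0 <= h"
 shows "integrable M (%w. min ((L h w)\<^sup>2) \<bar>L h w\<bar>)"
 using finite_mean[OF assms] L_measurable[OF assms]
 by (intro Bochner_Integration.integrable_bound[OF integrable_abs[OF finite_mean[OF assms]]]) auto

lemma clip_moment_increment:
 assumes "0 <= s" "0 <= h"
 shows "expectation (%w. min ((L (s + h) w - L s w)\<^sup>2) \<bar>L (s + h) w - L s w\<bar>) = clip_moment h"
  and "integrable M (%w. min ((L (s + h) w - L s w)\<^sup>2) \<bar>L (s + h) w - L s w\<bar>)"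
proof -
 show "expectation (%w. min ((L (s + h) w - L s w)\<^sup>2) \<bar>L (s + h) w - L s w\<bar>) = clip_moment h"
  using expectation_increment[OF assms, of "%z. min (z\<^sup>2) \<bar>z\<bar>"]
   integral_law[OF assms(2), of "%z. min (z\<^sup>2) \<bar>z\<bar>"] by (simp add: clip_moment_def)
 show "integrable M (%w. min ((L (s + h) w - L s w)\<^sup>2) \<bar>L (s + h) w - L s w\<bar>)"
  using increment_measurable[OF assms]
  by (intro Bochner_Integration.integrable_bound[OF integrable_abs[OF integrable_increment[OF assms]]])
   auto
qed

lemma expectation_mult_increment:
 fixes Y :: "'w => real" and g :: "real => real"
 assumes "0 <= s" "0 <= h" "Y \<in> borel_measurable (F s)" "integrable M Y" "g \<in> borel_measurable borel"
  and "integrable M (%w. g (L (s + h) w - L s w))"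
 shows "expectation (%w. Y w * g (L (s + h) w - L s w)) =
   expectation Y * expectation (%w. g (L h w))" and "integrable M (%w. Y w * g (L (s + h) w - L s w))"
proof -
 have "indep_var borel ((%x. x) \<circ> Y) borel (g \<circ> (%w. L (s + h) w - L s w))"
  using indep_increment[OF assms(1-3)] assms(5) by (intro indep_var_compose) auto
 then have ind: "indep_var borel Y borel (%w. g (L (s + h) w - L s w))" by (simp add: comp_def)
 show "expectation (%w. Y w * g (L (s + h) w - L s w)) =
   expectation Y * expectation (%w. g (L h w))"
  using indep_var_lebesgue_integral[OF ind assms(4,6)] expectation_increment[OF assms(1,2,5)]
   integral_law[OF assms(2,5)] by simp
 show "integrable M (%w. Y w * g (L (s + h) w - L s w))" by (rule indep_var_integrable[OF ind assms(4,6)])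
qed

text \<open>Continuity in probability at 0, from right-continuity of the paths along a sequence of
  supposed counterexamples.\<close>

lemma prob_small:
 assumes "0 < p"
 shows "EX d>0. ALL t. 0 <= t & t <= d --> prob {w\<in>space M. abs (L t w) <= 1} >= 1 - p"
proof (rule ccontr)
 assume neg: "~ ?thesis"
 have "EX t. 0 <= t & t <= 1 / real (Suc n) & prob {w\<in>space M. abs (L t w) <= 1} < 1 - p" for n
 proof -
  have "0 < 1 / real (Suc n)" by simp
  then show ?thesis using neg not_le by blast
 qed
 then have "EX t. ALL n. 0 <= t n & t n <= 1 / real (Suc n) & prob {w\<in>space M. abs (L (t n) w) <= 1} < 1 - p"
  by (intro choice allI)
 then obtain t where t: "!!n. 0 <= t n" "!!n. t n <= 1 / real (Suc n)"
   "!!n. prob {w\<in>space M. abs (L (t n) w) <= 1} < 1 - p" by blast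
 have "(%n. 1 / real (Suc n)) \<longlonglongrightarrow> 0"
  using LIMSEQ_inverse_real_of_nat by (simp add: inverse_eq_divide)
 then have tlim: "t \<longlonglongrightarrow> 0" by (rule tendsto_sandwich[of "%_. 0", rotated 3])
   (use t(1,2) in \<open>auto intro: always_eventually\<close>)
 have [measurable]: "L (t n) \<in> borel_measurable M" for n using L_measurable t(1) .
 have "(%n. expectation (%w. indicator {- 1..1} (L (t n) w))) \<longlonglongrightarrow> expectation (%w. 1 :: real)"
 proof (rule integral_dominated_convergence[where w = "%_. 1"])
  show "AE w in M. (%n. indicator {- 1..1} (L (t n) w)) \<longlonglongrightarrow> (1 :: real)"
   using L_0 L_right_cont
  proof eventually_elim
   case (elim w)
   obtain r where r: "0 < r" "!!s. 0 <= s ==> s < r ==> abs (L s w - L 0 w) < 1"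
    using right_cont_ex[OF elim(2), of 0 1] by auto
   have "eventually (%n. t n < r) sequentially" using tlim r(1) by (rule order_tendstoD)
   then have "eventually (%n. indicator {- 1..1} (L (t n) w) = (1 :: real)) sequentially"
   proof eventually_elim
    case (elim n)
    then show ?case using r(2)[OF t(1) elim] \<open>L 0 w = 0\<close> by (auto simp: indicator_def)
   qed
   then show ?case by (rule tendsto_eventually)
  qed
 qed (auto simp: indicator_def)
 moreover have "expectation (%w. indicator {- 1..1} (L (t n) w) :: real)
   = prob {w\<in>space M. abs (L (t n) w) <= 1}" for n
 proof -
  have "expectation (%w. indicator {- 1..1} (L (t n) w) :: real)
    = expectation (indicator {w\<in>space M. abs (L (t n) w) <= 1})"
   by (intro Bochner_Integration.integral_cong) (auto simp: indicator_def abs_le_iff)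
  then show ?thesis by simp
 qed
 ultimately have "1 <= 1 - p" using t(3) by (intro LIMSEQ_le_const2) (auto simp: prob_space intro: less_imp_le)
 then show False using assms by simp
qed

end

section \<open>Expectation bounds for the controls and almost sure regularity\<close>

lemma (in levy_model) grid_measurable:
 assumes W: "!!k. W k \<in> borel_measurable (F (\<tau> k))" and \<tau>: "incseq \<tau>"
 shows "(%w. grid_up a b x (%k. W k w) k) \<in> borel_measurable (F (\<tau> k))"
  and "(%w. grid_down a b x (%k. W k w) k) \<in> borel_measurable (F (\<tau> k))"
  and "(%w. grid_pos a b x (%k. W k w) k) \<in> borel_measurable (F (\<tau> k))"
proof -
 have *: "(%w. grid_up a b x (%k. W k w) k) \<in> borel_measurable (F (\<tau> k)) &
  (%w. grid_down a b x (%k. W k w) k) \<in> borel_measurable (F (\<tau> k))"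
 proof (induction k)
  case 0
  note [measurable] = W[of 0]
  show ?case by simp
 next
  case (Suc k)
  have "\<tau> k <= \<tau> (Suc k)" using \<tau> by (simp add: incseq_SucD)
  then have [measurable]: "(%w. grid_up a b x (%k. W k w) k) \<in> borel_measurable (F (\<tau> (Suc k)))"
   "(%w. grid_down a b x (%k. W k w) k) \<in> borel_measurable (F (\<tau> (Suc k)))"
   using Suc measurable_F_mono by blast+
  note [measurable] = W[of "Suc k"]
  show ?case unfolding grid_up_Suc grid_down_Suc by simp
 qed
 then show "(%w. grid_up a b x (%k. W k w) k) \<in> borel_measurable (F (\<tau> k))"
  and "(%w. grid_down a b x (%k. W k w) k) \<in> borel_measurable (F (\<tau> k))" by auto
 then show "(%w. grid_pos a b x (%k. W k w) k) \<in> borel_measurable (F (\<tau> k))"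
  unfolding grid_pos_def using W[of k] by simp
qed

context levy_model
begin

text \<open>The clipped moment over a time \<open>h\<close> is of order \<open>h\<close>, from the
  finite mean alone. Along a walk with steps \<open>h = 1 / 2 ^ N\<close> up to the fixed time
  \<open>1 / 2 ^ j\<close>, the expected Huber function gains a fixed fraction of the clipped moment
  per step, apart from drift, whereas its final value is at most the mean absolute value
  \<open>E\<close>.\<close>

lemma clip_moment_bound: "EX C>=0. EX N0. ALL N>=N0. 2 ^ N * clip_moment (1 / 2 ^ N) <= C"
proof -
 obtain d where d: "0 < d" "!!t. 0 <= t ==> t <= d ==> 1 / 2 <= prob {w\<in>space M. abs (L t w) <= 1}"
  using prob_small[of "1 / 2"] by auto
 obtain j where j: "1 / 2 ^ j < d"
  using d(1) order_tendstoD(2)[OF tendsto_half_power d(1)] by (auto simp: eventually_sequentially)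
 define E where "E = expectation (%w. abs (L (1 / 2 ^ j) w))"
 have E: "0 <= E" unfolding E_def by (intro integral_nonneg_AE) auto
 have "2 ^ N * clip_moment (1 / 2 ^ N) <= 2 ^ j * (16 * E)" if "j <= N" for N
 proof -
  define n where "n = (2 :: nat) ^ (N - j)"
  define h where "h = (1 :: real) / 2 ^ N"
  have h: "0 <= h" by (simp add: h_def)
  have nh: "real n * h = 1 / 2 ^ j"
   using that by (simp add: n_def h_def power_diff_conv_inverse[of "2 :: real"] field_simps)
  define S where "S k = L (real k * h)" for k
  define D where "D k w = L (real k * h + h) w - L (real k * h) w" for k w
  have SD: "S (Suc k) w = S k w + D k w" for k w by (simp add: S_def D_def algebra_simps)
  have kh: "0 <= real k * h" for k using h by simp
  have Sm: "S k \<in> borel_measurable (F (real k * h))" for k unfolding S_def using kh by (intro L_measurable_F) auto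
  have SM [measurable]: "S k \<in> borel_measurable M" for k unfolding S_def using kh by (rule L_measurable)
  have Dint: "integrable M (D k)" for k unfolding D_def using kh h by (rule integrable_increment)
  have Sint: "integrable M (S k)" for k unfolding S_def using kh by (rule finite_mean)
  have hint: "integrable M (%w. huber 2 (S k w))" for k using huber_nonneg[of 2] huber_le_abs[of 2]
   by (intro Bochner_Integration.integrable_bound[OF integrable_abs[OF Sint[of k]]]) auto
  have slope: "integrable M (%w. huber_slope 2 (S k w))" for k
   using huber_slope_bound[of 2] by (intro integrable_const_bound[of _ 1]) auto
  have slope_m: "(%w. huber_slope 2 (S k w)) \<in> borel_measurable (F (real k * h))" for k
   using measurable_compose[OF Sm huber_slope_measurable] .
  define I :: "nat => 'w => real" where "I k w = indicator {- 1..1} (S k w)" for k w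
  have I_m: "(I k) \<in> borel_measurable (F (real k * h))" for k unfolding I_def using Sm by measurable
  have I_int: "integrable M (I k)" for k
   unfolding I_def by (intro integrable_const_bound[of _ 1]) (auto simp: indicator_def)
  have clip_int: "integrable M (%w. min ((D k w)\<^sup>2) \<bar>D k w\<bar>)" for k
   unfolding D_def by (rule clip_moment_increment(2)[OF kh h])
  have e1: "expectation (%w. huber_slope 2 (S k w) * D k w)
    = expectation (%w. huber_slope 2 (S k w)) * expectation (L h)"
   and i1: "integrable M (%w. huber_slope 2 (S k w) * D k w)" for k unfolding D_def
   using expectation_mult_increment[OF kh[of k] h slope_m slope, of "%x. x"] Dint[of k]
   by (simp_all add: D_def[abs_def])
  have e2: "expectation (%w. I k w * min ((D k w)\<^sup>2) \<bar>D k w\<bar>) = expectation (I k) * clip_moment h"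
   and i2: "integrable M (%w. I k w * min ((D k w)\<^sup>2) \<bar>D k w\<bar>)" for k
   unfolding D_def clip_moment_def
   using expectation_mult_increment[OF kh[of k] h I_m I_int, of "%x. min (x\<^sup>2) \<bar>x\<bar>"] clip_int[of k]
   by (simp_all add: D_def[abs_def])
  \<comment> \<open>With probability at least 1/2 the walk is in [-1, 1], where
    \<open>huber_increment_ge\<close> gives a quarter of the clipped increment; elsewhere plain
    convexity is used. Hence the factor 1/8.\<close>
  have step: "expectation (%w. huber 2 (S k w)) + clip_moment h / 8 - abs (expectation (L h))
    <= expectation (%w. huber 2 (S (Suc k) w))" if k: "k < n" for k
  proof -
   have "real k * h <= real n * h" using k h by (intro mult_right_mono) auto
   then have "1 / 2 <= prob {w\<in>space M. abs (S k w) <= 1}"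
    unfolding S_def using kh[of k] nh j by (intro d(2)) auto
   also have "\<dots> = expectation (indicator {w\<in>space M. abs (S k w) <= 1})" by simp
   also have "\<dots> = expectation (I k)"
    unfolding I_def by (intro Bochner_Integration.integral_cong) (auto simp: indicator_def abs_le_iff)
   finally have "clip_moment h / 2 <= expectation (I k) * clip_moment h"
    using mult_right_mono[OF _ clip_moment_nonneg[of h], of "1/2"] by simp
   moreover have "abs (expectation (%w. huber_slope 2 (S k w))) <= 1"
   proof -
    have "abs (expectation (%w. huber_slope 2 (S k w))) <= expectation (%w. abs (huber_slope 2 (S k w)))"
     by (rule integral_abs_bound)
    also have "\<dots> <= expectation (%w. 1)"
     by (intro integral_mono integrable_abs slope) (auto intro: huber_slope_bound)
    finally show ?thesis by (simp add: prob_space)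
   qed
   then have "abs (expectation (%w. huber_slope 2 (S k w)) * expectation (L h)) <= 1 * abs (expectation (L h))"
    unfolding abs_mult by (rule mult_right_mono) simp
   moreover have "expectation (%w. huber 2 (S k w) + huber_slope 2 (S k w) * D k w
     + (I k w * min ((D k w)\<^sup>2) \<bar>D k w\<bar>) / 4) <= expectation (%w. huber 2 (S (Suc k) w))"
   proof (rule integral_mono)
    fix w assume "w \<in> space M"
    show "huber 2 (S k w) + huber_slope 2 (S k w) * D k w
     + (I k w * min ((D k w)\<^sup>2) \<bar>D k w\<bar>) / 4 <= huber 2 (S (Suc k) w)"
    proof (cases "abs (S k w) <= 1")
     case True
     then show ?thesis using huber_increment_ge[OF True, of "D k w"] by (auto simp: SD I_def abs_le_iff)
    next
     case False
     have "huber 2 (S k w) + huber_slope 2 (S k w) * D k w <= huber 2 (S k w + D k w)"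
      using huber_ge[OF _ huber_slope_bound, of 2 2 "S k w" "S k w + D k w"]
      unfolding huber_def[of 2 "S k w"] by (simp add: algebra_simps)
     then show ?thesis using False by (auto simp: SD I_def indicator_def)
    qed
   qed (use hint i1 i2 in \<open>auto intro!: Bochner_Integration.integrable_add\<close>)
   moreover have "expectation (%w. huber 2 (S k w) + huber_slope 2 (S k w) * D k w
     + (I k w * min ((D k w)\<^sup>2) \<bar>D k w\<bar>) / 4) =
     expectation (%w. huber 2 (S k w)) + expectation (%w. huber_slope 2 (S k w)) * expectation (L h)
     + expectation (I k) * clip_moment h / 4" using hint i1 i2 by (simp add: e1 e2)
   ultimately show ?thesis by linarith
  qed
  have "expectation (%w. huber 2 (S 0 w)) + real m * (clip_moment h / 8 - abs (expectation (L h)))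
    <= expectation (%w. huber 2 (S m w))" if "m <= n" for m using that
  proof (induction m)
   case (Suc m)
   then show ?case using step[of m] by (simp add: algebra_simps add_divide_distrib)
  qed simp
  moreover have "0 <= expectation (%w. huber 2 (S 0 w))"
   by (intro integral_nonneg_AE AE_I2 huber_nonneg) simp
  ultimately have "real n * (clip_moment h / 8) <= expectation (%w. huber 2 (S n w))
    + real n * abs (expectation (L h))" by (fastforce simp: algebra_simps)
  also have "expectation (%w. huber 2 (S n w)) <= E" unfolding E_def S_def nh
   using hint[of n] finite_mean[of "1 / 2 ^ j"] huber_le_abs[of 2] by (intro integral_mono) (auto simp: S_def nh)
  also have "real n * abs (expectation (L h)) = abs (expectation (L (1 / 2 ^ j)))"
   using expectation_L_mult[OF h, of n] by (simp add: nh abs_mult)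
  also have "\<dots> <= E" unfolding E_def by (rule integral_abs_bound)
  \<comment> \<open>Two terms \<open>E\<close>, one from the final value and one from the drift,
    times 8.\<close>
  finally have "real n * clip_moment h <= 16 * E" by simp
  then have "2 ^ j * (real n * clip_moment h) <= 2 ^ j * (16 * E)" by (intro mult_left_mono) auto
  moreover have "2 ^ j * real n = 2 ^ N" using that by (simp add: n_def flip: power_add)
  ultimately show ?thesis by (simp add: h_def mult.assoc[symmetric])
 qed
 then show ?thesis using E by (intro exI[of _ "2 ^ j * (16 * E)"] conjI exI[of _ j]) auto
qed

lemma sample_measurable:
 assumes "0 <= s"
 shows "(%w. sample (%t. L (s + t) w - L s w) N k) \<in> borel_measurable (F (s + real k / 2 ^ N))"
proof -
 have "L (s + real k / 2 ^ N) \<in> borel_measurable (F (s + real k / 2 ^ N))"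
  "L s \<in> borel_measurable (F (s + real k / 2 ^ N))" using assms by (auto intro!: L_measurable_F)
 then show ?thesis unfolding sample_def by simp
qed

text \<open>\<open>grid_controls_le_huber\<close> in expectation. The slope is known before the
  increment, so the linear terms contribute only drift, and the corrections are clipped moments. The
  bound sees the grid only through the elapsed time \<open>real k / 2 ^ N\<close>, so it survives
  refinement.\<close>

lemma expectation_controls_le:
 "EX K>=0. EX N0. ALL N>=N0. ALL a b x k. a < b -->
   (\<integral>\<^sup>+\<omega>. ennreal (grid_up a b x (sample (%t. L t \<omega>) N) k + grid_down a b x (sample (%t. L t \<omega>) N) k) \<partial>M)
   <= ennreal (max 0 (a - x) + max 0 (x - b) + (b - a) / 4 + real k / 2 ^ N * (K * (1 + 1 / (b - a))))"
proof -
 obtain C N0 where C: "0 <= C" "!!N. N0 <= N ==> 2 ^ N * clip_moment (1 / 2 ^ N) <= C"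
  using clip_moment_bound by auto
 define K where "K = abs (expectation (L 1)) + 2 * C"
 have K: "0 <= K" using C by (simp add: K_def)
 have "(\<integral>\<^sup>+\<omega>. ennreal (grid_up a b x (sample (%t. L t \<omega>) N) n + grid_down a b x (sample (%t. L t \<omega>) N) n) \<partial>M)
   <= ennreal (max 0 (a - x) + max 0 (x - b) + (b - a) / 4 + real n / 2 ^ N * (K * (1 + 1 / (b - a))))"
  if N: "N0 <= N" and ab: "a < b" for N a b x n
 proof -
  define h where "h = (1 :: real) / 2 ^ N"
  have h: "0 <= h" by (simp add: h_def)
  have kh: "0 <= real k * h" for k using h by simp
  define W where "W k = L (real k * h)" for k
  have W: "sample (%t. L t \<omega>) N = (%k. W k \<omega>)" for \<omega>
   by (simp add: fun_eq_iff sample_def W_def h_def)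
  define D where "D k \<omega> = L (real k * h + h) \<omega> - L (real k * h) \<omega>" for k \<omega>
  have WD: "W (Suc k) \<omega> - W k \<omega> = D k \<omega>" for k \<omega> by (simp add: W_def D_def algebra_simps)
  define w where "w = (b - a) / 2"
  have w: "0 < w" using ab by (simp add: w_def)
  define m where "m = (a + b) / 2"
  define Y where "Y k \<omega> = huber_slope w (grid_pos a b x (%k. W k \<omega>) k - m)" for k \<omega>
  have Wm: "W k \<in> borel_measurable (F (real k * h))" for k unfolding W_def using kh by (intro L_measurable_F) auto
  have tau: "incseq (%k. real k * h)" using h by (auto simp: incseq_def intro: mult_right_mono)
  note gm = grid_measurable[of W, OF Wm tau]
  have Ym: "Y k \<in> borel_measurable (F (real k * h))" for k unfolding Y_def using gm(3)[of a b x k] by measurable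
  have YM [measurable]: "Y k \<in> borel_measurable M" for k by (rule measurable_F_M[OF Ym kh])
  have Yb: "abs (Y k \<omega>) <= 1" for k \<omega> unfolding Y_def by (rule huber_slope_bound)
  have Yint: "integrable M (Y k)" for k using Yb by (intro integrable_const_bound[of _ 1]) auto
  have Dint: "integrable M (D k)" for k unfolding D_def using kh h by (rule integrable_increment)
  have clip_int: "integrable M (%\<omega>. min ((D k \<omega>)\<^sup>2) \<bar>D k \<omega>\<bar>)" for k
   unfolding D_def by (rule clip_moment_increment(2)[OF kh h])
  have clip_e: "expectation (%\<omega>. min ((D k \<omega>)\<^sup>2) \<bar>D k \<omega>\<bar>) = clip_moment h" for k
   unfolding D_def by (rule clip_moment_increment(1)[OF kh h])
  have e1: "expectation (%\<omega>. Y k \<omega> * D k \<omega>) = expectation (Y k) * expectation (L h)"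
   and i1: "integrable M (%\<omega>. Y k \<omega> * D k \<omega>)" for k unfolding D_def
   using expectation_mult_increment[OF kh[of k] h Ym Yint, of "%x. x"] Dint[of k]
   by (simp_all add: D_def[abs_def])
  \<comment> \<open>With \<open>w = (b - a) / 2\<close> this is
    \<open>2 * (1 + 1 / (b - a))\<close>, the origin of that factor in the bound.\<close>
  define c where "c = 1 / w + 2"
  have c: "0 <= c" using w by (simp add: c_def)
  define R where "R \<omega> = max 0 (a - x) + max 0 (x - b) + (b - a) / 4 +
    (\<Sum>k<n. Y k \<omega> * D k \<omega> + c * min ((D k \<omega>)\<^sup>2) \<bar>D k \<omega>\<bar>)" for \<omega>
  have Rint: "integrable M R" unfolding R_def using i1 clip_int
   by (auto intro!: Bochner_Integration.integrable_add Bochner_Integration.integrable_sum)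
  have bound: "grid_up a b x (%k. W k \<omega>) n + grid_down a b x (%k. W k \<omega>) n <= R \<omega>" if "W 0 \<omega> = 0" for \<omega>
  proof -
   have "min ((D k \<omega>)\<^sup>2 / w) (2 * abs (D k \<omega>)) <= c * min ((D k \<omega>)\<^sup>2) \<bar>D k \<omega>\<bar>" for k
   proof -
    have "(D k \<omega>)\<^sup>2 / w <= c * (D k \<omega>)\<^sup>2" "2 * abs (D k \<omega>) <= c * abs (D k \<omega>)"
     using w by (auto simp: c_def field_simps)
    then show ?thesis using c by (simp add: min_def)
   qed
   then have "(\<Sum>k<n. Y k \<omega> * D k \<omega> + min ((D k \<omega>)\<^sup>2 / w) (2 * abs (D k \<omega>)))
     <= (\<Sum>k<n. Y k \<omega> * D k \<omega> + c * min ((D k \<omega>)\<^sup>2) \<bar>D k \<omega>\<bar>)"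
    by (intro sum_mono add_left_mono)
   moreover have "grid_up a b x (%k. W k \<omega>) n + grid_down a b x (%k. W k \<omega>) n <=
     max 0 (a - x) + max 0 (x - b) + (b - a) / 4 +
     (\<Sum>k<n. Y k \<omega> * D k \<omega> + min ((D k \<omega>)\<^sup>2 / w) (2 * abs (D k \<omega>)))"
    using grid_controls_le_huber[OF ab, of x "%k. W k \<omega>" n] that by (simp add: WD Y_def w_def m_def)
   ultimately show ?thesis unfolding R_def by linarith
  qed
  have W0: "AE \<omega> in M. W 0 \<omega> = 0" using L_0 by (simp add: W_def)
  have "(\<integral>\<^sup>+\<omega>. ennreal (grid_up a b x (%k. W k \<omega>) n + grid_down a b x (%k. W k \<omega>) n) \<partial>M)
    <= (\<integral>\<^sup>+\<omega>. ennreal (R \<omega>) \<partial>M)"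
   using W0 by (intro nn_integral_mono_AE) (auto elim!: eventually_mono intro!: ennreal_leI bound)
  also have "\<dots> = ennreal (expectation R)"
  proof (rule nn_integral_eq_integral[OF Rint])
   show "AE \<omega> in M. 0 <= R \<omega>" using W0
    by eventually_elim (rule order_trans[OF _ bound], auto simp: grid_up_nonneg grid_down_nonneg)
  qed
  also have "expectation R = max 0 (a - x) + max 0 (x - b) + (b - a) / 4 +
    (\<Sum>k<n. expectation (Y k) * expectation (L h) + c * clip_moment h)" unfolding R_def using i1 clip_int
   by (simp add: e1 clip_e prob_space Bochner_Integration.integral_sum)
  also have "\<dots> <= max 0 (a - x) + max 0 (x - b) + (b - a) / 4 + real n / 2 ^ N * (K * (1 + 1 / (b - a)))"
  proof -
   have "expectation (Y k) * expectation (L h) <= abs (expectation (L h))" for k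
   proof -
    have "abs (expectation (Y k)) <= expectation (%\<omega>. abs (Y k \<omega>))" by (rule integral_abs_bound)
    also have "\<dots> <= expectation (%\<omega>. 1)"
     using Yb by (intro integral_mono integrable_abs Yint) auto
    finally have "abs (expectation (Y k)) <= 1" by (simp add: prob_space)
    then have "abs (expectation (Y k) * expectation (L h)) <= 1 * abs (expectation (L h))"
     unfolding abs_mult by (rule mult_right_mono) simp
    then show ?thesis by linarith
   qed
   then have "(\<Sum>k<n. expectation (Y k) * expectation (L h) + c * clip_moment h)
     <= (\<Sum>k<n. abs (expectation (L h)) + c * clip_moment h)" by (intro sum_mono add_right_mono)
   also have "\<dots> = real n / 2 ^ N * (abs (2 ^ N * expectation (L h)) + c * (2 ^ N * clip_moment h))"
    by (simp add: abs_mult field_simps)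
   also have "2 ^ N * expectation (L h) = expectation (L 1)"
    using expectation_L_mult[OF h, of "2 ^ N"] by (simp add: h_def)
   also have "real n / 2 ^ N * (abs (expectation (L 1)) + c * (2 ^ N * clip_moment h))
     <= real n / 2 ^ N * (K * (1 + 1 / (b - a)))"
   proof (rule mult_left_mono)
    have "c * (2 ^ N * clip_moment h) <= c * C" using C(2)[OF N] c by (intro mult_left_mono) (auto simp: h_def)
    also have "c * C = (2 * C) * (1 + 1 / (b - a))" using ab by (simp add: c_def w_def field_simps)
    also have "abs (expectation (L 1)) <= abs (expectation (L 1)) * (1 + 1 / (b - a))"
     using ab by (simp add: field_simps)
    ultimately show "abs (expectation (L 1)) + c * (2 ^ N * clip_moment h) <= K * (1 + 1 / (b - a))"
     unfolding K_def distrib_right by linarith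
   qed simp
   finally show ?thesis by simp
  qed
  finally show ?thesis unfolding W by (simp add: ennreal_leI)
 qed
 then show ?thesis using K by (intro exI[of _ K] conjI exI[of _ N0]) auto
qed

lemma grid_up_measurable:
 "(%w. grid_up a b x (sample (%t. L t w) N) k) \<in> borel_measurable (F (real k / 2 ^ N))"
 and grid_down_measurable:
 "(%w. grid_down a b x (sample (%t. L t w) N) k) \<in> borel_measurable (F (real k / 2 ^ N))"
proof -
 have W: "L (real k / 2 ^ N) \<in> borel_measurable (F (real k / 2 ^ N))" for k by (rule L_measurable_F) auto
 have \<tau>: "incseq (%k. real k / 2 ^ N)" by (auto simp: incseq_def divide_right_mono)
 have eq: "sample (%t. L t w) N = (%k. L (real k / 2 ^ N) w)" for w
  by (simp add: fun_eq_iff sample_def)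
 show "(%w. grid_up a b x (sample (%t. L t w) N) k) \<in> borel_measurable (F (real k / 2 ^ N))"
  "(%w. grid_down a b x (sample (%t. L t w) N) k) \<in> borel_measurable (F (real k / 2 ^ N))"
  unfolding eq
  using grid_measurable(1,2)[of "%k. L (real k / 2 ^ N)" "%k. real k / 2 ^ N", OF W \<tau>] by auto
qed

lemma dyadic_up_measurable:
 assumes "0 <= t"
 shows "(%w. dyadic_up a b x (%t. L t w) t) \<in> borel_measurable (F t)"
  and "(%w. dyadic_up (- b) (- a) (- x) (%t. - L t w) t) \<in> borel_measurable (F t)"
proof -
 have "(%w. grid_up a b x (sample (%t. L t w) N) (grid_index N t)) \<in> borel_measurable (F t)" for N
  by (rule measurable_F_mono[OF grid_up_measurable grid_index_le[OF assms]])
 then show "(%w. dyadic_up a b x (%t. L t w) t) \<in> borel_measurable (F t)"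
  unfolding dyadic_up_def by (intro borel_measurable_SUP measurable_compose[OF _ measurable_ennreal]) auto
 have "(%w. grid_down a b x (sample (%t. L t w) N) (grid_index N t)) \<in> borel_measurable (F t)" for N
  by (rule measurable_F_mono[OF grid_down_measurable grid_index_le[OF assms]])
 then show "(%w. dyadic_up (- b) (- a) (- x) (%t. - L t w) t) \<in> borel_measurable (F t)"
  unfolding dyadic_up_def sample_uminus grid_down_eq_grid_up(1)[of a b x, symmetric]
  by (intro borel_measurable_SUP measurable_compose[OF _ measurable_ennreal]) auto
qed

lemma dyadic_up_expectation_le:
 "EX K>=0. ALL a b x t. a < b --> 0 <= t -->
   (\<integral>\<^sup>+w. dyadic_up a b x (%t. L t w) t \<partial>M)
    <= ennreal (max 0 (a - x) + max 0 (x - b) + (b - a) / 4 + t * (K * (1 + 1 / (b - a)))) &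
   (\<integral>\<^sup>+w. dyadic_up (- b) (- a) (- x) (%t. - L t w) t \<partial>M)
    <= ennreal (max 0 (a - x) + max 0 (x - b) + (b - a) / 4 + t * (K * (1 + 1 / (b - a))))"
proof -
 obtain K N0 where K: "0 <= K" and bnd: "!!N a b x k. N0 <= N ==> a < b ==>
   (\<integral>\<^sup>+w. ennreal (grid_up a b x (sample (%t. L t w) N) k + grid_down a b x (sample (%t. L t w) N) k) \<partial>M)
   <= ennreal (max 0 (a - x) + max 0 (x - b) + (b - a) / 4 + real k / 2 ^ N * (K * (1 + 1 / (b - a))))"
  using expectation_controls_le by blast
 have gen: "(\<integral>\<^sup>+w. (SUP N. ennreal (G N w)) \<partial>M) <= B"
  if inc: "!!w. incseq (%N. G N w :: real)" and m: "!!N. G N \<in> borel_measurable M"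
   and B: "!!N. N0 <= N ==> (\<integral>\<^sup>+w. ennreal (G N w) \<partial>M) <= B" for G B
 proof -
  have "(\<integral>\<^sup>+w. (SUP N. ennreal (G N w)) \<partial>M) = (SUP N. (\<integral>\<^sup>+w. ennreal (G N w) \<partial>M))"
   using inc m by (intro nn_integral_monotone_convergence_SUP)
    (auto simp: incseq_def le_fun_def intro: ennreal_leI)
  also have "\<dots> <= B"
  proof (rule SUP_least)
   \<comment> \<open>The bound is known from \<open>N0\<close> on; coarser grids have smaller
     controls.\<close>
   fix N
   have "(\<integral>\<^sup>+w. ennreal (G N w) \<partial>M) <= (\<integral>\<^sup>+w. ennreal (G (max N N0) w) \<partial>M)"
    using inc by (intro nn_integral_mono ennreal_leI) (auto simp: incseq_def)
   also have "\<dots> <= B" by (rule B) simp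
   finally show "(\<integral>\<^sup>+w. ennreal (G N w) \<partial>M) <= B" .
  qed
  finally show ?thesis .
 qed
 show ?thesis
 proof (intro exI[of _ K] conjI K allI impI)
  fix a b x t :: real assume ab: "a < b" and t: "0 <= t"
  let ?B = "max 0 (a - x) + max 0 (x - b) + (b - a) / 4 + t * (K * (1 + 1 / (b - a)))"
  have Kn: "0 <= K * (1 + 1 / (b - a))" using K ab by simp
  let ?u = "%N w. grid_up a b x (sample (%t. L t w) N) (grid_index N t)"
  let ?d = "%N w. grid_down a b x (sample (%t. L t w) N) (grid_index N t)"
  have B: "(\<integral>\<^sup>+w. ennreal (?u N w + ?d N w) \<partial>M) <= ennreal ?B" if "N0 <= N" for N
   using mult_right_mono[OF grid_index_le[OF t, of N] Kn]
   by (intro order_trans[OF bnd[OF that ab]] ennreal_leI add_left_mono)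
  show "(\<integral>\<^sup>+w. dyadic_up a b x (%t. L t w) t \<partial>M) <= ennreal ?B"
   unfolding dyadic_up_def
  proof (rule gen)
   show "incseq (%N. ?u N w)" for w using ab t by (intro grid_up_incseq) auto
   show "?u N \<in> borel_measurable M" for N by (rule measurable_F_M[OF grid_up_measurable]) simp
   show "(\<integral>\<^sup>+w. ennreal (?u N w) \<partial>M) <= ennreal ?B" if "N0 <= N" for N
    by (rule order_trans[OF _ B[OF that]], intro nn_integral_mono ennreal_leI)
     (simp add: grid_down_nonneg)
  qed
  show "(\<integral>\<^sup>+w. dyadic_up (- b) (- a) (- x) (%t. - L t w) t \<partial>M) <= ennreal ?B"
   unfolding dyadic_up_def sample_uminus
  proof (rule gen)
   show "incseq (%N. grid_up (- b) (- a) (- x) (%k. - sample (%t. L t w) N k) (grid_index N t))" for w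
    using grid_up_incseq[of "- b" "- a" t "- x" "%t. - L t w"] ab t by (simp add: sample_uminus)
   show "(%w. grid_up (- b) (- a) (- x) (%k. - sample (%t. L t w) N k) (grid_index N t)) \<in> borel_measurable M" for N
    unfolding grid_down_eq_grid_up(1)[of a b x, symmetric] by (rule measurable_F_M[OF grid_down_measurable]) simp
   show "(\<integral>\<^sup>+w. ennreal (grid_up (- b) (- a) (- x) (%k. - sample (%t. L t w) N k) (grid_index N t)) \<partial>M)
     <= ennreal ?B" if "N0 <= N" for N unfolding grid_down_eq_grid_up(1)[of a b x, symmetric]
    by (rule order_trans[OF _ B[OF that]], intro nn_integral_mono ennreal_leI)
     (simp add: grid_up_nonneg)
  qed
 qed
qed

text \<open>Finite expectations make the limiting controls almost surely finite for countably many
  bands and integer times, so one null set serves all; monotonicity in time covers the remaining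
  times.\<close>

lemma AE_regular_path: "AE w in M. regular_path (%t. L t w)"
proof -
 obtain K where K: "!!a b x t. a < b ==> 0 <= t ==>
   (\<integral>\<^sup>+w. dyadic_up a b x (%t. L t w) t \<partial>M)
    <= ennreal (max 0 (a - x) + max 0 (x - b) + (b - a) / 4 + t * (K * (1 + 1 / (b - a)))) &
   (\<integral>\<^sup>+w. dyadic_up (- b) (- a) (- x) (%t. - L t w) t \<partial>M)
    <= ennreal (max 0 (a - x) + max 0 (x - b) + (b - a) / 4 + t * (K * (1 + 1 / (b - a))))"
  using dyadic_up_expectation_le by blast
 have "AE w in M. dyadic_up 0 (1 / real (Suc m)) 0 (%t. L t w) (real n) < \<infinity> &
   dyadic_up (- (1 / real (Suc m))) (- 0) (- 0) (%t. - L t w) (real n) < \<infinity>" for m n :: nat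
 proof -
  note K' = K[of 0 "1 / real (Suc m)" "real n" 0]
  note meas = dyadic_up_measurable[where t = "real n" and a = 0 and b = "1 / real (Suc m)" and x = 0]
  have "AE w in M. dyadic_up 0 (1 / real (Suc m)) 0 (%t. L t w) (real n) \<noteq> \<infinity>"
   using K' by (intro nn_integral_noteq_infinite measurable_F_M[OF meas(1)]) (auto simp: top_unique)
  moreover have "AE w in M. dyadic_up (- (1 / real (Suc m))) (- 0) (- 0) (%t. - L t w) (real n) \<noteq> \<infinity>"
   using K' by (intro nn_integral_noteq_infinite measurable_F_M[OF meas(2)]) (auto simp: top_unique)
  ultimately show ?thesis by eventually_elim (auto simp: less_top)
 qed
 then have "AE w in M. ALL m n. dyadic_up 0 (1 / real (Suc m)) 0 (%t. L t w) (real n) < \<infinity> &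
   dyadic_up (- (1 / real (Suc m))) (- 0) (- 0) (%t. - L t w) (real n) < \<infinity>"
  unfolding AE_all_countable by blast
 then show ?thesis using L_0 L_right_cont
 proof eventually_elim
  case (elim w)
  have "dyadic_up 0 (1 / real (Suc m)) 0 (%t. L t w) t < \<infinity> &
   dyadic_up (- (1 / real (Suc m))) (- 0) (- 0) (%t. - L t w) t < \<infinity>" for t m
  proof -
   obtain n :: nat where "t <= real n" using real_arch_simple by blast
   then show ?thesis using elim(1) by (meson dyadic_up_mono order_le_less_trans)
  qed
  then show ?case using elim(2,3) unfolding regular_path_def tame_def by blast
 qed
qed

end

lemma regular_path_zero: "regular_path (%t. 0)"
proof -
 have "tame 0 (1 / real (Suc m)) 0 (%t. 0)" for m
  by (rule feasible_tame[of _ _ _ _ "%t. 0" "%t. 0"])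
   (auto simp: feasible_def right_cont_const intro: mono_onI)
 then show ?thesis by (simp add: regular_path_def right_cont_const)
qed

text \<open>The zero path is regular, so after this change pathwise statements hold for every
  scenario and no null set has to be carried along. Completeness of the filtration keeps the process
  adapted.\<close>

definition regularized :: "'w measure => (real => 'w => real) => real => 'w => real" where
 "regularized M L t w = (if regular_path (%t. L t w) then L t w else 0)"

lemma regularized_regular: "regular_path (%t. regularized M L t w)"
proof (cases "regular_path (%t. L t w)")
 case True
 then have "(%t. regularized M L t w) = (%t. L t w)" by (simp add: regularized_def)
 then show ?thesis using True by simp
next
 case False
 then have "(%t. regularized M L t w) = (%t. 0)" by (simp add: regularized_def)
 then show ?thesis using regular_path_zero by simp
qed

context levy_model
begin

lemma AE_regularized: "AE w in M. ALL t. regularized M L t w = L t w"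
 using AE_regular_path by eventually_elim (simp add: regularized_def)

lemma regularized_measurable:
 assumes "0 <= t"
 shows "regularized M L t \<in> borel_measurable (F t)"
proof -
 obtain N where N: "{w\<in>space M. ~ regular_path (%t. L t w)} \<subseteq> N" "N \<in> null_sets M"
  using AE_regular_path unfolding eventually_ae_filter by auto
 have "{w\<in>space M. ~ regular_path (%t. L t w)} \<in> sets (F t)"
  by (rule null_subset_F[OF N(2,1) assms])
 then have "space (F t) - {w\<in>space M. ~ regular_path (%t. L t w)} \<in> sets (F t)"
  by (rule sets.compl_sets)
 also have "space (F t) - {w\<in>space M. ~ regular_path (%t. L t w)}
   = {w\<in>space (F t). regular_path (%t. L t w)}" by auto
 finally show ?thesis unfolding regularized_def[abs_def]
  using L_measurable_F[OF assms order_refl] by (intro measurable_If) simp_all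
qed

lemma regularized_measurable_M: "0 <= t ==> regularized M L t \<in> borel_measurable M"
 by (rule measurable_F_M[OF regularized_measurable])

lemma levy_process_regularized: "levy_process M F (regularized M L)" unfolding levy_process_def
proof (intro conjI allI impI)
 show "adapted F (regularized M L)" unfolding adapted_def using regularized_measurable by auto
 show "AE w in M. regularized M L 0 w = 0" using L_0 by eventually_elim (simp add: regularized_def)
 show "AE w in M. cadlag (%t. regularized M L t w)" using L_cadlag AE_regularized by eventually_elim simp
next
 fix s t :: real assume st: "0 <= s" "s <= t"
 let ?D = "%w. L t w - L s w" and ?D' = "%w. regularized M L t w - regularized M L s w"
 have D: "?D \<in> borel_measurable M" "?D' \<in> borel_measurable M"
  using st by (auto intro!: borel_measurable_diff L_measurable regularized_measurable_M)
 have ind: "sets (F s) \<subseteq> events" "!!a B. a \<in> sets (F s) ==> B \<in> sets borel ==>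
   prob (a \<inter> (?D -` B \<inter> space M)) = prob a * prob (?D -` B \<inter> space M)"
  using L_indep[OF st] in_vimage_algebra[of _ borel ?D "space M"] unfolding indep_sets2_eq by auto
 have ae: "AE w in M. ?D w = ?D' w" using AE_regularized by eventually_elim simp
 show "indep_set (sets (F s)) (sets (vimage_algebra (space M) ?D' borel))" unfolding indep_sets2_eq
 proof (intro conjI ballI)
  show "sets (vimage_algebra (space M) ?D' borel) \<subseteq> events" by (rule sets_image_in_sets[OF _ D(2)]) simp
  fix a b assume a: "a \<in> sets (F s)" and "b \<in> sets (vimage_algebra (space M) ?D' borel)"
  then obtain B where b: "b = ?D' -` B \<inter> space M" and B: "B \<in> sets borel"
   by (auto simp: sets_vimage_algebra2)
  have aM: "a \<in> events" using a ind(1) by auto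
  have "prob b = prob (?D -` B \<inter> space M)" unfolding b using ae D B by (intro finite_measure_eq_AE) auto
  moreover have "prob (a \<inter> b) = prob (a \<inter> (?D -` B \<inter> space M))"
   unfolding b using ae D B aM by (intro finite_measure_eq_AE) auto
  ultimately show "prob (a \<inter> b) = prob a * prob b" using ind(2)[OF a B] by simp
 qed (rule ind(1))
next
 fix s h :: real assume sh: "0 <= s" "0 <= h"
 have "distr M borel (%w. regularized M L (s + h) w - regularized M L s w)
   = distr M borel (%w. L (s + h) w - L s w)" using AE_regularized sh
  by (intro distr_cong_AE borel_measurable_diff L_measurable regularized_measurable_M refl)
   (auto elim!: eventually_mono)
 also have "\<dots> = distr M borel (L h)" by (rule L_stationary[OF sh])
 also have "\<dots> = distr M borel (regularized M L h)" using AE_regularized sh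
  by (intro distr_cong_AE L_measurable regularized_measurable_M refl) (auto elim!: eventually_mono)
 finally show "distr M borel (%w. regularized M L (s + h) w - regularized M L s w)
  = distr M borel (regularized M L h)" .
qed

lemma levy_model_regularized: "levy_model M F (regularized M L)"
proof
 show "integrable M (regularized M L t)" if t: "0 <= t" for t
 proof -
  have "AE w in M. L t w = regularized M L t w" using AE_regularized by eventually_elim simp
  then show ?thesis using finite_mean[OF t] integrable_cong_AE[OF L_measurable[OF t] regularized_measurable_M[OF t]]
   by simp
 qed
qed (rule basis levy_process_regularized)+

lemma subordinator_regularized:
 assumes "subordinator M F (regularized M L)"
 shows "subordinator M F L"
proof -
 have "AE w in M. mono_on {0..} (%t. regularized M L t w)" using assms by (simp add: subordinator_def)
 then have "AE w in M. mono_on {0..} (%t. L t w)" using AE_regularized by eventually_elim simp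
 then show ?thesis using levy by (simp add: subordinator_def)
qed

end

section \<open>Reflected Levy processes\<close>

locale regular_levy = levy_model M F L
 for M :: "'w measure" and F :: "real => 'w measure" and L :: "real => 'w => real" +
 assumes regular_paths: "regular_path (%t. L t w)"
begin

abbreviation lpath :: "real => 'w => real => real" where
 "lpath s w \<equiv> shift_path s (%t. L t w)"

lemma L_zero [simp]: "L 0 w = 0" using regular_paths by (simp add: regular_path_def)

lemma path_0: "lpath 0 w = (%t. L t w)" by (simp add: shift_path_def fun_eq_iff)

abbreviation "up_at s a b x t w \<equiv> refl_up a b x (lpath s w) t"
abbreviation "down_at s a b x t w \<equiv> refl_down a b x (lpath s w) t"
abbreviation "pos_at s a b x t w \<equiv> refl_pos a b x (lpath s w) t"

lemma path_regular: "0 <= s ==> regular_path (lpath s w)"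
 using regular_paths by (rule regular_path_shift)

lemma path_tame: "0 <= s ==> a < b ==> tame a b x (lpath s w)"
 using path_regular by (rule regular_path_tame)

lemma path_measurable: "0 <= s ==> 0 <= t ==> (%w. lpath s w t) \<in> borel_measurable (F (s + t))"
 unfolding shift_path_def by (intro borel_measurable_diff L_measurable_F) auto

lemma sample_path_measurable:
 assumes "0 <= s"
 shows "(%w. grid_up a b x (sample (lpath s w) N) k) \<in> borel_measurable (F (s + real k / 2 ^ N))"
  "(%w. grid_down a b x (sample (lpath s w) N) k) \<in> borel_measurable (F (s + real k / 2 ^ N))"
  "(%w. grid_pos a b x (sample (lpath s w) N) k) \<in> borel_measurable (F (s + real k / 2 ^ N))"
proof -
 have W: "(%w. lpath s w (real k / 2 ^ N)) \<in> borel_measurable (F (s + real k / 2 ^ N))" for k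
  by (rule path_measurable[OF assms]) simp
 have \<tau>: "incseq (%k. s + real k / 2 ^ N)" by (auto simp: incseq_def divide_right_mono)
 have eq: "sample (lpath s w) N = (%k. lpath s w (real k / 2 ^ N))" for w by (simp add: fun_eq_iff sample_def)
 note g = grid_measurable[of "%k w. lpath s w (real k / 2 ^ N)" "%k. s + real k / 2 ^ N", OF W \<tau>]
 show "(%w. grid_up a b x (sample (lpath s w) N) k) \<in> borel_measurable (F (s + real k / 2 ^ N))"
  "(%w. grid_down a b x (sample (lpath s w) N) k) \<in> borel_measurable (F (s + real k / 2 ^ N))"
  "(%w. grid_pos a b x (sample (lpath s w) N) k) \<in> borel_measurable (F (s + real k / 2 ^ N))"
  unfolding eq by (rule g)+
qed

lemma dyadic_path_measurable:
 assumes "0 <= s" "0 <= t"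
 shows "(%w. dyadic_up a b x (lpath s w) t) \<in> borel_measurable (F (s + t))"
  and "(%w. dyadic_up (- b) (- a) (- x) (%t. - lpath s w t) t) \<in> borel_measurable (F (s + t))"
proof -
 have le: "s + real (grid_index N t) / 2 ^ N <= s + t" for N using grid_index_le[OF assms(2)] by simp
 have "(%w. grid_up a b x (sample (lpath s w) N) (grid_index N t)) \<in> borel_measurable (F (s + t))" for N
  by (rule measurable_F_mono[OF sample_path_measurable(1)[OF assms(1)] le])
 then show "(%w. dyadic_up a b x (lpath s w) t) \<in> borel_measurable (F (s + t))"
  unfolding dyadic_up_def by (intro borel_measurable_SUP measurable_compose[OF _ measurable_ennreal]) auto
 have "(%w. grid_down a b x (sample (lpath s w) N) (grid_index N t)) \<in> borel_measurable (F (s + t))" for N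
  by (rule measurable_F_mono[OF sample_path_measurable(2)[OF assms(1)] le])
 then show "(%w. dyadic_up (- b) (- a) (- x) (%t. - lpath s w t) t) \<in> borel_measurable (F (s + t))"
  unfolding dyadic_up_def sample_uminus grid_down_eq_grid_up(1)[of a b x, symmetric]
  by (intro borel_measurable_SUP measurable_compose[OF _ measurable_ennreal]) auto
qed

text \<open>The right-continuous control at \<open>t\<close> is a limit of values at later grid
  times, so it is first measurable at every time after \<open>s + t\<close>; right-continuity of the
  filtration gives \<open>s + t\<close> itself.\<close>

lemma refl_measurable_F:
 assumes "0 <= s" "0 <= t" "a < b"
 shows "(%w. up_at s a b x t w) \<in> borel_measurable (F (s + t))"
  and "(%w. down_at s a b x t w) \<in> borel_measurable (F (s + t))"
  and "(%w. pos_at s a b x t w) \<in> borel_measurable (F (s + t))"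
proof -
 have gen: "(%w. refl_up c d y (l w) t) \<in> borel_measurable (F (s + t))" if l: "!!w. tame c d y (l w)"
   and m: "!!t. 0 <= t ==> (%w. dyadic_up c d y (l w) t) \<in> borel_measurable (F (s + t))"
  for c d y and l :: "'w => real => real"
 proof (rule measurable_F_right)
  fix u assume u: "s + t < u"
  have "eventually (%n. next_grid n t < u - s) sequentially"
   using next_grid_tendsto[OF assms(2)] u by (intro order_tendstoD(2)) auto
  then obtain n0 where n0: "!!n. n0 <= n ==> next_grid n t < u - s"
   by (auto simp: eventually_sequentially)
  show "(%w. refl_up c d y (l w) t) \<in> borel_measurable (F u)"
  proof (rule borel_measurable_LIMSEQ_real)
   show "(%n. enn2real (dyadic_up c d y (l w) (next_grid (n + n0) t))) \<longlonglongrightarrow> refl_up c d y (l w) t" for w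
    by (rule LIMSEQ_ignore_initial_segment[OF refl_up_tendsto[OF l assms(2)]])
   show "(%w. enn2real (dyadic_up c d y (l w) (next_grid (n + n0) t))) \<in> borel_measurable (F u)" for n
   proof -
    have "0 <= next_grid (n + n0) t" using next_grid_gt[OF assms(2), of "n + n0"] assms(2) by simp
    moreover have "s + next_grid (n + n0) t <= u" using n0[of "n + n0"] by simp
    ultimately have "(%w. dyadic_up c d y (l w) (next_grid (n + n0) t)) \<in> borel_measurable (F u)"
     by (rule measurable_F_mono[OF m])
    then show ?thesis by simp
   qed
  qed
 qed (use assms in simp)
 show u: "(%w. up_at s a b x t w) \<in> borel_measurable (F (s + t))"
  by (rule gen) (use assms path_tame dyadic_path_measurable in auto)
 show d: "(%w. down_at s a b x t w) \<in> borel_measurable (F (s + t))" unfolding refl_down_def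
  by (rule gen) (use assms path_tame tame_uminus dyadic_path_measurable in auto)
 show "(%w. pos_at s a b x t w) \<in> borel_measurable (F (s + t))" unfolding refl_pos_def
  by (intro borel_measurable_diff borel_measurable_add u d path_measurable assms) auto
qed

lemma refl_measurable:
 assumes "0 <= s" "0 <= t" "a < b"
 shows "(%w. up_at s a b x t w) \<in> borel_measurable M"
  and "(%w. down_at s a b x t w) \<in> borel_measurable M"
  and "(%w. pos_at s a b x t w) \<in> borel_measurable M"
 using refl_measurable_F[OF assms] measurable_F_M[of _ "s + t" borel] assms by auto

lemma refl_bounds:
 assumes "0 <= s" "0 <= t" "a < b"
 shows "a <= pos_at s a b x t w" "pos_at s a b x t w <= b"
 using refl_pos_bounds[OF less_imp_le[OF assms(3)] path_tame[OF assms(1,3)] assms(2)] by auto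

text \<open>Transition of the Markov chain formed by the position and the upward push. The downward
  push is recovered later from the identity that defines the position.\<close>

definition grid_step :: "real => real => real \<times> real => real => real \<times> real" where
 "grid_step a b y z = (max a (min b (fst y + z)), snd y + max 0 (a - (fst y + z)))"

definition grid_state :: "real => real => real => real => nat => nat => 'w => real \<times> real" where
 "grid_state s a b x N k w =
   (grid_pos a b x (sample (lpath s w) N) k, grid_up a b x (sample (lpath s w) N) k)"

lemma grid_state_measurable:
 "0 <= s ==> grid_state s a b x N k \<in> F (s + real k / 2 ^ N) \<rightarrow>\<^sub>M borel \<Otimes>\<^sub>M borel"
 unfolding grid_state_def[abs_def] using sample_path_measurable[of s a b x N k] by (intro measurable_Pair) auto

lemma grid_state_Suc:
 assumes "a <= b"
 shows "grid_state s a b x N (Suc k) w = grid_step a b (grid_state s a b x N k w)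
   (L (s + real k / 2 ^ N + 1 / 2 ^ N) w - L (s + real k / 2 ^ N) w)"
proof -
 have "sample (lpath s w) N (Suc k) - sample (lpath s w) N k
   = L (s + real k / 2 ^ N + 1 / 2 ^ N) w - L (s + real k / 2 ^ N) w"
 proof -
  have eq: "s + real (Suc k) / 2 ^ N = s + real k / 2 ^ N + 1 / 2 ^ N" by (simp add: add_divide_distrib)
  show ?thesis unfolding sample_def shift_path_def eq by simp
 qed
 then show ?thesis unfolding grid_state_def grid_step_def grid_pos_Suc'[OF assms] grid_up_Suc_eq by simp
qed

lemma grid_state_0: "a <= b ==> grid_state s a b x N 0 w = (max a (min b x), max 0 (a - x))"
 by (simp add: grid_state_def grid_pos_0 sample_def shift_path_def)

text \<open>Markov property on the grid: a weight known at time \<open>s\<close> factors out, and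
  the chain started at \<open>s\<close> has the law of the chain started at 0. The induction
  integrates out the last increment, which replaces \<open>H\<close> by \<open>T\<close>.\<close>

lemma nn_integral_grid_state:
 assumes "a <= b" "0 <= s" "Z \<in> borel_measurable (F s)" "H \<in> borel_measurable (borel \<Otimes>\<^sub>M borel)"
 shows "(\<integral>\<^sup>+w. Z w * H (grid_state s a b x N k w) \<partial>M)
   = (\<integral>\<^sup>+w. Z w \<partial>M) * (\<integral>\<^sup>+w. H (grid_state 0 a b x N k w) \<partial>M)"
 using assms(4)
proof (induction k arbitrary: H)
 case 0
 have "Z \<in> borel_measurable M" by (rule measurable_F_M[OF assms(3,2)])
 then show ?case by (simp add: grid_state_0[OF assms(1)] nn_integral_multc emeasure_space_1)
next
 case (Suc k)
 note [measurable] = Suc.prems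
 define h where "h = (1 :: real) / 2 ^ N"
 have h: "0 <= h" by (simp add: h_def)
 have [measurable_cong]: "sets (law h) = sets borel" by (simp add: law_def)
 have step [measurable]: "(%p. grid_step a b (fst p) (snd p)) \<in> (borel \<Otimes>\<^sub>M borel) \<Otimes>\<^sub>M borel \<rightarrow>\<^sub>M borel \<Otimes>\<^sub>M borel"
  unfolding grid_step_def by measurable
 define T where "T y = (\<integral>\<^sup>+z. H (grid_step a b y z) \<partial>law h)" for y
 interpret Lh: prob_space "law h" unfolding law_def using L_measurable[OF h] by (rule prob_space_distr)
 have T [measurable]: "T \<in> borel_measurable (borel \<Otimes>\<^sub>M borel)"
 proof -
  have "(%p. H (grid_step a b (fst p) (snd p))) \<in> borel_measurable ((borel \<Otimes>\<^sub>M borel) \<Otimes>\<^sub>M law h)"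
   by measurable
  from Lh.borel_measurable_nn_integral_fst[OF this] show ?thesis by (simp add: T_def[abs_def])
 qed
 \<comment> \<open>Stated for every start time and weight: it is used with \<open>s\<close> and
   \<open>Z\<close> to remove the last increment, and with 0 and the constant 1 to put it
   back.\<close>
 have one: "(\<integral>\<^sup>+w. Y w * H (grid_state r a b x N (Suc k) w) \<partial>M)
   = (\<integral>\<^sup>+w. Y w * T (grid_state r a b x N k w) \<partial>M)"
  if r: "0 <= r" and Y: "Y \<in> borel_measurable (F r)" for r Y
 proof -
  define t where "t = r + real k / 2 ^ N"
  have t: "0 <= t" "r <= t" using r by (auto simp: t_def)
  have "Y \<in> borel_measurable (F t)" by (rule measurable_F_mono[OF Y t(2)])
  then have P: "(%w. (Y w, grid_state r a b x N k w)) \<in> F t \<rightarrow>\<^sub>M (borel :: ennreal measure) \<Otimes>\<^sub>M (borel \<Otimes>\<^sub>M borel)"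
   using grid_state_measurable[OF r] by (intro measurable_Pair) (auto simp: t_def)
  define g where "g p = fst (fst p) * H (grid_step a b (snd (fst p)) (snd p))"
   for p :: "(ennreal \<times> real \<times> real) \<times> real"
  have g: "g \<in> borel_measurable ((borel \<Otimes>\<^sub>M (borel \<Otimes>\<^sub>M borel)) \<Otimes>\<^sub>M borel)"
  proof -
   have "(%p. grid_step a b (snd (fst p)) (snd p)) \<in>
     ((borel :: ennreal measure) \<Otimes>\<^sub>M (borel \<Otimes>\<^sub>M borel)) \<Otimes>\<^sub>M borel \<rightarrow>\<^sub>M borel \<Otimes>\<^sub>M borel"
    unfolding grid_step_def by measurable
   from measurable_compose[OF this Suc.prems] show ?thesis unfolding g_def by measurable
  qed
  have "(\<integral>\<^sup>+w. Y w * H (grid_state r a b x N (Suc k) w) \<partial>M)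
   = (\<integral>\<^sup>+w. g ((Y w, grid_state r a b x N k w), L (t + h) w - L t w) \<partial>M)"
   by (simp add: grid_state_Suc[OF assms(1)] g_def t_def h_def)
  also have "\<dots> = (\<integral>\<^sup>+w. (\<integral>\<^sup>+z. g ((Y w, grid_state r a b x N k w), z) \<partial>law h) \<partial>M)"
   by (rule nn_integral_increment[OF t(1) h P g])
  also have "\<dots> = (\<integral>\<^sup>+w. Y w * T (grid_state r a b x N k w) \<partial>M)"
  proof (intro nn_integral_cong)
   fix w
   have "(%z. grid_step a b (grid_state r a b x N k w) z) \<in> borel \<rightarrow>\<^sub>M borel \<Otimes>\<^sub>M borel"
    unfolding grid_step_def by measurable
   from measurable_compose[OF this Suc.prems]
   show "(\<integral>\<^sup>+z. g ((Y w, grid_state r a b x N k w), z) \<partial>law h) = Y w * T (grid_state r a b x N k w)"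
    unfolding g_def T_def by (simp add: nn_integral_cmult)
  qed
  finally show ?thesis .
 qed
 have "(\<integral>\<^sup>+w. Z w * H (grid_state s a b x N (Suc k) w) \<partial>M)
   = (\<integral>\<^sup>+w. Z w * T (grid_state s a b x N k w) \<partial>M)" by (rule one[OF assms(2,3)])
 also have "\<dots> = (\<integral>\<^sup>+w. Z w \<partial>M) * (\<integral>\<^sup>+w. T (grid_state 0 a b x N k w) \<partial>M)" by (rule Suc.IH[OF T])
 also have "(\<integral>\<^sup>+w. T (grid_state 0 a b x N k w) \<partial>M) = (\<integral>\<^sup>+w. H (grid_state 0 a b x N (Suc k) w) \<partial>M)"
  using one[of 0 "%_. 1"] by simp
 finally show ?case .
qed

text \<open>The grid identity passes through both limits, refinement of the grid and approach of
  \<open>t\<close> from the right, by dominated convergence.\<close>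

lemma nn_integral_refl:
 assumes ab: "a < b" and s: "0 <= s" and t: "0 <= t"
  and Z: "Z \<in> borel_measurable (F s)" "(\<integral>\<^sup>+w. Z w \<partial>M) < \<infinity>"
  and g: "continuous_on UNIV g" "!!p u. a <= p ==> p <= b ==> 0 <= u ==> g (p, u) <= B"
 shows "(\<integral>\<^sup>+w. Z w * ennreal (g (pos_at s a b x t w, up_at s a b x t w)) \<partial>M)
  = (\<integral>\<^sup>+w. Z w \<partial>M) *
   (\<integral>\<^sup>+w. ennreal (g (pos_at 0 a b x t w, up_at 0 a b x t w)) \<partial>M)"
proof -
 have ab': "a <= b" using ab by simp
 have gm [measurable]: "g \<in> borel_measurable borel" using g(1) by (rule borel_measurable_continuous_onI)
 have gm' [measurable]: "g \<in> borel_measurable (borel \<Otimes>\<^sub>M borel)" using gm by (simp add: borel_prod)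
 have gt: "(%n. g (p n, u n)) \<longlonglongrightarrow> g (p', u')" if "p \<longlonglongrightarrow> p'" "u \<longlonglongrightarrow> u'" for p u p' u'
  using continuous_on_tendsto_compose[OF g(1) tendsto_Pair[OF that]] by auto
 have gB: "g (p, u) <= max 0 B" if "a <= p" "p <= b" "0 <= u" for p u using g(2)[OF that] by simp
 have lim: "(%N. (\<integral>\<^sup>+w. Y w * ennreal (g (P N w, V N w)) \<partial>M))
    \<longlonglongrightarrow> (\<integral>\<^sup>+w. Y w * ennreal (g (P' w, V' w)) \<partial>M)"
  if Y: "Y \<in> borel_measurable M" "(\<integral>\<^sup>+w. Y w \<partial>M) < \<infinity>"
   and PV: "!!N. P N \<in> borel_measurable M" "!!N. V N \<in> borel_measurable M"
    "P' \<in> borel_measurable M" "V' \<in> borel_measurable M"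
   and l: "!!w. (%N. P N w) \<longlonglongrightarrow> P' w" "!!w. (%N. V N w) \<longlonglongrightarrow> V' w"
   and b: "!!N w. a <= P N w & P N w <= b & 0 <= V N w" for Y P V P' V'
 proof (rule nn_integral_dominated_convergence)
  note [measurable] = Y(1) PV
  show "(%w. Y w * ennreal (g (P N w, V N w))) \<in> borel_measurable M" for N by measurable
  show "(%w. Y w * ennreal (g (P' w, V' w))) \<in> borel_measurable M" by measurable
  show "(%w. Y w * ennreal (max 0 B)) \<in> borel_measurable M" by measurable
  show "AE w in M. Y w * ennreal (g (P N w, V N w)) <= Y w * ennreal (max 0 B)" for N
   using b gB by (intro AE_I2 mult_left_mono ennreal_leI) auto
  show "(\<integral>\<^sup>+w. Y w * ennreal (max 0 B) \<partial>M) < \<infinity>"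
   using Y by (subst nn_integral_multc) (auto simp: ennreal_mult_less_top)
  have "AE w in M. Y w \<noteq> \<infinity>" using Y by (intro nn_integral_noteq_infinite) auto
  then show "AE w in M. (%N. Y w * ennreal (g (P N w, V N w))) \<longlonglongrightarrow> Y w * ennreal (g (P' w, V' w))"
  proof eventually_elim
   case (elim w)
   have "(%N. ennreal (g (P N w, V N w))) \<longlonglongrightarrow> ennreal (g (P' w, V' w))"
    by (intro tendsto_ennrealI gt l)
   then show ?case using elim by (intro tendsto_mult_ennreal tendsto_const) auto
  qed
 qed
 define P where "P r n N w = grid_pos a b x (sample (lpath r w) N) (grid_index N (next_grid n t))" for r n N w
 define V where "V r n N w = grid_up a b x (sample (lpath r w) N) (grid_index N (next_grid n t))" for r n N w
 define P' where "P' r n w = dyadic_pos a b x (lpath r w) (next_grid n t)" for r n w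
 define V' where "V' r n w = enn2real (dyadic_up a b x (lpath r w) (next_grid n t))" for r n w
 have ng: "0 <= next_grid n t" for n using next_grid_gt[OF t, of n] t by simp
 have ZM: "Z \<in> borel_measurable M" by (rule measurable_F_M[OF Z(1) s])
 have grid: "(\<integral>\<^sup>+w. Z w * ennreal (g (P s n N w, V s n N w)) \<partial>M)
   = (\<integral>\<^sup>+w. Z w \<partial>M) * (\<integral>\<^sup>+w. 1 * ennreal (g (P 0 n N w, V 0 n N w)) \<partial>M)" for n N
  using nn_integral_grid_state[OF ab' s Z(1), of "%y. ennreal (g y)" x N "grid_index N (next_grid n t)"]
  by (simp add: grid_state_def P_def V_def)
 have PVm: "P r n N \<in> borel_measurable M" "V r n N \<in> borel_measurable M" if "0 <= r" for r n N
  unfolding P_def[abs_def] V_def[abs_def] using that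
  by (auto intro!: measurable_F_M[OF sample_path_measurable(1)] measurable_F_M[OF sample_path_measurable(3)])
 have VP: "(%N. P r n N w) \<longlonglongrightarrow> P' r n w" "(%N. V r n N w) \<longlonglongrightarrow> V' r n w" if "0 <= r" for r n w
  unfolding P_def P'_def V_def V'_def
  using path_tame[OF that ab] ab' ng by (auto intro: grid_pos_tendsto_next dyadic_up_tendsto)
 have PV'm: "P' r n \<in> borel_measurable M" "V' r n \<in> borel_measurable M" if "0 <= r" for r n
  by (rule borel_measurable_LIMSEQ_real[OF VP(1)[OF that] PVm(1)[OF that]],
    rule borel_measurable_LIMSEQ_real[OF VP(2)[OF that] PVm(2)[OF that]])
 have bd: "a <= P r n N w & P r n N w <= b & 0 <= V r n N w" for r n N w
  unfolding P_def V_def by (simp add: grid_pos_bounds[OF ab'] grid_up_nonneg)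
 have bd': "a <= P' r n w & P' r n w <= b & 0 <= V' r n w" if "0 <= r" for r n w
  using LIMSEQ_le_const[OF VP(1)[OF that]] LIMSEQ_le_const2[OF VP(1)[OF that]] bd by (auto simp: V'_def)
 have dyadic: "(\<integral>\<^sup>+w. Z w * ennreal (g (P' s n w, V' s n w)) \<partial>M)
   = (\<integral>\<^sup>+w. Z w \<partial>M) * (\<integral>\<^sup>+w. 1 * ennreal (g (P' 0 n w, V' 0 n w)) \<partial>M)" for n
 proof (rule LIMSEQ_unique)
  show "(%N. (\<integral>\<^sup>+w. Z w * ennreal (g (P s n N w, V s n N w)) \<partial>M))
    \<longlonglongrightarrow> (\<integral>\<^sup>+w. Z w * ennreal (g (P' s n w, V' s n w)) \<partial>M)"
   by (rule lim[OF ZM Z(2) PVm[OF s] PV'm[OF s] VP[OF s] bd])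
  have "(%N. (\<integral>\<^sup>+w. 1 * ennreal (g (P 0 n N w, V 0 n N w)) \<partial>M))
    \<longlonglongrightarrow> (\<integral>\<^sup>+w. 1 * ennreal (g (P' 0 n w, V' 0 n w)) \<partial>M)"
   using PVm[OF order_refl] PV'm[OF order_refl] VP[OF order_refl] bd by (intro lim) (auto simp: emeasure_space_1)
  then show "(%N. (\<integral>\<^sup>+w. Z w * ennreal (g (P s n N w, V s n N w)) \<partial>M))
    \<longlonglongrightarrow> (\<integral>\<^sup>+w. Z w \<partial>M) * (\<integral>\<^sup>+w. 1 * ennreal (g (P' 0 n w, V' 0 n w)) \<partial>M)"
   unfolding grid using Z(2) by (intro ennreal_tendsto_cmult) auto
 qed
 define X where "X r w = pos_at r a b x t w" for r w
 define U where "U r w = up_at r a b x t w" for r w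
 have XU: "(%n. P' r n w) \<longlonglongrightarrow> X r w" "(%n. V' r n w) \<longlonglongrightarrow> U r w" if "0 <= r" for r w
  unfolding P'_def V'_def X_def U_def using path_tame[OF that ab] t by (auto intro: refl_pos_tendsto refl_up_tendsto)
 have XUm: "X r \<in> borel_measurable M" "U r \<in> borel_measurable M" if "0 <= r" for r
  unfolding X_def[abs_def] U_def[abs_def] using refl_measurable[OF that t ab] by auto
 have "(\<integral>\<^sup>+w. Z w * ennreal (g (X s w, U s w)) \<partial>M)
   = (\<integral>\<^sup>+w. Z w \<partial>M) * (\<integral>\<^sup>+w. 1 * ennreal (g (X 0 w, U 0 w)) \<partial>M)"
 proof (rule LIMSEQ_unique)
  show "(%n. (\<integral>\<^sup>+w. Z w * ennreal (g (P' s n w, V' s n w)) \<partial>M))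
    \<longlonglongrightarrow> (\<integral>\<^sup>+w. Z w * ennreal (g (X s w, U s w)) \<partial>M)"
   by (rule lim[OF ZM Z(2) PV'm[OF s] XUm[OF s] XU[OF s] bd'[OF s]])
  have "(%n. (\<integral>\<^sup>+w. 1 * ennreal (g (P' 0 n w, V' 0 n w)) \<partial>M))
    \<longlonglongrightarrow> (\<integral>\<^sup>+w. 1 * ennreal (g (X 0 w, U 0 w)) \<partial>M)"
   using PV'm[OF order_refl] XUm[OF order_refl] XU[OF order_refl] bd'[OF order_refl]
   by (intro lim) (auto simp: emeasure_space_1)
  then show "(%n. (\<integral>\<^sup>+w. Z w * ennreal (g (P' s n w, V' s n w)) \<partial>M))
    \<longlonglongrightarrow> (\<integral>\<^sup>+w. Z w \<partial>M) * (\<integral>\<^sup>+w. 1 * ennreal (g (X 0 w, U 0 w)) \<partial>M)"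
   unfolding dyadic using Z(2) by (intro ennreal_tendsto_cmult) auto
 qed
 then show ?thesis by (simp add: X_def U_def)
qed

end

lemma continuous_bounded_Icc:
 fixes h :: "real => real"
 assumes "continuous_on UNIV h"
 shows "EX B>=0. ALL z. a <= z --> z <= b --> abs (h z) <= B"
proof -
 have "compact (h ` {a..b})" by (rule compact_continuous_image) (auto intro: continuous_on_subset[OF assms])
 then have "bounded (h ` {a..b})" by (rule compact_imp_bounded)
 then obtain B where "ALL y:h ` {a..b}. norm y <= B" unfolding bounded_iff by blast
 then show ?thesis by (intro exI[of _ "max 0 B"]) (auto intro: max.coboundedI2)
qed

context regular_levy
begin

text \<open>The flow property at time 0, when the initial jump has already moved the start to the
  nearest point of the band.\<close>

lemma refl_pos_clip:
 assumes "0 <= s" "a < b" "0 <= t"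
 shows "pos_at s a b x t w = pos_at s a b (max a (min b x)) t w"
proof -
 note reg = path_regular[OF assms(1), of w]
 have 0: "shift_path 0 (lpath s w) = lpath s w" by (simp add: shift_path_def fun_eq_iff)
 have "pos_at s a b x 0 w = max a (min b x)" unfolding refl_pos_def
  using refl_initial[OF assms(2) path_tame[OF assms(1,2)], of x w] assms(2)
  by (simp add: shift_path_def max_def min_def)
 then show ?thesis using refl_flow(3)[OF reg assms(2) order_refl assms(3), of x] 0 by simp
qed

text \<open>Signed integrands reduce to the non-negative case by adding a bound of \<open>h\<close>
  on the band.\<close>

lemma expectation_refl:
 fixes Z :: "'w => real" and h :: "real => real"
 assumes ab: "a < b" and s: "0 <= s" and t: "0 <= t"
  and Z: "Z \<in> borel_measurable (F s)" "integrable M Z" "!!w. w \<in> space M ==> 0 <= Z w"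
  and h: "continuous_on UNIV h"
 shows "expectation (%w. Z w * h (pos_at s a b x t w))
   = expectation Z * expectation (%w. h (pos_at 0 a b x t w))"
  and "integrable M (%w. Z w * h (pos_at s a b x t w))"
  and "integrable M (%w. h (pos_at s a b x t w))"
proof -
 have hm [measurable]: "h \<in> borel_measurable borel" using h by (rule borel_measurable_continuous_onI)
 obtain B where B0: "0 <= B" and B: "!!p. a <= p ==> p <= b ==> abs (h p) <= B"
  using continuous_bounded_Icc[OF h] by blast
 define X where "X r w = pos_at r a b x t w" for r w
 have Xm: "X r \<in> borel_measurable M" if "0 <= r" for r
  unfolding X_def[abs_def] by (rule refl_measurable(3)[OF that t ab])
 note [measurable] = Xm[OF s] Xm[OF order_refl]
 have Xb: "abs (h (X r w)) <= B" if "0 <= r" for r w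
  unfolding X_def using refl_bounds[OF that t ab] by (intro B) auto
 have Xp: "0 <= h (X r w) + B" if "0 <= r" for r w using Xb[OF that, of w] by (simp add: abs_le_iff)
 have ZM [measurable]: "Z \<in> borel_measurable M" using Z(2) by auto
 show hi: "integrable M (%w. h (pos_at s a b x t w))"
  using Xb[OF s] unfolding X_def[symmetric] by (intro integrable_const_bound[of _ B]) auto
 have hi0: "integrable M (%w. h (X 0 w))"
  using Xb[OF order_refl] by (intro integrable_const_bound[of _ B]) auto
 have Zi: "integrable M (%w. Z w * h (X s w))"
 proof (rule Bochner_Integration.integrable_bound)
  show "integrable M (%w. B * Z w)" using Z(2) by simp
  show "AE w in M. norm (Z w * h (X s w)) <= norm (B * Z w)"
  proof (rule AE_I2)
   fix w
   have "abs (Z w) * abs (h (X s w)) <= abs (Z w) * B" by (rule mult_left_mono[OF Xb[OF s]]) simp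
   then show "norm (Z w * h (X s w)) <= norm (B * Z w)" using B0 by (simp add: abs_mult mult.commute)
  qed
 qed measurable
 then show "integrable M (%w. Z w * h (pos_at s a b x t w))" by (simp add: X_def)
 have Zfin: "(\<integral>\<^sup>+w. ennreal (Z w) \<partial>M) = ennreal (expectation Z)"
  using Z by (intro nn_integral_eq_integral) auto
 have EZ: "0 <= expectation Z" using Z(3) by (intro integral_nonneg_AE) auto
 have gc: "continuous_on UNIV (%p :: real \<times> real. h (fst p) + B)"
  by (intro continuous_intros continuous_on_compose2[OF h]) auto
 have "(\<integral>\<^sup>+w. ennreal (Z w) * ennreal (h (X s w) + B) \<partial>M)
   = (\<integral>\<^sup>+w. ennreal (Z w) \<partial>M) * (\<integral>\<^sup>+w. ennreal (h (X 0 w) + B) \<partial>M)"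
  using nn_integral_refl[OF ab s t _ _ gc, of "%w. ennreal (Z w)" "2 * B" x] Z(1) Zfin B
  by (fastforce simp: X_def abs_le_iff)
 also have "(\<integral>\<^sup>+w. ennreal (h (X 0 w) + B) \<partial>M) = ennreal (expectation (%w. h (X 0 w) + B))"
  using hi0 by (intro nn_integral_eq_integral AE_I2 Xp) auto
 also have "(\<integral>\<^sup>+w. ennreal (Z w) * ennreal (h (X s w) + B) \<partial>M)
   = (\<integral>\<^sup>+w. ennreal (Z w * (h (X s w) + B)) \<partial>M)"
  using Z(3) by (intro nn_integral_cong) (simp add: ennreal_mult')
 also have "\<dots> = ennreal (expectation (%w. Z w * (h (X s w) + B)))"
 proof (rule nn_integral_eq_integral)
  show "integrable M (%w. Z w * (h (X s w) + B))" using Zi Z(2) by (simp add: distrib_left)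
  show "AE w in M. 0 <= Z w * (h (X s w) + B)" by (intro AE_I2 mult_nonneg_nonneg Z(3) Xp[OF s])
 qed
 finally have "ennreal (expectation (%w. Z w * (h (X s w) + B)))
   = ennreal (expectation Z * expectation (%w. h (X 0 w) + B))"
  unfolding Zfin using EZ by (simp add: ennreal_mult')
 moreover have "0 <= expectation (%w. Z w * (h (X s w) + B))"
  "0 <= expectation (%w. h (X 0 w) + B)"
  by (intro integral_nonneg_AE AE_I2 mult_nonneg_nonneg Z(3) Xp s order_refl; assumption)+
 ultimately have "expectation (%w. Z w * (h (X s w) + B))
   = expectation Z * expectation (%w. h (X 0 w) + B)" using EZ by simp
 then show "expectation (%w. Z w * h (pos_at s a b x t w))
   = expectation Z * expectation (%w. h (pos_at 0 a b x t w))" using Zi Z(2) hi0 unfolding X_def[symmetric]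
  by (simp add: distrib_left prob_space algebra_simps)
qed

text \<open>The control is unbounded, so the factorization is applied to its truncations, followed
  by monotone convergence.\<close>

lemma nn_integral_refl_up_shift:
 assumes "a < b" "0 <= s" "0 <= t"
 shows "(\<integral>\<^sup>+w. ennreal (up_at s a b x t w) \<partial>M) = (\<integral>\<^sup>+w. ennreal (up_at 0 a b x t w) \<partial>M)"
proof -
 have sup: "(\<integral>\<^sup>+w. ennreal (V w) \<partial>M) = (SUP n. (\<integral>\<^sup>+w. ennreal (min (V w) (real n)) \<partial>M))"
  if V: "V \<in> borel_measurable M" for V
 proof -
  have "(\<integral>\<^sup>+w. (SUP n. ennreal (min (V w) (real n))) \<partial>M) = (SUP n. (\<integral>\<^sup>+w. ennreal (min (V w) (real n)) \<partial>M))"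
   using V by (intro nn_integral_monotone_convergence_SUP)
    (auto simp: incseq_def le_fun_def intro!: ennreal_leI)
  also have "(%w. (SUP n. ennreal (min (V w) (real n)))) = (%w. ennreal (V w))"
  proof
   fix w
   obtain n :: nat where n: "V w <= real n" using real_arch_simple by blast
   show "(SUP n. ennreal (min (V w) (real n))) = ennreal (V w)"
    by (rule antisym[OF SUP_least SUP_upper2[of n]]) (use n in \<open>auto intro: ennreal_leI\<close>)
  qed
  finally show ?thesis .
 qed
 have eq: "(\<integral>\<^sup>+w. ennreal (min (up_at s a b x t w) (real n)) \<partial>M)
   = (\<integral>\<^sup>+w. ennreal (min (up_at 0 a b x t w) (real n)) \<partial>M)" for n
 proof -
  have "continuous_on UNIV (%p :: real \<times> real. min (snd p) (real n))" by (intro continuous_intros)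
  from nn_integral_refl[OF assms _ _ this, of "%_. 1" "real n" x] show ?thesis by (simp add: emeasure_space_1)
 qed
 show ?thesis
  using sup[OF refl_measurable(1)[OF assms(2,3,1)]] sup[OF refl_measurable(1)[OF order_refl assms(3,1)]] eq by simp
qed

text \<open>The time is \<open>t + 1\<close> because the right-continuous control at
  \<open>t\<close> is dominated by the dyadic control at a strictly later time, for which
  \<open>t + 1\<close> is taken.\<close>

definition control_bound :: "real => real => real => real => real => real" where
 "control_bound K a b x t =
   max 0 (a - x) + max 0 (x - b) + (b - a) / 4 + (t + 1) * (K * (1 + 1 / (b - a)))"

lemma control_bound_nonneg: "0 <= K ==> a < b ==> 0 <= t ==> 0 <= control_bound K a b x t"
 unfolding control_bound_def by (intro add_nonneg_nonneg mult_nonneg_nonneg) auto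

definition control_constant :: "real => bool" where
 "control_constant K \<longleftrightarrow> 0 <= K & (ALL a b x t. a < b --> 0 <= t -->
   (\<integral>\<^sup>+w. ennreal (up_at 0 a b x t w) \<partial>M) <= ennreal (control_bound K a b x t) &
   (\<integral>\<^sup>+w. ennreal (down_at 0 a b x t w) \<partial>M) <= ennreal (control_bound K a b x t))"

lemma ex_control_constant: "EX K. control_constant K"
proof -
 obtain K where K: "0 <= K" and bnd: "!!a b x t. a < b ==> 0 <= t ==>
   (\<integral>\<^sup>+w. dyadic_up a b x (%t. L t w) t \<partial>M)
    <= ennreal (max 0 (a - x) + max 0 (x - b) + (b - a) / 4 + t * (K * (1 + 1 / (b - a)))) &
   (\<integral>\<^sup>+w. dyadic_up (- b) (- a) (- x) (%t. - L t w) t \<partial>M)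
    <= ennreal (max 0 (a - x) + max 0 (x - b) + (b - a) / 4 + t * (K * (1 + 1 / (b - a))))"
  using dyadic_up_expectation_le by blast
 show ?thesis unfolding control_constant_def
 proof (intro exI[of _ K] conjI[OF K] allI impI)
  fix a b x t :: real assume ab: "a < b" and t: "0 <= t"
  have t1: "0 <= t + 1" using t by simp
  have le: "ennreal (refl_up c d y l t) <= dyadic_up c d y l (t + 1)" if "tame c d y l" for c d y l
  proof -
   have "ennreal (refl_up c d y l t) <= ennreal (enn2real (dyadic_up c d y l (t + 1)))"
    by (rule ennreal_leI, rule refl_up_le_dyadic[OF that t]) simp
   also have "\<dots> = dyadic_up c d y l (t + 1)" using that t by (simp add: tame_def)
   finally show ?thesis .
  qed
  note b = bnd[OF ab t1, of x, folded control_bound_def]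
  show "(\<integral>\<^sup>+w. ennreal (up_at 0 a b x t w) \<partial>M) <= ennreal (control_bound K a b x t) &
   (\<integral>\<^sup>+w. ennreal (down_at 0 a b x t w) \<partial>M) <= ennreal (control_bound K a b x t)"
  proof
   show "(\<integral>\<^sup>+w. ennreal (up_at 0 a b x t w) \<partial>M) <= ennreal (control_bound K a b x t)"
    by (rule order_trans[OF nn_integral_mono[OF le[OF path_tame[OF order_refl ab]]]])
     (use b in \<open>simp only: path_0\<close>)
   show "(\<integral>\<^sup>+w. ennreal (down_at 0 a b x t w) \<partial>M) <= ennreal (control_bound K a b x t)"
    unfolding refl_down_def
    by (rule order_trans[OF nn_integral_mono[OF le[OF tame_uminus[OF path_tame[OF order_refl ab]]]]])
     (use b in \<open>simp only: path_0\<close>)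
  qed
 qed
qed

lemma refl_integrable:
 assumes s: "0 <= s" and t: "0 <= t" and ab: "a < b"
 shows "integrable M (%w. up_at s a b x t w)"
  "integrable M (%w. down_at s a b x t w)"
  "integrable M (%w. pos_at s a b x t w)"
proof -
 obtain K where "control_constant K" using ex_control_constant by blast
 then obtain c where "(\<integral>\<^sup>+w. ennreal (up_at 0 a b x t w) \<partial>M) <= ennreal c"
  unfolding control_constant_def using t ab by blast
 then have c: "(\<integral>\<^sup>+w. ennreal (up_at s a b x t w) \<partial>M) <= ennreal c"
  unfolding nn_integral_refl_up_shift[OF ab s t] .
 show us: "integrable M (%w. up_at s a b x t w)"
 proof (rule integrableI_nonneg)
  show "(\<integral>\<^sup>+w. ennreal (up_at s a b x t w) \<partial>M) < \<infinity>"
   using c by (rule order_le_less_trans) simp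
 qed (rule refl_measurable(1)[OF s t ab], simp add: refl_up_nonneg)
 have ps: "integrable M (%w. lpath s w t)" unfolding shift_path_def using s t by (rule integrable_increment)
 show Xs: "integrable M (%w. pos_at s a b x t w)"
  by (rule expectation_refl(3)[OF ab s t, of "%_. 0" "%x. x" x]) auto
 have "(%w. down_at s a b x t w)
   = (%w. x + lpath s w t + up_at s a b x t w - pos_at s a b x t w)" by (simp add: refl_pos_def fun_eq_iff)
 then show "integrable M (%w. down_at s a b x t w)" using us ps Xs by simp
qed

lemma refl_controls_bound:
 assumes "control_constant K" and ab: "a < b" and t: "0 <= t"
 shows "expectation (%w. up_at 0 a b x t w) <= control_bound K a b x t"
  and "expectation (%w. down_at 0 a b x t w) <= control_bound K a b x t"
proof -
 note K = assms(1)[unfolded control_constant_def]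
 have ex: "expectation V <= control_bound K a b x t" if "integrable M V" "!!w. 0 <= V w"
  "(\<integral>\<^sup>+w. ennreal (V w) \<partial>M) <= ennreal (control_bound K a b x t)" for V
 proof -
  have "(\<integral>\<^sup>+w. ennreal (V w) \<partial>M) = ennreal (expectation V)"
   by (rule nn_integral_eq_integral[OF that(1)]) (simp add: that(2))
  then show ?thesis using that(3) by (simp only: ennreal_le_iff[OF control_bound_nonneg[OF K[THEN conjunct1] ab t]])
 qed
 note b = K[THEN conjunct2, rule_format, OF ab t, of x]
 show "expectation (%w. up_at 0 a b x t w) <= control_bound K a b x t"
  by (rule ex[OF refl_integrable(1)[OF order_refl t ab] refl_up_nonneg b[THEN conjunct1]])
 show "expectation (%w. down_at 0 a b x t w) <= control_bound K a b x t"
  by (rule ex[OF refl_integrable(2)[OF order_refl t ab] refl_down_nonneg b[THEN conjunct2]])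
qed

text \<open>For the upward control from equality in law; the downward one is then a combination of
  the start, the path, the upward control and the position.\<close>

lemma expectation_controls_shift:
 assumes "0 <= s" "0 <= t" "a < b"
 shows "expectation (%w. up_at s a b x t w) = expectation (%w. up_at 0 a b x t w)"
  and "expectation (%w. down_at s a b x t w) = expectation (%w. down_at 0 a b x t w)"
proof -
 show u: "expectation (%w. up_at s a b x t w) = expectation (%w. up_at 0 a b x t w)"
 proof -
  have *: "ennreal (expectation (%w. up_at r a b x t w)) = (\<integral>\<^sup>+w. ennreal (up_at r a b x t w) \<partial>M)"
   if "0 <= r" for r by (rule nn_integral_eq_integral[symmetric, OF refl_integrable(1)[OF that assms(2,3)]])
    (simp add: refl_up_nonneg)
  have nn: "0 <= expectation (%w. up_at r a b x t w)" for r
   by (rule integral_nonneg_AE) (simp add: refl_up_nonneg)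
  have "ennreal (expectation (%w. up_at s a b x t w))
    = ennreal (expectation (%w. up_at 0 a b x t w))"
   unfolding *[OF assms(1)] *[OF order_refl] by (rule nn_integral_refl_up_shift[OF assms(3,1,2)])
  then show ?thesis by (simp only: ennreal_inj[OF nn nn])
 qed
 have X: "expectation (%w. pos_at s a b x t w) = expectation (%w. pos_at 0 a b x t w)"
 proof -
  have "expectation (%w. 1 * pos_at s a b x t w)
    = expectation (%_. 1) * expectation (%w. pos_at 0 a b x t w)"
   by (rule expectation_refl(1)[OF assms(3,1,2), of "%_. 1" "%x. x" x]) auto
  then show ?thesis by (simp add: prob_space)
 qed
 have P: "integrable M (%w. lpath r w t)" "expectation (%w. lpath r w t) = expectation (L t)" if "0 <= r" for r
 proof -
  show "integrable M (%w. lpath r w t)"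
   unfolding shift_path_def by (rule integrable_increment[OF that assms(2)])
  have "integrable M (L (r + t))" "integrable M (L r)" using that assms(2) by (auto intro: finite_mean)
  then show "expectation (%w. lpath r w t) = expectation (L t)"
   unfolding shift_path_def using expectation_L_add[OF that assms(2)] by simp
 qed
 have D: "expectation (%w. down_at r a b x t w) = x + expectation (L t)
   + expectation (%w. up_at r a b x t w) - expectation (%w. pos_at r a b x t w)" if "0 <= r" for r
 proof -
  have "expectation (%w. down_at r a b x t w)
   = expectation (%w. x + lpath r w t + up_at r a b x t w - pos_at r a b x t w)"
   by (rule Bochner_Integration.integral_cong) (simp_all add: refl_pos_def)
  also have "\<dots> = x + expectation (L t)
   + expectation (%w. up_at r a b x t w) - expectation (%w. pos_at r a b x t w)"
   using P(1)[OF that] refl_integrable[OF that assms(2,3), of x] by (simp add: prob_space P(2)[OF that])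
  finally show ?thesis .
 qed
 show "expectation (%w. down_at s a b x t w) = expectation (%w. down_at 0 a b x t w)"
  unfolding D[OF assms(1)] D[OF order_refl] u X ..
qed

end

section \<open>Downward drops and exponential coupling\<close>

locale dropping_levy = regular_levy M F L
 for M :: "'w measure" and F :: "real => 'w measure" and L :: "real => 'w => real" +
 assumes not_subordinator: "~ subordinator M F L"
begin

text \<open>Otherwise all increments between dyadic times are almost surely non-negative, and
  right-continuity makes the paths nondecreasing.\<close>

lemma drop: "EX t>0. EX d>0. 0 < measure (law t) {.. - d}"
proof (rule ccontr)
 assume neg: "~ ?thesis"
 have neg': "measure (law t) {.. - d} = 0" if "0 < t" "0 < d" for t d
 proof -
  have "~ 0 < measure (law t) {.. - d}" using neg that by blast
  then show ?thesis using measure_nonneg[of "law t" "{.. - d}"] by simp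
 qed
 have AE_pos: "AE w in M. 0 <= L (s + t) w - L s w" if st: "0 <= s" "0 < t" for s t
 proof -
  have t: "0 <= t" using st by simp
  note [measurable] = increment_measurable[OF st(1) t]
  have "AE w in M. ALL n. ~ (L (s + t) w - L s w <= - (1 / real (Suc n)))" unfolding AE_all_countable
  proof
   fix n
   have "prob {w\<in>space M. L (s + t) w - L s w <= - (1 / real (Suc n))} = measure (law t) {.. - (1 / real (Suc n))}"
   proof -
    have "{w\<in>space M. L (s + t) w - L s w <= - (1 / real (Suc n))}
      = (%w. L (s + t) w - L s w) -` {.. - (1 / real (Suc n))} \<inter> space M" by auto
    then show ?thesis unfolding law_increment[OF st(1) t, symmetric]
     by (simp only: measure_distr[OF increment_measurable[OF st(1) t] atMost_borel])
   qed
   also have "\<dots> = 0" by (rule neg') (use st in auto)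
   finally show "AE w in M. ~ (L (s + t) w - L s w <= - (1 / real (Suc n)))"
    by (intro AE_I[of _ _ "{w\<in>space M. L (s + t) w - L s w <= - (1 / real (Suc n))}"])
     (simp_all add: emeasure_eq_measure)
  qed
  then show ?thesis
  proof eventually_elim
   case (elim w)
   show ?case
   proof (rule ccontr)
    assume "~ ?case"
    then have "0 < - (L (s + t) w - L s w)" by simp
    then obtain n where "1 / real (Suc n) < - (L (s + t) w - L s w)" by (rule nat_approx_posE)
    then show False using elim[rule_format, of n] by simp
   qed
  qed
 qed
 have "AE w in M. ALL n i j :: nat. i <= j --> L (real i / 2 ^ n) w <= L (real j / 2 ^ n) w"
  unfolding AE_all_countable
 proof (intro allI)
  fix n i j :: nat
  show "AE w in M. i <= j --> L (real i / 2 ^ n) w <= L (real j / 2 ^ n) w"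
  proof (cases "i < j")
   case True
   have "AE w in M. 0 <= L (real i / 2 ^ n + (real j - real i) / 2 ^ n) w - L (real i / 2 ^ n) w"
    using True by (intro AE_pos) auto
   moreover have "real i / 2 ^ n + (real j - real i) / 2 ^ n = real j / 2 ^ n" by (simp add: diff_divide_distrib)
   ultimately show ?thesis by simp
  qed auto
 qed
 then have "AE w in M. mono_on {0..} (%t. L t w)"
 proof eventually_elim
  case (elim w)
  show ?case
  proof (rule mono_onI)
   fix s t :: real assume st: "s \<in> {0..}" "t \<in> {0..}" "s <= t"
   have rc: "right_cont (%t. L t w)" using regular_paths by (rule regular_path_right_cont)
   have lim: "(%n. L (next_grid n r) w) \<longlonglongrightarrow> L r w" if "0 <= r" for r
    by (rule right_cont_tendsto[OF rc that next_grid_tendsto[OF that] next_grid_gt[OF that]])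
   have le: "L (next_grid n s) w <= L (next_grid n t) w" for n
   proof -
    have ng: "next_grid n r = real (grid_index n r + 1) / 2 ^ n" for r by (simp add: next_grid_def)
    have "grid_index n s + 1 <= grid_index n t + 1" using grid_index_mono[OF st(3), of n] by simp
    from elim[rule_format, OF this] show ?thesis unfolding ng .
   qed
   have "0 <= s" "0 <= t" using st by auto
   from lim[OF this(1)] lim[OF this(2)] show "L s w <= L t w" by (rule LIMSEQ_le) (use le in blast)
  qed
 qed
 then show False using not_subordinator levy by (simp add: subordinator_def)
qed

text \<open>Consecutive increments are independent, so \<open>n\<close> drops by \<open>d\<close> in
  a row have probability at least \<open>p ^ n\<close>.\<close>

lemma big_drop: "EX h>0. EX p>0. p <= measure (law h) {.. - W}"
proof -
 obtain t d where td: "0 < t" "0 < d" "0 < measure (law t) {.. - d}" using drop by auto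
 define p where "p = measure (law t) {.. - d}"
 have p: "0 < p" using td by (simp add: p_def)
 have L: "measure (law (real n * t)) {.. - (real n * d)} = prob {w\<in>space M. L (real n * t) w <= - (real n * d)}" for n
  unfolding law_def using L_measurable[of "real n * t"] td(1)
  by (subst measure_distr) (auto intro!: arg_cong[where f = prob])
 have "p ^ n <= prob {w\<in>space M. L (real n * t) w <= - (real n * d)}" for n
 proof (induction n)
  case 0
  then show ?case by (simp add: prob_space)
 next
  case (Suc n)
  let ?A = "{w\<in>space M. L (real n * t) w <= - (real n * d)}"
  let ?D = "%w. L (real n * t + t) w - L (real n * t) w"
  have nt: "0 <= real n * t" "0 <= t" using td by auto
  have A: "?A \<in> sets (F (real n * t))"
  proof -
   note [measurable] = L_measurable_F[OF nt(1) order_refl]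
   have "{w\<in>space (F (real n * t)). L (real n * t) w <= - (real n * d)} \<in> sets (F (real n * t))"
    by measurable
   then show ?thesis by simp
  qed
  have snt: "0 <= real (Suc n) * t" using td(1) by simp
  note [measurable] = L_measurable[OF snt]
  have "p ^ Suc n <= prob ?A * p" using Suc p by (simp add: mult.commute mult_left_mono)
  also have "\<dots> = prob (?A \<inter> (?D -` {.. - d} \<inter> space M))"
   unfolding p_def by (rule prob_increment[OF nt A, symmetric]) simp
  also have "\<dots> <= prob {w\<in>space M. L (real (Suc n) * t) w <= - (real (Suc n) * d)}"
  proof (rule finite_measure_mono)
   show "?A \<inter> (?D -` {.. - d} \<inter> space M) \<subseteq> {w\<in>space M. L (real (Suc n) * t) w <= - (real (Suc n) * d)}"
    by (auto simp: algebra_simps)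
   show "{w\<in>space M. L (real (Suc n) * t) w <= - (real (Suc n) * d)} \<in> events" by measurable
  qed
  finally show ?case .
 qed
 then have *: "p ^ n <= measure (law (real n * t)) {.. - (real n * d)}" for n unfolding L .
 obtain n0 where "W / d <= real n0" using real_arch_simple by blast
 \<comment> \<open>The successor keeps the total time positive even if \<open>W\<close> is
   not.\<close>
 define n where "n = Suc n0"
 have n: "W <= real n * d" using \<open>W / d <= real n0\<close> td(2) by (simp add: n_def field_simps)
 have nt: "0 < real n * t" using td by (simp add: n_def)
 interpret Q: prob_space "law (real n * t)" unfolding law_def using L_measurable nt by (intro prob_space_distr) auto
 have "measure (law (real n * t)) {.. - (real n * d)} <= measure (law (real n * t)) {.. - W}"
  using n by (intro Q.finite_measure_mono) (auto simp: law_def)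
 then show ?thesis using * [of n] p nt by (intro exI[of _ "real n * t"] conjI exI[of _ "p ^ n"]) auto
qed

text \<open>The two extreme starts suffice: by monotonicity all other reflected paths are squeezed
  between them.\<close>

definition separated :: "real => real => real => real => 'w set" where
 "separated s a b t = {w\<in>space M. pos_at s a b a t w \<noteq> pos_at s a b b t w}"

lemma separated_measurable_F:
 assumes "0 <= s" "0 <= t" "a < b"
 shows "separated s a b t \<in> sets (F (s + t))"
proof -
 note [measurable] = refl_measurable_F(3)[OF assms, of a] refl_measurable_F(3)[OF assms, of b]
 have "{w\<in>space (F (s + t)). pos_at s a b a t w \<noteq> pos_at s a b b t w} \<in> sets (F (s + t))" by measurable
 then show ?thesis by (simp add: separated_def)
qed

lemma separated_antimono:
 assumes "0 <= s" "a < b" "0 <= r" "r <= t"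
 shows "separated s a b t \<subseteq> separated s a b r"
proof
 fix w assume "w \<in> separated s a b t"
 moreover have "pos_at s a b y (r + (t - r)) w
   = refl_pos a b (pos_at s a b y r w) (shift_path r (lpath s w)) (t - r)" for y
  by (rule refl_flow(3)) (use assms path_regular in auto)
 ultimately show "w \<in> separated s a b r" by (auto simp: separated_def)
qed

lemma refl_pos_eq_unless_separated:
 assumes "0 <= s" "0 <= t" "a < b" "w \<in> space M" "w \<notin> separated s a b t"
 shows "pos_at s a b x t w = pos_at s a b y t w"
proof -
 have *: "pos_at s a b z t w = pos_at s a b a t w" for z
 proof -
  let ?z = "max a (min b z)"
  have "pos_at s a b a t w <= pos_at s a b ?z t w"
   "pos_at s a b ?z t w <= pos_at s a b b t w" using assms path_tame[OF assms(1,3)] by (auto intro!: refl_pos_mono)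
  then show ?thesis using assms(4,5) refl_pos_clip[OF assms(1,3,2), of z w] by (auto simp: separated_def)
 qed
 show ?thesis using *[of x] *[of y] by simp
qed

text \<open>Every time span \<open>h\<close> offers an independent chance of at least
  \<open>p\<close> for a drop by \<open>W\<close>, after which the extreme paths coincide. The band
  enters the constants only through the bound \<open>W\<close> on its width.\<close>

lemma prob_separated:
 "EX C l. 0 < C & 0 < l & (ALL a b s t. a < b --> b - a <= W --> 0 <= s --> 0 <= t -->
   prob (separated s a b t) <= C * exp (- l * t))"
proof -
 obtain h p where hp: "0 < h" "0 < p" "p <= measure (law h) {.. - W}" using big_drop[of W] by auto
 \<comment> \<open>At least 1/2, so that \<open>ln q\<close> makes sense even if
   \<open>p = 1\<close>.\<close>
 define q where "q = max (1 / 2) (1 - p)"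
 have q: "0 < q" "q < 1" "1 - p <= q" using hp(2) by (auto simp: q_def)
 interpret Q: prob_space "law h" unfolding law_def using L_measurable hp(1) by (intro prob_space_distr) auto
 have power: "prob (separated s a b (real k * h)) <= q ^ k"
  if ab: "a < b" "b - a <= W" and s: "0 <= s" for a b s k
 proof (induction k)
  case (Suc k)
  have kh: "0 <= real k * h" and h0: "0 <= h" using hp(1) by auto
  let ?A = "separated s a b (real k * h)"
  let ?D = "%w. L (s + real k * h + h) w - L (s + real k * h) w"
  have "separated s a b (real (Suc k) * h) \<subseteq> ?A \<inter> (?D -` {- W<..} \<inter> space M)"
  proof
   fix w assume w: "w \<in> separated s a b (real (Suc k) * h)"
   have sk: "real (Suc k) * h = real k * h + h" by (simp add: algebra_simps)
   have "w \<in> ?A" using separated_antimono[OF s ab(1) kh, of "real (Suc k) * h"] w hp(1) by (auto simp: sk)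
   moreover have "- W < ?D w"
   proof (rule ccontr)
    assume "~ - W < ?D w"
    then have "lpath s w (real k * h + h) - lpath s w (real k * h) <= - W" by (simp add: shift_path_def add.assoc)
    moreover have "pos_at s a b a (real k * h + h) w \<noteq> pos_at s a b b (real k * h + h) w"
     using w unfolding separated_def sk by blast
    moreover have "~ lpath s w (real k * h + h) - lpath s w (real k * h) <= - (b - a)"
     using refl_coalesce[OF path_regular[OF s] ab(1) kh hp(1)] calculation(2) by blast
    ultimately show False using ab(2) by linarith
   qed
   moreover have "w \<in> space M" using w by (simp add: separated_def)
   ultimately show "w \<in> ?A \<inter> (?D -` {- W<..} \<inter> space M)" by auto
  qed
  moreover have A: "?A \<in> sets (F (s + real k * h))" by (rule separated_measurable_F[OF s kh ab(1)])
  moreover have "?A \<inter> (?D -` {- W<..} \<inter> space M) \<in> events"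
  proof (rule sets.Int)
   show "?A \<in> events" using A sets_F_M[of "s + real k * h"] s kh by auto
   show "?D -` {- W<..} \<inter> space M \<in> events"
    using increment_measurable[of "s + real k * h" h] s kh h0 by (intro measurable_sets[of _ M borel]) auto
  qed
  ultimately have "prob (separated s a b (real (Suc k) * h)) <= prob (?A \<inter> (?D -` {- W<..} \<inter> space M))"
   by (intro finite_measure_mono) auto
  also have "\<dots> = prob ?A * measure (law h) {- W<..}" by (rule prob_increment) (use A s kh h0 in auto)
  also have "measure (law h) {- W<..} = 1 - measure (law h) {.. - W}"
  proof -
   have "{- W<..} = space (law h) - {.. - W}" by (auto simp: law_def)
   then show ?thesis using Q.prob_compl[of "{.. - W}"] by (simp add: law_def)
  qed
  also have "prob ?A * (1 - measure (law h) {.. - W}) <= q ^ k * q" using Suc hp(3) q by (intro mult_mono) auto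
  finally show ?case by (simp add: mult.commute)
 qed simp
 define l where "l = - ln q / h"
 have l: "0 < l" using q hp(1) by (simp add: l_def divide_neg_pos)
 \<comment> \<open>The factor \<open>1 / q\<close> pays for the incomplete last time span.\<close>
 have "prob (separated s a b t) <= (1 / q) * exp (- l * t)"
  if ab: "a < b" "b - a <= W" and s: "0 <= s" and t: "0 <= t" for a b s t
 proof -
  define k where "k = nat \<lfloor>t / h\<rfloor>"
  have fl: "0 <= \<lfloor>t / h\<rfloor>" using t hp(1) by simp
  have kr: "real k = of_int \<lfloor>t / h\<rfloor>" unfolding k_def using fl by simp
  have k: "real k * h <= t" "t / h - 1 <= real k"
   unfolding kr using hp(1) by (auto simp: pos_le_divide_eq[symmetric] le_floor_iff)
  have "prob (separated s a b t) <= prob (separated s a b (real k * h))"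
  proof (rule finite_measure_mono)
   show "separated s a b t \<subseteq> separated s a b (real k * h)"
    using hp(1) k s ab by (intro separated_antimono) auto
   show "separated s a b (real k * h) \<in> events"
    using separated_measurable_F[of s "real k * h" a b] sets_F_M[of "s + real k * h"] s hp(1) ab by auto
  qed
  also have "\<dots> <= q ^ k" by (rule power[OF ab s])
  also have "q ^ k = exp (real k * ln q)" using q by (simp add: exp_of_nat_mult)
  also have "\<dots> <= exp ((t / h - 1) * ln q)"
   using k(2) q by (intro exp_le_cancel_iff[THEN iffD2] mult_right_mono_neg) auto
  also have "(t / h - 1) * ln q = - l * t - ln q" by (simp add: l_def algebra_simps)
  also have "exp (- l * t - ln q) = (1 / q) * exp (- l * t)" using q by (simp add: exp_diff)
  finally show ?thesis .
 qed
 then show ?thesis using q l by (intro exI[of _ "1 / q"] exI[of _ l]) auto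
qed

end

section \<open>Uniform ergodicity and stationary laws\<close>

lemma clip_continuous: "continuous_on UNIV (%x :: real. max a (min b x))" by (intro continuous_intros)

lemma clip_id: "a <= y ==> y <= b ==> max a (min b y) = (y :: real)" by simp

context regular_levy
begin

definition mean_pos :: "(real => real) => real => real => real => real => real" where
 "mean_pos h a b x t = expectation (%w. h (pos_at 0 a b x t w))"

lemma mean_pos_shift:
 assumes "a < b" "0 <= s" "0 <= t" "continuous_on UNIV h"
 shows "mean_pos h a b x t = expectation (%w. h (pos_at s a b x t w))"
proof -
 have "expectation (%w. 1 * h (pos_at s a b x t w))
   = expectation (%_. 1) * expectation (%w. h (pos_at 0 a b x t w))"
  by (rule expectation_refl(1)[OF assms(1,2,3), of "%_. 1" h x]) (use assms(4) in auto)
 then show ?thesis by (simp add: prob_space mean_pos_def)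
qed

lemma integrable_pos:
 fixes h :: "real => real"
 assumes "a < b" "0 <= s" "0 <= t" "continuous_on UNIV h"
 shows "integrable M (%w. h (pos_at s a b x t w))"
 by (rule expectation_refl(3)[OF assms(1,2,3), of "%_. 1" h x]) (use assms(4) in auto)

lemma mean_pos_bound:
 assumes "a < b" "0 <= t" "!!y. a <= y ==> y <= b ==> abs (h y) <= B" "continuous_on UNIV h"
 shows "abs (mean_pos h a b x t) <= B"
proof -
 have "abs (mean_pos h a b x t) <= expectation (%w. abs (h (pos_at 0 a b x t w)))"
  unfolding mean_pos_def by (rule integral_abs_bound)
 also have "\<dots> <= expectation (%w. B)" using assms(3) refl_bounds[OF order_refl assms(2,1)]
  by (intro integral_mono integrable_abs integrable_pos assms(1,2,4) order_refl) auto
 finally show ?thesis by (simp add: prob_space)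
qed

lemma shift_lpath: "0 <= s ==> shift_path s (lpath 0 w) = lpath s w"
 by (simp add: shift_path_def fun_eq_iff)

lemma refl_pos_flow:
 assumes "a < b" "0 <= s" "0 <= t"
 shows "pos_at 0 a b x (s + t) w = pos_at s a b (refl_pos a b x (lpath 0 w) s) t w"
 using refl_flow(3)[OF path_regular[OF order_refl] assms, of x w] shift_lpath[OF assms(2)] by simp

text \<open>The position is pathwise Lipschitz in band and start, so dominated convergence applies.
  The integrands vary along with the bands, to allow for a moving parameter.\<close>

lemma mean_pos_tendsto:
 assumes ab: "!!n. as n < bs n" "a < b" and t: "0 <= t"
  and lim: "as \<longlonglongrightarrow> a" "bs \<longlonglongrightarrow> b" "xs \<longlonglongrightarrow> x"
  and hn: "!!n. continuous_on UNIV (hn n)" "continuous_on UNIV h"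
  and h: "!!y ys. ys \<longlonglongrightarrow> y ==> (%n. hn n (ys n)) \<longlonglongrightarrow> h y"
  and B: "!!n y. as n <= y ==> y <= bs n ==> abs (hn n y) <= B"
 shows "(%n. mean_pos (hn n) (as n) (bs n) (xs n) t) \<longlonglongrightarrow> mean_pos h a b x t"
 unfolding mean_pos_def
proof (rule integral_dominated_convergence[where w = "%_. B"])
 show "(%w. h (pos_at 0 a b x t w)) \<in> borel_measurable M"
  using integrable_pos[OF ab(2) order_refl t hn(2)] by (rule borel_measurable_integrable)
 show "(%w. hn n (pos_at 0 (as n) (bs n) (xs n) t w)) \<in> borel_measurable M" for n
  using integrable_pos[OF ab(1) order_refl t hn(1)] by (rule borel_measurable_integrable)
 show "AE w in M. norm (hn n (pos_at 0 (as n) (bs n) (xs n) t w)) <= B" for n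
  unfolding real_norm_def by (intro AE_I2 B refl_bounds[OF order_refl t ab(1)])
 show "AE w in M. (%n. hn n (pos_at 0 (as n) (bs n) (xs n) t w)) \<longlonglongrightarrow> h (pos_at 0 a b x t w)"
 proof (intro AE_I2 h)
  fix w
  define e where "e n = abs (as n - a) + abs (bs n - b) + abs (xs n - x)" for n
  have "e \<longlonglongrightarrow> abs (a - a) + abs (b - b) + abs (x - x)"
   unfolding e_def by (intro tendsto_intros lim)
  then have e: "e \<longlonglongrightarrow> 0" by simp
  have "abs (pos_at 0 (as n) (bs n) (xs n) t w - pos_at 0 a b x t w) <= e n" for n
   by (rule refl_pos_lipschitz[OF less_imp_le[OF ab(1)] path_tame[OF order_refl ab(1)]
      less_imp_le[OF ab(2)] path_tame[OF order_refl ab(2)] t]) (auto simp: e_def)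
  then show "(%n. pos_at 0 (as n) (bs n) (xs n) t w) \<longlonglongrightarrow> pos_at 0 a b x t w"
   by (intro Lim_transform_bound[OF _ e, THEN LIM_zero_cancel] always_eventually)
    (simp add: order_trans[OF _ abs_ge_self])
 qed
qed simp

lemma refl_process_measurable:
 assumes "a < b"
 shows "(%(t, w). pos_at 0 a b x (max 0 t) w) \<in> borel_measurable (borel \<Otimes>\<^sub>M M)"
proof -
 note T = path_tame[OF order_refl assms]
 show "(%(t, w). pos_at 0 a b x (max 0 t) w) \<in> borel_measurable (borel \<Otimes>\<^sub>M M)"
  by (rule right_cont_process_measurable[of "%t w. pos_at 0 a b x t w"])
   (auto intro: refl_measurable(3)[OF order_refl _ assms] refl_pos_right_cont[OF T])
qed

lemma mean_pos_measurable:
 assumes "a < b" "continuous_on UNIV h"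
 shows "(%t. mean_pos h a b x (max 0 t)) \<in> borel_measurable borel"
proof -
 have "h \<in> borel_measurable borel" using assms(2) by (rule borel_measurable_continuous_onI)
 from measurable_compose[OF refl_process_measurable[OF assms(1)] this]
 have "(%(t, w). h (pos_at 0 a b x (max 0 t) w)) \<in> borel_measurable (borel \<Otimes>\<^sub>M M)"
  by (simp add: case_prod_beta')
 from borel_measurable_lebesgue_integral[OF this] show ?thesis unfolding mean_pos_def .
qed

end

context dropping_levy
begin

text \<open>One pair of constants for all bands of width at most \<open>W\<close>, all starts and
  all integrands: uniformity over bands is what permits limits along moving bands.\<close>

definition mixing_rate :: "real => real => real => bool" where
 "mixing_rate W C l \<longleftrightarrow> 0 < C & 0 < l & (ALL h a b x y s t B. a < b --> b - a <= W --> 0 <= s --> 0 <= t -->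
   continuous_on UNIV h --> (ALL z. a <= z --> z <= b --> abs (h z) <= B) -->
   \<bar>mean_pos h a b x (s + t) - mean_pos h a b y t\<bar> <= 2 * B * (C * exp (- l * t)))"

lemma mixing_rateD:
 assumes "mixing_rate W C l"
 shows "0 < C" "0 < l"
  and "a < b ==> b - a <= W ==> 0 <= s ==> 0 <= t ==> continuous_on UNIV h ==>
   ALL z. a <= z --> z <= b --> abs (h z) <= B ==>
   \<bar>mean_pos h a b x (s + t) - mean_pos h a b y t\<bar> <= 2 * B * (C * exp (- l * t))"
 using assms unfolding mixing_rate_def by simp_all

text \<open>\<open>mean_pos h a b y t\<close> is realised by the process started from
  \<open>y\<close> at time \<open>s\<close> and driven by the same increments. Outside
  \<open>separated s a b t\<close> it agrees at time \<open>s + t\<close> with the process started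
  from \<open>x\<close> at time 0; elsewhere the values differ by at most
  \<open>2 * B\<close>.\<close>

lemma mean_pos_ergodic: "EX C l. mixing_rate W C l"
proof -
 obtain C l where C: "0 < C" "0 < l" and sep: "!!a b s t. a < b ==> b - a <= W ==> 0 <= s ==> 0 <= t ==>
   prob (separated s a b t) <= C * exp (- l * t)" using prob_separated[of W] by blast
 have "mixing_rate W C l" unfolding mixing_rate_def
 proof (intro conjI C allI impI)
  fix h :: "real => real" and a b x y s t B :: real
  assume ab: "a < b" "b - a <= W" and s: "0 <= s" and t: "0 <= t" and h: "continuous_on UNIV h"
   and B: "ALL z. a <= z --> z <= b --> abs (h z) <= B"
  have B0: "0 <= B" using B ab(1) by (metis abs_ge_zero order.strict_implies_order order.trans order_refl)
  have st: "0 <= s + t" using s t by simp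
  let ?S = "separated s a b t"
  have S [measurable]: "?S \<in> events" using separated_measurable_F[OF s t ab(1)] sets_F_M[OF st] by blast
  let ?X = "%w. h (pos_at 0 a b x (s + t) w)" and ?Y = "%w. h (pos_at s a b y t w)"
  have i: "integrable M ?X" "integrable M ?Y"
   by (rule integrable_pos[OF ab(1) order_refl st h], rule integrable_pos[OF ab(1) s t h])
  have "abs (mean_pos h a b x (s + t) - mean_pos h a b y t) = abs (expectation ?X - expectation ?Y)"
   unfolding mean_pos_shift[OF ab(1) s t h, of y] by (simp add: mean_pos_def)
  also have "\<dots> = abs (expectation (%w. ?X w - ?Y w))" using i by simp
  also have "\<dots> <= expectation (%w. abs (?X w - ?Y w))" by (rule integral_abs_bound)
  also have "\<dots> <= expectation (%w. 2 * B * indicator ?S w)"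
  proof (rule integral_mono)
   show "integrable M (%w. abs (?X w - ?Y w))" using i by (intro integrable_abs Bochner_Integration.integrable_diff)
   show "integrable M (%w. 2 * B * indicator ?S w :: real)"
    by (intro integrable_mult_right integrable_real_indicator S) (simp add: less_top[symmetric])
   fix w assume w: "w \<in> space M"
   have 1: "abs (?X w) <= B" using refl_bounds[OF order_refl st ab(1), of x w] B by blast
   have 2: "abs (?Y w) <= B" using refl_bounds[OF s t ab(1), of y w] B by blast
   show "abs (?X w - ?Y w) <= 2 * B * indicator ?S w"
   proof (cases "w \<in> ?S")
    case True
    then show ?thesis using 1 2 by simp
   next
    case False
    have "?X w = ?Y w" unfolding refl_pos_flow[OF ab(1) s t, of x w]
     by (rule arg_cong[OF refl_pos_eq_unless_separated[OF s t ab(1) w False]])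
    then show ?thesis using B0 False by simp
   qed
  qed
  also have "\<dots> = 2 * B * prob ?S" by simp
  also have "\<dots> <= 2 * B * (C * exp (- l * t))" using B0 sep[OF ab s t] by (intro mult_left_mono) auto
  finally show "abs (mean_pos h a b x (s + t) - mean_pos h a b y t) <= 2 * B * (C * exp (- l * t))" .
 qed
 then show ?thesis by blast
qed

definition is_limit_law :: "real => real => real measure => bool" where
 "is_limit_law a b \<mu> \<longleftrightarrow> real_distribution \<mu> & (AE y in \<mu>. y \<in> {a..b}) &
   (ALL h x. continuous_on UNIV h --> ((%t. mean_pos h a b x t) \<longlongrightarrow> (\<integral>y. h y \<partial>\<mu>)) at_top)"

text \<open>Tightness gives a limit along a subsequence of integer times; the mixing bound then
  forces the means at all times and from all starts to the same limit.\<close>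

lemma ex_limit_law:
 assumes ab: "a < b"
 shows "EX \<mu>. is_limit_law a b \<mu>"
proof -
 define \<nu> where "\<nu> n = distr M borel (%\<omega>. pos_at 0 a b a (real n) \<omega>)" for n :: nat
 have Xm [measurable]: "(%\<omega>. pos_at 0 a b a (real n) \<omega>) \<in> borel_measurable M" for n :: nat
  by (rule refl_measurable(3)[OF order_refl _ ab]) simp
 have Xb: "a <= pos_at 0 a b a (real n) \<omega>" "pos_at 0 a b a (real n) \<omega> <= b" for \<omega> and n :: nat
  using refl_bounds[OF order_refl _ ab, of "real n" a \<omega>] by simp_all
 have \<nu>d: "real_distribution (\<nu> n)" for n unfolding \<nu>_def by (rule real_distribution_distr) (rule Xm)
 have "tight \<nu>" unfolding tight_def
 proof (intro conjI allI impI \<nu>d)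
  fix e :: real assume e: "0 < e"
  have "measure (\<nu> n) {a - 1<..b} = 1" for n
  proof -
   have "(%\<omega>. pos_at 0 a b a (real n) \<omega>) -` {a - 1<..b} \<inter> space M = space M"
    using less_le_trans[of "a - 1" a, OF _ Xb(1)] Xb(2) by auto
   then show ?thesis unfolding \<nu>_def by (simp add: measure_distr prob_space)
  qed
  then show "EX c d. c < d & (ALL n. 1 - e < measure (\<nu> n) {c<..d})"
   using ab e by (intro exI[of _ "a - 1"] exI[of _ b]) auto
 qed
 from tight_imp_convergent_subsubsequence[OF this strict_mono_id]
 obtain r \<mu> where r: "strict_mono r" and \<mu>: "real_distribution \<mu>" and w: "weak_conv_m (\<nu> \<circ> id \<circ> r) \<mu>"
  by blast
 interpret \<mu>: real_distribution \<mu> by (rule \<mu>)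
 obtain C l where m: "mixing_rate (b - a) C l" using mean_pos_ergodic by blast
 note C = mixing_rateD(1,2)[OF m]
 have bdd: "((%t. mean_pos h a b x t) \<longlongrightarrow> (\<integral>y. h y \<partial>\<mu>)) at_top"
  if h: "continuous_on UNIV h" "!!y. abs (h y) <= B" for h x B
 proof -
  have hm: "h \<in> borel_measurable borel" using h(1) by (rule borel_measurable_continuous_onI)
  have "(%n. integral\<^sup>L ((\<nu> \<circ> id \<circ> r) n) h) \<longlonglongrightarrow> integral\<^sup>L \<mu> h"
  proof (rule weak_conv_imp_integral_bdd_continuous_conv[OF _ \<mu> w])
   show "real_distribution ((\<nu> \<circ> id \<circ> r) n)" for n using \<nu>d by simp
   show "isCont h y" for y using h(1) by (simp add: continuous_on_eq_continuous_at)
   show "norm (h y) <= B" for y using h(2) by simp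
  qed
  moreover have "integral\<^sup>L ((\<nu> \<circ> id \<circ> r) n) h = mean_pos h a b a (real (r n))" for n
   unfolding \<nu>_def mean_pos_def comp_def id_def by (rule integral_distr[OF Xm hm])
  ultimately have lim: "(%n. mean_pos h a b a (real (r n))) \<longlonglongrightarrow> (\<integral>y. h y \<partial>\<mu>)" by simp
  have "abs ((\<integral>y. h y \<partial>\<mu>) - mean_pos h a b x t) <= 2 * B * (C * exp (- l * t))" if t: "0 <= t" for t
  proof -
   obtain N :: nat where N: "t <= real N" using real_arch_simple by blast
   show ?thesis
  proof (rule Lim_bounded)
   show "(%n. abs (mean_pos h a b a (real (r n)) - mean_pos h a b x t)) \<longlonglongrightarrow> abs ((\<integral>y. h y \<partial>\<mu>) - mean_pos h a b x t)"
    by (intro tendsto_intros lim)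
   show "ALL n>=N. abs (mean_pos h a b a (real (r n)) - mean_pos h a b x t) <= 2 * B * (C * exp (- l * t))"
   proof (intro allI impI)
    fix n assume "N <= n"
    then have "real N <= real (r n)" using seq_suble[OF r, of n] by simp
    then have "0 <= real (r n) - t" using N by simp
    from mixing_rateD(3)[OF m ab order_refl this t h(1), of B a x] h(2)
    show "abs (mean_pos h a b a (real (r n)) - mean_pos h a b x t) <= 2 * B * (C * exp (- l * t))" by simp
   qed
  qed
  qed
  then have ev: "eventually (%t. norm (mean_pos h a b x t - (\<integral>y. h y \<partial>\<mu>)) <= 2 * B * (C * exp (- l * t))) at_top"
   unfolding real_norm_def by (intro eventually_mono[OF eventually_ge_at_top[of 0]]) (simp add: abs_minus_commute)
  have "((%t. 2 * B * (C * exp (- l * t))) \<longlongrightarrow> 0) at_top" using C by real_asymp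
  from Lim_null_comparison[OF ev this] show ?thesis by (rule LIM_zero_cancel)
 qed
 have clip: "mean_pos (%y. h (max a (min b y))) a b x t = mean_pos h a b x t" if "0 <= t" for h x t
  unfolding mean_pos_def
  by (rule Bochner_Integration.integral_cong) (simp_all only: clip_id[OF refl_bounds[OF order_refl that ab]])
 have AE: "AE y in \<mu>. y \<in> {a..b}"
 proof -
  \<comment> \<open>A bounded continuous function vanishing exactly on the band. Its mean is 0 along
    the process, hence in the limit, which confines the limit law to the band.\<close>
  define h where "h y = min 1 \<bar>y - max a (min b y)\<bar>" for y
  have h: "continuous_on UNIV h" unfolding h_def by (intro continuous_intros)
  have hm [measurable]: "h \<in> borel_measurable borel" using h by (rule borel_measurable_continuous_onI)
  have h1: "abs (h y) <= 1" for y by (simp add: h_def)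
  have "mean_pos h a b a t = 0" if "0 <= t" for t
  proof -
   have "mean_pos h a b a t = expectation (%\<omega>. 0)" unfolding mean_pos_def h_def
    by (rule Bochner_Integration.integral_cong) (simp_all add: clip_id[OF refl_bounds[OF order_refl that ab]])
   then show ?thesis by simp
  qed
  then have "eventually (%t. 0 = mean_pos h a b a t) at_top"
   by (intro eventually_mono[OF eventually_ge_at_top[of 0]]) simp
  then have "((%t. mean_pos h a b a t) \<longlongrightarrow> 0) at_top"
   by (rule Lim_transform_eventually[OF tendsto_const])
  then have "(\<integral>y. h y \<partial>\<mu>) = 0"
   using bdd[OF h h1, of a] tendsto_unique[OF trivial_limit_at_top_linorder] by blast
  moreover have "integrable \<mu> h" using h1 by (intro \<mu>.integrable_const_bound[of _ 1]) auto
  moreover have "AE y in \<mu>. 0 <= h y" by (simp add: h_def)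
  ultimately have "AE y in \<mu>. h y = 0" using integral_nonneg_eq_0_iff_AE by blast
  then show ?thesis
  proof eventually_elim
   case (elim y)
   then have "y = max a (min b y)" by (auto simp: h_def min_def split: if_splits)
   then show ?case using ab by (metis atLeastAtMost_iff less_imp_le max.bounded_iff max.cobounded1 min.cobounded1)
  qed
 qed
 have "((%t. mean_pos h a b x t) \<longlongrightarrow> (\<integral>y. h y \<partial>\<mu>)) at_top" if h: "continuous_on UNIV h" for h x
 proof -
  \<comment> \<open>Weak convergence tests bounded functions; clipping the argument bounds
    \<open>h\<close> without changing it on the band.\<close>
  let ?h = "%y. h (max a (min b y))"
  have hc: "continuous_on UNIV ?h" by (rule continuous_on_compose2[OF h clip_continuous]) auto
  obtain B where B: "ALL z. a <= z --> z <= b --> abs (h z) <= B" using continuous_bounded_Icc[OF h] by blast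
  have "abs (?h y) <= B" for y by (rule B[rule_format]) (use ab in auto)
  from bdd[OF hc this, of x] have 1: "((%t. mean_pos ?h a b x t) \<longlongrightarrow> (\<integral>y. ?h y \<partial>\<mu>)) at_top" .
  have "eventually (%t. mean_pos ?h a b x t = mean_pos h a b x t) at_top"
   using eventually_ge_at_top[of 0] by eventually_elim (rule clip)
  from Lim_transform_eventually[OF 1 this]
  have "((%t. mean_pos h a b x t) \<longlongrightarrow> (\<integral>y. ?h y \<partial>\<mu>)) at_top" .
  moreover have "(\<integral>y. ?h y \<partial>\<mu>) = (\<integral>y. h y \<partial>\<mu>)"
  proof (rule integral_cong_AE)
   show "?h \<in> borel_measurable \<mu>" "h \<in> borel_measurable \<mu>"
    using borel_measurable_continuous_onI[OF hc] borel_measurable_continuous_onI[OF h] by auto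
   show "AE y in \<mu>. ?h y = h y" using AE by eventually_elim (simp add: clip_id)
  qed
  ultimately show ?thesis by simp
 qed
 then show ?thesis using \<mu> AE unfolding is_limit_law_def by blast
qed

definition limit_law :: "real => real => real measure" where
 "limit_law a b = (SOME \<mu>. is_limit_law a b \<mu>)"

lemma limit_law: "a < b ==> is_limit_law a b (limit_law a b)"
 unfolding limit_law_def using ex_limit_law by (rule someI_ex)

text \<open>The mixing bound between the times \<open>r >= t\<close> and \<open>t\<close>, as
  \<open>r\<close> tends to infinity.\<close>

lemma limit_law_error:
 assumes ab: "a < b" "b - a <= W" and t: "0 <= t" and h: "continuous_on UNIV h"
  and B: "ALL z. a <= z --> z <= b --> abs (h z) <= B"
  and m: "mixing_rate W C l"
 shows "abs ((\<integral>y. h y \<partial>limit_law a b) - mean_pos h a b x t) <= 2 * B * (C * exp (- l * t))"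
proof (rule tendsto_upperbound[of "%r. abs (mean_pos h a b x r - mean_pos h a b x t)" _ at_top])
 have "((%r. mean_pos h a b x r) \<longlongrightarrow> (\<integral>y. h y \<partial>limit_law a b)) at_top"
  using limit_law[OF ab(1)] h unfolding is_limit_law_def by blast
 then show "((%r. abs (mean_pos h a b x r - mean_pos h a b x t))
   \<longlongrightarrow> abs ((\<integral>y. h y \<partial>limit_law a b) - mean_pos h a b x t)) at_top"
  by (intro tendsto_intros)
 show "eventually (%r. abs (mean_pos h a b x r - mean_pos h a b x t) <= 2 * B * (C * exp (- l * t))) at_top"
  using eventually_ge_at_top[of t]
 proof eventually_elim
  case (elim r)
  then have "0 <= r - t" by simp
  from mixing_rateD(3)[OF m ab this t h B, of x x] show ?case by simp
 qed
qed simp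

text \<open>Uniform ergodicity makes the stationary mean continuous in the band.\<close>

lemma limit_law_tendsto:
 fixes h :: "real => real"
 assumes ab: "!!n. as n < bs n" "a < b" and lim: "as \<longlonglongrightarrow> a" "bs \<longlonglongrightarrow> b"
  and h: "continuous_on UNIV h"
 shows "(%n. \<integral>y. h y \<partial>limit_law (as n) (bs n)) \<longlonglongrightarrow> (\<integral>y. h y \<partial>limit_law a b)"
proof -
 have "Bseq as" by (rule convergent_imp_Bseq[OF convergentI[OF lim(1)]])
 then obtain R1 where R1: "!!n. abs (as n) <= R1" unfolding Bseq_def real_norm_def by blast
 have "Bseq bs" by (rule convergent_imp_Bseq[OF convergentI[OF lim(2)]])
 then obtain R2 where R2: "!!n. abs (bs n) <= R2" unfolding Bseq_def real_norm_def by blast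
 define R where "R = max R1 R2"
 have R: "abs (as n) <= R" "abs (bs n) <= R" for n using R1[of n] R2[of n] by (auto simp: R_def)
 have abR: "abs a <= R" "abs b <= R"
  using tendsto_upperbound[OF tendsto_rabs[OF lim(1)] always_eventually[OF allI[OF R(1)]]]
   tendsto_upperbound[OF tendsto_rabs[OF lim(2)] always_eventually[OF allI[OF R(2)]]] by auto
 obtain C l where m: "mixing_rate (2 * R) C l" using mean_pos_ergodic by blast
 note C = mixing_rateD(1,2)[OF m]
 obtain B where B: "!!y. - R <= y ==> y <= R ==> abs (h y) <= B" using continuous_bounded_Icc[OF h] by blast
 have dec: "((%t. 2 * B * (C * exp (- l * t))) \<longlongrightarrow> 0) at_top" using C by real_asymp
 have err: "abs ((\<integral>y. h y \<partial>limit_law c d) - mean_pos h c d x t) <= 2 * B * (C * exp (- l * t))"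
  if "c < d" "abs c <= R" "abs d <= R" "0 <= t" for c d x t
 proof (rule limit_law_error[OF that(1) _ that(4) h _ m])
  show "d - c <= 2 * R" using that by linarith
  show "ALL z. c <= z --> z <= d --> abs (h z) <= B"
   using that by (intro allI impI B) linarith+
 qed
 show ?thesis
 proof (rule LIMSEQ_I)
  fix r :: real assume r: "0 < r"
  have "eventually (%t. 2 * B * (C * exp (- l * t)) < r / 3) at_top"
   using dec r by (intro order_tendstoD(2)) auto
  then obtain t0 where t0: "!!t. t0 <= t ==> 2 * B * (C * exp (- l * t)) < r / 3"
   by (auto simp: eventually_at_top_linorder)
  define t where "t = max 0 t0"
  have t: "0 <= t" "2 * B * (C * exp (- l * t)) < r / 3" using t0[of t] by (auto simp: t_def)
  have hs: "(%n. h (ys n)) \<longlonglongrightarrow> h y" if "ys \<longlonglongrightarrow> y" for ys y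
   using continuous_on_tendsto_compose[OF h that] by simp
  have "(%n. mean_pos h (as n) (bs n) 0 t) \<longlonglongrightarrow> mean_pos h a b 0 t"
  proof (rule mean_pos_tendsto[OF ab t(1) lim tendsto_const h h hs])
   fix n y assume "as n <= y" "y <= bs n"
   then show "abs (h y) <= B" using R(1)[of n] R(2)[of n] by (intro B) linarith+
  qed
  from LIMSEQ_D[OF this, of "r / 3"] r
  obtain N where N: "!!n. N <= n ==> abs (mean_pos h (as n) (bs n) 0 t - mean_pos h a b 0 t) < r / 3"
   unfolding real_norm_def by auto
  show "EX no. ALL n>=no. norm ((\<integral>y. h y \<partial>limit_law (as n) (bs n)) - (\<integral>y. h y \<partial>limit_law a b)) < r"
  proof (intro exI[of _ N] allI impI)
   fix n assume "N <= n"
   then show "norm ((\<integral>y. h y \<partial>limit_law (as n) (bs n)) - (\<integral>y. h y \<partial>limit_law a b)) < r"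
    using N[of n] err[OF ab(1) R t(1), of n 0] err[OF ab(2) abR t(1), of 0] t(2) unfolding real_norm_def by linarith
  qed
 qed
qed

end

section \<open>Real analysis: convex derivatives, quasi-additive functions, discount
  measures\<close>

lemma convex_derivative_mono:
 fixes g :: "real => real"
 assumes "convex_on UNIV g" "!!x. (g has_real_derivative g' x) (at x)"
 shows "g y >= g x + g' x * (y - x)" "mono g'"
proof -
 have t: "g y >= g x + g' x * (y - x)" for x y
  using convex_on_imp_above_tangent[OF assms(1), of x y "g' x"] assms(2)[of x] by simp
 show "g y >= g x + g' x * (y - x)" by (rule t)
 show "mono g'"
 proof (rule monoI)
  fix x y :: real assume xy: "x <= y"
  have "0 <= (g' y - g' x) * (y - x)" using t[of x y] t[of y x] by (simp add: algebra_simps)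
  then show "g' x <= g' y" using xy by (cases "x = y") (auto simp: zero_le_mult_iff)
 qed
qed

text \<open>The derivative is squeezed between difference quotients, which are jointly continuous.\<close>

lemma convex_derivative_jointly_continuous:
 fixes c c' :: "real => real => real"
 assumes convex: "!!y. convex_on UNIV (%x. c x y)"
  and deriv: "!!x y. ((%z. c z y) has_real_derivative c' x y) (at x)"
  and cont: "continuous_on UNIV (%(x, y). c x y)"
  and lim: "xs \<longlonglongrightarrow> x" "ys \<longlonglongrightarrow> y"
 shows "(%n. c' (xs n) (ys n)) \<longlonglongrightarrow> c' x y"
proof (rule LIMSEQ_I)
 fix r :: real assume r: "0 < r"
 have c: "(%n. c (xs n + h) (ys n)) \<longlonglongrightarrow> c (x + h) y" for h
 proof -
  have "(%n. (xs n + h, ys n)) \<longlonglongrightarrow> (x + h, y)" by (intro tendsto_intros lim)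
  from continuous_on_tendsto_compose[OF cont this] show ?thesis by simp
 qed
 have "((%h. (c (x + h) y - c x y) / h) \<longlongrightarrow> c' x y) (at 0)"
  using deriv[where x = x and y = y] by (simp add: DERIV_def)
 then have "eventually (%h. dist ((c (x + h) y - c x y) / h) (c' x y) < r / 2) (at 0)"
  using r by (intro tendstoD) auto
 then obtain d where d: "0 < d"
  "!!h. h \<noteq> 0 ==> abs h < d ==> abs ((c (x + h) y - c x y) / h - c' x y) < r / 2"
  by (auto simp: eventually_at dist_real_def)
 define h where "h = d / 2"
 have h: "0 < h" "abs ((c (x + h) y - c x y) / h - c' x y) < r / 2"
  "abs ((c (x + - h) y - c x y) / (- h) - c' x y) < r / 2"
 proof -
  show "0 < h" using d(1) by (simp add: h_def)
  show "abs ((c (x + h) y - c x y) / h - c' x y) < r / 2"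
   by (rule d(2)) (use d(1) in \<open>auto simp: h_def\<close>)
  show "abs ((c (x + - h) y - c x y) / (- h) - c' x y) < r / 2"
   by (rule d(2)) (use d(1) in \<open>auto simp: h_def\<close>)
 qed
 have q: "(%n. (c (xs n + k) (ys n) - c (xs n) (ys n)) / k) \<longlonglongrightarrow> (c (x + k) y - c x y) / k" if "k \<noteq> 0" for k
  using c[of 0] by (intro tendsto_intros c that) simp
 have "eventually (%n. (c (xs n + h) (ys n) - c (xs n) (ys n)) / h < c' x y + r) sequentially"
  by (rule order_tendstoD(2)[OF q]) (use h r in \<open>linarith+\<close>)
 moreover have "eventually (%n. (c (xs n + - h) (ys n) - c (xs n) (ys n)) / (- h) > c' x y - r) sequentially"
  by (rule order_tendstoD(1)[OF q]) (use h r in \<open>linarith+\<close>)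
 ultimately have "eventually (%n. norm (c' (xs n) (ys n) - c' x y) < r) sequentially"
 proof eventually_elim
  case (elim n)
  have "c' (xs n) (ys n) <= (c (xs n + h) (ys n) - c (xs n) (ys n)) / h"
   using convex_derivative_mono(1)[OF convex deriv, of "xs n" "ys n" "xs n + h"] h(1) by (simp add: field_simps)
  moreover have "c' (xs n) (ys n) >= (c (xs n + - h) (ys n) - c (xs n) (ys n)) / (- h)"
   using convex_derivative_mono(1)[OF convex deriv, of "xs n" "ys n" "xs n + - h"] h(1) by (simp add: field_simps)
  ultimately show ?case using elim unfolding real_norm_def by linarith
 qed
 then show "EX N. ALL n>=N. norm (c' (xs n) (ys n) - c' x y) < r" by (simp add: eventually_sequentially)
qed

text \<open>The slope \<open>k\<close> can be lost only on [-1, 1], an interval of length 2, and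
  there \<open>g\<close> still does not decrease.\<close>

lemma increasing_outside_unit:
 fixes g :: "real => real"
 assumes deriv: "!!x. (g has_real_derivative g' x) (at x)"
  and g': "!!x. 0 <= g' x" "!!x. 1 <= abs x ==> k <= g' x" "0 <= k" and xy: "x <= y"
 shows "k * (y - x - 2) <= g y - g x"
proof -
 have mono: "g u <= g v" if "u <= v" for u v
  by (rule DERIV_nonneg_imp_nondecreasing[OF that]) (use deriv g'(1) in blast)
 have out: "k * (v - u) <= g v - g u" if "u <= v" "v <= - 1 \<or> 1 <= u" for u v
 proof -
  have "g u - k * u <= g v - k * v"
  proof (rule DERIV_nonneg_imp_nondecreasing[OF that(1)])
   fix z assume "u <= z" "z <= v"
   then have "k <= g' z" using that(2) by (intro g'(2)) linarith
   moreover have "((%z. g z - k * z) has_real_derivative g' z - k) (at z)"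
    by (auto intro!: derivative_eq_intros deriv)
   ultimately show "EX d. ((%z. g z - k * z) has_real_derivative d) (at z) & 0 <= d" by force
  qed
  then show ?thesis by (simp add: algebra_simps)
 qed
 define u where "u = max x (min y (- 1))"
 define v where "v = min y (max x 1)"
 have uv: "x <= u" "u <= v" "v <= y" "v - u <= 2" using xy by (auto simp: u_def v_def)
 have "k * (u - x) <= g u - g x" by (cases "x <= - 1") (auto simp: u_def intro!: out)
 moreover have "k * (y - v) <= g y - g v" by (cases "1 <= y") (auto simp: v_def intro!: out)
 moreover have "g u <= g v" by (rule mono[OF uv(2)])
 moreover have "k * (y - x - 2) <= k * (u - x) + k * (y - v)"
  using uv(4) g'(3) by (simp add: distrib_left[symmetric] mult_left_mono)
 ultimately show ?thesis by linarith
qed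

text \<open>In the spirit of Fekete's lemma: repeated use of the hypothesis shows that every
  \<open>(w s - K) / s\<close> lies below every \<open>(w t + K) / t\<close>, and the slope
  \<open>r\<close> is chosen between them.\<close>

lemma quasi_additive:
 fixes w :: "real => real"
 assumes mono: "!!s t. 0 <= s ==> s <= t ==> w s <= w t" and nonneg: "0 <= w 0"
  and add: "!!s t. 0 <= s ==> 0 <= t ==> abs (w (s + t) - w s - w t) <= K"
 shows "EX r>=0. ALL t>=0. abs (w t - r * t) <= K"
proof -
 have w0: "0 <= w t" if "0 <= t" for t using mono[OF order_refl that] nonneg by simp
 have K0: "w 0 <= K" using add[of 0 0] by simp
 have mult: "real n * (w t - K) <= w (real n * t)" "w (real n * t) <= real n * (w t + K)"
  if "0 <= t" "0 < n" for n :: nat and t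
 proof -
  have "real n * (w t - K) + K <= w (real n * t) & w (real n * t) <= real n * (w t + K) - K" using that(2)
  proof (induction n rule: nat_induct_non_zero)
   case (Suc n)
   have "0 <= real n * t" using that(1) by simp
   from add[OF this that(1)] Suc.IH show ?case by (simp add: algebra_simps) linarith
  qed simp
  then show "real n * (w t - K) <= w (real n * t)" "w (real n * t) <= real n * (w t + K)"
   using K0 nonneg by linarith+
 qed
 \<comment> \<open>\<open>m\<close> steps of length \<open>t\<close> just cover \<open>Suc n\<close>
   steps of length \<open>s\<close>; the rounding error, at most one step, vanishes relative to the
   total as \<open>n\<close> grows.\<close>
 have cross: "(w s - K) / s <= (w t + K) / t" if st: "0 < s" "0 < t" for s t
 proof (rule LIMSEQ_le_const)
  show "(%n. (w t + K) / t + (w t + K) / s * (1 / real (Suc n))) \<longlonglongrightarrow> (w t + K) / t"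
   by real_asymp
  have "(w s - K) / s <= (w t + K) / t + (w t + K) / s * (1 / real (Suc n))" for n
  proof -
   define m where "m = nat \<lceil>real (Suc n) * s / t\<rceil>"
   have m: "real (Suc n) * s / t <= real m" "real m <= real (Suc n) * s / t + 1"
    using st by (auto simp: m_def) linarith?
   have m0: "0 < m" using m(1) st by (intro gr0I) (auto simp: divide_le_0_iff mult_le_0_iff)
   have "real (Suc n) * (w s - K) <= w (real (Suc n) * s)" using st by (intro mult) auto
   also have "\<dots> <= w (real m * t)" using m(1) st by (intro mono) (auto simp: field_simps)
   also have "\<dots> <= real m * (w t + K)" using st m0 by (intro mult) auto
   also have "\<dots> <= (real (Suc n) * s / t + 1) * (w t + K)"
    using m(2) w0[of t] st K0 nonneg by (intro mult_right_mono) auto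
   finally have "real (Suc n) * (w s - K) / (real (Suc n) * s)
     <= (real (Suc n) * s / t + 1) * (w t + K) / (real (Suc n) * s)" using st by (intro divide_right_mono) auto
   moreover have "(real (Suc n) * s / t + 1) * (w t + K) / (real (Suc n) * s)
     = (w t + K) / t + (w t + K) / s * (1 / real (Suc n))" using st by (simp add: field_simps del: of_nat_Suc)
   ultimately show ?thesis by (simp del: of_nat_Suc)
  qed
  then show "EX N. ALL n>=N. (w s - K) / s <= (w t + K) / t + (w t + K) / s * (1 / real (Suc n))" by blast
 qed
 define r where "r = (SUP s\<in>{0<..}. (w s - K) / s)"
 have bdd: "bdd_above ((%s. (w s - K) / s) ` {0<..})" by (rule bdd_aboveI2, rule cross[of _ 1]) auto
 have lower: "(w t - K) / t <= r" if "0 < t" for t unfolding r_def using that by (intro cSUP_upper bdd) simp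
 have upper: "r <= (w t + K) / t" if "0 < t" for t unfolding r_def by (rule cSUP_least) (use cross that in auto)
 have bound: "abs (w t - r * t) <= K" if "0 <= t" for t
 proof (cases "t = 0")
  case True
  then show ?thesis using K0 nonneg by simp
 next
  case False
  then have "0 < t" using that by simp
  with lower[OF this] upper[OF this] show ?thesis by (simp add: field_simps abs_le_iff)
 qed
 moreover have "0 <= r"
 proof (rule ccontr)
  assume "~ 0 <= r"
  then have r: "r < 0" by simp
  define t where "t = (K + 1) / - r"
  have t: "0 <= t" using r K0 nonneg unfolding t_def by (intro divide_nonneg_nonneg) linarith+
  have "- (r * t) = K + 1" using r by (simp add: t_def)
  with bound[OF t] w0[OF t] show False by linarith
 qed
 ultimately show ?thesis by blast
qed

text \<open>Of total mass \<open>1 / e\<close> and not normalized, so that integrals against it are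
  discounted costs.\<close>

definition discount :: "real => real measure" where
 "discount e = density lborel (%s. ennreal (indicator {0..} s * exp (- e * s)))"

lemma sets_discount [simp, measurable_cong]: "sets (discount e) = sets borel" by (simp add: discount_def)

lemma space_discount [simp]: "space (discount e) = UNIV" by (simp add: discount_def)

lemma nn_integral_discount:
 assumes [measurable]: "g \<in> borel_measurable borel"
 shows "(\<integral>\<^sup>+s. g s \<partial>discount e) = (\<integral>\<^sup>+s\<in>{0..}. ennreal (exp (- e * s)) * g s \<partial>lborel)"
 unfolding discount_def by (subst nn_integral_density) (auto intro!: nn_integral_cong simp: indicator_def ac_simps)

lemma integral_discount:
 fixes g :: "real => real"
 assumes [measurable]: "g \<in> borel_measurable borel"
 shows "(\<integral>s. g s \<partial>discount e) = (\<integral>s. indicator {0..} s * exp (- e * s) * g s \<partial>lborel)"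
 unfolding discount_def by (subst integral_density) (auto simp: indicator_def)

lemma AE_discount: "AE s in discount e. 0 <= s"
 unfolding discount_def by (subst AE_density) (auto simp: indicator_def)

lemma emeasure_discount:
 assumes "0 < e" "0 <= t"
 shows "emeasure (discount e) {t..} = ennreal (exp (- e * t) / e)"
proof -
 have "emeasure (discount e) {t..} = (\<integral>\<^sup>+s. ennreal (exp (- e * s)) * indicator {t..} s \<partial>lborel)"
  unfolding discount_def using assms(2)
  by (subst emeasure_density) (auto intro!: nn_integral_cong simp: indicator_def)
 also have "\<dots> = ennreal (0 - (- exp (- e * t) / e))"
 proof (rule nn_integral_FTC_atLeast)
  show "((%s. - exp (- e * s) / e) has_real_derivative exp (- e * s)) (at s)" for s
   using assms by (auto intro!: derivative_eq_intros)
  show "((%s. - exp (- e * s) / e) \<longlongrightarrow> 0) at_top" using assms by real_asymp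
 qed auto
 finally show ?thesis by simp
qed

lemma nn_integral_discount_id:
 assumes "0 < e"
 shows "(\<integral>\<^sup>+s. ennreal s \<partial>discount e) = ennreal (1 / e ^ 2)"
proof -
 have "(\<integral>\<^sup>+s. ennreal s \<partial>discount e) = (\<integral>\<^sup>+s. ennreal (exp (- e * s) * s) * indicator {0..} s \<partial>lborel)"
  by (subst nn_integral_discount) (auto intro!: nn_integral_cong simp: indicator_def ennreal_mult)
 also have "\<dots> = ennreal (0 - (- (0 / e + 1 / e ^ 2) * exp (- e * 0)))"
 proof (rule nn_integral_FTC_atLeast)
  show "((%s. - (s / e + 1 / e ^ 2) * exp (- e * s)) has_real_derivative exp (- e * s) * s) (at s)" for s
   using assms by (auto intro!: derivative_eq_intros simp: field_simps power2_eq_square)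
  show "((%s. - (s / e + 1 / e ^ 2) * exp (- e * s)) \<longlongrightarrow> 0) at_top" using assms by real_asymp
 qed auto
 finally show ?thesis by simp
qed

lemma finite_measure_discount: "0 < e ==> finite_measure (discount e)"
proof (rule finite_measureI)
 assume e: "0 < e"
 have "emeasure (discount e) (space (discount e)) = emeasure (discount e) {0..}"
  by (rule emeasure_eq_AE) (use AE_discount[of e] in auto)
 then show "emeasure (discount e) (space (discount e)) \<noteq> \<infinity>"
  using emeasure_discount[OF e, of 0] by simp
qed

lemma measure_discount: "0 < e ==> measure (discount e) UNIV = 1 / e"
proof -
 assume e: "0 < e"
 have "emeasure (discount e) UNIV = emeasure (discount e) {0..}"
  by (rule emeasure_eq_AE) (use AE_discount[of e] in auto)
 then show ?thesis using emeasure_discount[OF e, of 0] e by (simp add: measure_def)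
qed

lemma integral_discount_exp: "0 < e ==> 0 <= l ==> (\<integral>s. exp (- l * s) \<partial>discount e) = 1 / (e + l)"
proof -
 assume "0 < e" "0 <= l"
 then have "1 / (e + l) = (\<integral>s. 1 \<partial>discount (e + l))" using measure_discount[of "e + l"] by simp
 also have "\<dots> = (\<integral>s. exp (- l * s) \<partial>discount e)" by (subst (1 2) integral_discount)
   (auto intro!: Bochner_Integration.integral_cong simp: mult_exp_exp algebra_simps)
 finally show ?thesis by simp
qed

lemma integral_discount_shift:
 fixes g :: "real => real"
 assumes [measurable]: "g \<in> borel_measurable borel" and t: "0 <= t"
 shows "(\<integral>s. indicator {t..} s * g s \<partial>discount e) = exp (- e * t) * (\<integral>s. g (t + s) \<partial>discount e)"
proof -
 have "(\<integral>s. indicator {t..} s * g s \<partial>discount e)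
   = (\<integral>s. indicator {0..} s * exp (- e * s) * (indicator {t..} s * g s) \<partial>lborel)"
  by (rule integral_discount) measurable
 also have "\<dots> = (\<integral>s. indicator {0..} (t + 1 * s) * exp (- e * (t + 1 * s)) * (indicator {t..} (t + 1 * s) * g (t + 1 * s)) \<partial>lborel)"
  by (subst lborel_integral_real_affine[of 1 _ t]) auto
 also have "\<dots> = (\<integral>s. exp (- e * t) * (indicator {0..} s * exp (- e * s) * g (t + s)) \<partial>lborel)"
  using t by (intro Bochner_Integration.integral_cong)
   (auto simp: indicator_def mult_exp_exp algebra_simps)
 also have "\<dots> = exp (- e * t) * (\<integral>s. g (t + s) \<partial>discount e)"
  by (subst integral_discount) auto
 finally show ?thesis .
qed

section \<open>Discounted means\<close>

context regular_levy
begin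

text \<open>The adjoint function, when \<open>h\<close> is \<open>cx\<close> at a fixed
  parameter.\<close>

definition discounted_mean :: "(real => real) => real => real => real => real => real" where
 "discounted_mean h e a b y = (\<integral>s. mean_pos h a b y (max 0 s) \<partial>discount e)"

lemma mean_pos_integrable_discount:
 assumes "a < b" "continuous_on UNIV h" "0 < e"
 shows "integrable (discount e) (%s. mean_pos h a b y (max 0 s))"
proof -
 obtain B where B: "ALL z. a <= z --> z <= b --> abs (h z) <= B"
  using continuous_bounded_Icc[OF assms(2)] by blast
 interpret finite_measure "discount e" by (rule finite_measure_discount[OF assms(3)])
 show ?thesis
 proof (rule integrable_const_bound[of _ B])
  show "AE s in discount e. norm (mean_pos h a b y (max 0 s)) <= B"
   unfolding real_norm_def by (intro AE_I2 mean_pos_bound assms(1,2) B[rule_format]) auto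
  show "(%s. mean_pos h a b y (max 0 s)) \<in> borel_measurable (discount e)"
   using mean_pos_measurable[OF assms(1,2), of y] by simp
 qed
qed

lemma discounted_mean_tendsto:
 assumes ab: "!!n. as n < bs n" "a < b" and e: "0 < e"
  and lim: "as \<longlonglongrightarrow> a" "bs \<longlonglongrightarrow> b" "xs \<longlonglongrightarrow> x"
  and hn: "!!n. continuous_on UNIV (hn n)" "continuous_on UNIV h"
  and h: "!!y ys. ys \<longlonglongrightarrow> y ==> (%n. hn n (ys n)) \<longlonglongrightarrow> h y"
  and B: "!!n y. as n <= y ==> y <= bs n ==> abs (hn n y) <= B"
 shows "(%n. discounted_mean (hn n) e (as n) (bs n) (xs n)) \<longlonglongrightarrow> discounted_mean h e a b x"
 unfolding discounted_mean_def
proof (rule integral_dominated_convergence[where w = "%_. B"])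
 interpret finite_measure "discount e" by (rule finite_measure_discount[OF e])
 show "integrable (discount e) (%_. B)" by simp
 show "(%s. mean_pos h a b x (max 0 s)) \<in> borel_measurable (discount e)"
  using mean_pos_measurable[OF ab(2) hn(2), of x] by simp
 show "(%s. mean_pos (hn n) (as n) (bs n) (xs n) (max 0 s)) \<in> borel_measurable (discount e)" for n
  using mean_pos_measurable[OF ab(1) hn(1), of n n "xs n"] by simp
 show "AE s in discount e. (%n. mean_pos (hn n) (as n) (bs n) (xs n) (max 0 s)) \<longlonglongrightarrow> mean_pos h a b x (max 0 s)"
  by (rule AE_I2, rule mean_pos_tendsto[OF ab _ lim hn h B]) simp_all
 show "AE s in discount e. norm (mean_pos (hn n) (as n) (bs n) (xs n) (max 0 s)) <= B" for n
  unfolding real_norm_def by (intro AE_I2 mean_pos_bound ab hn B) auto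
qed

lemma mean_pos_spread_nonneg:
 assumes "a < b" "0 <= t" "continuous_on UNIV h" "mono h"
 shows "mean_pos h a b a t <= mean_pos h a b b t" unfolding mean_pos_def
proof (rule integral_mono)
 show "h (pos_at 0 a b a t w) <= h (pos_at 0 a b b t w)" for w
  by (rule monoD[OF assms(4) refl_pos_mono[OF less_imp_le[OF assms(1)] path_tame[OF order_refl assms(1)]
     less_imp_le[OF assms(1)] path_tame[OF order_refl assms(1)] assms(2)]])
   (use assms(1) in auto)
qed (intro integrable_pos assms order_refl)+

text \<open>Started from \<open>a\<close> and from \<open>b\<close>, the two positions are
  \<open>b - a\<close> apart until pushed. Only the upward push of the lower one and the downward
  push of the upper one close the gap, and each has expectation at most
  \<open>(b - a) / 4 + 4 * K\<close>.\<close>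

lemma mean_pos_spread_lower:
 assumes K: "control_constant K" and ab: "a < b" "1 <= b - a" and t: "0 <= t" "t <= 1" and h: "continuous_on UNIV h"
  and k: "0 <= k" "!!x y. x <= y ==> k * (y - x - 2) <= h y - h x"
 shows "k * ((b - a) / 2 - 8 * K - 2) <= mean_pos h a b b t - mean_pos h a b a t"
proof -
 note T = path_tame[OF order_refl ab(1)]
 have K0: "0 <= K" using K by (simp add: control_constant_def)
 let ?P = "%x w. pos_at 0 a b x t w"
 let ?U = "%x w. up_at 0 a b x t w" and ?D = "%x w. down_at 0 a b x t w"
 note i = refl_integrable[OF order_refl t(1) ab(1)]
 have pos: "0 <= ?U x w" "0 <= ?D x w" for x w using refl_feasible[OF less_imp_le[OF ab(1)] T, of x w] t(1)
  unfolding feasible_def mono_on_def by (meson atLeast_iff order.trans order_refl)+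
 \<comment> \<open>The constant 4 is a factor 2 from \<open>t <= 1\<close> and a factor 2 from the
   width being at least 1.\<close>
 have c: "control_bound K a b x t <= (b - a) / 4 + 4 * K" if "x = a \<or> x = b" for x
 proof -
  have "1 / (b - a) <= 1" using ab(2) by simp
  then have "K * (1 + 1 / (b - a)) <= K * 2" using K0 by (intro mult_left_mono) auto
  then have "(t + 1) * (K * (1 + 1 / (b - a))) <= 2 * (K * 2)" using t K0 ab by (intro mult_mono) auto
  then show ?thesis unfolding control_bound_def using that ab(1) by auto
 qed
 have "(b - a) / 2 - 8 * K <= (b - a) - expectation (?U a) - expectation (?D b)"
  using refl_controls_bound(1)[OF K ab(1) t(1), of a] refl_controls_bound(2)[OF K ab(1) t(1), of b]
   c[OF disjI1[OF refl]] c[OF disjI2[OF refl]] by argo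
 also have "\<dots> = expectation (%w. (b - a) - ?U a w - ?D b w)" using i(1,2) by (simp add: prob_space)
 also have "\<dots> <= expectation (%w. ?P b w - ?P a w)"
 proof (rule integral_mono)
  show "b - a - ?U a w - ?D b w <= ?P b w - ?P a w" for w
   unfolding refl_pos_def using pos(1)[of b w] pos(2)[of a w] by simp
 qed (intro Bochner_Integration.integrable_diff i integrable_const)+
 finally have "k * ((b - a) / 2 - 8 * K - 2) <= k * (expectation (%w. ?P b w - ?P a w) - 2)"
  using k(1) by (intro mult_left_mono) auto
 also have "\<dots> = expectation (%w. k * (?P b w - ?P a w - 2))" using i(3) by (simp add: prob_space)
 also have "\<dots> <= expectation (%w. h (?P b w) - h (?P a w))"
 proof (rule integral_mono)
  show "k * (?P b w - ?P a w - 2) <= h (?P b w) - h (?P a w)" for w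
   by (intro k(2) refl_pos_mono[OF less_imp_le[OF ab(1)] T less_imp_le[OF ab(1)] T t(1)])
    (use ab in auto)
 qed (intro Bochner_Integration.integrable_diff integrable_mult_right i integrable_const
   integrable_pos h ab order_refl t)+
 also have "\<dots> = mean_pos h a b b t - mean_pos h a b a t"
  unfolding mean_pos_def by (intro Bochner_Integration.integral_diff integrable_pos h ab order_refl t)
 finally show ?thesis .
qed

text \<open>Only times in [0, 1] are counted, where \<open>e <= 1\<close> keeps the discount factor
  above \<open>exp (- 1)\<close>; monotonicity of \<open>h\<close> makes the other times contribute
  non-negatively. The bound is thus uniform in \<open>e\<close>.\<close>

lemma discounted_mean_spread_lower:
 assumes K: "control_constant K" and ab1: "1 <= b - a" and e: "0 < e" "e <= 1" and h: "continuous_on UNIV h" "mono h"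
  and k: "0 <= k" and kh: "!!x y. x <= y ==> k * (y - x - 2) <= h y - h x" and pos: "0 <= (b - a) / 2 - 8 * K - 2"
 shows "k * ((b - a) / 2 - 8 * K - 2) * exp (- 1) <= discounted_mean h e a b b - discounted_mean h e a b a"
proof -
 have ab: "a < b" using ab1 by simp
 define m where "m = k * ((b - a) / 2 - 8 * K - 2)"
 have m: "0 <= m" using k pos by (simp add: m_def)
 let ?d = "%s. mean_pos h a b b (max 0 s) - mean_pos h a b a (max 0 s)"
 interpret finite_measure "discount e" by (rule finite_measure_discount[OF e(1)])
 note int = mean_pos_integrable_discount[OF ab h(1) e(1)]
 have "exp (- 1) = (\<integral>s. indicator {0..1::real} s * exp (- 1 :: real) \<partial>lborel)" by simp
 also have "\<dots> <= (\<integral>s. indicator {0..} s * exp (- e * s) * indicator {0..1} s \<partial>lborel)"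
 proof (rule integral_mono)
  have "integrable lborel (%s. indicator {0..1} s *\<^sub>R exp (- e * s))"
   by (rule borel_integrable_atLeastAtMost'[unfolded set_integrable_def]) (intro continuous_intros)
  then show "integrable lborel (%s. indicator {0..} s * exp (- e * s) * indicator {0..1} s)"
   by (rule Bochner_Integration.integrable_cong[THEN iffD1, rotated 2]) (auto simp: indicator_def)
  fix s :: real
  show "indicator {0..1} s * exp (- 1) <= indicator {0..} s * exp (- e * s) * indicator {0..1} s"
   using e mult_mono[of e 1 s 1] by (auto simp: indicator_def)
 qed simp
 also have "\<dots> = (\<integral>s. indicator {0..1} s \<partial>discount e)" by (rule integral_discount[symmetric]) simp
 finally have "m * exp (- 1) <= m * (\<integral>s. indicator {0..1} s \<partial>discount e)"
  using m by (rule mult_left_mono)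
 also have "\<dots> = (\<integral>s. m * indicator {0..1} s \<partial>discount e)" by simp
 also have "\<dots> <= (\<integral>s. ?d s \<partial>discount e)"
 proof (rule integral_mono)
  show "integrable (discount e) (%s. m * indicator {0..1} s)" by (simp add: less_top[symmetric])
  show "integrable (discount e) ?d" by (intro Bochner_Integration.integrable_diff int)
  fix s :: real
  have n: "0 <= ?d s" using mean_pos_spread_nonneg[OF ab _ h, of "max 0 s"] by simp
  show "m * indicator {0..1} s <= ?d s"
  proof (cases "s \<in> {0..1}")
   case True
   then have "m <= ?d s" unfolding m_def using mean_pos_spread_lower[OF K ab ab1 _ _ h(1) k kh, of s] by auto
   then show ?thesis using True by simp
  qed (use n in simp)
 qed
 also have "\<dots> = discounted_mean h e a b b - discounted_mean h e a b a"
  unfolding discounted_mean_def by (intro Bochner_Integration.integral_diff int)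
 finally show ?thesis unfolding m_def .
qed

lemma discounted_mean_nonneg:
 assumes "a < b" "!!y. a <= y ==> y <= b ==> 0 <= h y"
 shows "0 <= discounted_mean h e a b x" unfolding discounted_mean_def mean_pos_def
 by (intro Bochner_Integration.integral_nonneg assms refl_bounds) auto

lemma discounted_mean_uminus: "discounted_mean (%y. - h y) e a b x = - discounted_mean h e a b x"
 by (simp add: discounted_mean_def mean_pos_def)

end

context dropping_levy
begin

text \<open>The mixing bound for \<open>h - h a\<close>, whose size on the band is
  \<open>h b - h a\<close>, decays like \<open>exp (- l * s)\<close> and integrates to at most
  \<open>1 / l\<close> whatever the discount rate.\<close>

lemma discounted_mean_spread_upper:
 assumes m: "mixing_rate W C l" and ab: "a < b" "b - a <= W" and e: "0 < e" and h: "continuous_on UNIV h" "mono h"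
 shows "discounted_mean h e a b b - discounted_mean h e a b a <= 2 * C / l * (h b - h a)"
proof -
 note C = mixing_rateD(1,2)[OF m]
 interpret finite_measure "discount e" by (rule finite_measure_discount[OF e])
 note int = mean_pos_integrable_discount[OF ab(1) h(1) e]
 let ?d = "%s. mean_pos h a b b (max 0 s) - mean_pos h a b a (max 0 s)"
 have hc: "continuous_on UNIV (%z. h z - h a)" by (intro continuous_intros h)
 have hab: "0 <= h b - h a" using monoD[OF h(2), of a b] ab(1) by simp
 have d: "?d s <= 2 * (h b - h a) * C * exp (- l * s)" if s: "0 <= s" for s
 proof -
  have sub: "mean_pos (%z. h z - h a) a b x s = mean_pos h a b x s - h a" for x
   unfolding mean_pos_def using integrable_pos[OF ab(1) order_refl s h(1)] by (simp add: prob_space)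
  have "ALL z. a <= z --> z <= b --> abs (h z - h a) <= h b - h a"
  proof (intro allI impI)
   fix z assume "a <= z" "z <= b"
   then show "abs (h z - h a) <= h b - h a" using monoD[OF h(2), of a z] monoD[OF h(2), of z b] by simp
  qed
  from mixing_rateD(3)[OF m ab order_refl s hc this, of b a]
  show ?thesis using s by (simp add: sub)
 qed
 have "discounted_mean h e a b b - discounted_mean h e a b a = (\<integral>s. ?d s \<partial>discount e)"
  unfolding discounted_mean_def by (intro Bochner_Integration.integral_diff[symmetric] int)
 also have "\<dots> <= (\<integral>s. 2 * (h b - h a) * C * exp (- l * s) \<partial>discount e)"
 proof (rule integral_mono_AE)
  show "integrable (discount e) ?d" by (intro Bochner_Integration.integrable_diff int)
  have "integrable (discount e) (%s. exp (- l * s))"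
   by (rule integrable_const_bound[of _ 1]) (use AE_discount[of e] C in \<open>auto elim!: eventually_mono\<close>)
  then show "integrable (discount e) (%s. 2 * (h b - h a) * C * exp (- l * s))" by simp
  show "AE s in discount e. ?d s <= 2 * (h b - h a) * C * exp (- l * s)"
   using AE_discount[of e] by eventually_elim (rule d)
 qed
 also have "\<dots> = 2 * (h b - h a) * C * (1 / (e + l))" using integral_discount_exp[OF e, of l] C by simp
 also have "\<dots> <= 2 * (h b - h a) * C * (1 / l)" using hab C e by (intro mult_left_mono divide_left_mono) auto
 finally show ?thesis by (simp add: field_simps)
qed

end

section \<open>Optimality of reflection\<close>

text \<open>For \<open>s >= 0\<close> this is the path frozen at the last dyadic time before or at
  \<open>s\<close> and stopped at time \<open>m\<close>. As a sum of increments times indicators of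
  future intervals, it splits an integral of the path into integrals with weights known when their
  interval begins.\<close>

definition dyadic_path :: "(real => real) => nat => nat => real => real" where
 "dyadic_path y m n s = y 0 * indicator {0..} s +
   (\<Sum>k<m * 2 ^ n. (y ((real k + 1) / 2 ^ n) - y (real k / 2 ^ n)) * indicator {(real k + 1) / 2 ^ n..} s)"

lemma dyadic_path_eq:
 assumes "0 <= s"
 shows "dyadic_path y m n s = y (min (real m) (real (nat \<lfloor>s * 2 ^ n\<rfloor>) / 2 ^ n))"
proof -
 define j where "j = nat \<lfloor>s * 2 ^ n\<rfloor>"
 have le: "(real k + 1) / 2 ^ n <= s \<longleftrightarrow> k < j" for k
 proof -
  have "(real k + 1) / 2 ^ n <= s \<longleftrightarrow> of_int (int k + 1) <= s * 2 ^ n" by (simp add: field_simps)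
  also have "\<dots> \<longleftrightarrow> int k + 1 <= \<lfloor>s * 2 ^ n\<rfloor>" by (rule le_floor_iff[symmetric])
  also have "\<dots> \<longleftrightarrow> k < j" using assms by (auto simp: j_def)
  finally show ?thesis .
 qed
 have ind: "indicator {(real k + 1) / 2 ^ n..} s = (if k < j then 1 else 0 :: real)" for k
  using le[of k] by (simp add: indicator_def)
 have "y 0 + (\<Sum>k<K. (y ((real k + 1) / 2 ^ n) - y (real k / 2 ^ n)) * (if k < j then 1 else 0))
   = y (real (min K j) / 2 ^ n)" for K
 proof (induction K)
  case (Suc K)
  then show ?case by (cases "K < j") (auto simp: min_def add.commute)
 qed simp
 then have "dyadic_path y m n s = y (real (min (m * 2 ^ n) j) / 2 ^ n)"
  unfolding dyadic_path_def ind using assms by simp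
 also have "real (min (m * 2 ^ n) j) / 2 ^ n = min (real m) (real j / 2 ^ n)"
 proof -
  have "real m <= real j / 2 ^ n \<longleftrightarrow> real (m * 2 ^ n) <= real j" by (simp add: field_simps)
  then show ?thesis unfolding of_nat_le_iff by (auto simp: min_def)
 qed
 finally show ?thesis by (simp add: j_def)
qed

lemma dyadic_floor:
 assumes "0 <= s"
 shows "real (nat \<lfloor>s * 2 ^ n\<rfloor>) / 2 ^ n <= s" "(%n. real (nat \<lfloor>s * 2 ^ n\<rfloor>) / 2 ^ n) \<longlonglongrightarrow> s"
proof -
 have j: "real (nat \<lfloor>s * 2 ^ n\<rfloor>) = of_int \<lfloor>s * 2 ^ n\<rfloor>" for n using assms by simp
 show "real (nat \<lfloor>s * 2 ^ n\<rfloor>) / 2 ^ n <= s" unfolding j by (simp add: field_simps)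
 have "abs (real (nat \<lfloor>s * 2 ^ n\<rfloor>) / 2 ^ n - s) <= 1 / 2 ^ n" for n
 proof -
  have "real (nat \<lfloor>s * 2 ^ n\<rfloor>) / 2 ^ n - s = (of_int \<lfloor>s * 2 ^ n\<rfloor> - s * 2 ^ n) / 2 ^ n"
   unfolding j by (simp add: field_simps)
  moreover have "abs (of_int \<lfloor>s * 2 ^ n\<rfloor> - s * 2 ^ n) <= 1" by linarith
  ultimately show ?thesis by (simp add: divide_right_mono)
 qed
 then show "(%n. real (nat \<lfloor>s * 2 ^ n\<rfloor>) / 2 ^ n) \<longlonglongrightarrow> s"
  by (intro LIM_zero_cancel[OF Lim_null_comparison[OF _ tendsto_half_power]] always_eventually) simp
qed

lemma dyadic_ceiling:
 assumes "0 <= s"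
 shows "s <= real (nat \<lceil>s * 2 ^ n\<rceil>) / 2 ^ n" "(%n. real (nat \<lceil>s * 2 ^ n\<rceil>) / 2 ^ n) \<longlonglongrightarrow> s"
proof -
 have j: "real (nat \<lceil>s * 2 ^ n\<rceil>) = of_int \<lceil>s * 2 ^ n\<rceil>" for n
 proof -
  have "- 1 < s * 2 ^ n" by (rule less_le_trans[of _ 0]) (use assms in auto)
  then show ?thesis by simp
 qed
 show "s <= real (nat \<lceil>s * 2 ^ n\<rceil>) / 2 ^ n" unfolding j by (simp add: field_simps)
 have "abs (real (nat \<lceil>s * 2 ^ n\<rceil>) / 2 ^ n - s) <= 1 / 2 ^ n" for n
 proof -
  have "real (nat \<lceil>s * 2 ^ n\<rceil>) / 2 ^ n - s = (of_int \<lceil>s * 2 ^ n\<rceil> - s * 2 ^ n) / 2 ^ n"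
   unfolding j by (simp add: field_simps)
  moreover have "abs (of_int \<lceil>s * 2 ^ n\<rceil> - s * 2 ^ n) <= 1" by linarith
  ultimately show ?thesis by (simp add: divide_right_mono)
 qed
 then show "(%n. real (nat \<lceil>s * 2 ^ n\<rceil>) / 2 ^ n) \<longlonglongrightarrow> s"
  by (intro LIM_zero_cancel[OF Lim_null_comparison[OF _ tendsto_half_power]] always_eventually) simp
qed

lemma AE_lborel_discount: "AE s in lborel. P s ==> AE s in discount e. P s"
 unfolding discount_def by (subst AE_density) (auto elim!: eventually_mono)

text \<open>A monotone path has countably many discontinuities, a null set of times; at all other
  times approximation from below is harmless.\<close>

lemma AE_dyadic_path_tendsto:
 assumes "mono_on {0..} y"
 shows "AE s in discount e. (%n. dyadic_path y m n s) \<longlonglongrightarrow> y (min (real m) s)"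
proof -
 let ?z = "%s. y (min (real m) s)"
 have "mono_on {0..} ?z" using assms by (auto simp: mono_on_def)
 then have "countable {s\<in>{0..}. ~ continuous (at s within {0..}) ?z}" by (rule mono_on_ctble_discont)
 then have "{s\<in>{0..}. ~ continuous (at s within {0..}) ?z} \<in> null_sets lborel"
  by (rule countable_imp_null_set_lborel)
 then have "AE s in discount e. s \<notin> {s\<in>{0..}. ~ continuous (at s within {0..}) ?z}"
  by (intro AE_lborel_discount AE_not_in)
 with AE_discount[of e] show ?thesis
 proof eventually_elim
  case (elim s)
  then have "continuous (at s within {0..}) ?z" by auto
  then have "(%n. ?z (real (nat \<lfloor>s * 2 ^ n\<rfloor>) / 2 ^ n)) \<longlonglongrightarrow> ?z s"
   by (rule continuous_within_tendsto_compose'[OF _ _ dyadic_floor(2)[OF elim(1)]]) simp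
  then show ?case using elim(1) by (simp add: dyadic_path_eq)
 qed
qed

lemma dyadic_path_nonneg_bounds:
 assumes "mono_on {0..} y" "0 <= s" "0 <= y 0"
 shows "0 <= dyadic_path y m n s" "dyadic_path y m n s <= y s" "dyadic_path y m n s <= y (real m)"
proof -
 let ?t = "min (real m) (real (nat \<lfloor>s * 2 ^ n\<rfloor>) / 2 ^ n)"
 have t: "0 <= ?t" "?t <= s" "?t <= real m" using dyadic_floor(1)[OF assms(2), of n] by auto
 have "y 0 <= y ?t" by (rule mono_onD[OF assms(1)]) (use t in auto)
 then show "0 <= dyadic_path y m n s" using assms(3) by (simp add: dyadic_path_eq[OF assms(2)])
 show "dyadic_path y m n s <= y s" "dyadic_path y m n s <= y (real m)"
  unfolding dyadic_path_eq[OF assms(2)] by (rule mono_onD[OF assms(1)]; use t assms(2) in auto)+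
qed

lemma dyadic_path_bounds:
 assumes "mono_on {0..} y" "0 <= y 0"
 shows "abs (dyadic_path y m n s) <= y (max 0 s)" "abs (dyadic_path y m n s) <= y (real m)"
proof -
 have "abs (dyadic_path y m n s) <= y (max 0 s) & abs (dyadic_path y m n s) <= y (real m)"
 proof (cases "0 <= s")
  case True
  then show ?thesis using dyadic_path_nonneg_bounds[OF assms(1) True assms(2)] by simp
 next
  case False
  have ind: "indicator {(real k + 1) / 2 ^ n..} s = (0 :: real)" "indicator {0..} s = (0 :: real)" for k
  proof -
   have "0 < (real k + 1) / 2 ^ n" by (simp add: add_nonneg_pos)
   then have "~ (real k + 1) / 2 ^ n <= s" using False by linarith
   then show "indicator {(real k + 1) / 2 ^ n..} s = (0 :: real)" by simp
   show "indicator {0..} s = (0 :: real)" using False by simp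
  qed
  have "dyadic_path y m n s = 0" unfolding dyadic_path_def ind by simp
  moreover have "y 0 <= y (real m)" by (rule mono_onD[OF assms(1)]) auto
  moreover have "max 0 s = 0" using False by simp
  ultimately show ?thesis using assms(2) by simp
 qed
 then show "abs (dyadic_path y m n s) <= y (max 0 s)" "abs (dyadic_path y m n s) <= y (real m)" by blast+
qed

text \<open>Right-endpoint sums converge to the Stieltjes integral because the integrand is right-continuous.\<close>

lemma right_endpoint_sums_tendsto_0:
 assumes y: "mono_on {0..} y" "right_cont y" and G: "right_cont G" "!!t. 0 <= t ==> 0 <= G t" "!!t. 0 <= t ==> G t <= g"
  and zero: "(\<integral>\<^sup>+t\<in>{0<..}. ennreal (G t) \<partial>stieltjes y) = 0"
 shows "(%n. \<Sum>k<m * 2 ^ n. (y ((real k + 1) / 2 ^ n) - y (real k / 2 ^ n)) * G ((real k + 1) / 2 ^ n)) \<longlonglongrightarrow> 0"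
proof -
 let ?S = "%n. \<Sum>k<m * 2 ^ n. (y ((real k + 1) / 2 ^ n) - y (real k / 2 ^ n)) * G ((real k + 1) / 2 ^ n)"
 let ?I = "%n k. {real k / 2 ^ n<..(real k + 1) / 2 ^ n}"
 let ?f = "%n s. \<Sum>k<m * 2 ^ n. ennreal (G ((real k + 1) / 2 ^ n)) * indicator (?I n k) s"
 have g: "0 <= g" using G(2,3)[of 0] by simp
 have inc: "0 <= y ((real k + 1) / 2 ^ n) - y (real k / 2 ^ n)" for k n
  using mono_onD[OF y(1), of "real k / 2 ^ n" "(real k + 1) / 2 ^ n"] by (simp add: divide_right_mono)
 have S0: "0 <= ?S n" for n by (intro sum_nonneg mult_nonneg_nonneg inc G) simp
 have int: "(\<integral>\<^sup>+s. ?f n s \<partial>stieltjes y) = ennreal (?S n)" for n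
 proof -
  have "(\<integral>\<^sup>+s. ?f n s \<partial>stieltjes y)
    = (\<Sum>k<m * 2 ^ n. ennreal (G ((real k + 1) / 2 ^ n)) * emeasure (stieltjes y) (?I n k))"
   by (subst nn_integral_sum) (auto simp: nn_integral_cmult_indicator)
  also have "\<dots> = (\<Sum>k<m * 2 ^ n. ennreal ((y ((real k + 1) / 2 ^ n) - y (real k / 2 ^ n)) * G ((real k + 1) / 2 ^ n)))"
   using inc G(2)
   by (intro sum.cong refl) (simp add: emeasure_stieltjes_Ioc[OF y] divide_right_mono ennreal_mult mult.commute)
  also have "\<dots> = ennreal (?S n)" by (intro sum_ennreal mult_nonneg_nonneg inc G) simp
  finally show ?thesis .
 qed
 \<comment> \<open>The sum of indicators evaluates \<open>G\<close> at the right endpoint of the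
   dyadic cell containing \<open>s\<close>, which is a ceiling; the endpoints tend to
   \<open>s\<close> from the right.\<close>
 have f: "?f n s = ennreal (G (real (nat \<lceil>s * 2 ^ n\<rceil>) / 2 ^ n)) * indicator {0<..real m} s" for n s
 proof -
  define j where "j = \<lceil>s * 2 ^ n\<rceil>"
  have mem: "s \<in> ?I n k \<longleftrightarrow> int k + 1 = j" for k
  proof -
   have "s \<in> ?I n k \<longleftrightarrow> of_int (int k + 1) - 1 < s * 2 ^ n & s * 2 ^ n <= of_int (int k + 1)"
    by (simp add: field_simps)
   also have "\<dots> \<longleftrightarrow> int k + 1 = j" unfolding j_def by (subst ceiling_eq_iff[symmetric]) auto
   finally show ?thesis .
  qed
  have pos: "0 < s \<longleftrightarrow> 1 <= j" 
  proof -
   have "0 < s \<longleftrightarrow> of_int 0 < s * 2 ^ n" by (simp add: zero_less_mult_iff)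
   also have "\<dots> \<longleftrightarrow> 0 < j" unfolding j_def by (rule less_ceiling_iff[symmetric])
   finally show ?thesis by linarith
  qed
  have ub: "s <= real m \<longleftrightarrow> j <= int (m * 2 ^ n)"
  proof -
   have "s <= real m \<longleftrightarrow> s * 2 ^ n <= of_int (int (m * 2 ^ n))" by simp
   also have "\<dots> \<longleftrightarrow> j <= int (m * 2 ^ n)" unfolding j_def by (rule ceiling_le_iff[symmetric])
   finally show ?thesis .
  qed
  show ?thesis
  proof (cases "0 < s & s <= real m")
   case True
   define k where "k = nat (j - 1)"
   have k: "k < m * 2 ^ n" "int k + 1 = j"
    using True pos ub unfolding k_def by (auto simp flip: of_nat_less_iff[where 'a = int])
   have "?f n s = (\<Sum>i<m * 2 ^ n. if i = k then ennreal (G ((real k + 1) / 2 ^ n)) else 0)"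
    by (intro sum.cong refl) (use mem k(2) in \<open>auto simp: indicator_def simp del: greaterThanAtMost_iff\<close>)
   also have "\<dots> = ennreal (G ((real k + 1) / 2 ^ n))" using k(1) by simp
   also have "real k + 1 = real (nat \<lceil>s * 2 ^ n\<rceil>)" using k(2) by (simp add: j_def[symmetric])
   finally show ?thesis using True by simp
  next
   case False
   have "?f n s = (\<Sum>i<m * 2 ^ n. 0)"
   proof (intro sum.cong refl)
    fix i assume "i \<in> {..<m * 2 ^ n}"
    then have "i + 1 <= m * 2 ^ n" by simp
    then have "int i + 1 <= int (m * 2 ^ n)" by linarith
    then have "s \<notin> ?I n i" using False pos ub mem[of i] by linarith
    then show "ennreal (G ((real i + 1) / 2 ^ n)) * indicator (?I n i) s = 0" by simp
   qed
   then show ?thesis using False by (auto simp: indicator_def)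
  qed
 qed
 have "(%n. \<integral>\<^sup>+s. ?f n s \<partial>stieltjes y) \<longlonglongrightarrow> (\<integral>\<^sup>+s. ennreal (G (max 0 s)) * indicator {0<..real m} s \<partial>stieltjes y)"
 proof (rule nn_integral_dominated_convergence[where w = "%s. ennreal g * indicator {0<..real m} s"])
  show "(%s. ennreal (G (max 0 s)) * indicator {0<..real m} s) \<in> borel_measurable (stieltjes y)"
   using right_cont_measurable[OF G(1)] by measurable
  show "AE s in stieltjes y. ?f n s <= ennreal g * indicator {0<..real m} s" for n
   unfolding f by (intro AE_I2 mult_right_mono ennreal_leI G(3)) auto
  show "(\<integral>\<^sup>+s. ennreal g * indicator {0<..real m} s \<partial>stieltjes y) < \<infinity>"
   by (simp add: nn_integral_cmult_indicator emeasure_stieltjes_Ioc[OF y] ennreal_mult_less_top)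
  show "AE s in stieltjes y. (%n. ?f n s) \<longlonglongrightarrow> ennreal (G (max 0 s)) * indicator {0<..real m} s"
  proof (rule AE_I2)
   fix s :: real
   show "(%n. ?f n s) \<longlonglongrightarrow> ennreal (G (max 0 s)) * indicator {0<..real m} s"
   proof (cases "s \<in> {0<..real m}")
    case True
    then have s: "0 <= s" by simp
    have "continuous (at_right s) G" using G(1) s unfolding right_cont_def by blast
    then have "continuous (at s within {s..}) G" unfolding continuous_within by (simp add: at_within_Ici_at_right)
    then have "(%n. G (real (nat \<lceil>s * 2 ^ n\<rceil>) / 2 ^ n)) \<longlonglongrightarrow> G s"
     by (rule continuous_within_tendsto_compose'[OF _ _ dyadic_ceiling(2)[OF s]]) (use dyadic_ceiling(1)[OF s] in simp)
    then show ?thesis unfolding f using True by simp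
   qed (simp add: f)
  qed
 qed measurable
 moreover have "(\<integral>\<^sup>+s. ennreal (G (max 0 s)) * indicator {0<..real m} s \<partial>stieltjes y) = 0"
 proof -
  have "(\<integral>\<^sup>+s. ennreal (G (max 0 s)) * indicator {0<..real m} s \<partial>stieltjes y)
    <= (\<integral>\<^sup>+t\<in>{0<..}. ennreal (G t) \<partial>stieltjes y)"
   by (intro nn_integral_mono) (auto simp: indicator_def)
  then show ?thesis using zero by simp
 qed
 ultimately have "(%n. ennreal (?S n)) \<longlonglongrightarrow> ennreal 0" by (simp only: int ennreal_0)
 then show ?thesis by (rule tendsto_ennrealD) (use S0 in \<open>auto intro!: always_eventually\<close>)
qed

section \<open>Integrals of controls against marginal costs\<close>

context regular_levy
begin

abbreviation "MD e \<equiv> M \<Otimes>\<^sub>M discount e"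
abbreviation "pair_rv \<equiv> borel_measurable (M \<Otimes>\<^sub>M borel)"
abbreviation "pev Y p \<equiv> Y (max 0 (snd p)) (fst p)"

text \<open>One component of an admissible control, with the path conditions required for every
  scenario instead of almost surely.\<close>

definition regular_control :: "(real => 'w => real) => bool" where
 "regular_control Y \<longleftrightarrow> (ALL t>=0. Y t \<in> borel_measurable (F t) & integrable M (Y t)) &
   (ALL w. mono_on {0..} (%t. Y t w) & right_cont (%t. Y t w) & 0 <= Y 0 w)"

lemma regular_controlD:
 assumes "regular_control Y"
 shows "0 <= t ==> Y t \<in> borel_measurable (F t)" "0 <= t ==> integrable M (Y t)"
  "mono_on {0..} (%t. Y t w)" "right_cont (%t. Y t w)" "0 <= Y 0 w"
  "0 <= s ==> s <= t ==> Y s w <= Y t w" "0 <= t ==> 0 <= Y t w"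
proof -
 show m: "mono_on {0..} (%t. Y t w)" and z: "0 <= Y 0 w" and "right_cont (%t. Y t w)"
  using assms unfolding regular_control_def by blast+
 show "0 <= t ==> Y t \<in> borel_measurable (F t)" "0 <= t ==> integrable M (Y t)"
  using assms unfolding regular_control_def by blast+
 show i: "0 <= s ==> s <= t ==> Y s w <= Y t w" for s
  by (rule mono_onD[OF m]) auto
 show "0 <= t ==> 0 <= Y t w" using i[of 0] z by simp
qed

lemma right_cont_pair_measurable:
 assumes "!!t. 0 <= t ==> Y t \<in> borel_measurable M" "!!w. right_cont (%t. Y t w)"
 shows "(%p. pev Y p :: real) \<in> pair_rv"
proof -
 have "(%(t, w). Y (max 0 t) w) \<in> borel_measurable (borel \<Otimes>\<^sub>M M)"
  using assms by (intro right_cont_process_measurable)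
 from measurable_pair_swap[OF this] show ?thesis by (simp add: case_prod_beta')
qed

lemma regular_control_pair_measurable:
 assumes "regular_control Y"
 shows "(%p. pev Y p) \<in> pair_rv" using regular_controlD[OF assms]
 by (intro right_cont_pair_measurable) (auto intro: borel_measurable_integrable)

lemma pair_measurable_discount:
 "borel_measurable (MD e) = pair_rv" by (intro measurable_cong_sets sets_pair_measure_cong) auto

lemma pair_sigma_finite_discount: "0 < e ==> pair_sigma_finite M (discount e)"
 using finite_measure.axioms(1)[OF finite_measure_discount]
 by (intro pair_sigma_finite.intro sigma_finite_measure_axioms)

lemma integrable_pair_mult:
 fixes f :: "'w \<times> real => real"
 assumes e: "0 < e" and Z: "integrable M Z" and f: "f \<in> pair_rv" "!!p. abs (f p) <= B"
 shows "integrable (MD e) (%p. Z (fst p) * f p)"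
proof -
 interpret D: finite_measure "discount e" by (rule finite_measure_discount[OF e])
 have [measurable]: "Z \<in> borel_measurable M" using Z by simp
 have Zi: "integrable (MD e) (%p. Z (fst p))"
 proof (rule integrableI_bounded)
  have "(\<integral>\<^sup>+p. norm (Z (fst p)) \<partial>(MD e)) = (\<integral>\<^sup>+w. \<integral>\<^sup>+s. norm (Z w) \<partial>discount e \<partial>M)"
   by (subst D.nn_integral_fst[symmetric]) auto
  also have "\<dots> = (\<integral>\<^sup>+w. norm (Z w) \<partial>M) * emeasure (discount e) UNIV"
   by (simp add: nn_integral_multc)
  also have "\<dots> < \<infinity>" using Z D.emeasure_finite[of UNIV]
   by (simp add: integrable_iff_bounded ennreal_mult_eq_top_iff less_top[symmetric])
  finally show "(\<integral>\<^sup>+p. norm (Z (fst p)) \<partial>(MD e)) < \<infinity>" .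
 qed measurable
 show ?thesis
 proof (rule Bochner_Integration.integrable_bound[OF integrable_mult_right[OF integrable_abs[OF Zi], of B]])
  show "AE p in MD e. norm (Z (fst p) * f p) <= norm (B * abs (Z (fst p)))"
  proof (rule AE_I2)
   fix p
   have "abs (f p) <= abs B" using f(2)[of p] by linarith
   then show "norm (Z (fst p) * f p) <= norm (B * abs (Z (fst p)))"
    by (simp add: abs_mult mult.commute mult_right_mono)
  qed
  have "f \<in> borel_measurable (MD e)" using f(1) by (simp add: pair_measurable_discount)
  then show "(%p. Z (fst p) * f p) \<in> borel_measurable (MD e)" by measurable
 qed
qed

text \<open>The effect of a push by \<open>Z\<close> at time \<open>t\<close> that is kept for ever,
  when \<open>f\<close> is the marginal cost of displacement.\<close>

definition tail_integral :: "real => ('w \<times> real => real) => real => ('w => real) => real" where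
 "tail_integral e f t Z = (\<integral>p. Z (fst p) * (indicator {t..} (snd p) * f p) \<partial>(MD e))"

text \<open>Each increment of the control acts from the right endpoint of its cell onwards. It is
  known at that time, as the tail estimates require.\<close>

lemma dyadic_integral:
 assumes e: "0 < e" and Y: "regular_control Y" and f: "f \<in> pair_rv" "!!p. abs (f p) <= B"
 shows "integrable (MD e) (%p. dyadic_path (%t. Y t (fst p)) m n (snd p) * f p)" (is "integrable ?P ?g")
  and "(\<integral>p. dyadic_path (%t. Y t (fst p)) m n (snd p) * f p \<partial>(MD e)) =
   tail_integral e f 0 (Y 0) +
   (\<Sum>k<m * 2 ^ n. tail_integral e f ((real k + 1) / 2 ^ n) (%w. Y ((real k + 1) / 2 ^ n) w - Y (real k / 2 ^ n) w))"
proof -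
 let ?Z = "%k w. Y ((real k + 1) / 2 ^ n) w - Y (real k / 2 ^ n) w"
 have eq: "?g = (%p. Y 0 (fst p) * (indicator {0..} (snd p) * f p) +
   (\<Sum>k<m * 2 ^ n. ?Z k (fst p) * (indicator {(real k + 1) / 2 ^ n..} (snd p) * f p)))"
  by (simp only: dyadic_path_def distrib_right sum_distrib_right mult.assoc)
 have i: "integrable ?P (%p. Z (fst p) * (indicator {t..} (snd p) * f p))" if "integrable M Z" for Z t
 proof (rule integrable_pair_mult[OF e that])
  show "(%p. indicator {t..} (snd p) * f p) \<in> pair_rv" using f(1) by measurable
  show "abs (indicator {t..} (snd p) * f p) <= abs B" for p using f(2)[of p] by (auto simp: indicator_def)
 qed
 have i0: "integrable ?P (%p. Y 0 (fst p) * (indicator {0..} (snd p) * f p))"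
  by (rule i[OF regular_controlD(2)[OF Y]]) simp
 have ik: "integrable ?P (%p. ?Z k (fst p) * (indicator {(real k + 1) / 2 ^ n..} (snd p) * f p))" for k
  by (intro i Bochner_Integration.integrable_diff regular_controlD(2)[OF Y]) auto
 show "integrable ?P ?g"
  unfolding eq by (intro Bochner_Integration.integrable_add Bochner_Integration.integrable_sum i0 ik)
 show "(\<integral>p. ?g p \<partial>?P) = tail_integral e f 0 (Y 0) +
   (\<Sum>k<m * 2 ^ n. tail_integral e f ((real k + 1) / 2 ^ n) (?Z k))" unfolding eq tail_integral_def
  by (subst Bochner_Integration.integral_add[OF i0 Bochner_Integration.integrable_sum[OF ik]])
   (simp only: Bochner_Integration.integral_sum[OF ik])
qed

lemma dyadic_integral_tendsto:
 assumes e: "0 < e" and Y: "regular_control Y" and f: "f \<in> pair_rv" "!!p. abs (f p) <= B"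
  and int: "integrable (MD e) (%p. pev Y p)"
 shows "(%n. \<integral>p. dyadic_path (%t. Y t (fst p)) m n (snd p) * f p \<partial>(MD e))
   \<longlonglongrightarrow> (\<integral>p. Y (min (real m) (max 0 (snd p))) (fst p) * f p \<partial>(MD e))"
  and "(%m. \<integral>p. Y (min (real m) (max 0 (snd p))) (fst p) * f p \<partial>(MD e))
   \<longlonglongrightarrow> (\<integral>p. pev Y p * f p \<partial>(MD e))"
proof -
 let ?P = "MD e"
 let ?w = "%p. abs B * pev Y p"
 interpret P: pair_sigma_finite M "discount e" by (rule pair_sigma_finite_discount[OF e])
 have w: "integrable ?P ?w" by (rule integrable_mult_right[OF int])
 have fm [measurable]: "f \<in> borel_measurable ?P" using f(1) by (simp add: pair_measurable_discount)
 have Ym [measurable]: "(%p. Y (min (real m) (max 0 (snd p))) (fst p)) \<in> borel_measurable ?P" for m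
 proof -
  have "(%p. (fst p, min (real m) (max 0 (snd p)))) \<in> M \<Otimes>\<^sub>M borel \<rightarrow>\<^sub>M M \<Otimes>\<^sub>M borel" by measurable
  from measurable_compose[OF this regular_control_pair_measurable[OF Y]]
  have "(%p. Y (max 0 (min (real m) (max 0 (snd p)))) (fst p)) \<in> pair_rv" by simp
  moreover have "max 0 (min (real m) (max 0 s)) = min (real m) (max 0 s)" for s by simp
  ultimately show ?thesis by (simp only: pair_measurable_discount)
 qed
 have dm [measurable]: "(%p. dyadic_path (%t. Y t (fst p)) m n (snd p)) \<in> borel_measurable ?P" for m n
  using borel_measurable_integrable[OF dyadic_integral(1)[OF e Y borel_measurable_const, of 1 1 m n]] by simp
 have bound: "norm (y * f p) <= ?w p" if "abs y <= pev Y p" for y p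
  unfolding real_norm_def abs_mult using that f(2)[of p] by (subst mult.commute, intro mult_mono) auto
 show "(%n. \<integral>p. dyadic_path (%t. Y t (fst p)) m n (snd p) * f p \<partial>?P)
   \<longlonglongrightarrow> (\<integral>p. Y (min (real m) (max 0 (snd p))) (fst p) * f p \<partial>?P)"
 proof (rule integral_dominated_convergence[where w = ?w])
  show "AE p in ?P. norm (dyadic_path (%t. Y t (fst p)) m n (snd p) * f p) <= ?w p" for n
   by (intro AE_I2 bound dyadic_path_bounds regular_controlD[OF Y])
  have "AE p in ?P. (%n. dyadic_path (%t. Y t (fst p)) m n (snd p)) \<longlonglongrightarrow> Y (min (real m) (max 0 (snd p))) (fst p)"
  proof (rule P.AE_pair_measure)
   show "{p \<in> space ?P. (%n. dyadic_path (%t. Y t (fst p)) m n (snd p)) \<longlonglongrightarrow> Y (min (real m) (max 0 (snd p))) (fst p)} \<in> sets ?P"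
    using Measurable.predE[OF measurable_limit2[OF dm Ym]] .
   show "AE \<omega> in M. AE s in discount e. (%n. dyadic_path (%t. Y t (fst (\<omega>, s))) m n (snd (\<omega>, s)))
     \<longlonglongrightarrow> Y (min (real m) (max 0 (snd (\<omega>, s)))) (fst (\<omega>, s))"
   proof (rule AE_I2)
    fix \<omega>
    show "AE s in discount e. (%n. dyadic_path (%t. Y t (fst (\<omega>, s))) m n (snd (\<omega>, s)))
     \<longlonglongrightarrow> Y (min (real m) (max 0 (snd (\<omega>, s)))) (fst (\<omega>, s))"
     using AE_discount[of e] AE_dyadic_path_tendsto[OF regular_controlD(3)[OF Y, of \<omega>], of m e]
     by eventually_elim simp
   qed
  qed
  then show "AE p in ?P. (%n. dyadic_path (%t. Y t (fst p)) m n (snd p) * f p)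
    \<longlonglongrightarrow> Y (min (real m) (max 0 (snd p))) (fst p) * f p"
   by eventually_elim (intro tendsto_mult tendsto_const)
  show "(%p. Y (min (real m) (max 0 (snd p))) (fst p) * f p) \<in> borel_measurable ?P" by measurable
  show "(%p. dyadic_path (%t. Y t (fst p)) m n (snd p) * f p) \<in> borel_measurable ?P" for n by measurable
 qed (rule w)
 show "(%m. \<integral>p. Y (min (real m) (max 0 (snd p))) (fst p) * f p \<partial>?P)
   \<longlonglongrightarrow> (\<integral>p. pev Y p * f p \<partial>?P)"
 proof (rule integral_dominated_convergence[where w = ?w])
  have "abs (Y (min (real m) (max 0 s)) \<omega>) <= Y (max 0 s) \<omega>" for m s \<omega>
   using regular_controlD(6)[OF Y, of "min (real m) (max 0 s)" "max 0 s" \<omega>]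
    regular_controlD(7)[OF Y, of "min (real m) (max 0 s)" \<omega>] by simp
  then show "AE p in ?P. norm (Y (min (real m) (max 0 (snd p))) (fst p) * f p) <= ?w p" for m
   by (intro AE_I2 bound)
  show "AE p in ?P. (%m. Y (min (real m) (max 0 (snd p))) (fst p) * f p) \<longlonglongrightarrow> pev Y p * f p"
  proof (rule AE_I2, rule tendsto_eventually)
   fix p :: "'w \<times> real"
   obtain N :: nat where "max 0 (snd p) <= real N" using real_arch_simple by blast
   then have "min (real m) (max 0 (snd p)) = max 0 (snd p)" if "N <= m" for m using that by simp
   then show "eventually (%m. Y (min (real m) (max 0 (snd p))) (fst p) * f p = pev Y p * f p) sequentially"
    by (intro eventually_mono[OF eventually_ge_at_top[of N]]) simp
  qed
  show "(%p. pev Y p * f p) \<in> borel_measurable ?P" using borel_measurable_integrable[OF int] by measurable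
  show "(%p. Y (min (real m) (max 0 (snd p))) (fst p) * f p) \<in> borel_measurable ?P" for m by measurable
 qed (rule w)
qed

lemma regular_control_increment:
 assumes Y: "regular_control Y" and st: "0 <= s" "s <= t"
 shows "(%w. Y t w - Y s w) \<in> borel_measurable (F t)" "integrable M (%w. Y t w - Y s w)"
  "0 <= Y t w - Y s w"
 using regular_controlD(1,2,6)[OF Y] measurable_F_mono[OF regular_controlD(1)[OF Y st(1)] st(2)] st
 by (auto intro!: borel_measurable_diff)

text \<open>A control is a superposition of pushes, each with a non-negative effect: first the grid
  is refined, then the horizon \<open>m\<close> grows.\<close>

lemma control_integral_nonneg:
 assumes e: "0 < e" and Y: "regular_control Y" and f: "f \<in> pair_rv" "!!p. abs (f p) <= B"
  and int: "integrable (MD e) (%p. pev Y p)"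
  and tail: "!!t Z. 0 <= t ==> Z \<in> borel_measurable (F t) ==> integrable M Z ==> (!!w. 0 <= Z w) ==>
   0 <= tail_integral e f t Z"
 shows "0 <= (\<integral>p. pev Y p * f p \<partial>(MD e))"
proof -
 have "0 <= (\<integral>p. dyadic_path (%t. Y t (fst p)) m n (snd p) * f p \<partial>(MD e))" for m n
  unfolding dyadic_integral(2)[OF e Y f]
  by (intro add_nonneg_nonneg sum_nonneg tail regular_control_increment[OF Y] regular_controlD[OF Y])
   (auto intro: divide_right_mono)
 then have "0 <= (\<integral>p. Y (min (real m) (max 0 (snd p))) (fst p) * f p \<partial>(MD e))" for m
  by (intro LIMSEQ_le_const[OF dyadic_integral_tendsto(1)[OF e Y f int]]) auto
 then show ?thesis by (intro LIMSEQ_le_const[OF dyadic_integral_tendsto(2)[OF e Y f int]]) auto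
qed

text \<open>The effect of a push at time \<open>t\<close> is at most a multiple of
  \<open>G t\<close>, and \<open>G\<close> vanishes where the control grows. The resulting
  right-endpoint sums tend to 0.\<close>

lemma control_integral_nonpos:
 assumes e: "0 < e" and Y: "regular_control Y" and f: "f \<in> pair_rv" "!!p. abs (f p) <= B"
  and int: "integrable (MD e) (%p. pev Y p)"
  and G: "!!t. 0 <= t ==> G t \<in> borel_measurable M" "!!w. right_cont (%t. G t w)"
   "!!t w. 0 <= t ==> 0 <= G t w" "!!t w. 0 <= t ==> G t w <= g"
  and comp: "!!w. (\<integral>\<^sup>+t\<in>{0<..}. ennreal (G t w) \<partial>stieltjes (%t. Y t w)) = 0" "!!w. Y 0 w * G 0 w = 0"
  and tail: "!!t Z. 0 <= t ==> Z \<in> borel_measurable (F t) ==> integrable M Z ==> (!!w. 0 <= Z w) ==>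
   tail_integral e f t Z <= k * expectation (%w. Z w * G t w)"
 shows "(\<integral>p. pev Y p * f p \<partial>(MD e)) <= 0"
proof -
 let ?S = "%m n w. \<Sum>k<m * 2 ^ n. (Y ((real k + 1) / 2 ^ n) w - Y (real k / 2 ^ n) w) * G ((real k + 1) / 2 ^ n) w"
 have inc: "0 <= Y ((real k + 1) / 2 ^ n) w - Y (real k / 2 ^ n) w" for k n w
  by (intro regular_control_increment(3)[OF Y]) (auto intro: divide_right_mono)
 have g: "0 <= g" using G(3,4)[of 0] order_trans by blast
 have ZG: "integrable M (%w. Z w * G t w)" if "integrable M Z" "0 <= t" for Z t
 proof (rule Bochner_Integration.integrable_bound[OF integrable_mult_right[OF that(1), of g]])
  show "(%w. Z w * G t w) \<in> borel_measurable M" using that G(1)[OF that(2)] by measurable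
  show "AE w in M. norm (Z w * G t w) <= norm (g * Z w)"
   using G(3,4)[OF that(2)] g by (intro AE_I2) (simp add: abs_mult mult.commute mult_right_mono)
 qed
 have i: "integrable M (%w. (Y ((real k + 1) / 2 ^ n) w - Y (real k / 2 ^ n) w) * G ((real k + 1) / 2 ^ n) w)" for k n
  by (intro ZG regular_control_increment(2)[OF Y]) (auto intro: divide_right_mono)
 have Si: "integrable M (?S m n)" for m n by (intro Bochner_Integration.integrable_sum i)
 have S0: "0 <= ?S m n w" for m n w by (intro sum_nonneg mult_nonneg_nonneg inc G(3)) auto
 have SY: "?S m n w <= g * Y (real m) w" for m n w
 proof -
  have tel: "(\<Sum>k<K. Y ((real k + 1) / 2 ^ n) w - Y (real k / 2 ^ n) w) = Y (real K / 2 ^ n) w - Y 0 w" for K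
   using sum_lessThan_telescope[of "%k. Y (real k / 2 ^ n) w" K] by (simp add: add.commute)
  have "?S m n w <= (\<Sum>k<m * 2 ^ n. (Y ((real k + 1) / 2 ^ n) w - Y (real k / 2 ^ n) w) * g)"
   by (intro sum_mono mult_left_mono inc G(4)) auto
  also have "\<dots> = (Y (real m) w - Y 0 w) * g" unfolding sum_distrib_right[symmetric] tel by simp
  also have "\<dots> <= Y (real m) w * g" using g regular_controlD(5)[OF Y] by (intro mult_right_mono) auto
  finally show ?thesis by (simp add: mult.commute)
 qed
 have upper: "(\<integral>p. dyadic_path (%t. Y t (fst p)) m n (snd p) * f p \<partial>(MD e)) <= k * expectation (?S m n)" for m n
 proof -
  have "(\<integral>p. dyadic_path (%t. Y t (fst p)) m n (snd p) * f p \<partial>(MD e))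
    <= k * expectation (%w. Y 0 w * G 0 w) + (\<Sum>j<m * 2 ^ n. k * expectation (%w.
     (Y ((real j + 1) / 2 ^ n) w - Y (real j / 2 ^ n) w) * G ((real j + 1) / 2 ^ n) w))"
   unfolding dyadic_integral(2)[OF e Y f]
   by (intro add_mono sum_mono tail regular_control_increment[OF Y] regular_controlD[OF Y])
    (auto intro: divide_right_mono)
  also have "\<dots> = k * expectation (?S m n)"
   unfolding comp(2) sum_distrib_left[symmetric] by (subst Bochner_Integration.integral_sum[OF i]) simp
  finally show ?thesis .
 qed
 have lim: "(%n. expectation (?S m n)) \<longlonglongrightarrow> expectation (%w. 0)" for m
 proof (rule integral_dominated_convergence[where w = "%w. g * Y (real m) w"])
  show "?S m n \<in> borel_measurable M" for n using Si by (rule borel_measurable_integrable)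
  show "integrable M (%w. g * Y (real m) w)" by (intro integrable_mult_right regular_controlD(2)[OF Y]) simp
  show "AE w in M. (%n. ?S m n w) \<longlonglongrightarrow> 0"
   by (intro AE_I2 right_endpoint_sums_tendsto_0[where g = g] regular_controlD(3,4)[OF Y] G(2-4) comp)
  show "AE w in M. norm (?S m n w) <= g * Y (real m) w" for n using S0 SY by (intro AE_I2) simp
 qed simp
 have "(\<integral>p. Y (min (real m) (max 0 (snd p))) (fst p) * f p \<partial>(MD e)) <= k * expectation (%w. 0)" for m
  using upper by (intro LIMSEQ_le[OF dyadic_integral_tendsto(1)[OF e Y f int] tendsto_mult_left[OF lim]]) auto
 then show ?thesis by (intro LIMSEQ_le_const2[OF dyadic_integral_tendsto(2)[OF e Y f int]]) auto
qed

end

context regular_levy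
begin

text \<open>By the flow and Markov properties, the tail is the discounted mean of \<open>Z\<close>
  times the sum of \<open>q\<close> and the adjoint function at the current position. That sum is 0
  at \<open>z\<close>; \<open>low\<close> and \<open>upp\<close> compare all other positions with
  \<open>z\<close> path by path. In this form one lemma serves both barriers, the upper one with
  \<open>- h\<close>.\<close>

lemma tail_integral_bounds:
 fixes a b x z :: real
 assumes e: "0 < e" and ab: "a < b" and h: "continuous_on UNIV h"
  and low: "!!y s t w. a <= y ==> y <= b ==> 0 <= s ==> 0 <= t ==>
   h (pos_at s a b z t w) <= h (pos_at s a b y t w)"
  and upp: "!!y s t w. a <= y ==> y <= b ==> 0 <= s ==> 0 <= t ==>
   h (pos_at s a b y t w) <= h (pos_at s a b z t w) + k * abs (y - z)"
  and k: "0 <= k" and eq: "discounted_mean h e a b z = - q"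
  and t: "0 <= t" and Z: "Z \<in> borel_measurable (F t)" "integrable M Z" "!!w. 0 <= Z w"
 defines "f \<equiv> %p. h (pos_at 0 a b x (max 0 (snd p)) (fst p)) + e * q"
 shows "0 <= tail_integral e f t Z"
  and "tail_integral e f t Z <= k / e * expectation (%w. Z w * abs (pos_at 0 a b x t w - z))"
proof -
 let ?X = "%w. pos_at 0 a b x t w"
 interpret D: finite_measure "discount e" by (rule finite_measure_discount[OF e])
 interpret P: pair_sigma_finite M "discount e" by (rule pair_sigma_finite_discount[OF e])
 obtain B where B: "0 <= B" "ALL z. a <= z --> z <= b --> abs (h z) <= B"
  using continuous_bounded_Icc[OF h] by blast
 define B' where "B' = B + abs (e * q)"
 have fm: "f \<in> pair_rv"
 proof -
  have "(%p. pos_at 0 a b x (max 0 (snd p)) (fst p)) \<in> pair_rv"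
   by (intro right_cont_pair_measurable[of "%t w. pos_at 0 a b x t w"]
     refl_measurable(3)[OF order_refl _ ab] refl_pos_right_cont[OF path_tame[OF order_refl ab]])
  from measurable_compose[OF this borel_measurable_continuous_onI[OF h]]
  show ?thesis unfolding f_def by measurable
 qed
 have fB: "abs (f p) <= B'" for p unfolding f_def B'_def
  using B(2)[rule_format, OF refl_bounds[OF order_refl _ ab, of "max 0 (snd p)" x "fst p"]] by simp
 have [measurable]: "Z \<in> borel_measurable M" using Z(2) by simp
 define g where "g s = expectation (%w. Z w * f (w, s))" for s
 have gm: "g \<in> borel_measurable borel"
 proof -
  have "(%(s, w). f (w, s)) \<in> borel_measurable (borel \<Otimes>\<^sub>M M)"
   using measurable_pair_swap[OF fm] by simp
  then have "(%(s, w). Z w * f (w, s)) \<in> borel_measurable (borel \<Otimes>\<^sub>M M)" by measurable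
  from borel_measurable_lebesgue_integral[OF this] show ?thesis unfolding g_def .
 qed
 have Zf: "integrable M (%w. Z w * f (w, s))" for s
 proof (rule Bochner_Integration.integrable_bound[OF integrable_mult_right[OF Z(2), of B']])
  have "(%w. f (w, s)) \<in> borel_measurable M" using fm by measurable
  then show "(%w. Z w * f (w, s)) \<in> borel_measurable M" by measurable
  have "0 <= B'" using B(1) by (simp add: B'_def)
  then show "AE w in M. norm (Z w * f (w, s)) <= norm (B' * Z w)"
   using mult_right_mono[OF fB abs_ge_zero] by (intro AE_I2) (simp add: abs_mult mult.commute)
 qed
 have gB: "abs (g s) <= B' * expectation Z" for s
 proof -
  have "abs (g s) <= expectation (%w. abs (Z w * f (w, s)))" unfolding g_def by (rule integral_abs_bound)
  also have "\<dots> <= expectation (%w. B' * Z w)"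
   using mult_right_mono[OF fB Z(3)] Z(3) by (intro integral_mono integrable_abs Zf integrable_mult_right Z(2))
    (simp add: abs_mult mult.commute)
  finally show ?thesis by simp
 qed
 have tail: "tail_integral e f t Z = exp (- e * t) * (\<integral>s. g (t + s) \<partial>discount e)"
 proof -
  have "integrable (MD e) (%p. Z (fst p) * (indicator {t..} (snd p) * f p))"
  proof (rule integrable_pair_mult[OF e Z(2)])
   show "(%p. indicator {t..} (snd p) * f p) \<in> pair_rv" using fm by measurable
   show "abs (indicator {t..} (snd p) * f p) <= abs B'" for p using fB[of p] by (auto simp: indicator_def)
  qed
  then have "integrable (MD e) (%(w, s). Z w * (indicator {t..} s * f (w, s)))" by (simp add: case_prod_beta')
  from P.integral_snd[OF this]
  have "tail_integral e f t Z = (\<integral>s. expectation (%w. Z w * (indicator {t..} s * f (w, s))) \<partial>discount e)"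
   unfolding tail_integral_def by (simp add: case_prod_beta')
  also have "\<dots> = (\<integral>s. indicator {t..} s * g s \<partial>discount e)"
  proof (rule Bochner_Integration.integral_cong[OF refl])
   fix s
   have "(%w. Z w * (indicator {t..} s * f (w, s))) = (%w. indicator {t..} s * (Z w * f (w, s)))"
    by (simp add: ac_simps)
   then show "expectation (%w. Z w * (indicator {t..} s * f (w, s))) = indicator {t..} s * g s"
    by (simp add: g_def)
  qed
  also have "\<dots> = exp (- e * t) * (\<integral>s. g (t + s) \<partial>discount e)" by (rule integral_discount_shift[OF gm t])
  finally show ?thesis .
 qed
 \<comment> \<open>The value of \<open>g (t + s)\<close> if the position at \<open>t\<close> were
   \<open>z\<close>. Its discounted integral is 0 by the equation at \<open>z\<close>.\<close>
 define m where "m s = expectation Z * (mean_pos h a b z (max 0 s) + e * q)" for s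
 define G where "G = expectation (%w. Z w * abs (?X w - z))"
 have Xm [measurable]: "?X \<in> borel_measurable M" by (rule refl_measurable(3)[OF order_refl t ab])
 have Xb: "a <= ?X w" "?X w <= b" for w by (rule refl_bounds[OF order_refl t ab])+
 have ZG: "integrable M (%w. Z w * abs (?X w - z))"
 proof (rule Bochner_Integration.integrable_bound[OF integrable_mult_right[OF Z(2), of "abs a + abs b + abs z"]])
  have "abs (?X w - z) <= abs a + abs b + abs z" for w using Xb[of w] by linarith
  from mult_left_mono[OF this abs_ge_zero]
  show "AE w in M. norm (Z w * abs (?X w - z)) <= norm ((abs a + abs b + abs z) * Z w)"
   by (intro AE_I2) (simp add: abs_mult mult.commute)
 qed measurable
 have G0: "0 <= G" unfolding G_def using Z(3) by (intro Bochner_Integration.integral_nonneg) simp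
 have bnd: "m s <= g (t + s) & g (t + s) <= m s + k * G" if s: "0 <= s" for s
 proof -
  let ?H = "%w. h (pos_at t a b z s w)"
  have ZH: "integrable M (%w. Z w * ?H w)" "expectation (%w. Z w * ?H w) = expectation Z * mean_pos h a b z s"
   using expectation_refl(1,2)[OF ab t s Z(1,2) Z(3) h, of z] by (simp_all add: mean_pos_def)
  have ms: "m s = expectation (%w. Z w * ?H w + e * q * Z w)"
   using ZH Z(2) s by (simp add: m_def algebra_simps)
  have fs: "f (w, t + s) = h (pos_at t a b (?X w) s w) + e * q" for w
   using refl_pos_flow[OF ab t s, of x w] t s by (simp add: f_def)
  have "m s <= g (t + s)" unfolding ms g_def
  proof (rule integral_mono)
   fix w
   show "Z w * ?H w + e * q * Z w <= Z w * f (w, t + s)"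
    using mult_left_mono[OF low[OF Xb t s, of w w] Z(3)[of w]] by (simp only: fs) (simp add: algebra_simps)
  qed (intro Bochner_Integration.integrable_add integrable_mult_right ZH Z Zf)+
  moreover have "g (t + s) <= expectation (%w. (Z w * ?H w + e * q * Z w) + k * (Z w * abs (?X w - z)))"
   unfolding g_def
  proof (rule integral_mono)
   fix w
   show "Z w * f (w, t + s) <= (Z w * ?H w + e * q * Z w) + k * (Z w * abs (?X w - z))"
    using mult_left_mono[OF upp[OF Xb t s, of w w] Z(3)[of w]] by (simp only: fs) (simp add: algebra_simps)
  qed (intro Bochner_Integration.integrable_add integrable_mult_right ZH Z Zf ZG)+
  moreover have "\<dots> = m s + k * G" unfolding ms G_def
   by (subst Bochner_Integration.integral_add) (use ZH Z ZG in simp_all)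
  ultimately show ?thesis by simp
 qed
 have mi: "integrable (discount e) m" "(\<integral>s. m s \<partial>discount e) = 0"
 proof -
  note i = mean_pos_integrable_discount[OF ab h e, of z]
  show "integrable (discount e) m" unfolding m_def using i by simp
  have "(\<integral>s. m s \<partial>discount e) = expectation Z * (discounted_mean h e a b z + (\<integral>s. e * q \<partial>discount e))"
   unfolding m_def discounted_mean_def using i by simp
  also have "(\<integral>s. e * q \<partial>discount e) = q" using e measure_discount[OF e] by simp
  finally show "(\<integral>s. m s \<partial>discount e) = 0" using eq by simp
 qed
 have gi: "integrable (discount e) (%s. g (t + s))"
  by (rule D.integrable_const_bound[of _ "B' * expectation Z"]) (use gB gm in auto)
 have "0 <= (\<integral>s. g (t + s) \<partial>discount e)" unfolding mi(2)[symmetric] using AE_discount[of e]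
  by (intro integral_mono_AE mi gi) (auto elim!: eventually_mono simp: bnd)
 then show "0 <= tail_integral e f t Z" unfolding tail by simp
 have "(\<integral>s. g (t + s) \<partial>discount e) <= (\<integral>s. m s + k * G \<partial>discount e)"
  using AE_discount[of e]
  by (intro integral_mono_AE Bochner_Integration.integrable_add mi gi) (auto elim!: eventually_mono simp: bnd)
 also have "\<dots> = k / e * G" using mi measure_discount[OF e] by simp
 finally have "exp (- e * t) * (\<integral>s. g (t + s) \<partial>discount e) <= exp (- e * t) * (k / e * G)"
  by (rule mult_left_mono) simp
 then have "tail_integral e f t Z <= exp (- e * t) * (k / e * G)" unfolding tail .
 also have "\<dots> <= 1 * (k / e * G)" using e t k G0 by (intro mult_right_mono) auto
 finally show "tail_integral e f t Z <= k / e * expectation (%w. Z w * abs (?X w - z))"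
  by (simp add: G_def)
qed

lemma refl_regular_control:
 assumes ab: "a < b"
 shows "regular_control (%t w. up_at 0 a b x t w)" and "regular_control (%t w. down_at 0 a b x t w)"
proof -
 note T = path_tame[OF order_refl ab]
 note fe = refl_feasible[OF less_imp_le[OF ab] T, unfolded feasible_def]
 show "regular_control (%t w. up_at 0 a b x t w)" unfolding regular_control_def
  using refl_measurable_F(1)[OF order_refl _ ab] refl_integrable(1)[OF order_refl _ ab] fe refl_up_right_cont[OF T]
  by simp
 show "regular_control (%t w. down_at 0 a b x t w)" unfolding regular_control_def
  using refl_measurable_F(2)[OF order_refl _ ab] refl_integrable(2)[OF order_refl _ ab] fe refl_down_right_cont[OF T]
  by simp
qed

lemma refl_controls_pair_integrable:
 assumes e: "0 < e" and ab: "a < b"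
 shows "integrable (MD e) (%p. up_at 0 a b x (max 0 (snd p)) (fst p))"
  and "integrable (MD e) (%p. down_at 0 a b x (max 0 (snd p)) (fst p))"
proof -
 interpret D: finite_measure "discount e" by (rule finite_measure_discount[OF e])
 interpret P: pair_sigma_finite M "discount e" by (rule pair_sigma_finite_discount[OF e])
 obtain K where K: "control_constant K" using ex_control_constant by blast
 then have K0: "0 <= K" by (simp add: control_constant_def)
 define k1 where "k1 = K * (1 + 1 / (b - a))"
 define k0 where "k0 = max 0 (a - x) + max 0 (x - b) + (b - a) / 4 + k1"
 have k: "0 <= k1" "0 <= k0" using K0 ab by (auto simp: k1_def k0_def)
 have cb: "control_bound K a b x t = k0 + k1 * t" for t
  unfolding control_bound_def k0_def k1_def[symmetric] by (simp add: algebra_simps)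
 have main: "integrable (MD e) (%p. pev Y p)"
  if Y: "regular_control Y" and bound: "!!t. 0 <= t ==> expectation (Y t) <= k0 + k1 * t" for Y
 proof (rule integrableI_bounded)
  have [measurable]: "(%p. pev Y p) \<in> borel_measurable (MD e)"
   using regular_control_pair_measurable[OF Y] by (simp add: pair_measurable_discount)
  show "(%p. pev Y p) \<in> borel_measurable (MD e)" by measurable
  have "(\<integral>\<^sup>+p. norm (pev Y p) \<partial>(MD e))
    = (\<integral>\<^sup>+s. \<integral>\<^sup>+w. ennreal (norm (Y (max 0 s) w)) \<partial>M \<partial>discount e)"
   by (subst P.nn_integral_snd[symmetric]) (auto simp: case_prod_beta')
  also have "\<dots> = (\<integral>\<^sup>+s. ennreal (expectation (Y (max 0 s))) \<partial>discount e)"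
  proof (rule nn_integral_cong)
   fix s :: real
   have Ys: "0 <= Y (max 0 s) w" for w by (rule regular_controlD(7)[OF Y]) simp
   have "(\<integral>\<^sup>+w. ennreal (Y (max 0 s) w) \<partial>M) = ennreal (expectation (Y (max 0 s)))"
    by (intro nn_integral_eq_integral regular_controlD(2)[OF Y] AE_I2 Ys) simp
   then show "(\<integral>\<^sup>+w. ennreal (norm (Y (max 0 s) w)) \<partial>M) = ennreal (expectation (Y (max 0 s)))"
    unfolding real_norm_def abs_of_nonneg[OF Ys] .
  qed
  also have "\<dots> <= (\<integral>\<^sup>+s. ennreal k0 + ennreal k1 * ennreal s \<partial>discount e)"
  proof (rule nn_integral_mono_AE)
   show "AE s in discount e. ennreal (expectation (Y (max 0 s))) <= ennreal k0 + ennreal k1 * ennreal s"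
    using AE_discount[of e]
   proof eventually_elim
    case (elim s)
    then show ?case using bound[OF elim] k
     by (simp add: ennreal_mult[symmetric] ennreal_plus[symmetric] ennreal_leI del: ennreal_plus)
   qed
  qed
  also have "\<dots> = ennreal k0 * emeasure (discount e) UNIV + ennreal k1 * ennreal (1 / e ^ 2)"
   by (subst nn_integral_add) (auto simp: nn_integral_cmult nn_integral_discount_id[OF e])
  also have "\<dots> < \<infinity>" using D.emeasure_finite[of UNIV]
   by (auto simp: ennreal_mult_less_top less_top[symmetric] ennreal_mult_eq_top_iff)
  finally show "(\<integral>\<^sup>+p. norm (pev Y p) \<partial>(MD e)) < \<infinity>" .
 qed
 show "integrable (MD e) (%p. up_at 0 a b x (max 0 (snd p)) (fst p))"
  by (rule main[OF refl_regular_control(1)[OF ab]]) (rule refl_controls_bound(1)[OF K ab, of _ x, unfolded cb])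
 show "integrable (MD e) (%p. down_at 0 a b x (max 0 (snd p)) (fst p))"
  by (rule main[OF refl_regular_control(2)[OF ab]]) (rule refl_controls_bound(2)[OF K ab, of _ x, unfolded cb])
qed

text \<open>The tail estimates with the distance to the barrier \<open>z\<close> in the role of
  \<open>G\<close>. One sign holds for every control, the opposite one for a control that acts only
  at the barrier.\<close>

lemma refl_control_signs:
 fixes a b x z :: real
 assumes e: "0 < e" and ab: "a < b" and h: "continuous_on UNIV h"
  and low: "!!y s t w. a <= y ==> y <= b ==> 0 <= s ==> 0 <= t ==>
   h (pos_at s a b z t w) <= h (pos_at s a b y t w)"
  and upp: "!!y s t w. a <= y ==> y <= b ==> 0 <= s ==> 0 <= t ==>
   h (pos_at s a b y t w) <= h (pos_at s a b z t w) + k * abs (y - z)"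
  and k: "0 <= k" and eq: "discounted_mean h e a b z = - q" and z: "z = a \<or> z = b"
  and Y: "regular_control Y" "integrable (MD e) (%p. pev Y p)"
 defines "f \<equiv> %p. h (pos_at 0 a b x (max 0 (snd p)) (fst p)) + e * q"
 shows "0 <= (\<integral>p. pev Y p * f p \<partial>(MD e))"
  and "(!!w. (\<integral>\<^sup>+t\<in>{0<..}. ennreal \<bar>pos_at 0 a b x t w - z\<bar> \<partial>stieltjes (%t. Y t w)) = 0) ==>
   (!!w. Y 0 w * abs (pos_at 0 a b x 0 w - z) = 0) ==>
   (\<integral>p. pev Y p * f p \<partial>(MD e)) <= 0" and "integrable (MD e) (%p. pev Y p * f p)"
proof -
 note T = path_tame[OF order_refl ab]
 obtain B where B: "ALL z. a <= z --> z <= b --> abs (h z) <= B"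
  using continuous_bounded_Icc[OF h] by blast
 have fm: "f \<in> pair_rv"
 proof -
  have "(%p. pos_at 0 a b x (max 0 (snd p)) (fst p)) \<in> pair_rv"
   by (intro right_cont_pair_measurable[of "%t w. pos_at 0 a b x t w"]
     refl_measurable(3)[OF order_refl _ ab] refl_pos_right_cont[OF T])
  from measurable_compose[OF this borel_measurable_continuous_onI[OF h]]
  show ?thesis unfolding f_def by measurable
 qed
 have fB: "abs (f p) <= B + abs (e * q)" for p unfolding f_def
  using B[rule_format, OF refl_bounds[OF order_refl _ ab, of "max 0 (snd p)" x "fst p"]] by simp
 note tb = tail_integral_bounds[OF e ab h low upp k eq, where x = x, folded f_def]
 show "0 <= (\<integral>p. pev Y p * f p \<partial>(MD e))"
  by (rule control_integral_nonneg[OF e Y(1) fm fB Y(2)]) (rule tb(1))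
 show "(\<integral>p. pev Y p * f p \<partial>(MD e)) <= 0"
  if comp: "!!w. (\<integral>\<^sup>+t\<in>{0<..}. ennreal \<bar>pos_at 0 a b x t w - z\<bar> \<partial>stieltjes (%t. Y t w)) = 0"
   "!!w. Y 0 w * abs (pos_at 0 a b x 0 w - z) = 0"
 proof (rule control_integral_nonpos[OF e Y(1) fm fB Y(2), where G = "%t w. abs (pos_at 0 a b x t w - z)" and g = "b - a", OF _ _ _ _ comp tb(2)])
  show "(%w. abs (pos_at 0 a b x t w - z)) \<in> borel_measurable M" if "0 <= t" for t
   using refl_measurable(3)[OF order_refl that ab, of x] by measurable
  show "right_cont (%t. abs (pos_at 0 a b x t w - z))" for w
   using refl_pos_right_cont[OF T, of x w] unfolding right_cont_def by (auto intro!: continuous_intros)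
  show "abs (pos_at 0 a b x t w - z) <= b - a" if "0 <= t" for t w
   using refl_bounds[OF order_refl that ab, of x w] z by auto
 qed simp_all
 show "integrable (MD e) (%p. pev Y p * f p)"
 proof (rule Bochner_Integration.integrable_bound[OF integrable_mult_left[OF Y(2), of "B + abs (e * q)"]])
  have "f \<in> borel_measurable (MD e)" using fm by (simp add: pair_measurable_discount)
  then show "(%p. pev Y p * f p) \<in> borel_measurable (MD e)"
   using borel_measurable_integrable[OF Y(2)] by measurable
  show "AE p in MD e. norm (pev Y p * f p) <= norm (pev Y p * (B + abs (e * q)))"
   using fB by (intro AE_I2) (simp add: abs_mult mult_left_mono order_trans[OF _ abs_ge_self])
 qed
qed

end

section \<open>Reflection against an arbitrary regular control\<close>

context regular_levy
begin

text \<open>Its integral over scenarios and discounted time is the discounted cost: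
  \<open>e * qu * U\<close> is what integration by parts makes of the cost of \<open>dU\<close>,
  initial jump included.\<close>

definition pair_cost :: "(real => real) => real => real => real => real =>
  (real => 'w => real) => (real => 'w => real) => 'w \<times> real => real" where
 "pair_cost g qu qd e x U D p =
   g (x + pev L p + pev U p - pev D p) +
   e * qu * pev U p + e * qd * pev D p"

lemma L_pair_measurable: "(%p. pev L p) \<in> pair_rv" using regular_paths unfolding regular_path_def
 by (intro right_cont_pair_measurable L_measurable) blast+

lemma pair_cost_measurable:
 assumes "continuous_on UNIV g" "regular_control U" "regular_control D"
 shows "pair_cost g qu qd e x U D \<in> pair_rv"
proof -
 have [measurable]: "g \<in> borel_measurable borel" by (rule borel_measurable_continuous_onI[OF assms(1)])
 note [measurable] = L_pair_measurable regular_control_pair_measurable[OF assms(2)]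
  regular_control_pair_measurable[OF assms(3)]
 show ?thesis unfolding pair_cost_def[abs_def] by measurable
qed

text \<open>Convexity bounds the cost difference from below by a linear functional of the difference
  of the controls, with marginal costs \<open>h + e * qu\<close> and \<open>- h + e * qd\<close>
  along the reflected path. The terms of the competitor are non-negative and those of the reflecting
  controls non-positive.\<close>

lemma refl_optimal:
 fixes g h :: "real => real"
 assumes e: "0 < e" and ab: "a < b" and h: "continuous_on UNIV h" "mono h"
  and g: "continuous_on UNIV g" "!!y. 0 <= g y" "!!y z. g z + h z * (y - z) <= g y"
  and k: "0 <= k" "!!y z. a <= y ==> y <= b ==> a <= z ==> z <= b ==> abs (h y - h z) <= k * abs (y - z)"
  and q: "0 < qu" "0 < qd" and eq: "discounted_mean h e a b a = - qu" "discounted_mean h e a b b = qd"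
  and U: "regular_control U" and D: "regular_control D"
 shows "(\<integral>\<^sup>+p. ennreal (pair_cost g qu qd e x (%t w. up_at 0 a b x t w)
    (%t w. down_at 0 a b x t w) p) \<partial>(MD e))
  <= (\<integral>\<^sup>+p. ennreal (pair_cost g qu qd e x U D p) \<partial>(MD e))"
  (is "?R <= ?C")
proof (cases "?C = \<infinity>")
 case False
 let ?P = "MD e"
 let ?U' = "%t w. up_at 0 a b x t w" and ?D' = "%t w. down_at 0 a b x t w"
 let ?u = "%p. pev U p" and ?d = "%p. pev D p"
 let ?u' = "%p. up_at 0 a b x (max 0 (snd p)) (fst p)"
 let ?d' = "%p. down_at 0 a b x (max 0 (snd p)) (fst p)"
 let ?X = "%p. pos_at 0 a b x (max 0 (snd p)) (fst p)"
 let ?C1 = "pair_cost g qu qd e x U D" and ?C2 = "pair_cost g qu qd e x ?U' ?D'"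
 interpret P: pair_sigma_finite M "discount e" by (rule pair_sigma_finite_discount[OF e])
 interpret Df: finite_measure "discount e" by (rule finite_measure_discount[OF e])
 interpret Pf: finite_measure ?P by (rule finite_measure_pair_measure) (unfold_locales)
 note T = path_tame[OF order_refl ab]
 note ab' = less_imp_le[OF ab]
 note U' = refl_regular_control(1)[OF ab, of x] and D' = refl_regular_control(2)[OF ab, of x]
 have pos: "0 <= ?u p" "0 <= ?d p" "0 <= ?u' p" "0 <= ?d' p" for p
  using regular_controlD(7)[OF U] regular_controlD(7)[OF D] regular_controlD(7)[OF U'] regular_controlD(7)[OF D']
  by simp_all
 have C1pos: "0 <= ?C1 p" and C2pos: "0 <= ?C2 p" for p unfolding pair_cost_def using g(2) pos e q by simp_all
 have C1i: "integrable ?P ?C1"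
 proof (rule integrableI_bounded)
  show "?C1 \<in> borel_measurable ?P" using pair_cost_measurable[OF g(1) U D] by (simp add: pair_measurable_discount)
  show "(\<integral>\<^sup>+p. norm (?C1 p) \<partial>?P) < \<infinity>" using False C1pos by (simp add: less_top)
 qed
 \<comment> \<open>The competitor is integrable because its cost is finite and
   \<open>e * qu * U\<close> is a summand of it; likewise below for \<open>D\<close>.\<close>
 have ui: "integrable ?P ?u"
 proof (rule Bochner_Integration.integrable_bound[OF integrable_mult_right[OF C1i, of "1 / (e * qu)"]])
  show "?u \<in> borel_measurable ?P" using regular_control_pair_measurable[OF U] by (simp add: pair_measurable_discount)
  have "e * qu * ?u p <= ?C1 p" for p unfolding pair_cost_def using g(2) pos(2)[of p] e q by simp
  then show "AE p in ?P. norm (?u p) <= norm (1 / (e * qu) * ?C1 p)"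
   using pos(1) C1pos e q by (intro AE_I2) (simp add: field_simps)
 qed
 have di: "integrable ?P ?d"
 proof (rule Bochner_Integration.integrable_bound[OF integrable_mult_right[OF C1i, of "1 / (e * qd)"]])
  show "?d \<in> borel_measurable ?P" using regular_control_pair_measurable[OF D] by (simp add: pair_measurable_discount)
  have "e * qd * ?d p <= ?C1 p" for p unfolding pair_cost_def using g(2) pos(1)[of p] e q by simp
  then show "AE p in ?P. norm (?d p) <= norm (1 / (e * qd) * ?C1 p)"
   using pos(2) C1pos e q by (intro AE_I2) (simp add: field_simps)
 qed
 note u'i = refl_controls_pair_integrable(1)[OF e ab, of x] and d'i = refl_controls_pair_integrable(2)[OF e ab, of x]
 have X: "x + pev L p + ?u' p - ?d' p = ?X p" for p by (simp add: refl_pos_def path_0)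
 have Xb: "a <= ?X p" "?X p <= b" for p by (rule refl_bounds[OF order_refl _ ab], simp)+
 obtain B where B: "ALL z. a <= z --> z <= b --> abs (g z) <= B" using continuous_bounded_Icc[OF g(1)] by blast
 have C2i: "integrable ?P ?C2"
 proof (rule Bochner_Integration.integrable_bound)
  show "integrable ?P (%p. B + e * qu * ?u' p + e * qd * ?d' p)"
   by (intro Bochner_Integration.integrable_add integrable_mult_right u'i d'i) simp
  show "?C2 \<in> borel_measurable ?P" using pair_cost_measurable[OF g(1) U' D'] by (simp add: pair_measurable_discount)
  show "AE p in ?P. norm (?C2 p) <= norm (B + e * qu * ?u' p + e * qd * ?d' p)"
  proof (rule AE_I2)
   fix p
   have "?C2 p <= B + e * qu * ?u' p + e * qd * ?d' p"
    unfolding pair_cost_def X using B[rule_format, OF Xb, of p] by simp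
   then show "norm (?C2 p) <= norm (B + e * qu * ?u' p + e * qd * ?d' p)" using C2pos[of p] by simp
  qed
 qed
 have a_low: "h (pos_at s a b a t w) <= h (pos_at s a b y t w)"
  and a_upp: "h (pos_at s a b y t w) <= h (pos_at s a b a t w) + k * abs (y - a)"
  and b_low: "- h (pos_at s a b b t w) <= - h (pos_at s a b y t w)"
  and b_upp: "- h (pos_at s a b y t w) <= - h (pos_at s a b b t w) + k * abs (y - b)"
  if y: "a <= y" "y <= b" and st: "0 <= s" "0 <= t" for y s t w
 proof -
  note Ts = path_tame[OF st(1) ab]
  note bd = refl_bounds[OF st ab]
  show "h (pos_at s a b a t w) <= h (pos_at s a b y t w)"
   by (rule monoD[OF h(2) refl_pos_mono[OF ab' Ts ab' Ts st(2) order_refl order_refl y(1)]])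
  have "h (pos_at s a b y t w) <= h (pos_at s a b b t w)"
   by (rule monoD[OF h(2) refl_pos_mono[OF ab' Ts ab' Ts st(2) order_refl order_refl y(2)]])
  then show "- h (pos_at s a b b t w) <= - h (pos_at s a b y t w)" by simp
  have lip: "abs (h (pos_at s a b y t w) - h (pos_at s a b z t w)) <= k * abs (y - z)" for z
  proof -
   have "abs (pos_at s a b y t w - pos_at s a b z t w) <= abs (y - z)"
    by (rule refl_pos_lipschitz[OF ab' Ts ab' Ts st(2)]) auto
   from mult_left_mono[OF this k(1)] k(2)[OF bd bd, of y w z w] show ?thesis by linarith
  qed
  show "h (pos_at s a b y t w) <= h (pos_at s a b a t w) + k * abs (y - a)" using lip[of a] by linarith
  show "- h (pos_at s a b y t w) <= - h (pos_at s a b b t w) + k * abs (y - b)" using lip[of b] by linarith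
 qed
 have hm: "continuous_on UNIV (%y. - h y)" by (intro continuous_intros h)
 have eqb: "discounted_mean (%y. - h y) e a b b = - qd" using eq(2) by (simp add: discounted_mean_uminus)
 have sk: "skorokhod_path a b x (lpath 0 w) (refl_up a b x (lpath 0 w)) (refl_down a b x (lpath 0 w))" for w
  by (rule refl_skorokhod_path[OF path_regular[OF order_refl] ab])
 have nn: "(\<integral>\<^sup>+t\<in>{0<..}. ennreal \<bar>f t\<bar> \<partial>N) = (\<integral>\<^sup>+t\<in>{0<..}. ennreal (f t) \<partial>N)" if "!!t. 0 < t ==> 0 <= f t" for f and N :: "real measure"
  using that by (intro nn_integral_cong) (auto simp: indicator_def)
 have compU: "(\<integral>\<^sup>+t\<in>{0<..}. ennreal \<bar>pos_at 0 a b x t w - a\<bar> \<partial>stieltjes (%t. ?U' t w)) = 0" for w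
  using sk[of w] refl_bounds(1)[OF order_refl _ ab, of _ x w]
  by (subst nn) (simp_all add: skorokhod_path_def refl_pos_def[symmetric])
 have compD: "(\<integral>\<^sup>+t\<in>{0<..}. ennreal \<bar>pos_at 0 a b x t w - b\<bar> \<partial>stieltjes (%t. ?D' t w)) = 0" for w
  unfolding abs_minus_commute[of _ b] using sk[of w] refl_bounds(2)[OF order_refl _ ab, of _ x w]
  by (subst nn) (simp_all add: skorokhod_path_def refl_pos_def[symmetric])
 have u0: "?U' 0 w * abs (pos_at 0 a b x 0 w - a) = 0"
  and d0: "?D' 0 w * abs (pos_at 0 a b x 0 w - b) = 0" for w
  unfolding refl_pos_def refl_initial[OF ab T] using ab by (auto simp: path_0 max_def)
 note SU = refl_control_signs[OF e ab h(1) a_low a_upp k(1) eq(1) disjI1[OF refl], where x = x]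
 note SD = refl_control_signs[OF e ab hm b_low b_upp k(1) eqb disjI2[OF refl], where x = x]
 let ?f = "%p. h (?X p) + e * qu" and ?f' = "%p. - h (?X p) + e * qd"
 have s1: "0 <= (\<integral>p. ?u p * ?f p \<partial>?P)" by (rule SU(1)[rotated 8, OF U ui])
 have s1i: "integrable ?P (%p. ?u p * ?f p)" by (rule SU(3)[rotated 8, OF U ui])
 have s2: "(\<integral>p. ?u' p * ?f p \<partial>?P) <= 0" by (rule SU(2)[rotated 8, OF U' u'i compU u0])
 have s2i: "integrable ?P (%p. ?u' p * ?f p)" by (rule SU(3)[rotated 8, OF U' u'i])
 have s3: "0 <= (\<integral>p. ?d p * ?f' p \<partial>?P)" by (rule SD(1)[rotated 8, OF D di])
 have s3i: "integrable ?P (%p. ?d p * ?f' p)" by (rule SD(3)[rotated 8, OF D di])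
 have s4: "(\<integral>p. ?d' p * ?f' p \<partial>?P) <= 0" by (rule SD(2)[rotated 8, OF D' d'i compD d0])
 have s4i: "integrable ?P (%p. ?d' p * ?f' p)" by (rule SD(3)[rotated 8, OF D' d'i])
 have "0 <= (\<integral>p. ?u p * ?f p \<partial>?P) - (\<integral>p. ?u' p * ?f p \<partial>?P) + (\<integral>p. ?d p * ?f' p \<partial>?P) - (\<integral>p. ?d' p * ?f' p \<partial>?P)"
  using s1 s2 s3 s4 by linarith
 also have "\<dots> = (\<integral>p. ?u p * ?f p - ?u' p * ?f p + ?d p * ?f' p - ?d' p * ?f' p \<partial>?P)"
  using s1i s2i s3i s4i by simp
 also have "\<dots> <= (\<integral>p. ?C1 p - ?C2 p \<partial>?P)"
 proof (rule integral_mono)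
  fix p
  have "g (?X p) + h (?X p) * (?u p - ?u' p - ?d p + ?d' p) <= g (x + pev L p + ?u p - ?d p)"
  proof -
   have *: "x + pev L p + ?u p - ?d p - ?X p = ?u p - ?u' p - ?d p + ?d' p" using X[of p] by linarith
   show ?thesis using g(3)[of "?X p" "x + pev L p + ?u p - ?d p"] unfolding * .
  qed
  then show "?u p * ?f p - ?u' p * ?f p + ?d p * ?f' p - ?d' p * ?f' p <= ?C1 p - ?C2 p"
   unfolding pair_cost_def X by (simp add: algebra_simps)
 qed (intro Bochner_Integration.integrable_diff Bochner_Integration.integrable_add C1i C2i s1i s2i s3i s4i)+
 also have "\<dots> = (\<integral>p. ?C1 p \<partial>?P) - (\<integral>p. ?C2 p \<partial>?P)" using C1i C2i by simp
 finally have "(\<integral>p. ?C2 p \<partial>?P) <= (\<integral>p. ?C1 p \<partial>?P)" by simp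
 then show ?thesis
  using C1pos C2pos by (simp add: nn_integral_eq_integral[OF C1i] nn_integral_eq_integral[OF C2i] ennreal_leI)
qed simp

end

section \<open>Existence of discounted equilibria\<close>

text \<open>Brouwer's theorem for the map that sends \<open>z\<close> to the point of
  \<open>T\<close> nearest to \<open>z - G z\<close>; the inequality is the obtuse angle property of
  the projection.\<close>

lemma variational_inequality:
 fixes G :: "'a::euclidean_space => 'a"
 assumes "compact T" "convex T" "T \<noteq> {}" "continuous_on T G"
 shows "EX z:T. ALL z':T. 0 <= G z \<bullet> (z' - z)"
proof -
 have cl: "closed T" using assms(1) by (rule compact_imp_closed)
 have "continuous_on T (%z. closest_point T (z - G z))"
  by (rule continuous_on_compose2[OF continuous_on_closest_point[OF assms(2) cl assms(3), of UNIV]])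
   (auto intro!: continuous_intros assms)
 moreover have "(%z. closest_point T (z - G z)) \<in> T \<rightarrow> T"
  using closest_point_in_set[OF cl assms(3)] by auto
 ultimately obtain z where z: "z \<in> T" "closest_point T (z - G z) = z" by (rule brouwer[OF assms(1,2,3)])
 have "0 <= G z \<bullet> (z' - z)" if "z' \<in> T" for z'
  using closest_point_dot[OF assms(2) cl that, of "z - G z"] by (simp add: z(2))
 then show ?thesis using z(1) by blast
qed

definition bands :: "real => real => (real \<times> real) set" where
 "bands w W = {(a, b). a <= 0 & 0 <= b & w <= b - a & b - a <= W}"

lemma compact_bands: "compact (bands w W)"
proof (rule compact_eq_bounded_closed[THEN iffD2], intro conjI)
 have "bands w W \<subseteq> {-W..0} \<times> {0..W}" by (auto simp: bands_def)
 then show "bounded (bands w W)" by (rule bounded_subset[rotated]) (intro bounded_Times bounded_closed_interval)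
 have "bands w W = {z. fst z <= 0} \<inter> {z. 0 <= snd z} \<inter> {z. w <= snd z - fst z} \<inter> {z. snd z - fst z <= W}"
  by (auto simp: bands_def)
 also have "closed \<dots>" by (intro closed_Int closed_Collect_le continuous_intros)
 finally show "closed (bands w W)" .
qed

lemma convex_bands: "convex (bands w W)"
proof (rule convexI)
 fix y z :: "real \<times> real" and u v :: real
 assume yz: "y \<in> bands w W" "z \<in> bands w W" and uv: "0 <= u" "0 <= v" "u + v = 1"
 obtain a b a' b' where [simp]: "y = (a, b)" "z = (a', b')" by (cases y, cases z)
 have ab: "a <= 0" "0 <= b" "w <= b - a" "b - a <= W" and ab': "a' <= 0" "0 <= b'" "w <= b' - a'" "b' - a' <= W"
  using yz by (auto simp: bands_def)
 have "u * a + v * a' <= 0" using ab ab' uv by (simp add: add_nonpos_nonpos mult_nonneg_nonpos)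
 moreover have "0 <= u * b + v * b'" using ab ab' uv by simp
 moreover have "w <= u * (b - a) + v * (b' - a')" "u * (b - a) + v * (b' - a') <= W"
  using convex_bound_le[of "b - a" W "b' - a'" u v] convex_bound_le[of "a - b" "- w" "a' - b'" u v] ab ab' uv
  by (auto simp: algebra_simps)
 ultimately show "u *\<^sub>R y + v *\<^sub>R z \<in> bands w W" by (simp add: bands_def algebra_simps)
qed

text \<open>Every direction that stays in the set gives a sign of \<open>G1\<close> or
  \<open>G2\<close> at the solution. The boundary hypotheses contradict these signs on each side, so
  the solution is interior and both components vanish.\<close>

lemma band_zero:
 fixes G1 G2 :: "real \<times> real => real"
 assumes w: "0 < w" "w < W" and cont: "continuous_on (bands w W) G1" "continuous_on (bands w W) G2"
  and a0: "!!b. (0, b) \<in> bands w W ==> 0 < G1 (0, b)"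
  and b0: "!!a. (a, 0) \<in> bands w W ==> G2 (a, 0) < 0"
  and wide: "!!a b. (a, b) \<in> bands w W ==> b - a = W ==> G1 (a, b) < G2 (a, b)"
  and narrow: "!!a b. (a, b) \<in> bands w W ==> b - a = w ==> G2 (a, b) < G1 (a, b)"
 shows "EX z:bands w W. G1 z = 0 & G2 z = 0"
proof -
 have "(0, W) \<in> bands w W" using w by (simp add: bands_def)
 then have "bands w W \<noteq> {}" by blast
 from variational_inequality[OF compact_bands convex_bands this, of "%z. (G1 z, G2 z)"] cont
 obtain a b where ab: "(a, b) \<in> bands w W"
  and vi: "!!a' b'. (a', b') \<in> bands w W ==> 0 <= G1 (a, b) * (a' - a) + G2 (a, b) * (b' - b)"
  by (force intro: continuous_on_Pair)
 let ?g1 = "G1 (a, b)" and ?g2 = "G2 (a, b)"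
 have T: "a <= 0" "0 <= b" "w <= b - a" "b - a <= W" using ab by (auto simp: bands_def)
 have up_a: "0 <= ?g1" if "a < 0" "w < b - a"
 proof -
  define t where "t = min (- a) (b - a - w)"
  have t: "0 < t" "t <= - a" "t <= b - a - w" using that by (auto simp: t_def)
  have "(a + t, b) \<in> bands w W" using T t by (auto simp: bands_def)
  from vi[OF this] t(1) show ?thesis by (simp add: zero_le_mult_iff)
 qed
 have down_b: "?g2 <= 0" if "0 < b" "w < b - a"
 proof -
  define t where "t = min b (b - a - w)"
  have t: "0 < t" "t <= b" "t <= b - a - w" using that by (auto simp: t_def)
  have "(a, b - t) \<in> bands w W" using T t by (auto simp: bands_def)
  from vi[OF this] t(1) show ?thesis by (simp add: mult_le_0_iff)
 qed
 have down_a: "?g1 <= 0" if "b - a < W"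
 proof -
  have "(a - (W - (b - a)), b) \<in> bands w W" using T that by (auto simp: bands_def)
  from vi[OF this] that show ?thesis by (simp add: zero_le_mult_iff)
 qed
 have up_b: "0 <= ?g2" if "b - a < W"
 proof -
  have "(a, b + (W - (b - a))) \<in> bands w W" using T that by (auto simp: bands_def)
  from vi[OF this] that show ?thesis by (simp add: zero_le_mult_iff)
 qed
 \<comment> \<open>At width \<open>W\<close> the inward moves are still possible; their signs clash
   with \<open>wide\<close> or with the sign prescribed where one end is 0. Once this is excluded,
   the outward moves are free.\<close>
 have nW: "b - a < W"
 proof (rule ccontr)
  assume "~ b - a < W"
  then have W: "b - a = W" using T by simp
  have g: "?g1 < ?g2" by (rule wide[OF ab W])
  show False
  proof (cases "a < 0")
   case True
   then have "0 <= ?g1" using up_a W w by simp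
   moreover have "b = 0" using down_b W w T g calculation by (cases "0 < b") auto
   ultimately show False using b0[of a] ab g by auto
  next
   case False
   then have "a = 0" using T by simp
   then show False using down_b W w g a0[of b] ab by auto
  qed
 qed
 have nw: "w < b - a"
 proof (rule ccontr)
  assume "~ w < b - a"
  then have "b - a = w" using T by simp
  from narrow[OF ab this] show False using down_a[OF nW] up_b[OF nW] by simp
 qed
 have "a < 0" using down_a[OF nW] a0[of b] ab T by (cases "a = 0") auto
 then have "?g1 = 0" using up_a nw down_a[OF nW] by simp
 moreover have "0 < b" using up_b[OF nW] b0[of a] ab T by (cases "b = 0") auto
 then have "?g2 = 0" using down_b nw up_b[OF nW] by simp
 ultimately show ?thesis using ab by blast
qed

locale control_problem = dropping_levy M F L
 for M :: "'w measure" and F :: "real => 'w measure" and L :: "real => 'w => real" +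
 fixes f :: "real => real" and c cx cxx :: "real => real => real" and qu qd :: real
 assumes f_cont: "continuous_on UNIV f" and q_pos: "0 < qu" "0 < qd" and c_nonneg: "!!x y. 0 <= c x y"
  and c_cont: "continuous_on UNIV (%(x, y). c x y)"
  and c_deriv: "!!x y. ((%z. c z y) has_real_derivative cx x y) (at x)"
  and cx_deriv: "!!x y. ((%z. cx z y) has_real_derivative cxx x y) (at x)"
  and cxx_cont: "!!y. continuous_on UNIV (%x. cxx x y)"
  and c_convex: "!!y. strictly_convex (%x. c x y)" and c_min: "!!x y. c 0 y <= c x y"
  and cxx_pos: "!!r. r > 0 ==> (INF (x, y)\<in>{(x, y). abs x >= r}. cxx x y) > 0"
begin

lemma c_convex_on: "convex_on UNIV (%x. c x y)"
proof (rule convex_onI)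
 fix t x z :: real assume t: "0 < t" "t < 1"
 show "c ((1 - t) *\<^sub>R x + t *\<^sub>R z) y <= (1 - t) * c x y + t * c z y"
 proof (cases "x = z")
  case True
  have "(1 - t) *\<^sub>R z + t *\<^sub>R z = z" by (simp add: algebra_simps)
  then show ?thesis using True by (simp add: algebra_simps)
 next
  case False
  have "0 < 1 - t" "1 - t < 1" using t by auto
  with c_convex[of y] False have "c ((1 - t) * x + (1 - (1 - t)) * z) y < (1 - t) * c x y + (1 - (1 - t)) * c z y"
   unfolding strictly_convex_def by blast
  then show ?thesis by simp
 qed
qed simp

lemma c_tangent: "c z y + cx z y * (x - z) <= c x y"
 using convex_derivative_mono(1)[OF c_convex_on c_deriv] by simp

lemma cx_mono: "mono (%x. cx x y)" using convex_derivative_mono(2)[OF c_convex_on c_deriv] by simp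

lemma cx_0: "cx 0 y = 0"
proof (rule antisym)
 show "cx 0 y <= 0"
 proof (rule ccontr)
  assume "~ cx 0 y <= 0"
  from DERIV_pos_inc_left[OF c_deriv this[unfolded not_le]] obtain d where
   "0 < d" "!!h. 0 < h ==> h < d ==> c (0 - h) y < c 0 y" by auto
  then have "c (0 - d / 2) y < c 0 y" by simp
  then show False using c_min[of y "0 - d / 2"] by simp
 qed
 show "0 <= cx 0 y"
 proof (rule ccontr)
  assume "~ 0 <= cx 0 y"
  from DERIV_neg_dec_right[OF c_deriv this[unfolded not_le]] obtain d where
   "0 < d" "!!h. 0 < h ==> h < d ==> c (0 + h) y < c 0 y" by auto
  then have "c (0 + d / 2) y < c 0 y" by (metis half_gt_zero field_sum_of_halves less_add_same_cancel1)
  then show False using c_min[of y "0 + d / 2"] by simp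
 qed
qed

lemma cx_tendsto: "xs \<longlonglongrightarrow> x ==> ys \<longlonglongrightarrow> y ==> (%n. cx (xs n) (ys n)) \<longlonglongrightarrow> cx x y"
 by (rule convex_derivative_jointly_continuous[OF c_convex_on c_deriv c_cont])

lemma cx_continuous: "continuous_on UNIV (%(x, y). cx x y)"
 unfolding continuous_on_sequentially comp_def case_prod_beta'
 by (intro ballI allI impI cx_tendsto tendsto_fst tendsto_snd) (elim conjE, assumption)+

lemma cx_continuous_fst: "continuous_on UNIV (%x. cx x y)"
 using cx_deriv by (intro continuous_at_imp_continuous_on ballI DERIV_isCont)

lemma c_continuous_fst: "continuous_on UNIV (%x. c x y)"
 using c_deriv by (intro continuous_at_imp_continuous_on ballI DERIV_isCont)

lemma cxx_nonneg: "0 <= cxx x y"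
 by (rule mono_on_imp_deriv_nonneg[of UNIV "%x. cx x y"]) (use cx_mono cx_deriv in auto)

text \<open>The uniform lower bound on \<open>cxx\<close> at distance 1 from the origin; its
  independence of the parameter makes \<open>k\<close> uniform.\<close>

lemma cx_growth: "EX k>0. ALL x y p. x <= y --> k * (y - x - 2) <= cx y p - cx x p"
proof -
 let ?S = "{(x, y). abs x >= (1 :: real)} :: (real \<times> real) set"
 define k where "k = (INF (x, y)\<in>?S. cxx x y)"
 have k0: "0 < k" unfolding k_def by (rule cxx_pos) simp
 have bdd: "bdd_below ((%(x, y). cxx x y) ` ?S)" by (rule bdd_belowI2[of _ 0]) (auto simp: cxx_nonneg)
 have k: "k <= cxx x y" if "1 <= abs x" for x y
  unfolding k_def using cINF_lower[OF bdd, of "(x, y)"] that by simp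
 have "k * (y - x - 2) <= cx y p - cx x p" if "x <= y" for x y p
  by (rule increasing_outside_unit[of "%x. cx x p" "%x. cxx x p", OF cx_deriv cxx_nonneg k _ that])
   (use k0 in auto)
 then show ?thesis using k0 by blast
qed

lemma cx_lipschitz:
 "EX k>=0. ALL y z. a <= y --> y <= b --> a <= z --> z <= b --> abs (cx y p - cx z p) <= k * abs (y - z)"
proof -
 obtain k where k: "0 <= k" "ALL z. a <= z --> z <= b --> abs (cxx z p) <= k"
  using continuous_bounded_Icc[OF cxx_cont] by blast
 have "abs (cx y p - cx z p) <= k * abs (y - z)" if "a <= y" "y <= b" "a <= z" "z <= b" for y z
  using field_differentiable_bound[of "{a..b}" "%x. cx x p" "%x. cxx x p" k z y] that k
   DERIV_subset[OF cx_deriv subset_UNIV] by (simp add: abs_minus_commute)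
 then show ?thesis using k(1) by blast
qed

lemma discounted_mean_continuous_on:
 assumes w: "0 < w" and e: "0 < e" and \<pi>: "continuous_on (bands w W) \<pi>" "!!z. z \<in> bands w W ==> abs (\<pi> z) <= B"
  and y: "continuous_on (bands w W) y"
 shows "continuous_on (bands w W) (%z. discounted_mean (%x. cx x (\<pi> z)) e (fst z) (snd z) (y z))"
 unfolding continuous_on_sequentially comp_def
proof (intro ballI allI impI, elim conjE)
 fix z zs assume z: "z \<in> bands w W" and zs: "ALL n :: nat. zs n \<in> bands w W" "zs \<longlonglongrightarrow> z"
 have "compact ((%(x, y). cx x y) ` ({-W..W} \<times> {-B..B}))"
  by (intro compact_continuous_image continuous_on_subset[OF cx_continuous] compact_Times) auto
 then have "bounded ((%(x, y). cx x y) ` ({-W..W} \<times> {-B..B}))" by (rule compact_imp_bounded)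
 then obtain K where K: "!!v. v \<in> (%(x, y). cx x y) ` ({-W..W} \<times> {-B..B}) ==> norm v <= K"
  unfolding bounded_iff by blast
 have lt: "fst z < snd z" "- W <= fst z" "snd z <= W" if "z \<in> bands w W" for z
  using that w by (auto simp: bands_def)
 have \<pi>s: "(%n. \<pi> (zs n)) \<longlonglongrightarrow> \<pi> z" and ys: "(%n. y (zs n)) \<longlonglongrightarrow> y z"
  using \<pi>(1) y z zs unfolding continuous_on_sequentially comp_def by blast+
 show "(%n. discounted_mean (%x. cx x (\<pi> (zs n))) e (fst (zs n)) (snd (zs n)) (y (zs n)))
   \<longlonglongrightarrow> discounted_mean (%x. cx x (\<pi> z)) e (fst z) (snd z) (y z)"
 proof (rule discounted_mean_tendsto[OF lt(1)[OF zs(1)[rule_format]] lt(1)[OF z] e tendsto_fst[OF zs(2)]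
    tendsto_snd[OF zs(2)] ys cx_continuous_fst cx_continuous_fst cx_tendsto[OF _ \<pi>s]])
  fix n x assume x: "fst (zs n) <= x" "x <= snd (zs n)"
  have zn: "zs n \<in> bands w W" using zs(1) by blast
  have "(x, \<pi> (zs n)) \<in> {-W..W} \<times> {-B..B}" using x lt(2,3)[OF zn] \<pi>(2)[OF zn] by auto
  then have "(%(x, y). cx x y) (x, \<pi> (zs n)) \<in> (%(x, y). cx x y) ` ({-W..W} \<times> {-B..B})" by (rule imageI)
  from K[OF this] show "abs (cx x (\<pi> (zs n))) <= K" by simp
 qed assumption
qed

definition optimal_band :: "real => real => real \<times> real => bool" where
 "optimal_band e p z \<longleftrightarrow> discounted_mean (%x. cx x p) e (fst z) (snd z) (fst z) = - qu &
   discounted_mean (%x. cx x p) e (fst z) (snd z) (snd z) = qd"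

text \<open>The parameter is an arbitrary continuous function \<open>\<pi>\<close> of the band
  because two cases are used: the stationary parameter of the band itself, which gives equilibria,
  and a constant, which gives bands optimal for a prescribed parameter. The set of bands is fixed
  before \<open>e\<close> and \<open>\<pi>\<close>.\<close>

lemma optimal_band_exists:
 "EX w W B. 0 < w & w < W & (ALL z. - W <= z --> z <= W --> abs (f z) <= B) &
  (ALL e \<pi>. 0 < e --> e <= 1 --> continuous_on (bands w W) \<pi> --> (ALL z:bands w W. abs (\<pi> z) <= B) -->
   (EX z:bands w W. optimal_band e (\<pi> z) z))"
proof -
 obtain k where k: "0 < k" "!!p. ALL x y. x <= y --> k * (y - x - 2) <= cx y p - cx x p"
  using cx_growth by blast
 obtain K where K': "control_constant K" using ex_control_constant by blast
 then have K: "0 <= K" by (simp add: control_constant_def)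
 \<comment> \<open>Chosen so that at width \<open>W\<close> the lower bound on the spread of the
   adjoint function is \<open>qu + qd + 1\<close>, more than the required
   \<open>qu + qd\<close>.\<close>
 define r where "r = (qu + qd + 1) * exp 1 / k"
 have r: "0 < r" "k * r * exp (- 1) = qu + qd + 1"
 proof -
  show "0 < r" unfolding r_def using q_pos k(1) by (intro divide_pos_pos mult_pos_pos) auto
  have "k * r * exp (- 1) = (qu + qd + 1) * (exp 1 * exp (- 1))" using k(1) by (simp add: r_def)
  then show "k * r * exp (- 1) = qu + qd + 1" by (simp add: mult_exp_exp)
 qed
 define W where "W = 2 * (8 * K + 2 + r)"
 have W: "1 <= W" "W / 2 - 8 * K - 2 = r" using K r(1) by (auto simp: W_def field_simps)
 obtain B where B: "0 <= B" "ALL z. - W <= z --> z <= W --> abs (f z) <= B"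
  using continuous_bounded_Icc[OF f_cont] by blast
 obtain C' l where m: "mixing_rate W C' l" using mean_pos_ergodic by blast
 define C where "C = 2 * C' / l"
 have C: "0 < C" using mixing_rateD(1,2)[OF m] by (simp add: C_def)
 have "uniformly_continuous_on ({-W..W} \<times> {-B..B}) (%(x, y). cx x y)"
  by (intro compact_uniformly_continuous continuous_on_subset[OF cx_continuous] compact_Times) auto
 moreover have "0 < (qu + qd) / C" using q_pos C by simp
 ultimately obtain d where d: "0 < d" and dd: "ALL v:{-W..W} \<times> {-B..B}. ALL v':{-W..W} \<times> {-B..B}. dist v' v < d -->
   dist (case v' of (x, y) => cx x y) (case v of (x, y) => cx x y) < (qu + qd) / C"
  unfolding uniformly_continuous_on_def by blast
 \<comment> \<open>Below \<open>d\<close>, so that \<open>cx\<close> varies by less than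
   \<open>(qu + qd) / C\<close> across a band of width \<open>w\<close> and the spread stays below
   \<open>qu + qd\<close>. The 1/2 ensures \<open>w < W\<close>.\<close>
 define w where "w = min (d / 2) (1 / 2)"
 have w: "0 < w" "w < W" "w < d" using d W(1) by (auto simp: w_def)
 show ?thesis
 proof (rule exI[of _ w], rule exI[of _ W], rule exI[of _ B], intro conjI w(1,2) B(2), intro allI impI)
  fix e :: real and \<pi> :: "real \<times> real => real"
  assume e: "0 < e" "e <= 1" and \<pi>: "continuous_on (bands w W) \<pi>" "ALL z:bands w W. abs (\<pi> z) <= B"
  let ?h = "%z x. cx x (\<pi> z)"
  let ?V = "%z y. discounted_mean (?h z) e (fst z) (snd z) y"
  note cont = discounted_mean_continuous_on[OF w(1) e(1) \<pi>(1) \<pi>(2)[rule_format]]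
  have "EX z:bands w W. ?V z (fst z) + qu = 0 & ?V z (snd z) - qd = 0"
  proof (rule band_zero[OF w(1,2)])
   show "continuous_on (bands w W) (%z. ?V z (fst z) + qu)" by (intro continuous_intros cont)
   show "continuous_on (bands w W) (%z. ?V z (snd z) - qd)" by (intro continuous_intros cont)
   show "0 < ?V (0, b) (fst (0, b)) + qu" if "(0, b) \<in> bands w W" for b
   proof -
    have "0 < b" using that w(1) by (auto simp: bands_def)
    then have "0 <= ?V (0, b) (fst (0, b))"
     using monoD[OF cx_mono] cx_0 by (intro discounted_mean_nonneg) (auto, metis)
    then show ?thesis using q_pos by simp
   qed
   show "?V (a, 0) (snd (a, 0)) - qd < 0" if "(a, 0) \<in> bands w W" for a
   proof -
    have "a < 0" using that w(1) by (auto simp: bands_def)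
    then have "0 <= discounted_mean (%x. - ?h (a, 0) x) e a 0 0"
    proof (rule discounted_mean_nonneg)
     fix y assume "a <= y" "y <= (0 :: real)"
     then show "0 <= - ?h (a, 0) y" using monoD[OF cx_mono, of y 0] cx_0 by simp
    qed
    then show ?thesis using q_pos by (simp add: discounted_mean_uminus)
   qed
   show "?V (a, b) (fst (a, b)) + qu < ?V (a, b) (snd (a, b)) - qd" if "(a, b) \<in> bands w W" "b - a = W" for a b
    using discounted_mean_spread_lower[OF K' _ e cx_continuous_fst cx_mono less_imp_le[OF k(1)] k(2)[rule_format], of b a "\<pi> (a, b)"]
     W r that(2) by simp
   show "?V (a, b) (snd (a, b)) - qd < ?V (a, b) (fst (a, b)) + qu" if ab: "(a, b) \<in> bands w W" "b - a = w" for a b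
   proof -
    have "a < b" "b - a <= W" and mem: "(a, \<pi> (a, b)) \<in> {-W..W} \<times> {-B..B}" "(b, \<pi> (a, b)) \<in> {-W..W} \<times> {-B..B}"
     using ab w \<pi>(2)[rule_format, OF ab(1)] by (auto simp: bands_def)
    note u = discounted_mean_spread_upper[OF m this(1,2) e(1) cx_continuous_fst cx_mono, of "\<pi> (a, b)", folded C_def]
    have "dist (b, \<pi> (a, b)) (a, \<pi> (a, b)) < d" using ab w by (simp add: dist_Pair_Pair dist_real_def)
    from dd[rule_format, OF mem this] have "?h (a, b) b - ?h (a, b) a < (qu + qd) / C" by (simp add: dist_real_def)
    then have "C * (?h (a, b) b - ?h (a, b) a) < qu + qd" using C by (simp add: field_simps)
    with u show ?thesis by simp
   qed
  qed
  then show "EX z:bands w W. optimal_band e (\<pi> z) z" unfolding optimal_band_def by force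
 qed
qed

lemma limit_law_bound:
 fixes h :: "real => real"
 assumes "a < b" "continuous_on UNIV h" "!!z. a <= z ==> z <= b ==> abs (h z) <= B"
 shows "abs (\<integral>y. h y \<partial>limit_law a b) <= B"
proof (rule tendsto_upperbound)
 have "((%t. mean_pos h a b 0 t) \<longlongrightarrow> (\<integral>y. h y \<partial>limit_law a b)) at_top"
  using limit_law[OF assms(1)] assms(2) unfolding is_limit_law_def by blast
 then show "((%t. abs (mean_pos h a b 0 t)) \<longlongrightarrow> abs (\<integral>y. h y \<partial>limit_law a b)) at_top" by (rule tendsto_rabs)
 show "eventually (%t. abs (mean_pos h a b 0 t) <= B) at_top"
  using eventually_ge_at_top[of 0] by eventually_elim (rule mean_pos_bound[OF assms(1) _ assms(3,2)])
qed simp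

definition param :: "real \<times> real => real" where
 "param z = (\<integral>y. f y \<partial>limit_law (fst z) (snd z))"

lemma param_bound:
 assumes "a < b" "ALL z. a <= z --> z <= b --> abs (f z) <= B"
 shows "abs (param (a, b)) <= B" using limit_law_bound[OF assms(1) f_cont] assms(2) by (simp add: param_def)

lemma param_tendsto:
 assumes "0 < w" "!!n. zs n \<in> bands w W" "z \<in> bands w W" "zs \<longlonglongrightarrow> z"
 shows "(%n. param (zs n)) \<longlonglongrightarrow> param z"
proof -
 have "fst z < snd z" if "z \<in> bands w W" for z using that assms(1) by (auto simp: bands_def)
 then show ?thesis unfolding param_def using assms by (intro limit_law_tendsto tendsto_fst tendsto_snd f_cont) auto
qed

lemma param_continuous_on: "0 < w ==> continuous_on (bands w W) param"
 unfolding continuous_on_sequentially comp_def using param_tendsto by blast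

end

section \<open>Discounted and ergodic costs\<close>

text \<open>Integration by parts for \<open>u - u 0\<close>. The constant \<open>u 0\<close>
  integrates to itself, which is how the initial jump enters the cost without discount.\<close>

lemma discounted_stieltjes:
 assumes e: "0 < e" and u: "mono_on {0..} u" "right_cont u" "0 <= u 0"
 shows "(\<integral>\<^sup>+s. ennreal (e * u (max 0 s)) \<partial>discount e) =
  ennreal (u 0) + (\<integral>\<^sup>+s\<in>{0<..}. ennreal (exp (- e * s)) \<partial>stieltjes u)"
proof -
 note [measurable] = right_cont_measurable[OF u(2)]
 have inc: "0 <= u (max 0 s) - u 0" for s using mono_onD[OF u(1), of 0 "max 0 s"] by simp
 have "(\<integral>\<^sup>+s. ennreal (e * u (max 0 s)) \<partial>discount e)
   = (\<integral>\<^sup>+s. ennreal (e * u 0) + ennreal (e * (u (max 0 s) - u 0)) \<partial>discount e)"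
  using e u(3) inc by (intro nn_integral_cong) (simp add: ennreal_plus[symmetric] algebra_simps del: ennreal_plus)
 also have "\<dots> = ennreal (e * u 0) * emeasure (discount e) UNIV + (\<integral>\<^sup>+s. ennreal (e * (u (max 0 s) - u 0)) \<partial>discount e)"
  by (subst nn_integral_add) auto
 also have "ennreal (e * u 0) * emeasure (discount e) UNIV = ennreal (u 0)"
  using e u(3) finite_measure.emeasure_eq_measure[OF finite_measure_discount[OF e], of UNIV]
  by (simp add: measure_discount[OF e] ennreal_mult[symmetric])
 also have "(\<integral>\<^sup>+s. ennreal (e * (u (max 0 s) - u 0)) \<partial>discount e)
   = (\<integral>\<^sup>+s\<in>{0..}. ennreal (e * exp (- e * s) * (u s - u 0)) \<partial>lborel)"
  using e inc by (subst nn_integral_discount, measurable)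
   (auto intro!: nn_integral_cong simp: indicator_def ennreal_mult[symmetric] max_def ac_simps)
 also have "\<dots> = (\<integral>\<^sup>+s\<in>{0<..}. ennreal (exp (- e * s)) \<partial>stieltjes u)"
  by (rule stieltjes_exp[OF u(1,2) e, symmetric])
 finally show ?thesis .
qed

text \<open>Tonelli: an accumulated quantity, discounted at rate e, is e times the discounted flow.\<close>

lemma discounted_accumulation:
 assumes e: "0 < e" and y [measurable]: "y \<in> borel_measurable borel"
 shows "(\<integral>\<^sup>+T. ennreal e * (\<integral>\<^sup>+s\<in>{0..T}. y s \<partial>lborel) \<partial>discount e) = (\<integral>\<^sup>+s. y s \<partial>discount e)"
proof -
 interpret D: finite_measure "discount e" by (rule finite_measure_discount[OF e])
 interpret P: pair_sigma_finite "discount e" lborel by unfold_locales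
 have m: "(%(T, s). ennreal e * (y s * indicator {0..T} s)) \<in> borel_measurable (discount e \<Otimes>\<^sub>M lborel)"
 proof -
  have "Measurable.pred (borel \<Otimes>\<^sub>M borel) (%p :: real \<times> real. snd p \<in> {0..fst p})"
   by (simp add: atLeastAtMost_def) measurable
  then have "(%p. indicator {0..fst p} (snd p) :: ennreal) \<in> borel_measurable (borel \<Otimes>\<^sub>M borel :: (real \<times> real) measure)"
   by (intro borel_measurable_indicator') (simp add: pred_def)
  moreover have "borel_measurable (discount e \<Otimes>\<^sub>M lborel) = borel_measurable (borel \<Otimes>\<^sub>M borel :: (real \<times> real) measure)"
   by (intro measurable_cong_sets sets_pair_measure_cong) auto
  ultimately show ?thesis by (simp add: case_prod_beta') measurable
 qed
 have "(\<integral>\<^sup>+T. ennreal e * (\<integral>\<^sup>+s\<in>{0..T}. y s \<partial>lborel) \<partial>discount e)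
   = (\<integral>\<^sup>+T. \<integral>\<^sup>+s. ennreal e * (y s * indicator {0..T} s) \<partial>lborel \<partial>discount e)"
  by (intro nn_integral_cong) (simp add: nn_integral_cmult)
 also have "\<dots> = (\<integral>\<^sup>+s. \<integral>\<^sup>+T. ennreal e * (y s * indicator {0..T} s) \<partial>discount e \<partial>lborel)"
  by (rule P.Fubini'[OF m, symmetric])
 also have "\<dots> = (\<integral>\<^sup>+s\<in>{0..}. ennreal (exp (- e * s)) * y s \<partial>lborel)"
 proof (rule nn_integral_cong)
  fix s :: real
  show "(\<integral>\<^sup>+T. ennreal e * (y s * indicator {0..T} s) \<partial>discount e) = ennreal (exp (- e * s)) * y s * indicator {0..} s"
  proof (cases "0 <= s")
   case True
   have "(\<integral>\<^sup>+T. ennreal e * (y s * indicator {0..T} s) \<partial>discount e) = (\<integral>\<^sup>+T. ennreal e * y s * indicator {s..} T \<partial>discount e)"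
    using True by (intro nn_integral_cong) (auto simp: indicator_def)
   also have "\<dots> = ennreal e * y s * ennreal (exp (- e * s) / e)"
    by (simp add: nn_integral_cmult_indicator emeasure_discount[OF e True])
   also have "\<dots> = y s * (ennreal e * ennreal (exp (- e * s) / e))" by (simp add: ac_simps)
   also have "ennreal e * ennreal (exp (- e * s) / e) = ennreal (exp (- e * s))"
    using e by (simp add: ennreal_mult[symmetric])
   finally show ?thesis using True by (simp add: mult.commute)
  qed (simp add: indicator_def)
 qed
 also have "\<dots> = (\<integral>\<^sup>+s. y s \<partial>discount e)" by (rule nn_integral_discount[symmetric]) measurable
 finally show ?thesis .
qed

context regular_levy
begin

definition running_cost :: "(real => real) => real => real => real =>
  (real => 'w => real) => (real => 'w => real) => real => ennreal" where
 "running_cost g qu qd x U D T = (\<integral>\<^sup>+w.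
   (\<integral>\<^sup>+s\<in>{0..T}. ennreal (g (x + L s w + U s w - D s w)) \<partial>lborel) +
   ennreal (qu * U T w) + ennreal (qd * D T w) \<partial>M)"

lemma ergodic_cost_eq:
 "ergodic_cost M L f c qu qd x (U, D) \<mu> =
  Limsup at_top (%T. ennreal (1 / T) * running_cost (%y. c y (mean_field_parameter f \<mu>)) qu qd x U D T)"
 by (simp add: ergodic_cost_def running_cost_def controlled_def)

lemma flow_measurable:
 fixes x :: real and g :: "real => real"
 assumes "continuous_on UNIV g" "regular_control U" "regular_control D"
 shows "(%p. g (x + pev L p + pev U p - pev D p)) \<in> pair_rv"
 using pair_cost_measurable[OF assms, of 0 0 0 x] by (simp add: pair_cost_def[abs_def])

context
 fixes e qu qd x :: real and g :: "real => real" and U D :: "real => 'w => real"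
 assumes e: "0 < e" and q: "0 < qu" "0 < qd" and g: "continuous_on UNIV g" "!!y. 0 <= g y"
  and U: "regular_control U" and D: "regular_control D"
begin

lemma pair_cost_fst:
 "(\<integral>\<^sup>+p. ennreal (pair_cost g qu qd e x U D p) \<partial>(MD e)) =
  (\<integral>\<^sup>+w. (\<integral>\<^sup>+s. ennreal (g (x + L (max 0 s) w + U (max 0 s) w - D (max 0 s) w)) \<partial>discount e) +
    ennreal qu * (\<integral>\<^sup>+s. ennreal (e * U (max 0 s) w) \<partial>discount e) +
    ennreal qd * (\<integral>\<^sup>+s. ennreal (e * D (max 0 s) w) \<partial>discount e) \<partial>M)"
proof -
 interpret Df: finite_measure "discount e" by (rule finite_measure_discount[OF e])
 have "pair_cost g qu qd e x U D \<in> borel_measurable (MD e)"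
  using pair_cost_measurable[OF g(1) U D] by (simp add: pair_measurable_discount)
 then have "(\<integral>\<^sup>+p. ennreal (pair_cost g qu qd e x U D p) \<partial>(MD e))
   = (\<integral>\<^sup>+w. \<integral>\<^sup>+s. ennreal (pair_cost g qu qd e x U D (w, s)) \<partial>discount e \<partial>M)"
  by (subst Df.nn_integral_fst) auto
 also have "\<dots> = (\<integral>\<^sup>+w. (\<integral>\<^sup>+s. ennreal (g (x + L (max 0 s) w + U (max 0 s) w - D (max 0 s) w)) \<partial>discount e) +
    ennreal qu * (\<integral>\<^sup>+s. ennreal (e * U (max 0 s) w) \<partial>discount e) +
    ennreal qd * (\<integral>\<^sup>+s. ennreal (e * D (max 0 s) w) \<partial>discount e) \<partial>M)"
 proof (rule nn_integral_cong)
  fix w assume w: "w \<in> space M"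
  have [measurable]: "(%s. U (max 0 s) w) \<in> borel_measurable borel" "(%s. D (max 0 s) w) \<in> borel_measurable borel"
   by (intro right_cont_measurable[of "%t. U t w"] right_cont_measurable[of "%t. D t w"] regular_controlD[OF U] regular_controlD[OF D])+
  have [measurable]: "(%s. g (x + L (max 0 s) w + U (max 0 s) w - D (max 0 s) w)) \<in> borel_measurable borel"
   using measurable_compose[OF measurable_Pair1'[OF w] flow_measurable[OF g(1) U D, of x]] by simp
  have pos: "0 <= U (max 0 s) w" "0 <= D (max 0 s) w" for s
   by (rule regular_controlD(7)[OF U], simp) (rule regular_controlD(7)[OF D], simp)
  have "ennreal (pair_cost g qu qd e x U D (w, s)) =
    ennreal (g (x + L (max 0 s) w + U (max 0 s) w - D (max 0 s) w)) +
    ennreal qu * ennreal (e * U (max 0 s) w) + ennreal qd * ennreal (e * D (max 0 s) w)" for s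
   unfolding pair_cost_def using g(2) pos[of s] e q
   by (simp add: ennreal_mult[symmetric] ennreal_plus[symmetric] ac_simps del: ennreal_plus)
  then show "(\<integral>\<^sup>+s. ennreal (pair_cost g qu qd e x U D (w, s)) \<partial>discount e) =
    (\<integral>\<^sup>+s. ennreal (g (x + L (max 0 s) w + U (max 0 s) w - D (max 0 s) w)) \<partial>discount e) +
    ennreal qu * (\<integral>\<^sup>+s. ennreal (e * U (max 0 s) w) \<partial>discount e) +
    ennreal qd * (\<integral>\<^sup>+s. ennreal (e * D (max 0 s) w) \<partial>discount e)"
   by (simp add: nn_integral_add nn_integral_cmult)
 qed
 finally show ?thesis .
qed

lemma discounted_cost_regular:
 assumes "!!y. g y = c y (mean_field_parameter f \<mu>)"
 shows "discounted_cost M L f c qu qd e x (U, D) \<mu> =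
  (\<integral>\<^sup>+p. ennreal (pair_cost g qu qd e x U D p) \<partial>(MD e))"
proof -
 interpret Df: finite_measure "discount e" by (rule finite_measure_discount[OF e])
 let ?S = "%Y w. \<integral>\<^sup>+s\<in>{0<..}. ennreal (exp (- e * s)) \<partial>stieltjes (%t. Y t w)"
 let ?G = "%w. \<integral>\<^sup>+s. ennreal (g (x + L (max 0 s) w + U (max 0 s) w - D (max 0 s) w)) \<partial>discount e"
 let ?Y = "%Y w. \<integral>\<^sup>+s. ennreal (e * Y (max 0 s) w) \<partial>discount e"
 have Y: "?Y Y w = ennreal (Y 0 w) + ?S Y w" if "regular_control Y" for Y w
  by (intro discounted_stieltjes e regular_controlD[OF that])
 have Sm: "?S Y \<in> borel_measurable M" if Y: "regular_control Y" for Y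
 proof -
  have "(%p. ennreal (e * exp (- e * snd p) * (pev Y p - Y 0 (fst p))) * indicator {0..} (snd p)) \<in> borel_measurable (M \<Otimes>\<^sub>M lborel)"
   using regular_control_pair_measurable[OF Y] borel_measurable_integrable[OF regular_controlD(2)[OF Y order_refl]]
   by measurable
  from lborel.borel_measurable_nn_integral_fst[OF this]
  have "(%w. \<integral>\<^sup>+s. ennreal (e * exp (- e * s) * (Y (max 0 s) w - Y 0 w)) * indicator {0..} s \<partial>lborel) \<in> borel_measurable M"
   by simp
  also have "(%w. \<integral>\<^sup>+s. ennreal (e * exp (- e * s) * (Y (max 0 s) w - Y 0 w)) * indicator {0..} s \<partial>lborel) = ?S Y"
   unfolding stieltjes_exp[OF regular_controlD(3,4)[OF Y] e]
   by (intro ext nn_integral_cong) (auto simp: indicator_def max_def)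
  finally show ?thesis .
 qed
 have [measurable]: "U 0 \<in> borel_measurable M" "D 0 \<in> borel_measurable M" "?S U \<in> borel_measurable M" "?S D \<in> borel_measurable M"
  using borel_measurable_integrable[OF regular_controlD(2)[OF U order_refl]] borel_measurable_integrable[OF regular_controlD(2)[OF D order_refl]] Sm U D
  by blast+
 have Gm [measurable]: "?G \<in> borel_measurable M"
  using Df.borel_measurable_nn_integral_fst[of "%p. ennreal (g (x + pev L p + pev U p - pev D p))" M]
   flow_measurable[OF g(1) U D, of x] by (simp add: pair_measurable_discount)
 have G: "(\<integral>\<^sup>+s\<in>{0..}. ennreal (exp (- e * s) * c (controlled L x (U, D) s w) (mean_field_parameter f \<mu>)) \<partial>lborel) = ?G w"
  if w: "w \<in> space M" for w
 proof -
  have [measurable]: "(%s. g (x + L (max 0 s) w + U (max 0 s) w - D (max 0 s) w)) \<in> borel_measurable borel"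
   using measurable_compose[OF measurable_Pair1'[OF w] flow_measurable[OF g(1) U D, of x]] by simp
  show ?thesis using g(2) by (subst nn_integral_discount, measurable)
    (auto intro!: nn_integral_cong simp: indicator_def controlled_def max_def ennreal_mult assms[symmetric])
 qed
 have "discounted_cost M L f c qu qd e x (U, D) \<mu> =
   (\<integral>\<^sup>+w. ?G w + ennreal qu * ?S U w + ennreal qd * ?S D w \<partial>M)
   + ennreal qu * (\<integral>\<^sup>+w. ennreal (U 0 w) \<partial>M) + ennreal qd * (\<integral>\<^sup>+w. ennreal (D 0 w) \<partial>M)"
  unfolding discounted_cost_def prod.case by (intro arg_cong2[of _ _ _ _ "(+)"] nn_integral_cong refl) (simp only: G)
 also have "\<dots> = (\<integral>\<^sup>+w. ?G w + ennreal qu * ?S U w + ennreal qd * ?S D w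
   + ennreal qu * ennreal (U 0 w) + ennreal qd * ennreal (D 0 w) \<partial>M)"
 proof -
  have "(\<integral>\<^sup>+w. A w + ennreal qu * B w + ennreal qd * C w \<partial>M) + ennreal qu * (\<integral>\<^sup>+w. B' w \<partial>M) + ennreal qd * (\<integral>\<^sup>+w. C' w \<partial>M)
    = (\<integral>\<^sup>+w. A w + ennreal qu * B w + ennreal qd * C w + ennreal qu * B' w + ennreal qd * C' w \<partial>M)"
   if [measurable]: "A \<in> borel_measurable M" "B \<in> borel_measurable M" "C \<in> borel_measurable M"
    "B' \<in> borel_measurable M" "C' \<in> borel_measurable M" for A B C B' C' :: "'w => ennreal"
   by (simp add: nn_integral_add nn_integral_cmult)
  then show ?thesis by this measurable
 qed
 also have "\<dots> = (\<integral>\<^sup>+w. ?G w + ennreal qu * ?Y U w + ennreal qd * ?Y D w \<partial>M)"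
  unfolding Y[OF U] Y[OF D] by (intro nn_integral_cong) (simp add: distrib_left ac_simps)
 finally show ?thesis unfolding pair_cost_fst .
qed

text \<open>The bridge between the two problems: the discounted cost is the mean of the running cost
  over an exponentially distributed horizon, so bounds that are linear in \<open>T\<close> carry
  over.\<close>

lemma pair_cost_running:
 "(\<integral>\<^sup>+p. ennreal (pair_cost g qu qd e x U D p) \<partial>(MD e)) =
  (\<integral>\<^sup>+T. ennreal e * running_cost g qu qd x U D T \<partial>discount e)"
proof -
 interpret Df: finite_measure "discount e" by (rule finite_measure_discount[OF e])
 interpret P: pair_sigma_finite M "discount e" by (rule pair_sigma_finite_discount[OF e])
 let ?g = "%w s. ennreal (g (x + L (max 0 s) w + U (max 0 s) w - D (max 0 s) w))"
 let ?I = "%w T. \<integral>\<^sup>+s\<in>{0..T}. ?g w s \<partial>lborel"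
 let ?H = "%w T. ennreal e * (?I w T + ennreal (qu * U (max 0 T) w) + ennreal (qd * D (max 0 T) w))"
 have gm: "(%p. ?g (fst p) (snd p)) \<in> pair_rv" using flow_measurable[OF g(1) U D, of x] by measurable
 have Im: "(%p. ?I (fst p) (snd p)) \<in> pair_rv"
 proof -
  have "(%q. ?g (fst (fst q)) (snd q)) \<in> borel_measurable ((M \<Otimes>\<^sub>M borel) \<Otimes>\<^sub>M borel)"
   using measurable_compose[of "%q. (fst (fst q), snd q)" "(M \<Otimes>\<^sub>M borel) \<Otimes>\<^sub>M borel", OF _ gm] by simp
  moreover have "(%q. indicator {0..snd (fst q)} (snd q) :: ennreal) \<in> borel_measurable ((M \<Otimes>\<^sub>M borel) \<Otimes>\<^sub>M (borel :: real measure))"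
  proof -
   have "Measurable.pred ((M \<Otimes>\<^sub>M borel) \<Otimes>\<^sub>M (borel :: real measure)) (%q. snd q \<in> {0..snd (fst q)})"
    by (simp add: atLeastAtMost_def) measurable
   then show ?thesis by (intro borel_measurable_indicator') (simp add: pred_def)
  qed
  ultimately have "(%q. ?g (fst (fst q)) (snd q) * indicator {0..snd (fst q)} (snd q)) \<in> borel_measurable ((M \<Otimes>\<^sub>M borel) \<Otimes>\<^sub>M lborel)"
   by measurable
  from lborel.borel_measurable_nn_integral_fst[OF this] show ?thesis by simp
 qed
 have Hm: "(%p. ?H (fst p) (snd p)) \<in> borel_measurable (MD e)"
  unfolding pair_measurable_discount using Im regular_control_pair_measurable[OF U] regular_control_pair_measurable[OF D]
  by measurable
 have H: "(\<integral>\<^sup>+T. ?H w T \<partial>discount e) = (\<integral>\<^sup>+s. ?g w s \<partial>discount e) +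
    ennreal qu * (\<integral>\<^sup>+s. ennreal (e * U (max 0 s) w) \<partial>discount e) +
    ennreal qd * (\<integral>\<^sup>+s. ennreal (e * D (max 0 s) w) \<partial>discount e)" if w: "w \<in> space M" for w
 proof -
  have [measurable]: "(%s. U (max 0 s) w) \<in> borel_measurable borel" "(%s. D (max 0 s) w) \<in> borel_measurable borel"
   by (intro right_cont_measurable[of "%t. U t w"] right_cont_measurable[of "%t. D t w"] regular_controlD[OF U] regular_controlD[OF D])+
  have [measurable]: "?g w \<in> borel_measurable borel" "?I w \<in> borel_measurable borel"
   using measurable_compose[OF measurable_Pair1'[OF w] gm] measurable_compose[OF measurable_Pair1'[OF w] Im] by simp_all
  have pos: "0 <= U (max 0 s) w" "0 <= D (max 0 s) w" for s
   by (rule regular_controlD(7)[OF U], simp) (rule regular_controlD(7)[OF D], simp)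
  have "?H w T = ennreal e * ?I w T + ennreal qu * ennreal (e * U (max 0 T) w) + ennreal qd * ennreal (e * D (max 0 T) w)" for T
   using e q pos[of T] by (simp add: distrib_left ennreal_mult[symmetric] ac_simps)
  then have "(\<integral>\<^sup>+T. ?H w T \<partial>discount e) = (\<integral>\<^sup>+T. ennreal e * ?I w T \<partial>discount e) +
    ennreal qu * (\<integral>\<^sup>+s. ennreal (e * U (max 0 s) w) \<partial>discount e) +
    ennreal qd * (\<integral>\<^sup>+s. ennreal (e * D (max 0 s) w) \<partial>discount e)"
   by (simp add: nn_integral_add nn_integral_cmult)
  then show ?thesis by (simp add: discounted_accumulation[OF e])
 qed
 have "(\<integral>\<^sup>+p. ennreal (pair_cost g qu qd e x U D p) \<partial>(MD e)) = (\<integral>\<^sup>+w. \<integral>\<^sup>+T. ?H w T \<partial>discount e \<partial>M)"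
  unfolding pair_cost_fst by (intro nn_integral_cong H[symmetric])
 also have "\<dots> = (\<integral>\<^sup>+T. \<integral>\<^sup>+w. ?H w T \<partial>M \<partial>discount e)"
  using P.Fubini'[of ?H] Hm by (simp add: case_prod_beta')
 also have "\<dots> = (\<integral>\<^sup>+T. ennreal e * running_cost g qu qd x U D T \<partial>discount e)"
 proof (rule nn_integral_cong_AE)
  show "AE T in discount e. (\<integral>\<^sup>+w. ?H w T \<partial>M) = ennreal e * running_cost g qu qd x U D T"
   using AE_discount[of e]
  proof eventually_elim
   case (elim T)
   have m: "(%w. ?I w T + ennreal (qu * U (max 0 T) w) + ennreal (qd * D (max 0 T) w)) \<in> borel_measurable M"
    using measurable_compose[OF measurable_Pair2'[of T borel M] Im] 
     borel_measurable_integrable[OF regular_controlD(2)[OF U, of "max 0 T"]]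
     borel_measurable_integrable[OF regular_controlD(2)[OF D, of "max 0 T"]] by simp
   have I: "?I w T = (\<integral>\<^sup>+s\<in>{0..T}. ennreal (g (x + L s w + U s w - D s w)) \<partial>lborel)" for w
    by (intro nn_integral_cong) (auto simp: indicator_def)
   show ?case unfolding nn_integral_cmult[OF m] running_cost_def using elim by (simp add: I)
  qed
 qed
 finally show ?thesis .
qed

end

end

lemma nn_integral_discount_affine:
 assumes "0 < e" "0 <= j" "0 <= K"
 shows "(\<integral>\<^sup>+T. ennreal e * ennreal (j * T + K) \<partial>discount e) = ennreal (j / e + K)"
proof -
 have "(\<integral>\<^sup>+T. ennreal e * ennreal (j * T + K) \<partial>discount e) =
   (\<integral>\<^sup>+T. ennreal (e * j) * ennreal T + ennreal (e * K) \<partial>discount e)" using AE_discount[of e]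
  by (intro nn_integral_cong_AE, eventually_elim)
   (use assms in \<open>simp add: ennreal_mult[symmetric] ennreal_plus[symmetric] algebra_simps del: ennreal_plus\<close>)
 also have "\<dots> = ennreal (e * j) * ennreal (1 / e ^ 2) + ennreal (e * K) * emeasure (discount e) UNIV"
  by (subst nn_integral_add) (auto simp: nn_integral_cmult nn_integral_discount_id[OF assms(1)])
 also have "\<dots> = ennreal (j / e + K)"
  using assms finite_measure.emeasure_eq_measure[OF finite_measure_discount[OF assms(1)], of UNIV]
  by (simp add: measure_discount[OF assms(1)] ennreal_mult[symmetric] ennreal_plus[symmetric] power2_eq_square del: ennreal_plus)
 finally show ?thesis .
qed

context regular_levy
begin

lemma running_cost_mono:
 assumes U: "regular_control U" and D: "regular_control D" and q: "0 < qu" "0 < qd" and T: "0 <= T" "T <= T'"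
 shows "running_cost g qu qd x U D T <= running_cost g qu qd x U D T'"
 unfolding running_cost_def using regular_controlD(6)[OF U T] regular_controlD(6)[OF D T] T q
 by (intro nn_integral_mono add_mono ennreal_leI mult_left_mono) (auto simp: indicator_def intro!: mult_left_mono)

text \<open>If the upper rate is below \<open>j\<close>, the running cost is at most
  \<open>j * T\<close> beyond some \<open>S\<close>, hence by monotonicity at most
  \<open>j * (T + S)\<close> for all \<open>T\<close>. Averaging over exponential horizons gives
  \<open>j / e\<close> plus a constant.\<close>

lemma discounted_le_ergodic:
 assumes q: "0 < qu" "0 < qd" and g: "continuous_on UNIV g" "!!y. 0 <= g y"
  and U: "regular_control U" and D: "regular_control D" and j: "0 <= j"
  and less: "Limsup at_top (%T. ennreal (1 / T) * running_cost g qu qd x U D T) < ennreal j"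
 shows "EX K. ALL e>0. (\<integral>\<^sup>+p. ennreal (pair_cost g qu qd e x U D p) \<partial>(MD e)) <= ennreal (j / e + K)"
proof -
 let ?R = "running_cost g qu qd x U D"
 have "eventually (%T. ennreal (1 / T) * ?R T < ennreal j) at_top" by (rule Limsup_lessD[OF less])
 then obtain T0 where T0: "!!T. T0 <= T ==> ennreal (1 / T) * ?R T < ennreal j"
  by (auto simp: eventually_at_top_linorder)
 define S where "S = max 1 T0"
 have S: "1 <= S" by (simp add: S_def)
 have late: "?R T <= ennreal (j * T)" if "S <= T" for T
 proof -
  have T: "0 < T" using that S by simp
  have "?R T = ennreal T * (ennreal (1 / T) * ?R T)"
   using T by (simp add: mult.assoc[symmetric] ennreal_mult[symmetric])
  also have "\<dots> <= ennreal T * ennreal j" using T0[of T] that by (intro mult_left_mono) (auto simp: S_def)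
  finally show ?thesis using T j by (simp add: ennreal_mult[symmetric] mult.commute)
 qed
 have R: "?R T <= ennreal (j * T + j * S)" if "0 <= T" for T
 proof -
  have "?R T <= ?R (max T S)" using that by (intro running_cost_mono U D q) auto
  also have "\<dots> <= ennreal (j * max T S)" by (rule late) simp
  also have "j * max T S <= j * (T + S)" using that S j by (intro mult_left_mono) auto
  finally show ?thesis by (simp add: distrib_left ennreal_leI)
 qed
 have "(\<integral>\<^sup>+p. ennreal (pair_cost g qu qd e x U D p) \<partial>(MD e)) <= ennreal (j / e + j * S)" if e: "0 < e" for e
 proof -
  have "(\<integral>\<^sup>+T. ennreal e * ?R T \<partial>discount e) <= (\<integral>\<^sup>+T. ennreal e * ennreal (j * T + j * S) \<partial>discount e)"
   using AE_discount[of e] by (intro nn_integral_mono_AE, eventually_elim) (intro mult_left_mono R, auto)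
  also have "\<dots> = ennreal (j / e + j * S)" using S j by (intro nn_integral_discount_affine e) auto
  finally show ?thesis unfolding pair_cost_running[OF e q g U D] .
 qed
 then show ?thesis by blast
qed

text \<open>Averaging over exponential horizons turns \<open>j * T\<close> into \<open>j / e\<close>
  and leaves the error \<open>K\<close> as it is.\<close>

lemma cost_rate_consequences:
 assumes q: "0 < qu" "0 < qd" and g: "continuous_on UNIV g" "!!y. 0 <= g y"
  and U: "regular_control U" and D: "regular_control D" and j: "0 <= j" "0 <= K"
  and R: "!!T. 0 <= T ==> running_cost g qu qd x U D T <= ennreal (j * T + K)"
   "!!T. 0 <= T ==> ennreal (j * T - K) <= running_cost g qu qd x U D T"
 shows "0 < e ==> (\<integral>\<^sup>+p. ennreal (pair_cost g qu qd e x U D p) \<partial>(MD e)) <= ennreal (j / e + K)"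
  and "0 < e ==> ennreal (j / e) <= (\<integral>\<^sup>+p. ennreal (pair_cost g qu qd e x U D p) \<partial>(MD e)) + ennreal K"
  and "Limsup at_top (%T. ennreal (1 / T) * running_cost g qu qd x U D T) = ennreal j"
proof -
 let ?R = "running_cost g qu qd x U D"
 show "(\<integral>\<^sup>+p. ennreal (pair_cost g qu qd e x U D p) \<partial>(MD e)) <= ennreal (j / e + K)" if e: "0 < e"
 proof -
  have "(\<integral>\<^sup>+T. ennreal e * ?R T \<partial>discount e) <= (\<integral>\<^sup>+T. ennreal e * ennreal (j * T + K) \<partial>discount e)"
   using AE_discount[of e] by (intro nn_integral_mono_AE, eventually_elim) (intro mult_left_mono R, auto)
  also have "\<dots> = ennreal (j / e + K)" using j by (intro nn_integral_discount_affine e) auto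
  finally show ?thesis unfolding pair_cost_running[OF e q g U D] .
 qed
 show "ennreal (j / e) <= (\<integral>\<^sup>+p. ennreal (pair_cost g qu qd e x U D p) \<partial>(MD e)) + ennreal K" if e: "0 < e"
 proof -
  have "ennreal (j / e) = (\<integral>\<^sup>+T. ennreal e * ennreal (j * T) \<partial>discount e)"
   using nn_integral_discount_affine[OF e j(1) order_refl] by simp
  also have "\<dots> <= (\<integral>\<^sup>+T. ennreal e * ennreal (j * T - K) + ennreal e * ennreal K \<partial>discount e)"
  proof (rule nn_integral_mono)
   fix T
   have "ennreal (j * T) <= ennreal (j * T - K) + ennreal K"
   proof (cases "j * T <= K")
    case True
    then have "ennreal (j * T) <= ennreal K" by (rule ennreal_leI)
    then show ?thesis by (rule order_trans) simp
   next
    case False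
    then show ?thesis using j(2) by (simp add: ennreal_plus[symmetric] del: ennreal_plus)
   qed
   then show "ennreal e * ennreal (j * T) <= ennreal e * ennreal (j * T - K) + ennreal e * ennreal K"
    by (simp add: distrib_left[symmetric] mult_left_mono)
  qed
  also have "\<dots> = (\<integral>\<^sup>+T. ennreal e * ennreal (j * T - K) \<partial>discount e) + (\<integral>\<^sup>+T. ennreal e * ennreal K \<partial>discount e)"
   by (rule nn_integral_add) measurable
  also have "(\<integral>\<^sup>+T. ennreal e * ennreal K \<partial>discount e) = ennreal K"
   using nn_integral_discount_affine[OF e order_refl j(2)] by simp
  also have "(\<integral>\<^sup>+T. ennreal e * ennreal (j * T - K) \<partial>discount e) <= (\<integral>\<^sup>+T. ennreal e * ?R T \<partial>discount e)"
   using AE_discount[of e] by (intro nn_integral_mono_AE, eventually_elim) (intro mult_left_mono R, auto)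
  finally show ?thesis unfolding pair_cost_running[OF e q g U D] by (simp add: add_mono)
 qed
 have r: "?R T = ennreal (enn2real (?R T))" "abs (enn2real (?R T) - j * T) <= K" if T: "0 <= T" for T
 proof -
  have "?R T < \<top>" using R(1)[OF T] by (rule le_less_trans) simp
  then show e: "?R T = ennreal (enn2real (?R T))" by simp
  have "enn2real (?R T) <= j * T + K" using R(1)[OF T] j T by (intro enn2real_leI) auto
  moreover have "j * T - K <= enn2real (?R T)"
   using R(2)[OF T] enn2real_nonneg[of "?R T"] by (subst (asm) e) (auto simp: ennreal_le_iff2)
  ultimately show "abs (enn2real (?R T) - j * T) <= K" by simp
 qed
 have "((%T. ennreal (1 / T * enn2real (?R T))) \<longlongrightarrow> ennreal j) at_top"
 proof (rule tendsto_ennrealI, rule LIM_zero_cancel)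
  show "((%T. 1 / T * enn2real (?R T) - j) \<longlongrightarrow> 0) at_top"
  proof (rule Lim_null_comparison)
   show "eventually (%T. norm (1 / T * enn2real (?R T) - j) <= K / T) at_top"
    using eventually_gt_at_top[of 0]
   proof eventually_elim
    case (elim T)
    then have "1 / T * enn2real (?R T) - j = (enn2real (?R T) - j * T) / T" by (simp add: field_simps)
    then show ?case using elim r(2)[of T] by (simp add: divide_right_mono)
   qed
   show "((%T. K / T) \<longlongrightarrow> 0) at_top" by real_asymp
  qed
 qed
 moreover have "eventually (%T. ennreal (1 / T * enn2real (?R T)) = ennreal (1 / T) * ?R T) at_top"
  using eventually_gt_at_top[of 0]
 proof eventually_elim
  case (elim T)
  have "ennreal (1 / T) * ?R T = ennreal (1 / T) * ennreal (enn2real (?R T))"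
   by (rule arg_cong[OF r(1)[OF less_imp_le[OF elim]]])
  also have "\<dots> = ennreal (1 / T * enn2real (?R T))" using elim by (intro ennreal_mult[symmetric]) auto
  finally show ?case by (rule sym)
 qed
 ultimately have "((%T. ennreal (1 / T) * ?R T) \<longlongrightarrow> ennreal j) at_top" by (rule Lim_transform_eventually)
 then show "Limsup at_top (%T. ennreal (1 / T) * ?R T) = ennreal j" by (intro lim_imp_Limsup) simp_all
qed

text \<open>A limit along integers from a fixed start, so that convexity in the band is inherited
  from the controls.\<close>

definition control_rate :: "(real => real => real => (real => real) => real => real) => real \<times> real => real" where
 "control_rate R z = lim (%n. expectation (%w. R (fst z) (snd z) 0 (lpath 0 w) (real n)) / real n)"

text \<open>By the flow property the expected control is additive up to a change of start, and least
  controls are 1-Lipschitz in the start. Restarts lie in the band, so the error is at most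
  \<open>W\<close> and \<open>quasi_additive\<close> applies; another start \<open>x\<close> adds at
  most \<open>abs x\<close>.\<close>

lemma control_rate:
 assumes R: "R = refl_up \<or> R = refl_down" and ab: "a < b" "abs a <= W" "abs b <= W"
 shows "0 <= control_rate R (a, b)"
  and "(%n. expectation (%\<omega>. R a b 0 (lpath 0 \<omega>) (real n)) / real n) \<longlonglongrightarrow> control_rate R (a, b)"
  and "0 <= t ==> abs (expectation (%\<omega>. R a b x (lpath 0 \<omega>) t) - control_rate R (a, b) * t) <= W + abs x"
proof -
 let ?w = "%x t. expectation (%\<omega>. R a b x (lpath 0 \<omega>) t)"
 have i: "integrable M (%\<omega>. R a b x (lpath s \<omega>) t)" if "0 <= s" "0 <= t" for x s t
  using R refl_integrable(1,2)[OF that ab(1)] by blast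
 have reg: "regular_control (%t \<omega>. R a b x (lpath 0 \<omega>) t)" for x
  using R refl_regular_control[OF ab(1)] by blast
 have lip: "abs (R a b y (lpath s \<omega>) t - R a b x (lpath s \<omega>) t) <= abs (y - x)" if "0 <= s" "0 <= t" for x y s t \<omega>
 proof -
  note T = path_tame[OF that(1) ab(1)]
  have "up_at s a b y t \<omega> <= up_at s a b x t \<omega> + abs (y - x)"
   "down_at s a b y t \<omega> <= down_at s a b x t \<omega> + abs (y - x)" for x y
   using refl_change_start[OF less_imp_le[OF ab(1)] T that(2), of y \<omega> x] by linarith+
  from this[of y x] this[of x y] show ?thesis
   using R by (elim disjE) (simp_all only: abs_le_iff abs_minus_commute, linarith+)
 qed
 have flow: "R a b x (lpath 0 \<omega>) (s + t) = R a b x (lpath 0 \<omega>) s + R a b (pos_at 0 a b x s \<omega>) (lpath s \<omega>) t"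
  if "0 <= s" "0 <= t" for x s t \<omega>
  using R refl_flow(1,2)[OF path_regular[OF order_refl] ab(1) that, of x \<omega>] unfolding shift_lpath[OF that(1)] by metis
 have shift: "expectation (%\<omega>. R a b x (lpath s \<omega>) t) = ?w x t" if "0 <= s" "0 <= t" for x s t
  using R expectation_controls_shift[OF that ab(1)] by blast
 have "EX r>=0. ALL t>=0. abs (?w 0 t - r * t) <= W"
 proof (rule quasi_additive)
  show "?w 0 s <= ?w 0 t" if "0 <= s" "s <= t" for s t
   using that regular_controlD(6)[OF reg] by (intro integral_mono i) auto
  show "0 <= ?w 0 0" using regular_controlD(5)[OF reg] by (intro Bochner_Integration.integral_nonneg)
  fix s t :: real assume st: "0 <= s" "0 <= t"
  have st': "0 <= s + t" using st by simp
  have "abs (?w 0 (s + t) - ?w 0 s - ?w 0 t) = abs (expectation (%\<omega>. R a b 0 (lpath 0 \<omega>) (s + t) - R a b 0 (lpath 0 \<omega>) s - R a b 0 (lpath s \<omega>) t))"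
   using i[OF order_refl st'] i[OF order_refl st(1)] i[OF st] by (simp add: shift[OF st])
  also have "\<dots> <= expectation (%\<omega>. abs (R a b 0 (lpath 0 \<omega>) (s + t) - R a b 0 (lpath 0 \<omega>) s - R a b 0 (lpath s \<omega>) t))"
   by (rule integral_abs_bound)
  also have "\<dots> <= expectation (%\<omega>. W)"
  proof (rule integral_mono)
   show "integrable M (%\<omega>. abs (R a b 0 (lpath 0 \<omega>) (s + t) - R a b 0 (lpath 0 \<omega>) s - R a b 0 (lpath s \<omega>) t))"
    by (intro integrable_abs Bochner_Integration.integrable_diff i order_refl st st')
   show "abs (R a b 0 (lpath 0 \<omega>) (s + t) - R a b 0 (lpath 0 \<omega>) s - R a b 0 (lpath s \<omega>) t) <= W" for \<omega>
    using lip[OF st, of "pos_at 0 a b 0 s \<omega>" \<omega> 0] refl_bounds[OF order_refl st(1) ab(1), of 0 \<omega>] ab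
    unfolding flow[OF st] by simp
  qed simp
  finally show "abs (?w 0 (s + t) - ?w 0 s - ?w 0 t) <= W" by (simp add: prob_space)
 qed
 then obtain r where r: "0 <= r" "!!t. 0 <= t ==> abs (?w 0 t - r * t) <= W" by blast
 have lim: "(%n. ?w 0 (real n) / real n) \<longlonglongrightarrow> r"
 proof (rule LIM_zero_cancel, rule Lim_null_comparison)
  show "eventually (%n. norm (?w 0 (real n) / real n - r) <= W / real n) sequentially"
   using eventually_gt_at_top[of 0]
  proof eventually_elim
   case (elim n)
   then have "?w 0 (real n) / real n - r = (?w 0 (real n) - r * real n) / real n" by (simp add: field_simps)
   then show ?case using elim r(2)[of "real n"] by (simp add: divide_right_mono)
  qed
  show "(%n. W / real n) \<longlonglongrightarrow> 0" by real_asymp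
 qed
 then have cr: "control_rate R (a, b) = r" unfolding control_rate_def by (simp add: limI)
 show "0 <= control_rate R (a, b)" using cr r by simp
 show "(%n. ?w 0 (real n) / real n) \<longlonglongrightarrow> control_rate R (a, b)" using lim cr by simp
 show "abs (?w x t - control_rate R (a, b) * t) <= W + abs x" if t: "0 <= t"
 proof -
  have "abs (?w x t - ?w 0 t) = abs (expectation (%\<omega>. R a b x (lpath 0 \<omega>) t - R a b 0 (lpath 0 \<omega>) t))"
   using i[OF order_refl t] by simp
  also have "\<dots> <= expectation (%\<omega>. abs (R a b x (lpath 0 \<omega>) t - R a b 0 (lpath 0 \<omega>) t))" by (rule integral_abs_bound)
  also have "\<dots> <= expectation (%\<omega>. abs x)" using lip[OF order_refl t, of x _ 0]
   by (intro integral_mono integrable_abs Bochner_Integration.integrable_diff i t order_refl) auto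
  finally show ?thesis using r(2)[OF t] unfolding cr by (simp add: prob_space)
 qed
qed

text \<open>Convex functions on an open set are continuous, and convexity passes from
  \<open>refl_convex\<close> to the limit.\<close>

lemma control_rate_continuous:
 assumes R: "R = refl_up \<or> R = refl_down"
 shows "continuous_on {z. fst z < snd z} (control_rate R)"
proof (rule convex_on_continuous)
 show "open {z :: real \<times> real. fst z < snd z}" by (intro open_Collect_less continuous_intros)
 show "convex_on {z. fst z < snd z} (control_rate R)"
 proof (rule convex_onI)
  show "convex {z :: real \<times> real. fst z < snd z}"
  proof (rule convexI)
   fix y z :: "real \<times> real" and u v :: real
   assume "y \<in> {z. fst z < snd z}" "z \<in> {z. fst z < snd z}" "0 <= u" "0 <= v" "u + v = 1"
   then show "u *\<^sub>R y + v *\<^sub>R z \<in> {z. fst z < snd z}"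
    using convex_bound_lt[of "fst y - snd y" 0 "fst z - snd z" u v] by (simp add: algebra_simps)
  qed
  fix v :: real and y z :: "real \<times> real"
  assume v: "0 < v" "v < 1" and yz: "y \<in> {z. fst z < snd z}" "z \<in> {z. fst z < snd z}"
  obtain a b a' b' where [simp]: "y = (a, b)" "z = (a', b')" by (cases y, cases z)
  have ab: "a < b" "a' < b'" using yz by auto
  let ?c = "(1 - v) * a + v * a'" and ?d = "(1 - v) * b + v * b'"
  have cd: "?c < ?d" using ab v by (intro add_strict_mono mult_strict_left_mono) auto
  let ?w = "%a b n. expectation (%\<omega>. R a b 0 (lpath 0 \<omega>) (real n)) / real n"
  have i: "integrable M (%\<omega>. R a b 0 (lpath 0 \<omega>) (real n))" if "a < b" for a b n
   using R refl_integrable(1,2)[OF order_refl of_nat_0_le_iff that] by blast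
  have cv: "R ?c ?d 0 (lpath 0 \<omega>) (real n) <= (1 - v) * R a b 0 (lpath 0 \<omega>) (real n) + v * R a' b' 0 (lpath 0 \<omega>) (real n)" for \<omega> n
  proof -
   have "0 <= 1 - v" "0 <= v" "1 - v + v = 1" using v by auto
   from refl_convex[OF path_regular[OF order_refl] ab of_nat_0_le_iff this, of 0 0 \<omega> n]
   show ?thesis using R by (elim disjE) simp_all
  qed
  have w: "?w ?c ?d n <= (1 - v) * ?w a b n + v * ?w a' b' n" for n
  proof -
   have "expectation (%\<omega>. R ?c ?d 0 (lpath 0 \<omega>) (real n)) <= expectation (%\<omega>. (1 - v) * R a b 0 (lpath 0 \<omega>) (real n) + v * R a' b' 0 (lpath 0 \<omega>) (real n))"
    by (intro integral_mono cv i cd Bochner_Integration.integrable_add integrable_mult_right ab)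
   also have "\<dots> = (1 - v) * expectation (%\<omega>. R a b 0 (lpath 0 \<omega>) (real n)) + v * expectation (%\<omega>. R a' b' 0 (lpath 0 \<omega>) (real n))"
    using i ab by simp
   finally show ?thesis by (simp add: divide_right_mono add_divide_distrib[symmetric])
  qed
  have lim: "?w a b \<longlonglongrightarrow> control_rate R (a, b)" if "a < b" for a b
   by (rule control_rate(2)[OF R that, of "abs a + abs b"]) auto
  have "control_rate R (?c, ?d) <= (1 - v) * control_rate R (a, b) + v * control_rate R (a', b')"
   by (rule LIMSEQ_le[OF lim[OF cd] tendsto_add[OF tendsto_mult_left[OF lim[OF ab(1)]] tendsto_mult_left[OF lim[OF ab(2)]]]])
    (use w in blast)
  then show "control_rate R ((1 - v) *\<^sub>R y + v *\<^sub>R z) <= (1 - v) * control_rate R y + v * control_rate R z" by simp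
 qed
qed

end

section \<open>Null sets and regular versions of admissible controls\<close>

lemma stieltjes_cong: "(!!t. 0 <= t ==> g t = g' t) ==> stieltjes g = stieltjes g'"
 by (simp add: stieltjes_def)

lemma costs_cong:
 assumes "AE w in M. ALL t>=0. L t w = L' t w & U t w = U' t w & D t w = D' t w"
 shows "discounted_cost M L f c qu qd e x (U, D) \<mu> = discounted_cost M L' f c qu qd e x (U', D') \<mu>"
  and "ergodic_cost M L f c qu qd x (U, D) \<mu> = ergodic_cost M L' f c qu qd x (U', D') \<mu>"
proof -
 have eq: "(\<integral>\<^sup>+w. ennreal (U 0 w) \<partial>M) = (\<integral>\<^sup>+w. ennreal (U' 0 w) \<partial>M)"
  "(\<integral>\<^sup>+w. ennreal (D 0 w) \<partial>M) = (\<integral>\<^sup>+w. ennreal (D' 0 w) \<partial>M)"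
  using assms by (auto intro!: nn_integral_cong_AE elim!: eventually_mono)
 show "discounted_cost M L f c qu qd e x (U, D) \<mu> = discounted_cost M L' f c qu qd e x (U', D') \<mu>"
  unfolding discounted_cost_def prod.case eq
 proof (intro arg_cong2[of _ _ _ _ "(+)"] refl nn_integral_cong_AE)
  show "AE w in M.
    (\<integral>\<^sup>+s\<in>{0..}. ennreal (exp (- e * s) * c (controlled L x (U, D) s w) (mean_field_parameter f \<mu>)) \<partial>lborel)
    + ennreal qu * (\<integral>\<^sup>+s\<in>{0<..}. ennreal (exp (- e * s)) \<partial>stieltjes (%t. U t w))
    + ennreal qd * (\<integral>\<^sup>+s\<in>{0<..}. ennreal (exp (- e * s)) \<partial>stieltjes (%t. D t w)) =
    (\<integral>\<^sup>+s\<in>{0..}. ennreal (exp (- e * s) * c (controlled L' x (U', D') s w) (mean_field_parameter f \<mu>)) \<partial>lborel)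
    + ennreal qu * (\<integral>\<^sup>+s\<in>{0<..}. ennreal (exp (- e * s)) \<partial>stieltjes (%t. U' t w))
    + ennreal qd * (\<integral>\<^sup>+s\<in>{0<..}. ennreal (exp (- e * s)) \<partial>stieltjes (%t. D' t w))"
   using assms
  proof eventually_elim
   case (elim w)
   then have "stieltjes (%t. U t w) = stieltjes (%t. U' t w)" "stieltjes (%t. D t w) = stieltjes (%t. D' t w)"
    by (auto intro!: stieltjes_cong)
   with elim show ?case
    by (auto intro!: arg_cong2[of _ _ _ _ "(+)"] nn_integral_cong simp: controlled_def indicator_def)
  qed
 qed
 show "ergodic_cost M L f c qu qd x (U, D) \<mu> = ergodic_cost M L' f c qu qd x (U', D') \<mu>"
  unfolding ergodic_cost_def prod.case
 proof (rule Limsup_eq, rule eventually_mono[OF eventually_ge_at_top[of 0]])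
  fix T :: real assume T: "0 <= T"
  have "AE w in M. (\<integral>\<^sup>+s\<in>{0..T}. ennreal (c (controlled L x (U, D) s w) (mean_field_parameter f \<mu>)) \<partial>lborel)
     + ennreal (qu * U T w) + ennreal (qd * D T w) =
    (\<integral>\<^sup>+s\<in>{0..T}. ennreal (c (controlled L' x (U', D') s w) (mean_field_parameter f \<mu>)) \<partial>lborel)
     + ennreal (qu * U' T w) + ennreal (qd * D' T w)" using assms
   by eventually_elim (use T in \<open>auto intro!: arg_cong2[of _ _ _ _ "(+)"] nn_integral_cong simp: controlled_def indicator_def\<close>)
  then show "ennreal (1 / T) * (\<integral>\<^sup>+w. (\<integral>\<^sup>+s\<in>{0..T}. ennreal (c (controlled L x (U, D) s w) (mean_field_parameter f \<mu>)) \<partial>lborel)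
     + ennreal (qu * U T w) + ennreal (qd * D T w) \<partial>M) =
    ennreal (1 / T) * (\<integral>\<^sup>+w. (\<integral>\<^sup>+s\<in>{0..T}. ennreal (c (controlled L' x (U', D') s w) (mean_field_parameter f \<mu>)) \<partial>lborel)
     + ennreal (qu * U' T w) + ennreal (qd * D' T w) \<partial>M)"
   by (intro arg_cong2[of _ _ _ _ "(*)"] refl nn_integral_cong_AE)
 qed
qed

context regular_levy
begin

text \<open>The control is set to 0 on a null set containing the bad paths; completeness of the
  filtration keeps it adapted.\<close>

lemma regularize_process:
 assumes Y: "adapted F Y" "!!t w. 0 <= t ==> w \<in> space M ==> 0 <= Y t w" "!!t. 0 <= t ==> integrable M (Y t)"
  and good: "AE w in M. (ALL t>=0. continuous (at_right t) (%s. Y s w)) & mono_on {0..} (%s. Y s w)"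
 shows "EX Y'. regular_control Y' & (AE w in M. ALL t>=0. Y t w = Y' t w)"
proof -
 obtain N where N: "{w\<in>space M. ~ ((ALL t>=0. continuous (at_right t) (%s. Y s w)) & mono_on {0..} (%s. Y s w))} \<subseteq> N"
  "N \<in> null_sets M" using good unfolding eventually_ae_filter by blast
 define Y' where "Y' t w = (if w \<in> space M - N then Y t w else 0)" for t w
 have AE: "AE w in M. ALL t>=0. Y t w = Y' t w"
  using AE_not_in[OF N(2)] AE_space by eventually_elim (simp add: Y'_def)
 have NF: "N \<in> sets (F t)" if "0 <= t" for t by (rule null_subset_F[OF N(2) order_refl that])
 have Y'm: "Y' t \<in> borel_measurable (F t)" if "0 <= t" for t
 proof -
  have [measurable]: "Y t \<in> borel_measurable (F t)" using Y(1) that unfolding adapted_def by blast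
  have "(space M - N) \<inter> space (F t) \<in> sets (F t)" using sets.compl_sets[OF NF[OF that]] by (simp add: Int_absorb2)
  then show ?thesis unfolding Y'_def[abs_def] by (intro measurable_If_set) auto
 qed
 have "regular_control Y'" unfolding regular_control_def
 proof (intro conjI allI impI)
  fix t :: real assume t: "0 <= t"
  show "Y' t \<in> borel_measurable (F t)" by (rule Y'm[OF t])
  have "AE w in M. Y t w = Y' t w" using AE by eventually_elim (use t in blast)
  then show "integrable M (Y' t)"
   by (rule Bochner_Integration.integrable_cong_AE_imp[OF Y(3)[OF t] measurable_F_M[OF Y'm[OF t] t]])
 next
  fix w
  have "mono_on {0..} (%t. Y' t w) & right_cont (%t. Y' t w) & 0 <= Y' 0 w"
  proof (cases "w \<in> space M - N")
   case True
   then have "Y' t w = Y t w" for t by (simp add: Y'_def)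
   moreover have "(ALL t>=0. continuous (at_right t) (%s. Y s w)) & mono_on {0..} (%s. Y s w)" using True N(1) by blast
   ultimately show ?thesis using Y(2)[of 0 w] True by (simp add: right_cont_def)
  qed (auto simp: Y'_def mono_on_def right_cont_def)
  then show "mono_on {0..} (%t. Y' t w)" "right_cont (%t. Y' t w)" "0 <= Y' 0 w" by blast+
 qed
 then show ?thesis using AE by blast
qed

lemma admissible_regularize:
 assumes "(U, D) \<in> admissible M F"
 shows "EX U' D'. regular_control U' & regular_control D' &
  (AE w in M. ALL t>=0. L t w = L t w & U t w = U' t w & D t w = D' t w)"
proof -
 have reg: "EX Y'. regular_control Y' & (AE w in M. ALL t>=0. Y t w = Y' t w)" if Y: "Y \<in> {U, D}" for Y
 proof -
  from assms have "ALL Y:{U, D}. adapted F Y & (ALL t>=0. ALL w:space M. 0 <= Y t w) &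
   (AE w in M. (ALL t>=0. continuous (at_right t) (%s. Y s w)) & mono_on {0..} (%s. Y s w)) & (ALL t>=0. integrable M (Y t))"
   unfolding admissible_def mem_Collect_eq prod.case .
  note this[rule_format, OF Y]
  then show ?thesis by (elim conjE) (rule regularize_process, assumption, simp, simp, assumption)
 qed
 obtain U' where U': "regular_control U'" "AE w in M. ALL t>=0. U t w = U' t w"
  using reg[OF insertI1] by (elim exE conjE)
 obtain D' where D': "regular_control D'" "AE w in M. ALL t>=0. D t w = D' t w"
  using reg[OF insertI2[OF singletonI]] by (elim exE conjE)
 have "AE w in M. ALL t>=0. L t w = L t w & U t w = U' t w & D t w = D' t w"
  using U'(2) D'(2) by eventually_elim blast
 then show ?thesis using U'(1) D'(1) by blast
qed

lemma regular_admissible: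
 assumes "regular_control U" "regular_control D"
 shows "(U, D) \<in> admissible M F" using regular_controlD[OF assms(1)] regular_controlD[OF assms(2)]
 unfolding admissible_def adapted_def right_cont_def by simp

end

context dropping_levy
begin

definition stationary_cost :: "(real => real) => real => real => real \<times> real => real" where
 "stationary_cost g qu qd z =
   (\<integral>y. g y \<partial>limit_law (fst z) (snd z)) + qu * control_rate refl_up z + qd * control_rate refl_down z"

text \<open>The time integral of the mixing error, plus the bound of \<open>control_rate\<close> for
  each control. The band enters only through \<open>W\<close>, so the error is common to all bands
  considered.\<close>

definition rate_error :: "real => real => real => real => real => real => real => real" where
 "rate_error W B C l qu qd x = 2 * B * C / l + qu * (W + abs x) + qd * (W + abs x)"

text \<open>The position cost is linear in \<open>T\<close> by mixing, the two control costs by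
  \<open>control_rate\<close>; the errors add up.\<close>

lemma refl_running_cost:
 fixes a b x T :: real and g :: "real => real"
 assumes q: "0 < qu" "0 < qd" and B: "0 <= B" and mix: "mixing_rate (2 * W) C l"
  and ab: "a < b" "abs a <= W" "abs b <= W" and T: "0 <= T"
  and g: "continuous_on UNIV g" "ALL y. 0 <= g y" "ALL y. - W <= y --> y <= W --> g y <= B"
 shows "running_cost g qu qd x (%t w. up_at 0 a b x t w) (%t w. down_at 0 a b x t w) T
   <= ennreal (stationary_cost g qu qd (a, b) * T + rate_error W B C l qu qd x)" (is "?R <= _")
  and "ennreal (stationary_cost g qu qd (a, b) * T - rate_error W B C l qu qd x)
   <= running_cost g qu qd x (%t w. up_at 0 a b x t w) (%t w. down_at 0 a b x t w) T"
proof -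
 note C = mixing_rateD(1,2)[OF mix]
 define d where "d = 2 * B * C / l"
 define K where "K = rate_error W B C l qu qd x"
 define m where "m = (\<integral>y. g y \<partial>limit_law a b)"
 have d0: "0 <= d" using B C by (simp add: d_def)
 let ?X = "%w s. pos_at 0 a b x s w"
 let ?U = "%t w. up_at 0 a b x t w" and ?D = "%t w. down_at 0 a b x t w"
 let ?m = "%s. mean_pos g a b x s"
 interpret PL: pair_sigma_finite M lborel by unfold_locales
 have gm [measurable]: "g \<in> borel_measurable borel" by (rule borel_measurable_continuous_onI[OF g(1)])
 note U = refl_regular_control(1)[OF ab(1), of x] and D = refl_regular_control(2)[OF ab(1), of x]
 have gB: "ALL z. a <= z --> z <= b --> abs (g z) <= B" using g ab by auto
 have "b - a <= 2 * W" using ab by linarith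
 from limit_law_error[OF ab(1) this _ g(1) gB mix]
 have err: "abs (m - ?m s) <= 2 * B * (C * exp (- l * s))" if "0 <= s" for s using that unfolding m_def by blast
 have m0: "0 <= m" unfolding m_def using g(2) by (intro Bochner_Integration.integral_nonneg) blast
 have mp0: "0 <= ?m s" for s unfolding mean_pos_def using g(2) by (intro Bochner_Integration.integral_nonneg) blast
 have mm [measurable]: "(%s. ?m (max 0 s)) \<in> borel_measurable borel" by (rule mean_pos_measurable[OF ab(1) g(1)])
 define Z where "Z = (\<integral>\<^sup>+s\<in>{0..T}. ennreal (?m (max 0 s)) \<partial>lborel)"
 have tail: "(\<integral>\<^sup>+s\<in>{0..T}. ennreal (2 * B * (C * exp (- l * s))) \<partial>lborel) <= ennreal d"
 proof -
  have "(\<integral>\<^sup>+s\<in>{0..T}. ennreal (2 * B * (C * exp (- l * s))) \<partial>lborel)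
    <= (\<integral>\<^sup>+s\<in>{0..}. ennreal (exp (- l * s)) * ennreal (2 * B * C) \<partial>lborel)"
   using B C by (intro nn_integral_mono) (auto simp: indicator_def ennreal_mult[symmetric] ac_simps)
  also have "\<dots> = (\<integral>\<^sup>+s. ennreal (2 * B * C) \<partial>discount l)" by (rule nn_integral_discount[symmetric]) simp
  also have "\<dots> = ennreal (2 * B * C) * ennreal (1 / l)"
   using finite_measure.emeasure_eq_measure[OF finite_measure_discount[OF C(2)], of UNIV] by (simp add: measure_discount[OF C(2)])
  also have "\<dots> = ennreal d" using B C by (simp add: d_def ennreal_mult[symmetric])
  finally show ?thesis .
 qed
 have mT: "(\<integral>\<^sup>+s\<in>{0..T}. ennreal m \<partial>lborel) = ennreal (m * T)"
  using T m0 by (simp add: nn_integral_cmult_indicator ennreal_mult)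
 have "Z <= (\<integral>\<^sup>+s. ennreal m * indicator {0..T} s + ennreal (2 * B * (C * exp (- l * s))) * indicator {0..T} s \<partial>lborel)"
  unfolding Z_def
 proof (rule nn_integral_mono)
  fix s
  show "ennreal (?m (max 0 s)) * indicator {0..T} s <= ennreal m * indicator {0..T} s + ennreal (2 * B * (C * exp (- l * s))) * indicator {0..T} s"
   using err[of s] m0 B C by (auto simp: indicator_def ennreal_plus[symmetric] simp del: ennreal_plus intro!: ennreal_leI)
 qed
 also have "\<dots> = ennreal (m * T) + (\<integral>\<^sup>+s\<in>{0..T}. ennreal (2 * B * (C * exp (- l * s))) \<partial>lborel)"
  by (subst nn_integral_add) (auto simp: mT)
 also have "\<dots> <= ennreal (m * T) + ennreal d" by (intro add_left_mono tail)
 finally have Z1: "Z <= ennreal (m * T + d)" using m0 T d0 by simp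
 have "ennreal (m * T) <= (\<integral>\<^sup>+s. ennreal (?m (max 0 s)) * indicator {0..T} s + ennreal (2 * B * (C * exp (- l * s))) * indicator {0..T} s \<partial>lborel)"
  unfolding mT[symmetric]
 proof (rule nn_integral_mono)
  fix s
  show "ennreal m * indicator {0..T} s <= ennreal (?m (max 0 s)) * indicator {0..T} s + ennreal (2 * B * (C * exp (- l * s))) * indicator {0..T} s"
   using err[of s] mp0[of s] B C by (auto simp: indicator_def ennreal_plus[symmetric] simp del: ennreal_plus intro!: ennreal_leI)
 qed
 also have "\<dots> = Z + (\<integral>\<^sup>+s\<in>{0..T}. ennreal (2 * B * (C * exp (- l * s))) \<partial>lborel)"
  unfolding Z_def by (subst nn_integral_add) auto
 also have "\<dots> <= Z + ennreal d" by (intro add_left_mono tail)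
 finally have Z2: "ennreal (m * T) <= Z + ennreal d" .
 have "Z < \<top>" using Z1 by (rule le_less_trans) simp
 then obtain z where z: "Z = ennreal z" "0 <= z" by (cases Z) auto
 have zz: "abs (z - m * T) <= d" using Z1 Z2 z d0 m0 T by (simp add: ennreal_plus[symmetric] ennreal_le_iff abs_le_iff del: ennreal_plus)
 define u where "u = expectation (?U T)"
 define v where "v = expectation (?D T)"
 have u: "0 <= u" "abs (u - control_rate refl_up (a, b) * T) <= W + abs x"
  unfolding u_def using control_rate(3)[OF disjI1[OF refl] ab T] regular_controlD(7)[OF U T] by (auto intro: Bochner_Integration.integral_nonneg)
 have v: "0 <= v" "abs (v - control_rate refl_down (a, b) * T) <= W + abs x"
  unfolding v_def using control_rate(3)[OF disjI2[OF refl] ab T] regular_controlD(7)[OF D T] by (auto intro: Bochner_Integration.integral_nonneg)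
 have Xm: "(%p. ennreal (g (?X (fst p) (max 0 (snd p)))) * indicator {0..T} (snd p)) \<in> borel_measurable (M \<Otimes>\<^sub>M lborel)"
  using measurable_compose[OF right_cont_pair_measurable[of "%t w. ?X w t", OF refl_measurable(3)[OF order_refl _ ab(1)]
    refl_pos_right_cont[OF path_tame[OF order_refl ab(1)]]] gm] by measurable
 have inner: "(\<integral>\<^sup>+w. (\<integral>\<^sup>+s\<in>{0..T}. ennreal (g (?X w (max 0 s))) \<partial>lborel) \<partial>M) = Z"
 proof -
  have "(\<integral>\<^sup>+w. (\<integral>\<^sup>+s\<in>{0..T}. ennreal (g (?X w (max 0 s))) \<partial>lborel) \<partial>M)
    = (\<integral>\<^sup>+s. \<integral>\<^sup>+w. ennreal (g (?X w (max 0 s))) * indicator {0..T} s \<partial>M \<partial>lborel)"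
   using PL.Fubini'[of "%w s. ennreal (g (?X w (max 0 s))) * indicator {0..T} s"] Xm by (simp add: case_prod_beta')
  also have "\<dots> = Z" unfolding Z_def
  proof (rule nn_integral_cong)
   fix s :: real
   have i: "integrable M (%w. g (?X w (max 0 s)))" by (rule integrable_pos[OF ab(1) order_refl _ g(1)]) simp
   show "(\<integral>\<^sup>+w. ennreal (g (?X w (max 0 s))) * indicator {0..T} s \<partial>M) = ennreal (?m (max 0 s)) * indicator {0..T} s"
    unfolding mean_pos_def using nn_integral_eq_integral[OF i] g(2) borel_measurable_integrable[OF i]
    by (subst nn_integral_multc) auto
  qed
  finally show ?thesis .
 qed
 have "running_cost g qu qd x ?U ?D T = (\<integral>\<^sup>+w. (\<integral>\<^sup>+s\<in>{0..T}. ennreal (g (?X w (max 0 s))) \<partial>lborel) +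
   ennreal (qu * ?U T w) + ennreal (qd * ?D T w) \<partial>M)" unfolding running_cost_def
  by (intro nn_integral_cong arg_cong2[of _ _ _ _ "(+)"] refl) (auto simp: indicator_def refl_pos_def path_0)
 also have "\<dots> = Z + (\<integral>\<^sup>+w. ennreal (qu * ?U T w) \<partial>M) + (\<integral>\<^sup>+w. ennreal (qd * ?D T w) \<partial>M)"
 proof -
  have [measurable]: "(%w. \<integral>\<^sup>+s\<in>{0..T}. ennreal (g (?X w (max 0 s))) \<partial>lborel) \<in> borel_measurable M"
   using lborel.borel_measurable_nn_integral_fst[OF Xm] by simp
  have [measurable]: "?U T \<in> borel_measurable M" "?D T \<in> borel_measurable M"
   using borel_measurable_integrable[OF regular_controlD(2)[OF U T]] borel_measurable_integrable[OF regular_controlD(2)[OF D T]] by auto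
  show ?thesis unfolding inner[symmetric] by (subst nn_integral_add, measurable, subst nn_integral_add, measurable)
 qed
 also have "(\<integral>\<^sup>+w. ennreal (qu * ?U T w) \<partial>M) = ennreal (qu * u)"
  unfolding u_def using q regular_controlD(2,7)[OF U T] by (subst nn_integral_eq_integral) auto
 also have "(\<integral>\<^sup>+w. ennreal (qd * ?D T w) \<partial>M) = ennreal (qd * v)"
  unfolding v_def using q regular_controlD(2,7)[OF D T] by (subst nn_integral_eq_integral) auto
 finally have RC: "running_cost g qu qd x ?U ?D T = ennreal (z + qu * u + qd * v)" using z u(1) v(1) q by simp
 have scale: "abs (k * y - k * r * T) <= k * (W + abs x)" if "0 < k" "abs (y - r * T) <= W + abs x" for k y r
 proof -
  have "abs (k * y - k * r * T) = k * abs (y - r * T)" using that(1) abs_mult[of k "y - r * T"] by (simp add: algebra_simps)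
  then show ?thesis using that by (simp add: mult_left_mono)
 qed
 have "abs ((z + qu * u + qd * v) - (m + qu * control_rate refl_up (a, b) + qd * control_rate refl_down (a, b)) * T) <= K"
  using zz scale[OF q(1) u(2)] scale[OF q(2) v(2)] unfolding K_def rate_error_def d_def[symmetric] distrib_right abs_le_iff by linarith
 then have "z + qu * u + qd * v <= stationary_cost g qu qd (a, b) * T + K" "stationary_cost g qu qd (a, b) * T - K <= z + qu * u + qd * v"
  unfolding stationary_cost_def m_def fst_conv snd_conv abs_le_iff by linarith+
 then show "?R <= ennreal (stationary_cost g qu qd (a, b) * T + rate_error W B C l qu qd x)"
  "ennreal (stationary_cost g qu qd (a, b) * T - rate_error W B C l qu qd x) <= ?R"
  unfolding RC K_def[symmetric] by (simp_all add: ennreal_leI)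
qed

end

section \<open>Costs and cost rates of bands\<close>

context control_problem
begin

definition band_up :: "real \<times> real => real => real => 'w => real" where
 "band_up z x = (%t w. up_at 0 (fst z) (snd z) x t w)"

definition band_down :: "real \<times> real => real => real => 'w => real" where
 "band_down z x = (%t w. down_at 0 (fst z) (snd z) x t w)"

definition band_cost :: "real => real => real \<times> real => real => ennreal" where
 "band_cost e x z p = (\<integral>\<^sup>+v. ennreal (pair_cost (%y. c y p) qu qd e x (band_up z x) (band_down z x) v) \<partial>(MD e))"

definition band_rate :: "real \<times> real => real => real" where
 "band_rate z p = stationary_cost (%y. c y p) qu qd z"

lemma band_regular:
 assumes "fst z < snd z"
 shows "regular_control (band_up z x)" "regular_control (band_down z x)"
 unfolding band_up_def band_down_def using refl_regular_control[OF assms] by blast+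

lemma band_cost_optimal:
 assumes "0 < e" "fst z < snd z" "optimal_band e p z" "regular_control U" "regular_control D"
 shows "band_cost e x z p <= (\<integral>\<^sup>+v. ennreal (pair_cost (%y. c y p) qu qd e x U D v) \<partial>(MD e))"
proof -
 obtain k where k: "0 <= k" "ALL y y'. fst z <= y --> y <= snd z --> fst z <= y' --> y' <= snd z --> abs (cx y p - cx y' p) <= k * abs (y - y')"
  using cx_lipschitz[of "fst z" "snd z" p] by blast
 show ?thesis unfolding band_cost_def band_up_def band_down_def
  by (rule refl_optimal[OF assms(1,2) cx_continuous_fst cx_mono c_continuous_fst c_nonneg c_tangent k(1) k(2)[rule_format] q_pos
     assms(3)[unfolded optimal_band_def, THEN conjunct1] assms(3)[unfolded optimal_band_def, THEN conjunct2] assms(4,5)])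
qed

lemma band_discounted_cost:
 assumes "0 < e" "fst z < snd z"
 shows "discounted_cost M L f c qu qd e x (band_up z x, band_down z x) \<mu> = band_cost e x z (mean_field_parameter f \<mu>)"
 unfolding band_cost_def
 by (rule discounted_cost_regular[OF assms(1) q_pos c_continuous_fst c_nonneg band_regular[OF assms(2)] refl])

lemma band_cost_le_admissible:
 assumes "0 < e" "fst z < snd z" "optimal_band e (mean_field_parameter f \<mu>) z" "(U, D) \<in> admissible M F"
 shows "band_cost e x z (mean_field_parameter f \<mu>) <= discounted_cost M L f c qu qd e x (U, D) \<mu>"
proof -
 obtain U' D' where r: "regular_control U'" "regular_control D'"
  and AE: "AE w in M. ALL t>=0. L t w = L t w & U t w = U' t w & D t w = D' t w"
  using admissible_regularize[OF assms(4)] by blast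
 show ?thesis unfolding costs_cong(1)[OF AE]
   discounted_cost_regular[OF assms(1) q_pos c_continuous_fst c_nonneg r refl]
  by (rule band_cost_optimal[OF assms(1-3) r])
qed

lemma discounted_value_band:
 assumes "0 < e" "fst z < snd z" "optimal_band e (mean_field_parameter f \<mu>) z"
 shows "discounted_value M F L f c qu qd e x \<mu> = band_cost e x z (mean_field_parameter f \<mu>)"
proof (rule antisym)
 show "discounted_value M F L f c qu qd e x \<mu> <= band_cost e x z (mean_field_parameter f \<mu>)"
  unfolding discounted_value_def band_discounted_cost[OF assms(1,2), symmetric]
  by (rule INF_lower[OF regular_admissible[OF band_regular[OF assms(2)]]])
 show "band_cost e x z (mean_field_parameter f \<mu>) <= discounted_value M F L f c qu qd e x \<mu>"
  unfolding discounted_value_def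
 proof (rule INF_greatest)
  fix UD assume "UD \<in> admissible M F"
  then show "band_cost e x z (mean_field_parameter f \<mu>) <= discounted_cost M L f c qu qd e x UD \<mu>"
   using band_cost_le_admissible[OF assms] by (cases UD) auto
 qed
qed

lemma bands_lt:
 assumes "0 < w" "z \<in> bands w W"
 shows "fst z < snd z" "abs (fst z) <= W" "abs (snd z) <= W" using assms by (auto simp: bands_def)

lemma c_bounded: "EX K>=0. ALL y p. - W <= y --> y <= W --> abs p <= B --> c y p <= K"
proof -
 have "compact ((%(x, y). c x y) ` ({-W..W} \<times> {-B..B}))"
  by (intro compact_continuous_image continuous_on_subset[OF c_cont] compact_Times) auto
 then have "bounded ((%(x, y). c x y) ` ({-W..W} \<times> {-B..B}))" by (rule compact_imp_bounded)
 then obtain K where K: "!!v. v \<in> (%(x, y). c x y) ` ({-W..W} \<times> {-B..B}) ==> norm v <= K"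
  unfolding bounded_iff by blast
 have "c y p <= max 0 K" if "- W <= y" "y <= W" "abs p <= B" for y p
 proof -
  have "(y, p) \<in> {-W..W} \<times> {-B..B}" using that by auto
  from K[OF imageI[OF this]] show ?thesis by simp
 qed
 then show ?thesis by (intro exI[of _ "max 0 K"]) simp
qed

lemma band_cost_rate:
 assumes mix: "mixing_rate (2 * W) C l" and B: "0 <= B" "!!y. - W <= y ==> y <= W ==> c y p <= B"
  and lt: "fst z < snd z" "abs (fst z) <= W" "abs (snd z) <= W"
 shows "0 <= band_rate z p"
  and "0 < e ==> band_cost e x z p <= ennreal (band_rate z p / e + rate_error W B C l qu qd x)"
  and "0 < e ==> ennreal (band_rate z p / e) <= band_cost e x z p + ennreal (rate_error W B C l qu qd x)"
  and "mean_field_parameter f \<mu> = p ==>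
   ergodic_cost M L f c qu qd x (band_up z x, band_down z x) \<mu> = ennreal (band_rate z p)"
proof -
 have B': "ALL y. - W <= y --> y <= W --> c y p <= B" "ALL y. 0 <= c y p" using B(2) c_nonneg by blast+
 have W: "0 <= W" using lt by linarith
 have K: "0 <= rate_error W B C l qu qd x"
  unfolding rate_error_def using q_pos B(1) mixing_rateD(1,2)[OF mix] W by simp
 note rc = refl_running_cost[OF q_pos B(1) mix lt _ c_continuous_fst B'(2,1), of _ x, unfolded prod.collapse,
   folded band_up_def band_down_def band_rate_def]
 show pos: "0 <= band_rate z p" unfolding band_rate_def stationary_cost_def
  using control_rate(1)[OF disjI1[OF refl] lt] control_rate(1)[OF disjI2[OF refl] lt] q_pos c_nonneg
  by (intro add_nonneg_nonneg mult_nonneg_nonneg Bochner_Integration.integral_nonneg) auto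
 note cons = cost_rate_consequences[OF q_pos c_continuous_fst c_nonneg band_regular[OF lt(1)] pos K rc, rotated -1]
 show "band_cost e x z p <= ennreal (band_rate z p / e + rate_error W B C l qu qd x)"
  "ennreal (band_rate z p / e) <= band_cost e x z p + ennreal (rate_error W B C l qu qd x)" if "0 < e"
  unfolding band_cost_def by (rule cons(1)[OF that]; assumption) (rule cons(2)[OF that]; assumption)
 show "ergodic_cost M L f c qu qd x (band_up z x, band_down z x) \<mu> = ennreal (band_rate z p)"
  if "mean_field_parameter f \<mu> = p" unfolding ergodic_cost_eq that
  by (rule cost_rate_consequences(3)[OF q_pos c_continuous_fst c_nonneg band_regular[OF lt(1)] pos K rc]; assumption)
qed

lemma c_uniform:
 assumes "ps \<longlonglongrightarrow> p" "!!n. abs (ps n) <= B" "abs p <= B" "0 < r"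
 shows "eventually (%n. ALL y. - W <= y --> y <= W --> abs (c y (ps n) - c y p) <= r) sequentially"
proof -
 have "uniformly_continuous_on ({-W..W} \<times> {-B..B}) (%(x, y). c x y)"
  by (intro compact_uniformly_continuous continuous_on_subset[OF c_cont] compact_Times) auto
 then obtain d where d: "0 < d" and dd: "ALL v:{-W..W} \<times> {-B..B}. ALL v':{-W..W} \<times> {-B..B}. dist v' v < d -->
   dist (case v' of (x, y) => c x y) (case v of (x, y) => c x y) < r"
  using assms(4) unfolding uniformly_continuous_on_def by blast
 have "eventually (%n. dist (ps n) p < d) sequentially" using assms(1) d by (rule tendstoD)
 then show ?thesis
 proof eventually_elim
  case (elim n)
  show ?case
  proof (intro allI impI)
   fix y assume "- W <= y" "y <= W"
   then have m: "(y, p) \<in> {-W..W} \<times> {-B..B}" "(y, ps n) \<in> {-W..W} \<times> {-B..B}"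
    using assms(2)[of n] assms(3) by auto
   have "dist (y, ps n) (y, p) < d" using elim by (simp add: dist_Pair_Pair)
   from dd[rule_format, OF m this] show "abs (c y (ps n) - c y p) <= r" by (simp add: dist_real_def)
  qed
 qed
qed

lemma limit_law_integrable:
 fixes h :: "real => real"
 assumes "a < b" "continuous_on UNIV h"
 shows "integrable (limit_law a b) h"
proof -
 have \<mu>: "real_distribution (limit_law a b)" "AE y in limit_law a b. y \<in> {a..b}"
  using limit_law[OF assms(1)] unfolding is_limit_law_def by blast+
 interpret N: real_distribution "limit_law a b" by (rule \<mu>(1))
 obtain B where "ALL z. a <= z --> z <= b --> abs (h z) <= B" using continuous_bounded_Icc[OF assms(2)] by blast
 then have "AE y in limit_law a b. norm (h y) <= B" by (intro eventually_mono[OF \<mu>(2)]) simp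
 moreover have "h \<in> borel_measurable (limit_law a b)" using borel_measurable_continuous_onI[OF assms(2)] by simp
 ultimately show ?thesis by (rule N.integrable_const_bound)
qed

text \<open>The change of parameter is uniform on the interval that contains all bands; the change
  of band is covered by \<open>limit_law_tendsto\<close> and continuity of the control
  rates.\<close>

lemma band_rate_tendsto:
 assumes w: "0 < w" and zs: "!!n. zs n \<in> bands w W" "z \<in> bands w W" "zs \<longlonglongrightarrow> z"
  and ps: "ps \<longlonglongrightarrow> p" "!!n. abs (ps n) <= B" "abs p <= B"
 shows "(%n. band_rate (zs n) (ps n)) \<longlonglongrightarrow> band_rate z p"
proof -
 note lt = bands_lt[OF w zs(2)] and lts = bands_lt[OF w zs(1)]
 have cr: "(%n. control_rate R (zs n)) \<longlonglongrightarrow> control_rate R z" if "R = refl_up \<or> R = refl_down" for R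
  by (rule continuous_on_tendsto_compose[OF control_rate_continuous[OF that] zs(3)]) (use lt lts in simp_all)
 let ?I = "%p z. \<integral>y. c y p \<partial>limit_law (fst z) (snd z)"
 have "(%n. ?I (ps n) (zs n) - ?I p (zs n)) \<longlonglongrightarrow> 0"
 proof (rule LIMSEQ_I)
  fix r :: real assume r: "0 < r"
  from c_uniform[OF ps, of "r / 2" W] r obtain N where N: "!!n y. N <= n ==> - W <= y ==> y <= W ==> abs (c y (ps n) - c y p) <= r / 2"
   by (auto simp: eventually_sequentially)
  show "EX N. ALL n>=N. norm (?I (ps n) (zs n) - ?I p (zs n) - 0) < r"
  proof (intro exI[of _ N] allI impI)
   fix n assume n: "N <= n"
   have "?I (ps n) (zs n) - ?I p (zs n) = (\<integral>y. c y (ps n) - c y p \<partial>limit_law (fst (zs n)) (snd (zs n)))"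
    by (intro Bochner_Integration.integral_diff[symmetric] limit_law_integrable lts c_continuous_fst)
   also have "abs (\<dots>) <= r / 2"
   proof (rule limit_law_bound[OF lts(1)])
    show "continuous_on UNIV (%y. c y (ps n) - c y p)" by (intro continuous_intros c_continuous_fst)
    fix y assume "fst (zs n) <= y" "y <= snd (zs n)"
    then show "abs (c y (ps n) - c y p) <= r / 2" using lts[of n] by (intro N n) linarith+
   qed
   finally show "norm (?I (ps n) (zs n) - ?I p (zs n) - 0) < r" using r by simp
  qed
 qed
 moreover have "(%n. ?I p (zs n)) \<longlonglongrightarrow> ?I p z"
  by (rule limit_law_tendsto[OF lts(1) lt(1) tendsto_fst[OF zs(3)] tendsto_snd[OF zs(3)] c_continuous_fst])
 ultimately have "(%n. (?I (ps n) (zs n) - ?I p (zs n)) + ?I p (zs n)) \<longlonglongrightarrow> 0 + ?I p z" by (rule tendsto_add)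
 then show ?thesis unfolding band_rate_def stationary_cost_def by (intro tendsto_intros cr) simp_all
qed

text \<open>The reflected position never leaves the interval from \<open>- W\<close> to
  \<open>W\<close>, where the two costs differ by at most \<open>d\<close>; the total discounted
  time is \<open>1 / e\<close>.\<close>

lemma band_cost_perturb:
 assumes e: "0 < e" and w: "0 < w" and z: "z \<in> bands w W"
  and d: "0 <= d" "!!y. - W <= y ==> y <= W ==> c y p <= c y p' + d"
 shows "band_cost e x z p <= band_cost e x z p' + ennreal (d / e)"
proof -
 note lt = bands_lt[OF w z]
 interpret Df: finite_measure "discount e" by (rule finite_measure_discount[OF e])
 interpret P: pair_sigma_finite M "discount e" by (rule pair_sigma_finite_discount[OF e])
 let ?C = "%p. pair_cost (%y. c y p) qu qd e x (band_up z x) (band_down z x)"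
 have "?C p v <= ?C p' v + d" for v
 proof -
  have "x + pev L v + band_up z x (max 0 (snd v)) (fst v) - band_down z x (max 0 (snd v)) (fst v)
    = pos_at 0 (fst z) (snd z) x (max 0 (snd v)) (fst v)" by (simp add: band_up_def band_down_def refl_pos_def path_0)
  moreover have "- W <= pos_at 0 (fst z) (snd z) x (max 0 (snd v)) (fst v)"
    "pos_at 0 (fst z) (snd z) x (max 0 (snd v)) (fst v) <= W"
   using refl_bounds[OF order_refl _ lt(1), of "max 0 (snd v)" x "fst v"] lt by auto
  ultimately show ?thesis unfolding pair_cost_def using d(2) by simp
 qed
 moreover have "0 <= ?C p v" for p v
  unfolding pair_cost_def using c_nonneg q_pos e regular_controlD(7)[OF band_regular(1)[OF lt(1)]] regular_controlD(7)[OF band_regular(2)[OF lt(1)]]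
  by simp
 ultimately have "ennreal (?C p v) <= ennreal (?C p' v) + ennreal d" for v
  using d(1) by (simp add: ennreal_plus[symmetric] ennreal_leI del: ennreal_plus)
 then have "band_cost e x z p <= (\<integral>\<^sup>+v. ennreal (?C p' v) + ennreal d \<partial>(MD e))"
  unfolding band_cost_def by (rule nn_integral_mono)
 also have "\<dots> = band_cost e x z p' + ennreal d * emeasure (MD e) (space (MD e))"
 proof -
  have "?C p' \<in> borel_measurable (MD e)"
   using pair_cost_measurable[OF c_continuous_fst band_regular[OF lt(1)]] by (simp add: pair_measurable_discount)
  then show ?thesis unfolding band_cost_def by (subst nn_integral_add) auto
 qed
 also have "emeasure (MD e) (space (MD e)) = ennreal (1 / e)" unfolding space_pair_measure
  by (subst Df.emeasure_pair_measure_Times) (auto simp: emeasure_space_1 Df.emeasure_eq_measure measure_discount[OF e])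
 finally show ?thesis using d(1) e by (simp add: ennreal_mult[symmetric])
qed

end

section \<open>The limit of vanishing discount\<close>

context control_problem
begin

text \<open>The errors in \<open>band_cost_rate\<close> are common to all bands of the compact set.
  Multiplied by \<open>es n\<close> they vanish, so discounted values follow the cost rates, and
  these are continuous along the convergent bands.\<close>

theorem regular_equilibrium:
 "EX w W z zs es. 0 < w & z \<in> bands w W & (ALL n :: nat. zs n \<in> bands w W & 0 < es n) & zs \<longlonglongrightarrow> z & es \<longlonglongrightarrow> 0 &
  (ALL n x. discounted_value M F L f c qu qd (es n) x (limit_law (fst (zs n)) (snd (zs n))) =
   discounted_cost M L f c qu qd (es n) x (band_up (zs n) x, band_down (zs n) x) (limit_law (fst (zs n)) (snd (zs n)))) &
  (ALL x. ergodic_value M F L f c qu qd x (limit_law (fst z) (snd z)) =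
   ergodic_cost M L f c qu qd x (band_up z x, band_down z x) (limit_law (fst z) (snd z))) &
  (ALL x. (%n. ennreal (es n) * discounted_value M F L f c qu qd (es n) x (limit_law (fst (zs n)) (snd (zs n))))
   \<longlonglongrightarrow> ergodic_value M F L f c qu qd x (limit_law (fst z) (snd z)))"
proof -
 obtain w W B where w: "0 < w" "w < W" and fB: "ALL z. - W <= z --> z <= W --> abs (f z) <= B"
  and ex: "ALL e \<pi>. 0 < e --> e <= 1 --> continuous_on (bands w W) \<pi> --> (ALL z:bands w W. abs (\<pi> z) <= B) -->
   (EX z:bands w W. optimal_band e (\<pi> z) z)" using optimal_band_exists by (elim exE conjE)
 have W: "0 <= W" using w by simp
 have pB: "abs (param z) <= B" if "z \<in> bands w W" for z
 proof -
  have "abs (param (fst z, snd z)) <= B"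
   using bands_lt[OF w(1) that] by (intro param_bound allI impI fB[rule_format]) linarith+
  then show ?thesis by simp
 qed
 define e0 where "e0 n = 1 / real (Suc n)" for n
 have e0: "0 < e0 n" "e0 n <= 1" for n by (auto simp: e0_def)
 have "ALL n. EX z:bands w W. optimal_band (e0 n) (param z) z"
  using ex[rule_format, OF e0 param_continuous_on[OF w(1)] pB] by blast
 then obtain zs0 where zs0: "!!n. zs0 n \<in> bands w W" "!!n. optimal_band (e0 n) (param (zs0 n)) (zs0 n)" by metis
 obtain z r where z: "z \<in> bands w W" and r: "strict_mono r" "(zs0 \<circ> r) \<longlonglongrightarrow> z"
  using compact_bands[of w W, unfolded compact_def, rule_format, of zs0] zs0(1) by blast
 define zs where "zs = zs0 \<circ> r"
 define es where "es = e0 \<circ> r"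
 have zs: "zs n \<in> bands w W" "optimal_band (es n) (param (zs n)) (zs n)" "zs \<longlonglongrightarrow> z" for n
  using zs0 r by (simp_all add: zs_def es_def)
 have es: "0 < es n" "es n <= 1" for n using e0 by (simp_all add: es_def)
 have "e0 \<longlonglongrightarrow> 0" unfolding e0_def using LIMSEQ_inverse_real_of_nat by (simp add: inverse_eq_divide)
 then have es0: "es \<longlonglongrightarrow> 0" unfolding es_def using r(1) by (rule LIMSEQ_subseq_LIMSEQ)
 note lt = bands_lt[OF w(1) z] and lts = bands_lt[OF w(1) zs(1)]
 let ?\<mu> = "%z. limit_law (fst z) (snd z)"
 have mfp: "mean_field_parameter f (?\<mu> z) = param z" for z by (simp add: mean_field_parameter_def param_def)
 have ps: "(%n. param (zs n)) \<longlonglongrightarrow> param z" by (rule param_tendsto[OF w(1) zs(1) z zs(3)])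
 have rates: "(%n. band_rate (zs n) (param (zs n))) \<longlonglongrightarrow> band_rate z (param z)"
  by (rule band_rate_tendsto[OF w(1) zs(1) z zs(3) ps pB[OF zs(1)] pB[OF z]])
 have dv: "discounted_value M F L f c qu qd (es n) x (?\<mu> (zs n)) = band_cost (es n) x (zs n) (param (zs n))" for n x
  using discounted_value_band[where z = "zs n" and \<mu> = "?\<mu> (zs n)" and x = x, OF es(1) lts(1)] zs(2) unfolding mfp by blast
 obtain C l where mix: "mixing_rate (2 * W) C l" using mean_pos_ergodic by blast
 obtain Bc where Bc: "0 <= Bc" "!!y p. abs p <= B ==> - W <= y ==> y <= W ==> c y p <= Bc" using c_bounded by blast
 have erg: "ergodic_value M F L f c qu qd x (?\<mu> z) = ergodic_cost M L f c qu qd x (band_up z x, band_down z x) (?\<mu> z) &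
  (%n. ennreal (es n) * discounted_value M F L f c qu qd (es n) x (?\<mu> (zs n))) \<longlonglongrightarrow> ergodic_value M F L f c qu qd x (?\<mu> z)" for x
 proof -
  define K where "K = rate_error W Bc C l qu qd x"
  have K: "0 <= K" unfolding K_def rate_error_def using q_pos Bc(1) mixing_rateD(1,2)[OF mix] W by simp
  let ?j = "%n. band_rate (zs n) (param (zs n))" and ?J = "band_rate z (param z)"
  note Rn = band_cost_rate[OF mix Bc(1) Bc(2)[OF pB[OF zs(1)]] lts]
  note Rz = band_cost_rate[OF mix Bc(1) Bc(2)[OF pB[OF z]] lt]
  have J0: "0 <= ?J" by (rule Rz(1))
  have j0: "0 <= ?j n" for n by (rule Rn(1))
  have ec: "ergodic_cost M L f c qu qd x (band_up z x, band_down z x) (?\<mu> z) = ennreal ?J"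
   by (rule Rz(4)) (assumption | rule mfp)+
  have upper: "band_cost (es n) x (zs n) (param (zs n)) <= ennreal (?j n / es n + K)" for n
   unfolding K_def by (rule Rn(2)) (assumption | rule es)+
  have lower: "ennreal (?j n / es n) <= band_cost (es n) x (zs n) (param (zs n)) + ennreal K" for n
   unfolding K_def by (rule Rn(3)) (assumption | rule es)+
  \<comment> \<open>A control with rate \<open>j\<close> below that of the limit band would have
    discounted cost at most \<open>j / e\<close> plus a constant at the limiting parameter. For
    small discount this is less than what optimal bands allow.\<close>
  have le: "ennreal ?J <= ergodic_cost M L f c qu qd x (U, D) (?\<mu> z)" if UD: "(U, D) \<in> admissible M F" for U D
  proof (rule ccontr)
   assume "~ ennreal ?J <= ergodic_cost M L f c qu qd x (U, D) (?\<mu> z)"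
   then have "ergodic_cost M L f c qu qd x (U, D) (?\<mu> z) < ennreal ?J" by simp
   then obtain y where y: "ergodic_cost M L f c qu qd x (U, D) (?\<mu> z) < y" "y < ennreal ?J" using dense by blast
   then obtain j where j: "y = ennreal j" "0 <= j" by (cases y) auto
   have jJ: "j < ?J" using y(2) j by (simp add: ennreal_less_iff)
   obtain U' D' where reg: "regular_control U'" "regular_control D'"
    and AE: "AE \<omega> in M. ALL t>=0. L t \<omega> = L t \<omega> & U t \<omega> = U' t \<omega> & D t \<omega> = D' t \<omega>"
    using admissible_regularize[OF UD] by blast
   have "Limsup at_top (%T. ennreal (1 / T) * running_cost (%y. c y (param z)) qu qd x U' D' T) < ennreal j"
    using y(1)[unfolded costs_cong(2)[OF AE]] unfolding ergodic_cost_eq mfp j(1) .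
   from discounted_le_ergodic[OF q_pos c_continuous_fst c_nonneg reg j(2) this]
   obtain K' where K': "!!e. 0 < e ==>
    (\<integral>\<^sup>+v. ennreal (pair_cost (%y. c y (param z)) qu qd e x U' D' v) \<partial>(MD e)) <= ennreal (j / e + K')" by blast
   define K'' where "K'' = max 0 K'"
   \<comment> \<open>A quarter of the gap: one share for the convergence of the rates, one for the
     change of parameter, one for the bounded errors, and one to spare.\<close>
   define s where "s = (?J - j) / 4"
   have s: "0 < s" using jJ by (simp add: s_def)
   have pz: "abs (c y (param (zs n)) - c y (param z)) <= s --> c y (param (zs n)) <= c y (param z) + s" for n y by linarith
   have ev1: "eventually (%n. ALL y. - W <= y --> y <= W --> abs (c y (param (zs n)) - c y (param z)) <= s) sequentially"
    by (rule c_uniform[OF ps pB[OF zs(1)] pB[OF z] s])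
   have ev2: "eventually (%n. ?J - s < ?j n) sequentially" using s by (intro order_tendstoD(1)[OF rates]) simp
   have "(%n. es n * (K'' + K)) \<longlonglongrightarrow> 0 * (K'' + K)" by (intro tendsto_intros es0)
   then have ev3: "eventually (%n. es n * (K'' + K) < s) sequentially"
    using s by (intro order_tendstoD(2)) auto
   from eventually_conj[OF ev1 eventually_conj[OF ev2 ev3]] obtain n where
    n: "!!y. - W <= y ==> y <= W ==> abs (c y (param (zs n)) - c y (param z)) <= s" "?J - s < ?j n" "es n * (K'' + K) < s"
    by (auto simp: eventually_sequentially)
   \<comment> \<open>A band optimal for the limiting parameter. The competitor may leave the compact
     interval, where parameters cannot be exchanged uniformly. So \<open>zs n\<close> is compared
     with \<open>z'\<close> at its own parameter, the parameter is changed on \<open>z'\<close>, and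
     only then is \<open>z'\<close> compared with the competitor.\<close>
   obtain z' where z': "z' \<in> bands w W" "optimal_band (es n) (param z) z'"
    using ex[rule_format, OF es continuous_on_const pB[OF z]] by blast
   note lt' = bands_lt[OF w(1) z'(1)]
   have "ennreal (?j n / es n) <= band_cost (es n) x (zs n) (param (zs n)) + ennreal K" by (rule lower)
   also have "band_cost (es n) x (zs n) (param (zs n)) <= band_cost (es n) x z' (param (zs n))"
    unfolding band_cost_def[of _ _ z'] by (rule band_cost_optimal[OF es(1) lts(1) zs(2) band_regular[OF lt'(1)]])
   also have "\<dots> <= band_cost (es n) x z' (param z) + ennreal (s / es n)"
    by (rule band_cost_perturb[OF es(1) w(1) z'(1) less_imp_le[OF s]]) (rule pz[rule_format, OF n(1)])
   also have "band_cost (es n) x z' (param z) <= (\<integral>\<^sup>+v. ennreal (pair_cost (%y. c y (param z)) qu qd (es n) x U' D' v) \<partial>(M \<Otimes>\<^sub>M discount (es n)))"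
    by (rule band_cost_optimal[OF es(1) lt'(1) z'(2) reg])
   also have "\<dots> <= ennreal (j / es n + K')" by (rule K'[OF es(1)])
   also have "\<dots> <= ennreal (j / es n + K'')" by (rule ennreal_leI) (simp add: K''_def)
   finally have "ennreal (?j n / es n) <= ennreal (j / es n + K'') + ennreal (s / es n) + ennreal K"
    by (simp add: add_mono)
   also have "\<dots> = ennreal (j / es n + K'' + s / es n + K)"
    using j(2) es(1)[of n] s K by (simp add: ennreal_plus[symmetric] K''_def del: ennreal_plus)
   finally have "?j n / es n <= j / es n + K'' + s / es n + K"
    using j(2) es(1)[of n] s K by (subst (asm) ennreal_le_iff) (auto simp: K''_def)
   then have "?j n <= j + s + es n * (K'' + K)" using es(1)[of n] by (simp add: field_simps)
   with n(2,3) have "?J - s < j + s + s" by linarith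
   then show False using jJ by (simp add: s_def field_simps)
  qed
  have ev: "ergodic_value M F L f c qu qd x (?\<mu> z) = ennreal ?J"
  proof (rule antisym)
   show "ergodic_value M F L f c qu qd x (?\<mu> z) <= ennreal ?J"
    unfolding ergodic_value_def ec[symmetric] by (rule INF_lower[OF regular_admissible[OF band_regular[OF lt(1)]]])
   show "ennreal ?J <= ergodic_value M F L f c qu qd x (?\<mu> z)" unfolding ergodic_value_def
   proof (rule INF_greatest)
    fix UD assume "UD \<in> admissible M F"
    then show "ennreal ?J <= ergodic_cost M L f c qu qd x UD (?\<mu> z)" using le by (cases UD) simp
   qed
  qed
  define d where "d n = enn2real (band_cost (es n) x (zs n) (param (zs n)))" for n
  have d: "band_cost (es n) x (zs n) (param (zs n)) = ennreal (d n)" "0 <= d n" for n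
  proof -
   have "band_cost (es n) x (zs n) (param (zs n)) < \<top>" using upper[of n] by (rule le_less_trans) simp
   then show "band_cost (es n) x (zs n) (param (zs n)) = ennreal (d n)" "0 <= d n" by (simp_all add: d_def)
  qed
  have dj: "abs (es n * d n - ?j n) <= es n * K" for n
  proof -
   have p: "0 <= ?j n / es n" using j0[of n] es(1)[of n] by simp
   have "d n <= ?j n / es n + K" using upper[of n] p K unfolding d by (subst (asm) ennreal_le_iff) auto
   moreover have "?j n / es n <= d n + K"
    using lower[of n] d(2)[of n] K unfolding d by (simp add: ennreal_plus[symmetric] ennreal_le_iff del: ennreal_plus)
   ultimately show ?thesis using es(1)[of n] by (simp add: abs_le_iff field_simps)
  qed
  have "(%n. es n * K) \<longlonglongrightarrow> 0 * K" by (intro tendsto_intros es0)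
  then have K0: "(%n. es n * K) \<longlonglongrightarrow> 0" by simp
  have "eventually (%n. norm (es n * d n - ?j n) <= es n * K) sequentially"
   unfolding real_norm_def by (rule always_eventually) (rule allI, rule dj)
  from tendsto_add[OF Lim_null_comparison[OF this K0] rates] have "(%n. es n * d n) \<longlonglongrightarrow> ?J" by simp
  then have "(%n. ennreal (es n * d n)) \<longlonglongrightarrow> ennreal ?J" by (rule tendsto_ennrealI)
  moreover have "ennreal (es n * d n) = ennreal (es n) * band_cost (es n) x (zs n) (param (zs n))" for n
   unfolding d using es(1)[of n] d(2)[of n] by (intro ennreal_mult) auto
  ultimately show ?thesis unfolding dv ev ec by simp
 qed
 show ?thesis
 proof (rule exI[of _ w], rule exI[of _ W], rule exI[of _ z], rule exI[of _ zs], rule exI[of _ es], intro conjI allI)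
  show "discounted_value M F L f c qu qd (es n) x (?\<mu> (zs n)) =
   discounted_cost M L f c qu qd (es n) x (band_up (zs n) x, band_down (zs n) x) (?\<mu> (zs n))" for n x
   unfolding dv band_discounted_cost[OF es(1) lts(1)] mfp ..
 qed (rule w z zs es es0 erg[THEN conjunct1] erg[THEN conjunct2])+
qed

end

section \<open>From regular paths to the general case\<close>

text \<open>The characteristic functions converge to those of both limits, and a characteristic
  function determines its law.\<close>

lemma weak_limit_unique:
 assumes "!!n. real_distribution (N n)" "real_distribution \<mu>" "real_distribution \<mu>'" "weak_conv_m N \<mu>" "weak_conv_m N \<mu>'"
 shows "\<mu> = \<mu>'"
proof (rule Levy_uniqueness[OF assms(2,3)], rule ext)
 fix t show "char \<mu> t = char \<mu>' t"
  by (rule LIMSEQ_unique[OF levy_continuity1[OF assms(1,2,4)] levy_continuity1[OF assms(1,3,5)]])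
qed

lemma weak_conv_m_eventually_cong:
 assumes "weak_conv_m N \<mu>" "eventually (%n. N n = N' n) sequentially"
 shows "weak_conv_m N' \<mu>" unfolding weak_conv_m_def weak_conv_def
proof (intro allI impI)
 fix x assume "isCont (cdf \<mu>) x"
 then have "(%n. cdf (N n) x) \<longlonglongrightarrow> cdf \<mu> x" using assms(1) by (simp add: weak_conv_m_def weak_conv_def)
 then show "(%n. cdf (N' n) x) \<longlonglongrightarrow> cdf \<mu> x"
  by (rule Lim_transform_eventually) (use assms(2) in \<open>auto elim!: eventually_mono\<close>)
qed

context dropping_levy
begin

section \<open>Transfer to a process that agrees with a regular one up to a null set\<close>

context
 fixes L0 :: "real => 'w => real"
 assumes L0: "AE w in M. ALL t>=0. L t w = L0 t w"
begin

lemma value_transfer: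
 "discounted_cost M L0 f c qu qd e x UD \<mu> = discounted_cost M L f c qu qd e x UD \<mu>"
 "ergodic_cost M L0 f c qu qd x UD \<mu> = ergodic_cost M L f c qu qd x UD \<mu>"
 "discounted_value M F L0 f c qu qd e x \<mu> = discounted_value M F L f c qu qd e x \<mu>"
 "ergodic_value M F L0 f c qu qd x \<mu> = ergodic_value M F L f c qu qd x \<mu>"
proof -
 have AE: "AE w in M. ALL t>=0. L0 t w = L t w & U t w = U t w & D t w = D t w" for U D :: "real => 'w => real"
  using L0 by eventually_elim simp
 have 1: "discounted_cost M L0 f c qu qd e x UD \<mu> = discounted_cost M L f c qu qd e x UD \<mu>" for UD
  using costs_cong(1)[OF AE[of "fst UD" "snd UD"], where f = f and c = c and qu = qu and qd = qd and e = e and x = x and \<mu> = \<mu>] by simp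
 have 2: "ergodic_cost M L0 f c qu qd x UD \<mu> = ergodic_cost M L f c qu qd x UD \<mu>" for UD
  using costs_cong(2)[OF AE[of "fst UD" "snd UD"], where f = f and c = c and qu = qu and qd = qd and x = x and \<mu> = \<mu>] by simp
 show "discounted_cost M L0 f c qu qd e x UD \<mu> = discounted_cost M L f c qu qd e x UD \<mu>"
  "ergodic_cost M L0 f c qu qd x UD \<mu> = ergodic_cost M L f c qu qd x UD \<mu>"
  "discounted_value M F L0 f c qu qd e x \<mu> = discounted_value M F L f c qu qd e x \<mu>"
  "ergodic_value M F L0 f c qu qd x \<mu> = ergodic_value M F L f c qu qd x \<mu>"
  unfolding discounted_value_def ergodic_value_def by (simp_all only: 1 2)
qed

lemma refl_reflecting_control:
 assumes ab: "a < b"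
 shows "reflecting_control M F L0 x a b
  (%t w. up_at 0 a b x t w, %t w. down_at 0 a b x t w)" (is "reflecting_control _ _ _ _ _ _ (?U, ?D)")
proof -
 have sk: "skorokhod_path a b x (%t. L t w) (%t. ?U t w) (%t. ?D t w)" for w
  using refl_skorokhod_path[OF path_regular[OF order_refl] ab, of x w] by (simp add: path_0)
 then have s0: "?U 0 w = max (a - x) 0 & ?D 0 w = max (x - b) 0"
  and sb: "ALL t>=0. a <= x + L t w + ?U t w - ?D t w & x + L t w + ?U t w - ?D t w <= b"
  and su: "(\<integral>\<^sup>+t\<in>{0<..}. ennreal (x + L t w + ?U t w - ?D t w - a) \<partial>stieltjes (%t. ?U t w)) = 0"
  and sd: "(\<integral>\<^sup>+t\<in>{0<..}. ennreal (b - (x + L t w + ?U t w - ?D t w)) \<partial>stieltjes (%t. ?D t w)) = 0" for w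
  unfolding skorokhod_path_def by blast+
 have "skorokhod_control M F L0 x a b (?U, ?D)" unfolding skorokhod_control_def prod.case
 proof (intro conjI)
  show "(?U, ?D) \<in> admissible M F" by (rule regular_admissible[OF refl_regular_control[OF ab]])
  show "AE w in M. ?U 0 w = max (a - x) 0 & ?D 0 w = max (x - b) 0" by (rule AE_I2, rule s0)
  show "AE w in M. ALL t>=0. controlled L0 x (?U, ?D) t w \<in> {a..b}" using L0
  proof eventually_elim
   case (elim w)
   then have "controlled L0 x (?U, ?D) t w = x + L t w + ?U t w - ?D t w" if "0 <= t" for t
    using that by (simp add: controlled_def)
   then show ?case using sb[of w] by simp
  qed
  have int: "AE w in M. (\<integral>\<^sup>+t\<in>{0<..}. ennreal (h (controlled L0 x (?U, ?D) t w)) \<partial>N w) =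
    (\<integral>\<^sup>+t\<in>{0<..}. ennreal (h (x + L t w + ?U t w - ?D t w)) \<partial>N w)" for h :: "real => real" and N :: "'w => real measure"
   using L0 by eventually_elim (auto intro!: nn_integral_cong simp: controlled_def indicator_def)
  show "AE w in M. (\<integral>\<^sup>+t\<in>{0<..}. ennreal (controlled L0 x (?U, ?D) t w - a) \<partial>stieltjes (%t. ?U t w)) = 0"
   using int[of "%w. stieltjes (%t. ?U t w)" "%y. y - a"] unfolding su .
  show "AE w in M. (\<integral>\<^sup>+t\<in>{0<..}. ennreal (b - controlled L0 x (?U, ?D) t w) \<partial>stieltjes (%t. ?D t w)) = 0"
   using int[of "%w. stieltjes (%t. ?D t w)" "%y. b - y"] unfolding sd .
 qed
 then show ?thesis using ab by (simp add: reflecting_control_def)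
qed

text \<open>Pathwise uniqueness outside a null set. The definition of the stationary law quantifies
  over all reflecting controls, so the constructed one alone would not do.\<close>

lemma reflecting_control_pos:
 assumes ab: "a < b" and UD: "reflecting_control M F L0 x a b UD"
 shows "UD \<in> admissible M F" "AE w in M. ALL t>=0. controlled L0 x UD t w = pos_at 0 a b x t w"
proof -
 obtain U D where [simp]: "UD = (U, D)" by (cases UD)
 have sk: "skorokhod_control M F L0 x a b (U, D)" using UD ab by (simp add: reflecting_control_def)
 note skd = sk[unfolded skorokhod_control_def prod.case]
 note adm = skd[THEN conjunct1] and s1 = skd[THEN conjunct2, THEN conjunct1]
  and s2 = skd[THEN conjunct2, THEN conjunct2, THEN conjunct1]
  and s3 = skd[THEN conjunct2, THEN conjunct2, THEN conjunct2, THEN conjunct1]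
  and s4 = skd[THEN conjunct2, THEN conjunct2, THEN conjunct2, THEN conjunct2]
 show "UD \<in> admissible M F" using adm by simp
 have r: "AE w in M. (ALL t>=0. continuous (at_right t) (%s. Y s w)) & mono_on {0..} (%s. Y s w)" if "Y \<in> {U, D}" for Y
  using adm that unfolding admissible_def mem_Collect_eq prod.case by (elim ballE[of _ _ Y] conjE) simp_all
 from r[of U] r[of D]
 have rU: "AE w in M. right_cont (%s. U s w) & mono_on {0..} (%s. U s w)"
  and rD: "AE w in M. right_cont (%s. D s w) & mono_on {0..} (%s. D s w)"
  by (simp_all add: right_cont_def)
 show "AE w in M. ALL t>=0. controlled L0 x UD t w = pos_at 0 a b x t w" using L0 s1 s2 s3 s4 rU rD
 proof eventually_elim
  case (elim w)
  have eq: "controlled L0 x (U, D) t w = x + lpath 0 w t + U t w - D t w" if "0 <= t" for t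
   using elim(1) that by (simp add: controlled_def path_0)
  have int: "(\<integral>\<^sup>+t\<in>{0<..}. ennreal (h (controlled L0 x (U, D) t w)) \<partial>N) =
    (\<integral>\<^sup>+t\<in>{0<..}. ennreal (h (x + lpath 0 w t + U t w - D t w)) \<partial>N)" for h :: "real => real" and N :: "real measure"
   by (intro nn_integral_cong) (auto simp: indicator_def eq)
  have "skorokhod_path a b x (lpath 0 w) (%t. U t w) (%t. D t w)" unfolding skorokhod_path_def
  proof (intro conjI allI impI)
   fix t :: real assume t: "0 <= t"
   from elim(3)[rule_format, OF t]
   show "a <= x + lpath 0 w t + U t w - D t w" "x + lpath 0 w t + U t w - D t w <= b"
    unfolding eq[OF t] by simp_all
  next
   show "(\<integral>\<^sup>+t\<in>{0<..}. ennreal (x + lpath 0 w t + U t w - D t w - a) \<partial>stieltjes (%t. U t w)) = 0"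
    using elim(4) unfolding int[of _ "%y. y - a"] .
   show "(\<integral>\<^sup>+t\<in>{0<..}. ennreal (b - (x + lpath 0 w t + U t w - D t w)) \<partial>stieltjes (%t. D t w)) = 0"
    using elim(5) unfolding int[of _ "%y. b - y"] .
  qed (use elim(2,6,7) in \<open>blast+\<close>)
  from skorokhod_path_unique[OF path_regular[OF order_refl] ab this]
  show ?case by (simp add: eq)
 qed
qed

lemma reflecting_control_converges:
 assumes ab: "a < b" and UD: "reflecting_control M F L0 x a b UD" and L0m: "!!t. 0 <= t ==> L0 t \<in> borel_measurable M"
 shows "converges_in_distribution M (controlled L0 x UD) (limit_law a b)"
  and "!!n :: nat. real_distribution (distr M borel (controlled L0 x UD (real n)))"
proof -
 obtain U D where [simp]: "UD = (U, D)" by (cases UD)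
 let ?X = "%t w. pos_at 0 a b x t w"
 have cm: "controlled L0 x UD t \<in> borel_measurable M" if "0 <= t" for t
 proof -
  have "ALL Y:{U, D}. ALL t>=0. integrable M (Y t)"
   using reflecting_control_pos(1)[OF ab UD] unfolding admissible_def by simp
  then have "U t \<in> borel_measurable M" "D t \<in> borel_measurable M" using that by (auto intro: borel_measurable_integrable)
  then show ?thesis using L0m[OF that] unfolding controlled_def by simp
 qed
 have Xm: "?X t \<in> borel_measurable M" if "0 <= t" for t by (rule refl_measurable(3)[OF order_refl that ab])
 have eq: "distr M borel (?X t) = distr M borel (controlled L0 x UD t)" if "0 <= t" for t
 proof (rule distr_cong_AE[OF refl refl _ Xm[OF that] cm[OF that]])
  show "AE w in M. ?X t w = controlled L0 x UD t w"
   using reflecting_control_pos(2)[OF ab UD] by eventually_elim (simp add: that)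
 qed
 show "real_distribution (distr M borel (controlled L0 x UD (real n)))" for n :: nat
  by (rule real_distribution_distr) (rule cm, simp)
 show "converges_in_distribution M (controlled L0 x UD) (limit_law a b)" unfolding converges_in_distribution_def
 proof (intro allI impI)
  fix \<tau> :: "nat => real" assume \<tau>: "filterlim \<tau> at_top sequentially"
  \<comment> \<open>A sequence tending to infinity may begin with negative times;
    \<open>max 0\<close> makes every member meaningful and alters only finitely many.\<close>
  have "weak_conv_m (%n. distr M borel (?X (max 0 (\<tau> n)))) (limit_law a b)"
  proof (rule integral_bdd_continuous_conv_imp_weak_conv)
   show "real_distribution (distr M borel (?X (max 0 (\<tau> n))))" for n
    by (rule real_distribution_distr, rule Xm) simp
   show "real_distribution (limit_law a b)" using limit_law[OF ab] unfolding is_limit_law_def by blast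
   fix h :: "real => real" assume "!!x. isCont h x"
   then have h: "continuous_on UNIV h" by (simp add: continuous_on_eq_continuous_at)
   have "((%t. mean_pos h a b x t) \<longlongrightarrow> (\<integral>y. h y \<partial>limit_law a b)) at_top"
    using limit_law[OF ab] h unfolding is_limit_law_def by blast
   moreover have "filterlim (%n. max 0 (\<tau> n)) at_top sequentially"
    by (rule filterlim_at_top_mono[OF \<tau>]) simp
   ultimately have "(%n. mean_pos h a b x (max 0 (\<tau> n))) \<longlonglongrightarrow> (\<integral>y. h y \<partial>limit_law a b)"
    by (rule filterlim_compose)
   moreover have "integral\<^sup>L (distr M borel (?X (max 0 (\<tau> n)))) h = mean_pos h a b x (max 0 (\<tau> n))" for n
    unfolding mean_pos_def by (rule integral_distr[OF Xm borel_measurable_continuous_onI[OF h]]) simp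
   ultimately show "(%n. integral\<^sup>L (distr M borel (?X (max 0 (\<tau> n)))) h) \<longlonglongrightarrow> integral\<^sup>L (limit_law a b) h" by simp
  qed
  then show "weak_conv_m (%n. distr M borel (controlled L0 x UD (\<tau> n))) (limit_law a b)"
  proof (rule weak_conv_m_eventually_cong)
   have "eventually (%n. 0 <= \<tau> n) sequentially" using \<tau> by (simp add: filterlim_at_top)
   then show "eventually (%n. distr M borel (?X (max 0 (\<tau> n))) = distr M borel (controlled L0 x UD (\<tau> n))) sequentially"
   proof eventually_elim
    case (elim n)
    then show ?case using eq[OF elim] by (simp add: max_absorb2)
   qed
  qed
 qed
qed

text \<open>The definite description picks this law: it has the required property for every
  reflecting control, and the control constructed from start 0 leaves no other weak limit.\<close>

lemma stationary_law_eq: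
 assumes ab: "a < b" and L0m: "!!t. 0 <= t ==> L0 t \<in> borel_measurable M"
 shows "stationary_law M F L0 a b = limit_law a b"
proof -
 have conv: "converges_in_distribution M (controlled L0 x UD) (limit_law a b)"
  "real_distribution (distr M borel (controlled L0 x UD (real n)))"
  if "reflecting_control M F L0 x a b UD" for x UD and n :: nat
  by (rule reflecting_control_converges(1)[OF ab that L0m], assumption)
   (rule reflecting_control_converges(2)[OF ab that L0m], assumption)
 have \<mu>: "real_distribution (limit_law a b)" "AE y in limit_law a b. y \<in> {a..b}"
  using limit_law[OF ab] unfolding is_limit_law_def by blast+
 note r0 = refl_reflecting_control[OF ab, of 0]
 have "(THE \<mu>. \<mu> \<in> limit_laws M F L0 & (ALL x UD. reflecting_control M F L0 x a b UD -->
   converges_in_distribution M (controlled L0 x UD) \<mu>)) = limit_law a b"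
 proof (rule the_equality, intro conjI allI impI)
  show "limit_law a b \<in> limit_laws M F L0" unfolding limit_laws_def mem_Collect_eq
  proof (intro conjI \<mu>(1) exI[of _ "{a..b}"] compact_Icc \<mu>(2))
   show "EX \<eta>:admissible M F. converges_in_distribution M (controlled L0 0 \<eta>) (limit_law a b)"
    using conv(1)[OF r0] reflecting_control_pos(1)[OF ab r0] by (rule bexI)
  qed
  show "converges_in_distribution M (controlled L0 x UD) (limit_law a b)" if "reflecting_control M F L0 x a b UD" for x UD
   by (rule conv(1)[OF that])
  fix \<mu>' assume a: "\<mu>' \<in> limit_laws M F L0 & (ALL x UD. reflecting_control M F L0 x a b UD -->
   converges_in_distribution M (controlled L0 x UD) \<mu>')"
  then have \<mu>': "real_distribution \<mu>'" unfolding limit_laws_def by blast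
  let ?U = "(%t w. up_at 0 a b 0 t w, %t w. down_at 0 a b 0 t w)"
  have "converges_in_distribution M (controlled L0 0 ?U) \<mu>'" using a r0 by blast
  then have "weak_conv_m (%n. distr M borel (controlled L0 0 ?U (real n))) \<mu>'"
   unfolding converges_in_distribution_def using filterlim_real_sequentially by blast
  moreover have "weak_conv_m (%n. distr M borel (controlled L0 0 ?U (real n))) (limit_law a b)"
   using conv(1)[OF r0] unfolding converges_in_distribution_def using filterlim_real_sequentially by blast
  ultimately show "\<mu>' = limit_law a b" by (intro weak_limit_unique[OF conv(2)[OF r0] \<mu>' \<mu>(1)])
 qed
 then show ?thesis using ab by (simp add: stationary_law_def)
qed

end

end

theorem theorem2p12:
  fixes M :: "'w measure" and F :: "real \<Rightarrow> 'w measure" and L :: "real \<Rightarrow> 'w \<Rightarrow> real"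
    and f :: "real \<Rightarrow> real" and c cx cxx :: "real \<Rightarrow> real \<Rightarrow> real" and qu qd :: real
  assumes basis: "stochastic_basis M F"
    and levy: "levy_process M F L"
    and finite_mean: "\<And>t. t \<ge> 0 \<Longrightarrow> integrable M (L t)"
    and not_subordinator: "\<not> subordinator M F L"
    and not_opposite: "\<not> subordinator M F (\<lambda>t \<omega>. - L t \<omega>)"
    and f_cont: "continuous_on UNIV f"
    and q_pos: "qu > 0" "qd > 0"
    and c_nonneg: "\<And>x y. c x y \<ge> 0"
    and c_cont: "continuous_on UNIV (\<lambda>(x, y). c x y)"
    and c_deriv: "\<And>x y. ((\<lambda>z. c z y) has_real_derivative cx x y) (at x)"
    and cx_deriv: "\<And>x y. ((\<lambda>z. cx z y) has_real_derivative cxx x y) (at x)"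
    and cxx_cont: "\<And>y. continuous_on UNIV (\<lambda>x. cxx x y)"
    and c_convex: "\<And>y. strictly_convex (\<lambda>x. c x y)"
    and c_min: "\<And>x y. c 0 y \<le> c x y"
    and cxx_pos: "\<And>r. r > 0 \<Longrightarrow> (INF (x, y)\<in>{(x, y). \<bar>x\<bar> \<ge> r}. cxx x y) > 0"
    and c_growth: "\<exists>N>0. \<forall>y. \<exists>K>0. \<forall>x. c x y + K \<ge> N * \<bar>x\<bar>"
    and cx_integrable: "\<And>x y \<epsilon>. \<epsilon> > 0 \<Longrightarrow>
      (\<integral>\<^sup>+\<omega>. (\<integral>\<^sup>+s\<in>{0..}. ennreal \<bar>cx (x + L s \<omega>) y * exp (- \<epsilon> * s)\<bar> \<partial>lborel) \<partial>M) < \<infinity>"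
  shows "\<exists>a b. a \<le> 0 \<and> 0 \<le> b \<and> ergodic_equilibrium M F L f c qu qd a b \<and>
    (\<exists>as bs es.
       (\<forall>n::nat. es n > 0 \<and> discounted_equilibrium M F L f c qu qd (es n) (as n) (bs n)) \<and>
       as \<longlonglongrightarrow> a \<and> bs \<longlonglongrightarrow> b \<and> es \<longlonglongrightarrow> 0 \<and>
       (\<forall>x. (\<lambda>n. ennreal (es n) *
               discounted_value M F L f c qu qd (es n) x (stationary_law M F L (as n) (bs n)))
            \<longlonglongrightarrow> ergodic_value M F L f c qu qd x (stationary_law M F L a b)))"
proof -
 interpret L: levy_model M F L using basis levy finite_mean by unfold_locales
 let ?L = "regularized M L"
 interpret L': levy_model M F ?L by (rule L.levy_model_regularized)
 \<comment> \<open>Regularization changes paths only on a null set, so a monotone regular version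
   would make \<open>L\<close> itself a subordinator.\<close>
 interpret C: control_problem M F ?L f c cx cxx qu qd
 proof unfold_locales
  show "regular_path (%t. ?L t \<omega>)" for \<omega> by (rule regularized_regular)
  show "~ subordinator M F ?L" using L.subordinator_regularized not_subordinator by blast
 qed (rule f_cont q_pos c_nonneg c_cont c_deriv cx_deriv cxx_cont c_convex c_min cxx_pos, assumption?)+
 have L: "AE \<omega> in M. ALL t>=0. ?L t \<omega> = L t \<omega>"
  using L.AE_regularized by eventually_elim blast
 obtain w W z zs es where w: "0 < w" and z: "z \<in> bands w W" and zs: "ALL n :: nat. zs n \<in> bands w W & 0 < es n"
  and lim: "zs \<longlonglongrightarrow> z" "es \<longlonglongrightarrow> 0"
  and disc: "ALL n x. discounted_value M F ?L f c qu qd (es n) x (C.limit_law (fst (zs n)) (snd (zs n))) =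
   discounted_cost M ?L f c qu qd (es n) x (C.band_up (zs n) x, C.band_down (zs n) x) (C.limit_law (fst (zs n)) (snd (zs n)))"
  and erg: "ALL x. ergodic_value M F ?L f c qu qd x (C.limit_law (fst z) (snd z)) =
   ergodic_cost M ?L f c qu qd x (C.band_up z x, C.band_down z x) (C.limit_law (fst z) (snd z))"
  and conv: "ALL x. (%n. ennreal (es n) * discounted_value M F ?L f c qu qd (es n) x (C.limit_law (fst (zs n)) (snd (zs n))))
   \<longlonglongrightarrow> ergodic_value M F ?L f c qu qd x (C.limit_law (fst z) (snd z))"
  using C.regular_equilibrium by (elim exE conjE)
 note lt = C.bands_lt(1)[OF w z] and lts = C.bands_lt(1)[OF w zs[rule_format, THEN conjunct1]]
 \<comment> \<open>All bands in play have width at least \<open>w > 0\<close>, so the nondegenerate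
   case of the stationary law is the one that occurs.\<close>
 have law: "stationary_law M F L a b = C.limit_law a b" if "a < b" for a b
  by (rule C.stationary_law_eq[OF L that]) (rule borel_measurable_integrable[OF finite_mean])
 note refl = C.refl_reflecting_control[OF L]
 note val = C.value_transfer[OF L]
 show ?thesis
 proof (rule exI[of _ "fst z"], rule exI[of _ "snd z"], intro conjI)
  show "fst z <= 0" "0 <= snd z" using z by (auto simp: bands_def)
  show "ergodic_equilibrium M F L f c qu qd (fst z) (snd z)" unfolding ergodic_equilibrium_def law[OF lt] val
   using lt refl[OF lt] erg unfolding C.band_up_def C.band_down_def by (auto intro: less_imp_le)
  show "EX as bs es. (ALL n::nat. es n > 0 & discounted_equilibrium M F L f c qu qd (es n) (as n) (bs n)) &
    as \<longlonglongrightarrow> fst z & bs \<longlonglongrightarrow> snd z & es \<longlonglongrightarrow> 0 &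
    (ALL x. (%n. ennreal (es n) *
        discounted_value M F L f c qu qd (es n) x (stationary_law M F L (as n) (bs n)))
      \<longlonglongrightarrow> ergodic_value M F L f c qu qd x (stationary_law M F L (fst z) (snd z)))"
  proof (rule exI[of _ "%n. fst (zs n)"], rule exI[of _ "%n. snd (zs n)"], rule exI[of _ es], intro conjI allI)
   show "0 < es n" for n using zs by blast
   show "discounted_equilibrium M F L f c qu qd (es n) (fst (zs n)) (snd (zs n))" for n
    unfolding discounted_equilibrium_def law[OF lts] val
    using lts[of n] refl[OF lts] disc unfolding C.band_up_def C.band_down_def by (auto intro: less_imp_le)
   show "(%n. fst (zs n)) \<longlonglongrightarrow> fst z" "(%n. snd (zs n)) \<longlonglongrightarrow> snd z"
    by (intro tendsto_fst tendsto_snd lim)+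
   show "es \<longlonglongrightarrow> 0" by (rule lim)
   show "(%n. ennreal (es n) * discounted_value M F L f c qu qd (es n) x (stationary_law M F L (fst (zs n)) (snd (zs n))))
      \<longlonglongrightarrow> ergodic_value M F L f c qu qd x (stationary_law M F L (fst z) (snd z))" for x
    unfolding law[OF lt] law[OF lts] val using conv by blast
  qed
 qed
qed

end
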